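(* Let $d,p,k\ge 1$ be integers. Let $F\in C^\infty(\mathbb{R}^d,\mathbb{R}^p)$ satisfy: $F(0)=0$; $JF(x)\neq 0$ for every $x\in F^{-1}(0)$; and there exist $\mathtt{m},\alpha>0$ and $R\ge 0$ such that $\|F(x)\|\ge \mathtt{m}\|x\|^{\alpha}$ for all $x\in\mathbb{R}^d$ with $\|x\|\ge R$. Let $\Psi\in C(\mathbb{R}^d,[0,+\infty))$ be such that there is $C_\Psi\ge 0$ with $\Psi(x)\le C_\Psi\exp[C_\Psi\|x\|^{\alpha k}]$ for all $x\in\mathbb{R}^d$, and $\Psi(x)>0$ for all $x\in F^{-1}(0)$. Then for any $\varepsilon\ge 0$, $\pi_\varepsilon^\Psi$ is well-defined. Let $\mathsf{U}\subset\mathbb{R}^d$ be open and bounded with $F^{-1}(0)\subset \mathsf{U}$. (i) For every $\varphi\in C(\mathbb{R}^d,\mathbb{R})$ for which there is $C_\varphi\ge 0$ with $|\varphi(x)|\le C_\varphi\exp[C_\varphi\|x\|^{\alpha k}]$ for all $x\in\mathbb{R}^d$, one has $\lim_{\varepsilon\to 0}|\pi^\Psi_\varepsilon[\varphi]-\pi^\Psi_0[\varphi]|=0$. (ii) Assume in addition that $\Psi$ is $M_{1,\Psi}$-Lipschitz on $\mathsf{U}$ for some $M_{1,\Psi}\ge 0$. Then there exist a continuous non-decreasing function $A:[0,+\infty)\to[0,+\infty)$ and a continuous non-increasing function $\bar\varepsilon:[0,+\infty)\to(0,+\infty)$, not depending on $\varphi$, such that for every $\varphi\in C(\mathbb{R}^d,\mathbb{R})$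 and $C_\varphi\ge 0$ with $|\varphi(x)|\le C_\varphi\exp[C_\varphi\|x\|^{\alpha k}]$ for all $x\in\mathbb{R}^d$, and such that $\varphi$ is $M_{1,\varphi}$-Lipschitz on $\mathsf{U}$ with $M_{1,\varphi}\ge 0$, one has for all $\varepsilon\in(0,\bar\varepsilon(C_\varphi))$ $$|\pi^\Psi_\varepsilon[\varphi]-\pi^\Psi_0[\varphi]|\le A(C_\varphi)\,(1+M_{0,\varphi}+M_{1,\varphi})\,\varepsilon^{1/k},$$ where $M_{0,\varphi}=\sup\{|\varphi(x)|: x\in \mathsf{U}\}$.
   Context: For a differentiable map $F:\mathbb{R}^d\to\mathbb{R}^p$, $DF(x)$ is the $p\times d$ Jacobian matrix and the generalized Jacobian is $JF(x)=\det(DF(x)DF(x)^\top)^{1/2}$ if $d\ge p$ and $JF(x)=\det(DF(x)^\top DF(x))^{1/2}$ if $d\le p$; $JF(x)^{-1}$ denotes $1/JF(x)$. $\|\cdot\|$ is the Euclidean norm and $\mathcal{H}^r$ is the $r$-dimensional Hausdorff measure. For $\varepsilon>0$ and Borel $\mathsf{A}\subset\mathbb{R}^d$, $\pi^\Psi_\varepsilon(\mathsf{A})=\int_{\mathsf{A}}\Psi(x)\exp[-\|F(x)\|^k/\varepsilon]\,dx\big/\int_{\mathbb{R}^d}\Psi(x)\exp[-\|F(x)\|^k/\varepsilon]\,dx$, and $\pi^\Psi_0(\mathsf{A})=\int_{F^{-1}(0)\cap \mathsf{A}}\Psi(x)JF(x)^{-1}\,d\mathcal{H}^{d-\min(d,p)}(x)\big/\int_{F^{-1}(0)}\Psi(x)JF(x)^{-1}\,d\mathcal{H}^{d-\min(d,p)}(x)$.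 For a measure $\pi$, $\pi[\varphi]=\int\varphi\,d\pi$.
   Formalization: "For any ε≥0, π_ε^Ψ is well-defined" fails for large ε (F(x)=x, k=1, Ψ=Ce^{C|x|}, ε≥1/C: infinite denominator); finiteness is asserted for εC_Ψ<m^k, and for every ε≥0 the denominator is positive and π_ε^Ψ is a probability measure whenever it is finite. *)

theory Defs
  imports "HOL-Probability.Probability"
begin

text \<open>
  \<open>ck_map n\<close> is \<open>C\<^sup>n\<close> on the whole space: every \<open>n\<close>-fold iterated directional derivative
  exists and is continuous.
\<close>

primrec ck_map :: "nat \<Rightarrow> ('a::real_normed_vector \<Rightarrow> 'b::real_normed_vector) \<Rightarrow> bool" where
  "ck_map 0 f \<longleftrightarrow> continuous_on UNIV f"
| "ck_map (Suc n) f \<longleftrightarrow>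
     (\<forall>x. f differentiable (at x)) \<and> (\<forall>v. ck_map n (\<lambda>x. frechet_derivative f (at x) v))"

definition smooth_map :: "('a::real_normed_vector \<Rightarrow> 'b::real_normed_vector) \<Rightarrow> bool" where
  "smooth_map f \<longleftrightarrow> (\<forall>n. ck_map n f)"

text \<open>
  \<open>jacobian f (at x)\<close> is the matrix with \<open>CARD('p)\<close> rows and \<open>CARD('d)\<close> columns.
\<close>

definition gen_jacobian :: "(real^'d \<Rightarrow> real^'p) \<Rightarrow> real^'d \<Rightarrow> real" where
  "gen_jacobian F x =
     (let D = jacobian F (at x)
      in if CARD('p) \<le> CARD('d) then sqrt (det (D ** transpose D))
         else sqrt (det (transpose D ** D)))"

text \<open>
  The \<open>r\<close>-dimensional Hausdorff measure (\<open>r\<close> a natural number) in Federer's normalisation,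
  for which it agrees with Lebesgue measure if \<open>r\<close> is the dimension of the space and with the
  counting measure if \<open>r = 0\<close>. The empty set is treated separately because \<open>0 ^ 0 = 1\<close>, and
  boundedness is required because \<open>diameter\<close> is unspecified on unbounded sets.
  By Caratheodory's criterion the outer measure is countably additive on the Borel sets.
\<close>

definition hausdorff_premeasure :: "nat \<Rightarrow> 'a::metric_space set \<Rightarrow> ennreal" where
  "hausdorff_premeasure r S =
     (if S = {} then 0 else ennreal (unit_ball_vol (real r) * (diameter S / 2) ^ r))"

definition hausdorff_approx :: "nat \<Rightarrow> real \<Rightarrow> 'a::metric_space set \<Rightarrow> ennreal" where
  "hausdorff_approx r \<delta> A =
     (INF S \<in> {S :: nat \<Rightarrow> 'a set. A \<subseteq> (\<Union>i. S i) \<and> (\<forall>i. bounded (S i) \<and> diameter (S i) \<le> \<delta>)}.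
        \<Sum>i. hausdorff_premeasure r (S i))"

definition hausdorff_outer :: "nat \<Rightarrow> 'a::metric_space set \<Rightarrow> ennreal" where
  "hausdorff_outer r A = (SUP \<delta>\<in>{0<..}. hausdorff_approx r \<delta> A)"

definition hausdorff_measure :: "nat \<Rightarrow> 'a::metric_space measure" where
  "hausdorff_measure r = measure_of UNIV (sets borel) (hausdorff_outer r)"

text \<open>
  The numerator of \<open>\<pi>\<^sub>\<epsilon>\<close>; the denominator is its value at \<open>UNIV\<close>.
\<close>

definition laplace_mass ::
  "(real^'d \<Rightarrow> real^'p) \<Rightarrow> (real^'d \<Rightarrow> real) \<Rightarrow> nat \<Rightarrow> real \<Rightarrow> (real^'d) set \<Rightarrow> ennreal" where
  "laplace_mass F \<Psi> k \<epsilon> A =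
     (if \<epsilon> = 0
      then \<integral>\<^sup>+ x \<in> F -` {0} \<inter> A. ennreal (\<Psi> x / gen_jacobian F x)
             \<partial>hausdorff_measure (CARD('d) - min CARD('d) CARD('p))
      else \<integral>\<^sup>+ x \<in> A. ennreal (\<Psi> x * exp (- (norm (F x) ^ k / \<epsilon>))) \<partial>lborel)"

text \<open>
  If the denominator is \<open>0\<close> or \<open>\<infinity>\<close>, the quotient below does not define a probability measure;
  conversely \<open>prob_space (laplace_measure F \<Psi> k \<epsilon>)\<close> forces \<open>measure_of\<close> to return the set function
  it is given on all Borel sets.
\<close>

definition laplace_measure ::
  "(real^'d \<Rightarrow> real^'p) \<Rightarrow> (real^'d \<Rightarrow> real) \<Rightarrow> nat \<Rightarrow> real \<Rightarrow> (real^'d) measure" where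
  "laplace_measure F \<Psi> k \<epsilon> =
     measure_of UNIV (sets borel) (\<lambda>A. laplace_mass F \<Psi> k \<epsilon> A / laplace_mass F \<Psi> k \<epsilon> UNIV)"

end

theory Submission imports Defs
begin

text \<open>
  With \<open>s = \<epsilon> powr (1 / k)\<close> the weight is \<open>exp (- (norm (F x) / s) ^ k)\<close>, and as \<open>s\<close> tends to 0 it concentrates
  on the zero set of \<open>F\<close>. Let \<open>q\<close> be the smaller one of the two dimensions, which is the codimension of the
  zero set. The core is the expansion \<open>laplace_expansion\<close>: for a Lipschitz function \<open>g\<close>, the integral of \<open>g\<close>
  against the weight, divided by \<open>s ^ q\<close>, equals \<open>\<gamma>\<close> times the integral of \<open>g / gen_jacobian F\<close> over the zero set
  up to an error linear in \<open>s\<close>. The constant \<open>\<gamma>\<close> cancels in the quotients that define the two expectations, and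
  its value is never computed.

  Locally, a chart \<open>G\<close> carries the zero set to a coordinate subspace, and \<open>F\<close> agrees with \<open>D \<circ> G\<close> to second order
  in the distance to it, for a linear map \<open>D\<close> that vanishes exactly on the subspace. A change of variables and a
  scaling of the normal coordinates by \<open>s\<close> produce the factor \<open>s ^ q\<close> and an integrand that differs by \<open>O(s)\<close>
  from one in which the exponent is \<open>norm (D y) ^ k\<close> and \<open>g\<close> is evaluated on the subspace (\<open>local_laplace\<close>).

  The limit must be an integral against Hausdorff measure. Seen on the subspace it is the integral of a function
  against a translation-invariant measure, and such measures are unique up to a factor
  (\<open>translation_invariant_measures_proportional\<close>, \<open>profile_integral_eq_hausdorff\<close>). To apply this it
  suffices that the Hausdorff measure of a flat ball is finite and positive. The factor depends on \<open>D\<close> through a determinant that equals \<open>gen_jacobian F\<close> at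
  the centre of the chart (\<open>slab_mass_surjective\<close>, \<open>slab_mass_injective\<close>). A chart whose derivative at the centre
  is orthogonal distorts lengths, volumes and the Jacobian by factors at most \<open>\<theta>\<close>, so the limit agrees with the
  integral over the zero set up to powers of \<open>\<theta>\<close>. Since the limit does not depend on the charts, \<open>\<theta> \<rightarrow> 1\<close> gives
  equality.

  Globally, the zero set is compact by the growth condition, so finitely many charts and a Lipschitz cutoff suffice
  (\<open>cutoff_expansion\<close>), and off a neighbourhood of the zero set the weight is exponentially small in \<open>1 / s ^ k\<close>
  (\<open>tail_estimate\<close>). The theorem applies the expansion to \<open>\<Psi> * \<phi>\<close> and \<open>\<Psi>\<close>. For Lipschitz data the quotient has
  the rate \<open>s = \<epsilon> powr (1 / k)\<close>; for continuous data, uniform approximation by polynomials on \<open>U\<close> gives the limit.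
\<close>

section \<open>The Hausdorff measure on Borel sets\<close>

lemma hausdorff_premeasure_empty [simp]: "hausdorff_premeasure r {} = 0"
  by (simp add: hausdorff_premeasure_def)

lemma hausdorff_approx_le:
  assumes "A \<subseteq> (\<Union>i. S i)" "\<And>i. bounded (S i)" "\<And>i. diameter (S i) \<le> \<delta>"
  shows "hausdorff_approx r \<delta> A \<le> (\<Sum>i. hausdorff_premeasure r (S i))"
  unfolding hausdorff_approx_def by (rule INF_lower) (use assms in auto)

lemma hausdorff_approx_ge:
  assumes "\<And>S. A \<subseteq> (\<Union>i. S i) \<Longrightarrow> (\<And>i. bounded (S i)) \<Longrightarrow> (\<And>i. diameter (S i) \<le> \<delta>)
     \<Longrightarrow> c \<le> (\<Sum>i. hausdorff_premeasure r (S i))"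
  shows "c \<le> hausdorff_approx r \<delta> A"
  unfolding hausdorff_approx_def by (rule INF_greatest) (use assms in auto)

lemma hausdorff_approx_mono: "A \<subseteq> B \<Longrightarrow> hausdorff_approx r \<delta> A \<le> hausdorff_approx r \<delta> B"
  unfolding hausdorff_approx_def by (rule INF_superset_mono) auto

lemma hausdorff_approx_antimono: "\<delta> \<le> \<epsilon> \<Longrightarrow> hausdorff_approx r \<epsilon> A \<le> hausdorff_approx r \<delta> A"
  unfolding hausdorff_approx_def by (rule INF_superset_mono) (auto intro: order_trans)

lemma hausdorff_approx_le_outer: "0 < \<delta> \<Longrightarrow> hausdorff_approx r \<delta> A \<le> hausdorff_outer r A"
  unfolding hausdorff_outer_def by (rule SUP_upper) auto

lemma hausdorff_outer_le:
  "(\<And>\<delta>. 0 < \<delta> \<Longrightarrow> hausdorff_approx r \<delta> A \<le> c) \<Longrightarrow> hausdorff_outer r A \<le> c"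
  unfolding hausdorff_outer_def by (rule SUP_least) auto

lemma hausdorff_outer_mono: "A \<subseteq> B \<Longrightarrow> hausdorff_outer r A \<le> hausdorff_outer r B"
  by (meson hausdorff_outer_le hausdorff_approx_mono hausdorff_approx_le_outer order_trans)

lemma hausdorff_outer_empty [simp]: "hausdorff_outer r {} = 0"
proof -
  have "hausdorff_approx r \<delta> ({} :: 'a set) \<le> 0" if "0 < \<delta>" for \<delta>
    using hausdorff_approx_le[of "{}" "\<lambda>_. {}" \<delta> r] that by simp
  then have "hausdorff_outer r ({} :: 'a set) \<le> 0"
    by (rule hausdorff_outer_le)
  then show ?thesis by simp
qed

lemma hausdorff_approx_finite_cover:
  assumes "finite I" "A \<subseteq> (\<Union>i\<in>I. S i)" "\<And>i. i \<in> I \<Longrightarrow> bounded (S i)"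
    "\<And>i. i \<in> I \<Longrightarrow> diameter (S i) \<le> \<delta>" "0 \<le> \<delta>"
  shows "hausdorff_approx r \<delta> A \<le> (\<Sum>i\<in>I. hausdorff_premeasure r (S i))"
proof -
  obtain f where f: "bij_betw f {..<card I} I"
    using assms(1) ex_bij_betw_nat_finite atLeast0LessThan by metis
  define T where "T n = (if n < card I then S (f n) else {})" for n
  have "A \<subseteq> (\<Union>n. T n)"
  proof
    fix x assume "x \<in> A"
    then obtain i where "i \<in> I" "x \<in> S i" using assms by blast
    then obtain n where "n < card I" "f n = i"
      using bij_betw_imp_surj_on[OF f] by (metis imageE lessThan_iff)
    then have "x \<in> T n" using \<open>x \<in> S i\<close> by (simp add: T_def)
    then show "x \<in> (\<Union>n. T n)" by blast
  qed
  moreover have "f n \<in> I" if "n < card I" for n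
    using f that by (auto simp: bij_betw_def)
  ultimately have "hausdorff_approx r \<delta> A \<le> (\<Sum>n. hausdorff_premeasure r (T n))"
    by (intro hausdorff_approx_le) (auto simp: T_def assms)
  also have "\<dots> = (\<Sum>n<card I. hausdorff_premeasure r (T n))"
    by (rule suminf_finite) (auto simp: T_def)
  also have "\<dots> = (\<Sum>n<card I. hausdorff_premeasure r (S (f n)))"
    by (simp add: T_def)
  also have "\<dots> = (\<Sum>i\<in>I. hausdorff_premeasure r (S i))"
    by (rule sum.reindex_bij_betw[OF f])
  finally show ?thesis .
qed

lemma hausdorff_approx_countably_subadditive:
  "hausdorff_approx r \<delta> (\<Union>i. A i) \<le> (\<Sum>i. hausdorff_approx r \<delta> (A (i::nat)))"
proof (rule ennreal_le_epsilon)
  fix e :: real assume fin: "(\<Sum>i. hausdorff_approx r \<delta> (A i)) < top" and e: "0 < e"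
  have "\<exists>S. A i \<subseteq> (\<Union>j. S j) \<and> (\<forall>j::nat. bounded (S j) \<and> diameter (S j) \<le> \<delta>) \<and>
      (\<Sum>j. hausdorff_premeasure r (S j)) \<le> hausdorff_approx r \<delta> (A i) + ennreal (e * (1/2)^Suc i)" for i
  proof -
    have "hausdorff_approx r \<delta> (A i) < hausdorff_approx r \<delta> (A i) + ennreal (e * (1/2)^Suc i)"
    proof -
      have "hausdorff_approx r \<delta> (A i) < top"
        using fin ennreal_suminf_lessD by blast
      then show ?thesis using e
        by (metis ennreal_add_eq_top ennreal_less_zero_iff ennreal_neq_top half_gt_zero_iff less_le less_top
            mult_pos_pos not_less zero_less_one zero_less_power ennreal_add_left_cancel_less add.right_neutral zero_less_divide_1_iff zero_less_numeral)
    qed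
    then show ?thesis unfolding hausdorff_approx_def INF_less_iff
      by (auto intro: less_imp_le)
  qed
  then obtain S where S: "\<And>i. A i \<subseteq> (\<Union>j. S i j)" "\<And>i j::nat. bounded (S i j)"
    "\<And>i j. diameter (S i j) \<le> \<delta>"
    "\<And>i. (\<Sum>j. hausdorff_premeasure r (S i j)) \<le> hausdorff_approx r \<delta> (A i) + ennreal (e * (1/2)^Suc i)"
    by metis
  define C where "C = (\<lambda>(i,j). S i j) \<circ> prod_decode"
  have "(\<Union>i. A i) \<subseteq> (\<Union>n. C n)"
  proof
    fix x assume "x \<in> (\<Union>i. A i)"
    then obtain i j where "x \<in> S i j" using S(1) by blast
    then have "x \<in> C (prod_encode (i,j))" by (simp add: C_def)
    then show "x \<in> (\<Union>n. C n)" by blast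
  qed
  then have "hausdorff_approx r \<delta> (\<Union>i. A i) \<le> (\<Sum>n. hausdorff_premeasure r (C n))"
    using S(2,3) by (intro hausdorff_approx_le) (auto simp: C_def split: prod.splits)
  also have "\<dots> = (\<Sum>i. \<Sum>j. hausdorff_premeasure r (S i j))"
    using suminf_ennreal_2dimen[of "\<lambda>i. (\<Sum>j. hausdorff_premeasure r (S i j))" "\<lambda>(i,j). hausdorff_premeasure r (S i j)"]
    by (simp add: C_def comp_def split_def)
  also have "\<dots> \<le> (\<Sum>i. hausdorff_approx r \<delta> (A i) + ennreal (e * (1/2)^Suc i))"
    by (intro suminf_le S) auto
  also have "\<dots> = (\<Sum>i. hausdorff_approx r \<delta> (A i)) + (\<Sum>i. ennreal (e * (1/2)^Suc i))"
    by (intro suminf_add[symmetric]) auto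
  also have "(\<Sum>i. ennreal (e * (1/2)^Suc i)) = ennreal e"
    using sums_mult[OF power_half_series, of e] e
    by (subst suminf_ennreal2) (auto simp: sums_iff simp del: power_Suc)
  finally show "hausdorff_approx r \<delta> (\<Union>i. A i) \<le> (\<Sum>i. hausdorff_approx r \<delta> (A i)) + ennreal e" .
qed

lemma hausdorff_outer_countably_subadditive:
  "hausdorff_outer r (\<Union>i. A i) \<le> (\<Sum>i. hausdorff_outer r (A (i::nat)))"
proof (rule hausdorff_outer_le)
  fix \<delta> :: real assume "0 < \<delta>"
  have "hausdorff_approx r \<delta> (\<Union>i. A i) \<le> (\<Sum>i. hausdorff_approx r \<delta> (A i))"
    by (rule hausdorff_approx_countably_subadditive)
  also have "\<dots> \<le> (\<Sum>i. hausdorff_outer r (A i))"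
    using \<open>0 < \<delta>\<close> by (intro suminf_le hausdorff_approx_le_outer) auto
  finally show "hausdorff_approx r \<delta> (\<Union>i. A i) \<le> (\<Sum>i. hausdorff_outer r (A i))" .
qed

lemma outer_measure_space_hausdorff: "outer_measure_space UNIV (hausdorff_outer r)"
  unfolding outer_measure_space_def positive_def increasing_def countably_subadditive_def
  by (auto intro: hausdorff_outer_mono hausdorff_outer_countably_subadditive)

lemma hausdorff_outer_Un: "hausdorff_outer r (A \<union> B) \<le> hausdorff_outer r A + hausdorff_outer r B"
proof -
  have "hausdorff_outer r (\<Union>i. binaryset A B i) \<le> (\<Sum>i. hausdorff_outer r (binaryset A B i))"
    by (rule hausdorff_outer_countably_subadditive)
  moreover have "(\<Sum>i. hausdorff_outer r (binaryset A B i)) = hausdorff_outer r A + hausdorff_outer r B"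
    by (rule suminf_binaryset_eq) simp
  ultimately show ?thesis by (simp add: UN_binaryset_eq)
qed

text \<open>A set of diameter below the distance of two sets meets at most one of them, so every fine
  cover of the union splits into covers of the two parts.\<close>

lemma hausdorff_outer_separated:
  fixes A B :: "'a::metric_space set"
  assumes "0 < e" and sep: "\<And>a b. a \<in> A \<Longrightarrow> b \<in> B \<Longrightarrow> e \<le> dist a b"
  shows "hausdorff_outer r A + hausdorff_outer r B \<le> hausdorff_outer r (A \<union> B)"
proof -
  have main: "hausdorff_approx r \<delta> A + hausdorff_approx r \<delta> B \<le> hausdorff_approx r \<delta> (A \<union> B)"
    if "0 < \<delta>" "\<delta> < e" for \<delta>
  proof (rule hausdorff_approx_ge)
    fix S :: "nat \<Rightarrow> 'a set"
    assume S: "A \<union> B \<subseteq> (\<Union>i. S i)" "\<And>i. bounded (S i)" "\<And>i. diameter (S i) \<le> \<delta>"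
    define SA where "SA i = (if S i \<inter> A = {} then {} else S i)" for i
    define SB where "SB i = (if S i \<inter> B = {} then {} else S i)" for i
    have "hausdorff_approx r \<delta> A \<le> (\<Sum>i. hausdorff_premeasure r (SA i))"
      using S that by (intro hausdorff_approx_le) (auto 0 4 simp: SA_def)
    moreover have "hausdorff_approx r \<delta> B \<le> (\<Sum>i. hausdorff_premeasure r (SB i))"
      using S that by (intro hausdorff_approx_le) (auto 0 4 simp: SB_def)
    moreover have "hausdorff_premeasure r (SA i) + hausdorff_premeasure r (SB i) \<le> hausdorff_premeasure r (S i)" for i
    proof -
      have "S i \<inter> A = {} \<or> S i \<inter> B = {}"
      proof (rule ccontr)
        assume "\<not> ?thesis"
        then obtain a b where "a \<in> S i" "a \<in> A" "b \<in> S i" "b \<in> B" by blast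
        then have "e \<le> dist a b" "dist a b \<le> diameter (S i)"
          using sep diameter_bounded_bound[OF S(2)] by auto
        with S(3)[of i] that show False by linarith
      qed
      then show ?thesis by (auto simp: SA_def SB_def)
    qed
    then have "(\<Sum>i. hausdorff_premeasure r (SA i) + hausdorff_premeasure r (SB i)) \<le> (\<Sum>i. hausdorff_premeasure r (S i))"
      by (intro suminf_le) auto
    ultimately show "hausdorff_approx r \<delta> A + hausdorff_approx r \<delta> B \<le> (\<Sum>i. hausdorff_premeasure r (S i))"
      by (subst (asm) suminf_add[symmetric]) (auto intro: order_trans add_mono)
  qed
  have step: "hausdorff_approx r \<delta> A + hausdorff_approx r \<eta> B \<le> hausdorff_outer r (A \<union> B)" if "0 < \<delta>" "0 < \<eta>" for \<delta> \<eta>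
  proof -
    define \<theta> where "\<theta> = min (e/2) (min \<delta> \<eta>)"
    have t: "0 < \<theta>" "\<theta> < e" "\<theta> \<le> \<delta>" "\<theta> \<le> \<eta>" using that assms by (auto simp: \<theta>_def)
    have "hausdorff_approx r \<delta> A + hausdorff_approx r \<eta> B \<le> hausdorff_approx r \<theta> A + hausdorff_approx r \<theta> B"
      using t by (intro add_mono hausdorff_approx_antimono)
    also have "\<dots> \<le> hausdorff_outer r (A \<union> B)"
      using main[of \<theta>] t hausdorff_approx_le_outer order_trans by blast
    finally show ?thesis .
  qed
  have "hausdorff_outer r A + hausdorff_approx r \<eta> B \<le> hausdorff_outer r (A \<union> B)" if "0 < \<eta>" for \<eta>
    unfolding hausdorff_outer_def[of r A] using step that
    by (subst ennreal_SUP_add_left[symmetric]) (auto intro!: SUP_least)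
  then have "(SUP \<eta>\<in>{0<..}. hausdorff_outer r A + hausdorff_approx r \<eta> B) \<le> hausdorff_outer r (A \<union> B)"
    by (intro SUP_least) auto
  then show ?thesis
    unfolding hausdorff_outer_def[of r B]
    by (subst ennreal_SUP_add_right) auto
qed

text \<open>Caratheodory's criterion: the shells of points of \<open>X\<close> at distance between \<open>1/(n+2)\<close> and
  \<open>1/(n+1)\<close> from the closed set are pairwise separated after skipping every other one, so their
  measures are summable and the shells close to the set can be neglected.\<close>

lemma closed_in_lambda_system_hausdorff:
  fixes C :: "'a::metric_space set"
  assumes "closed C"
  shows "C \<in> lambda_system UNIV UNIV (hausdorff_outer r)"
proof -
  have "hausdorff_outer r (C \<inter> X) + hausdorff_outer r (- C \<inter> X) \<le> hausdorff_outer r X" for X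
  proof (cases "C = {} \<or> hausdorff_outer r X = top")
    case True
    then show ?thesis by (auto intro: hausdorff_outer_mono)
  next
    case False
    then have "C \<noteq> {}" and fin: "hausdorff_outer r X < top" by (auto simp: top.not_eq_extremum)
    define A where "A n = {x \<in> X. 1 / (real n + 1) \<le> infdist x C}" for n
    define R where "R n = {x \<in> X. 1 / (real n + 2) \<le> infdist x C \<and> infdist x C < 1 / (real n + 1)}" for n
    have RX: "R n \<subseteq> X" for n by (auto simp: R_def)
    have far: "infdist x C \<le> infdist y C + dist x y" for x y
      by (rule infdist_triangle)
    have skip: "(\<Sum>n<N. hausdorff_outer r (R (2 * n + j))) \<le> hausdorff_outer r (\<Union>n<N. R (2 * n + j))" for N j
    proof (induction N)
      case (Suc N)
      have "(\<Sum>n<Suc N. hausdorff_outer r (R (2 * n + j)))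
          \<le> hausdorff_outer r (\<Union>n<N. R (2 * n + j)) + hausdorff_outer r (R (2 * N + j))"
        using Suc by (simp add: add_mono)
      also have "\<dots> \<le> hausdorff_outer r ((\<Union>n<N. R (2 * n + j)) \<union> R (2 * N + j))"
      proof (cases "N = 0")
        case False
        show ?thesis
        proof (rule hausdorff_outer_separated)
          show "0 < 1 / (2 * real N + real j) - 1 / (2 * real N + real j + 1)"
            using False by (simp add: frac_less2)
        next
          fix a b assume a: "a \<in> (\<Union>n<N. R (2 * n + j))" and b: "b \<in> R (2 * N + j)"
          then obtain n where n: "n < N" "a \<in> R (2 * n + j)" by blast
          have "1 / (2 * real N + real j) \<le> 1 / (real (2 * n + j) + 2)"
            using n(1) by (intro divide_left_mono) auto
          also have "\<dots> \<le> infdist a C" using n(2) by (simp add: R_def)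
          finally show "1 / (2 * real N + real j) - 1 / (2 * real N + real j + 1) \<le> dist a b"
            using far[of a b] b by (auto simp: R_def)
        qed
      qed simp
      also have "(\<Union>n<N. R (2 * n + j)) \<union> R (2 * N + j) = (\<Union>n<Suc N. R (2 * n + j))"
        by (auto simp: less_Suc_eq)
      finally show ?case .
    qed simp
    have skip': "(\<Sum>n<N. hausdorff_outer r (R (2 * n + j))) \<le> hausdorff_outer r X" for N j
      by (rule order_trans[OF skip hausdorff_outer_mono]) (use RX in blast)
    have part: "(\<Sum>n<N. hausdorff_outer r (R n)) \<le> 2 * hausdorff_outer r X" for N
    proof -
      have "(\<Sum>n<N. hausdorff_outer r (R n)) \<le> (\<Sum>n<2*N. hausdorff_outer r (R n))"
        by (rule sum_mono2) auto
      also have "\<dots> = (\<Sum>n<N. hausdorff_outer r (R (2*n))) + (\<Sum>n<N. hausdorff_outer r (R (2*n+1)))"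
        by (induction N) (auto simp: algebra_simps)
      also have "\<dots> \<le> hausdorff_outer r X + hausdorff_outer r X"
        using skip'[where j = 0] skip'[where j = 1] by (intro add_mono) simp_all
      finally show ?thesis by (simp add: mult_2)
    qed
    define a where "a n = enn2real (hausdorff_outer r (R n))" for n
    have a: "hausdorff_outer r (R n) = ennreal (a n)" "0 \<le> a n" for n
      using le_less_trans[OF hausdorff_outer_mono[OF RX[of n]] fin] by (auto simp: a_def)
    have "summable a"
    proof (rule summableI_nonneg_bounded)
      fix N
      have "ennreal (\<Sum>n<N. a n) = (\<Sum>n<N. hausdorff_outer r (R n))"
        using a by (simp add: sum_ennreal)
      also have "\<dots> \<le> ennreal (2 * enn2real (hausdorff_outer r X))"
        using part[of N] fin by (simp add: ennreal_mult)
      finally show "(\<Sum>n<N. a n) \<le> 2 * enn2real (hausdorff_outer r X)"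
        by (simp add: ennreal_le_iff)
    qed (use a in auto)
    show ?thesis
    proof (rule ennreal_le_epsilon)
      fix e :: real assume "0 < e"
      obtain n where n: "norm (\<Sum>i. a (i + n)) < e"
        using suminf_exist_split[OF \<open>0 < e\<close> \<open>summable a\<close>] by auto
      have sa: "summable (\<lambda>i. a (i + n))" using \<open>summable a\<close> by (simp add: summable_iff_shift)
      have "- C \<inter> X \<subseteq> A n \<union> (\<Union>i. R (i + n))"
      proof
        fix x assume x: "x \<in> - C \<inter> X"
        then have "0 < infdist x C"
          using in_closed_iff_infdist_zero[OF \<open>closed C\<close> \<open>C \<noteq> {}\<close>, of x] infdist_nonneg[of x C] by auto
        show "x \<in> A n \<union> (\<Union>i. R (i + n))"
        proof (cases "1 / (real n + 1) \<le> infdist x C")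
          case True
          with x show ?thesis by (auto simp: A_def)
        next
          case False
          obtain k where k: "1 / (real k + 1) \<le> infdist x C"
            using reals_Archimedean[OF \<open>0 < infdist x C\<close>]
            by (auto simp: inverse_eq_divide add.commute dest: less_imp_le)
          define l where "l = (LEAST k. 1 / (real k + 1) \<le> infdist x C)"
          have l: "1 / (real l + 1) \<le> infdist x C" unfolding l_def by (rule LeastI, rule k)
          have lmin: "\<not> 1 / (real i + 1) \<le> infdist x C" if "i < l" for i
            using that unfolding l_def by (rule not_less_Least)
          have "n < l"
          proof (rule ccontr)
            assume "\<not> n < l"
            then have "1 / (real n + 1) \<le> 1 / (real l + 1)" by (intro divide_left_mono) auto
            with l False show False by linarith
          qed
          define i where "i = l - 1 - n"
          have "l = Suc (i + n)" using \<open>n < l\<close> by (simp add: i_def)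
          with l lmin[of "i + n"] x have "x \<in> R (i + n)"
            by (auto simp: R_def algebra_simps)
          then show ?thesis by blast
        qed
      qed
      then have "hausdorff_outer r (- C \<inter> X) \<le> hausdorff_outer r (A n) + hausdorff_outer r (\<Union>i. R (i + n))"
        by (meson hausdorff_outer_mono hausdorff_outer_Un order_trans)
      also have "hausdorff_outer r (\<Union>i. R (i + n)) \<le> (\<Sum>i. hausdorff_outer r (R (i + n)))"
        by (rule hausdorff_outer_countably_subadditive)
      also have "\<dots> = ennreal (\<Sum>i. a (i + n))"
        using a sa by (simp add: suminf_ennreal2)
      also have "\<dots> \<le> ennreal e" using n by (intro ennreal_leI) auto
      finally have 1: "hausdorff_outer r (- C \<inter> X) \<le> hausdorff_outer r (A n) + ennreal e"
        by (simp add: add_left_mono)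
      have "hausdorff_outer r (C \<inter> X) + hausdorff_outer r (A n) \<le> hausdorff_outer r ((C \<inter> X) \<union> A n)"
      proof (rule hausdorff_outer_separated)
        show "0 < 1 / (real n + 1)" by simp
        fix c y assume "c \<in> C \<inter> X" "y \<in> A n"
        then show "1 / (real n + 1) \<le> dist c y"
          using infdist_le[of c C y] by (auto simp: A_def dist_commute)
      qed
      also have "\<dots> \<le> hausdorff_outer r X" by (rule hausdorff_outer_mono) (auto simp: A_def)
      finally have 2: "hausdorff_outer r (C \<inter> X) + hausdorff_outer r (A n) \<le> hausdorff_outer r X" .
      have "hausdorff_outer r (C \<inter> X) + hausdorff_outer r (- C \<inter> X)
          \<le> (hausdorff_outer r (C \<inter> X) + hausdorff_outer r (A n)) + ennreal e"
        using 1 by (simp add: add.assoc add_left_mono)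
      also have "\<dots> \<le> hausdorff_outer r X + ennreal e" using 2 by (rule add_right_mono)
      finally show "hausdorff_outer r (C \<inter> X) + hausdorff_outer r (- C \<inter> X) \<le> hausdorff_outer r X + ennreal e" .
    qed
  qed
  moreover have "hausdorff_outer r X \<le> hausdorff_outer r (C \<inter> X) + hausdorff_outer r (- C \<inter> X)" for X
  proof -
    have "X = (C \<inter> X) \<union> (- C \<inter> X)" by blast
    then show ?thesis using hausdorff_outer_Un[of r "C \<inter> X" "- C \<inter> X"] by simp
  qed
  ultimately show ?thesis
    unfolding lambda_system_def Compl_eq_Diff_UNIV[symmetric] by (auto intro: antisym)
qed

lemma measure_space_hausdorff: "measure_space UNIV (sets borel) (hausdorff_outer r)"
proof -
  interpret sigma_algebra UNIV "UNIV :: 'a set set"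
    using sigma_algebra_Pow[of UNIV] by simp
  have L: "measure_space UNIV (lambda_system UNIV UNIV (hausdorff_outer r)) (hausdorff_outer r :: 'a set \<Rightarrow> _)"
    by (rule caratheodory_lemma[OF outer_measure_space_hausdorff])
  then interpret L: sigma_algebra UNIV "lambda_system UNIV UNIV (hausdorff_outer r) :: 'a set set"
    by (simp add: measure_space_def)
  have "sets borel \<subseteq> lambda_system UNIV UNIV (hausdorff_outer r :: 'a set \<Rightarrow> _)"
    unfolding borel_eq_closed
    by (subst sets_measure_of) (auto intro!: L.sigma_sets_subset closed_in_lambda_system_hausdorff)
  moreover have "sigma_algebra (UNIV :: 'a set) (sets borel)"
    using sets.sigma_algebra_axioms[of borel] by simp
  ultimately show ?thesis using L measure_down by blast
qed

lemma sets_hausdorff_measure [simp, measurable_cong]: "sets (hausdorff_measure r) = sets borel"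
  by (simp add: hausdorff_measure_def sets.sigma_sets_eq[of borel, simplified])

lemma space_hausdorff_measure [simp]: "space (hausdorff_measure r) = UNIV"
  by (simp add: hausdorff_measure_def)

lemma emeasure_hausdorff_measure:
  "A \<in> sets borel \<Longrightarrow> emeasure (hausdorff_measure r) A = hausdorff_outer r A"
  unfolding hausdorff_measure_def
  by (rule emeasure_measure_of_sigma) (use measure_space_hausdorff[of r] in \<open>auto simp: measure_space_def\<close>)

text \<open>The images of a cover of \<open>A\<close>, cut down to \<open>A\<close>, cover \<open>f ` A\<close>, and their diameters grow by the factor
  \<open>L\<close> at most. This is how near-isometric charts control the Hausdorff measure of the zero set.\<close>

lemma hausdorff_outer_lipschitz_image:
  fixes f :: "'a::metric_space \<Rightarrow> 'b::metric_space"
  assumes f: "L-lipschitz_on A f" and L: "0 < L"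
  shows "hausdorff_outer r (f ` A) \<le> ennreal (L ^ r) * hausdorff_outer r A"
proof (rule hausdorff_outer_le)
  fix \<delta> :: real assume d: "0 < \<delta>"
  have "hausdorff_approx r \<delta> (f ` A) * ennreal (1 / L ^ r) \<le> hausdorff_approx r (\<delta> / L) A"
  proof (rule hausdorff_approx_ge)
    fix S :: "nat \<Rightarrow> 'a set"
    assume S: "A \<subseteq> (\<Union>i. S i)" "\<And>i. bounded (S i)" "\<And>i. diameter (S i) \<le> \<delta> / L"
    have d1: "dist (f x) (f y) \<le> L * diameter (S i)" if "x \<in> S i \<inter> A" "y \<in> S i \<inter> A" for i x y
    proof -
      have "dist (f x) (f y) \<le> L * dist x y" using that f by (auto intro: lipschitz_onD)
      also have "\<dots> \<le> L * diameter (S i)"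
        using that L diameter_bounded_bound[OF S(2)[of i]] by (intro mult_left_mono) auto
      finally show ?thesis .
    qed
    have d2: "diameter (f ` (S i \<inter> A)) \<le> L * diameter (S i)" for i
      using d1[of _ i] L diameter_ge_0[OF S(2)[of i]] unfolding diameter_def[of "f ` (S i \<inter> A)"]
      by (auto intro!: cSUP_least)
    have p: "hausdorff_premeasure r (f ` (S i \<inter> A)) \<le> ennreal (L ^ r) * hausdorff_premeasure r (S i)" for i
    proof (cases "S i \<inter> A = {}")
      case False
      have b: "bounded (f ` (S i \<inter> A))"
        unfolding bounded_two_points using d1[of _ i] by blast
      have "unit_ball_vol (real r) * (diameter (f ` (S i \<inter> A)) / 2) ^ r
          \<le> unit_ball_vol (real r) * (L * diameter (S i) / 2) ^ r"
        using d2[of i] diameter_ge_0[OF b] by (intro mult_left_mono power_mono divide_right_mono) auto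
      also have "\<dots> = L ^ r * (unit_ball_vol (real r) * (diameter (S i) / 2) ^ r)"
        by (simp add: power_mult_distrib power_divide)
      finally show ?thesis
        using False L by (auto simp: hausdorff_premeasure_def ennreal_mult'[symmetric] intro!: ennreal_leI)
    qed simp
    have "hausdorff_approx r \<delta> (f ` A) \<le> (\<Sum>i. hausdorff_premeasure r (f ` (S i \<inter> A)))"
    proof (rule hausdorff_approx_le)
      show "f ` A \<subseteq> (\<Union>i. f ` (S i \<inter> A))" using S(1) by blast
      show "bounded (f ` (S i \<inter> A))" for i
        unfolding bounded_two_points using d1[of _ i] by blast
      show "diameter (f ` (S i \<inter> A)) \<le> \<delta>" for i
        using d2[of i] S(3)[of i] L by (simp add: field_simps)
    qed
    also have "\<dots> \<le> (\<Sum>i. ennreal (L ^ r) * hausdorff_premeasure r (S i))"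
      by (intro suminf_le p) auto
    finally have "hausdorff_approx r \<delta> (f ` A) \<le> ennreal (L ^ r) * (\<Sum>i. hausdorff_premeasure r (S i))"
      by simp
    then have "hausdorff_approx r \<delta> (f ` A) * ennreal (1 / L ^ r)
       \<le> ennreal (L ^ r) * (\<Sum>i. hausdorff_premeasure r (S i)) * ennreal (1 / L ^ r)"
      by (rule mult_right_mono) simp
    also have "\<dots> = (ennreal (L ^ r) * ennreal (1 / L ^ r)) * (\<Sum>i. hausdorff_premeasure r (S i))"
      by (simp add: ac_simps)
    also have "ennreal (L ^ r) * ennreal (1 / L ^ r) = 1"
      using L by (simp add: ennreal_mult'[symmetric])
    finally show "hausdorff_approx r \<delta> (f ` A) * ennreal (1 / L ^ r) \<le> (\<Sum>i. hausdorff_premeasure r (S i))"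
      by simp
  qed
  also have "\<dots> \<le> hausdorff_outer r A" using d L by (intro hausdorff_approx_le_outer) simp
  finally have "ennreal (L ^ r) * (hausdorff_approx r \<delta> (f ` A) * ennreal (1 / L ^ r)) \<le> ennreal (L ^ r) * hausdorff_outer r A"
    by (rule mult_left_mono) simp
  also have "ennreal (L ^ r) * (hausdorff_approx r \<delta> (f ` A) * ennreal (1 / L ^ r))
     = (ennreal (L ^ r) * ennreal (1 / L ^ r)) * hausdorff_approx r \<delta> (f ` A)"
    by (simp add: ac_simps)
  also have "ennreal (L ^ r) * ennreal (1 / L ^ r) = 1"
    using L by (simp add: ennreal_mult'[symmetric])
  finally show "hausdorff_approx r \<delta> (f ` A) \<le> ennreal (L ^ r) * hausdorff_outer r A" by simp
qed

section \<open>Change of variables for arbitrary finite index types\<close>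

text \<open>The index type with an arbitrary enumeration as its order. It transfers the change of
  variables formula, which is about well-ordered index types, to all finite index types.\<close>

typedef 'a ordered_index = "UNIV :: 'a set" by simp

instance ordered_index :: (finite) finite
proof
  show "finite (UNIV :: 'a ordered_index set)"
    by (simp add: type_definition.univ[OF type_definition_ordered_index])
qed

definition ordered_index_rank :: "'a::finite ordered_index \<Rightarrow> nat" where
  "ordered_index_rank = (SOME f. inj f)"

lemma inj_ordered_index_rank: "inj ordered_index_rank"
  unfolding ordered_index_rank_def
  using finite_imp_inj_to_nat_seg[OF finite] by (metis (mono_tags) someI_ex)

instantiation ordered_index :: (finite) wellorder
begin

definition "x \<le> y \<longleftrightarrow> ordered_index_rank x \<le> ordered_index_rank y" for x y :: "'a ordered_index"
definition "x < y \<longleftrightarrow> ordered_index_rank x < ordered_index_rank y" for x y :: "'a ordered_index"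

instance
proof
  fix x y z :: "'a ordered_index" and P :: "'a ordered_index \<Rightarrow> bool"
  show "(x < y) = (x \<le> y \<and> \<not> y \<le> x)" "x \<le> x" "x \<le> y \<Longrightarrow> y \<le> z \<Longrightarrow> x \<le> z" "x \<le> y \<or> y \<le> x"
    by (auto simp: less_ordered_index_def less_eq_ordered_index_def)
  show "x = y" if "x \<le> y" "y \<le> x"
  proof (rule injD[OF inj_ordered_index_rank])
    show "ordered_index_rank x = ordered_index_rank y"
      using that unfolding less_eq_ordered_index_def by (rule antisym)
  qed
  show "P x" if step: "\<And>x. (\<And>y. y < x \<Longrightarrow> P y) \<Longrightarrow> P x"
  proof (induction x rule: measure_induct_rule[of ordered_index_rank])
    case (less x)
    show ?case by (rule step, rule less) (simp add: less_ordered_index_def)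
  qed
qed

end

lemma sign_conjugate:
  fixes f :: "'a::finite \<Rightarrow> 'b::finite"
  assumes f: "bij f" and p: "p permutes UNIV"
  shows "sign (f \<circ> p \<circ> inv f) = sign p"
proof -
  have "map_permutation UNIV f p = f \<circ> p \<circ> inv f"
    using f by (simp add: map_permutation_def restrict_id_def bij_is_surj comp_def)
  then show ?thesis
    using sign_map_permutation[OF _ p finite, of f] f by (simp add: bij_is_inj)
qed

text \<open>Conjugation by the bijection permutes the terms of the Leibniz formula and preserves signs.\<close>

lemma det_relabel:
  fixes A :: "real^'d^'d" and f :: "'e::finite \<Rightarrow> 'd"
  assumes f: "bij f"
  shows "det (\<chi> i j. A $ f i $ f j) = det A"
proof -
  have [simp]: "inv f (f x) = x" "f (inv f y) = y" for x y
    using f by (simp_all add: bij_is_inj bij_is_surj surj_f_inv_f)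
  have bij: "bij_betw (\<lambda>p. f \<circ> p \<circ> inv f) {p. p permutes UNIV} {p. p permutes UNIV}"
    by (rule bij_betw_byWitness[where f' = "\<lambda>p. inv f \<circ> p \<circ> f"])
       (use f in \<open>auto simp: fun_eq_iff permutes_bij intro!: bij_imp_permutes bij_comp bij_imp_bij_inv\<close>)
  have "det A = (\<Sum>p\<in>{p. p permutes UNIV}. of_int (sign (f \<circ> p \<circ> inv f)) * (\<Prod>i\<in>UNIV. A $ i $ (f \<circ> p \<circ> inv f) i))"
    unfolding det_def by (rule sum.reindex_bij_betw[OF bij, symmetric])
  also have "\<dots> = (\<Sum>p\<in>{p. p permutes UNIV}. of_int (sign p) * (\<Prod>i\<in>UNIV. A $ f i $ f (p i)))"
  proof (rule sum.cong[OF refl])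
    fix p :: "'e \<Rightarrow> 'e" assume "p \<in> {p. p permutes UNIV}"
    moreover have "(\<Prod>i\<in>UNIV. A $ i $ (f \<circ> p \<circ> inv f) i) = (\<Prod>i\<in>UNIV. A $ f i $ f (p i))"
      using prod.reindex_bij_betw[OF f, of "\<lambda>i. A $ i $ (f \<circ> p \<circ> inv f) i"] by simp
    ultimately show "of_int (sign (f \<circ> p \<circ> inv f)) * (\<Prod>i\<in>UNIV. A $ i $ (f \<circ> p \<circ> inv f) i)
        = of_int (sign p) * (\<Prod>i\<in>UNIV. A $ f i $ f (p i))"
      using sign_conjugate[OF f] by simp
  qed
  also have "\<dots> = det (\<chi> i j. A $ f i $ f j)"
    by (simp add: det_def)
  finally show ?thesis by simp
qed

definition relabel :: "('e \<Rightarrow> 'd) \<Rightarrow> real^'d \<Rightarrow> real^'e" where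
  "relabel f x = (\<chi> i. x $ f i)"

lemma linear_relabel: "linear (relabel f)"
  by (auto intro!: linearI simp: relabel_def vec_eq_iff)

lemma relabel_inverse: "bij f \<Longrightarrow> relabel (inv f) (relabel f x) = x" "bij f \<Longrightarrow> relabel f (relabel (inv f) y) = y"
  by (simp_all add: relabel_def vec_eq_iff bij_is_inj bij_is_surj surj_f_inv_f)

lemma distr_relabel_lborel:
  fixes f :: "'e::finite \<Rightarrow> 'd::finite"
  assumes f: "bij f"
  shows "distr lborel borel (relabel f) = lborel"
proof (rule lborel_eqI[symmetric])
  have [measurable]: "relabel f \<in> borel_measurable borel"
    using linear_relabel by (intro borel_measurable_continuous_onI linear_continuous_on) (simp add: linear_linear)
  fix l u :: "real^'e" assume le: "\<And>b. b \<in> Basis \<Longrightarrow> l \<bullet> b \<le> u \<bullet> b"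
  have le': "l $ i \<le> u $ i" for i using le[of "axis i 1"] by (simp add: inner_axis axis_in_Basis_iff)
  have [simp]: "inv f (f x) = x" "f (inv f y) = y" for x y
    using f by (simp_all add: bij_is_inj bij_is_surj surj_f_inv_f)
  have "relabel f -` box l u = box (relabel (inv f) l) (relabel (inv f) u)"
  proof -
    have "(\<forall>i. l $ i < x $ f i \<and> x $ f i < u $ i) \<longleftrightarrow> (\<forall>j. l $ inv f j < x $ j \<and> x $ j < u $ inv f j)" for x :: "real^'d"
    proof (intro iffI allI)
      fix j assume "\<forall>i. l $ i < x $ f i \<and> x $ f i < u $ i"
      from this[rule_format, of "inv f j"] show "l $ inv f j < x $ j \<and> x $ j < u $ inv f j" by simp
    next
      fix i assume "\<forall>j. l $ inv f j < x $ j \<and> x $ j < u $ inv f j"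
      from this[rule_format, of "f i"] show "l $ i < x $ f i \<and> x $ f i < u $ i" by simp
    qed
    then show ?thesis by (auto simp: mem_box_cart relabel_def set_eq_iff)
  qed
  then have "emeasure (distr lborel borel (relabel f)) (box l u) = emeasure lborel (box (relabel (inv f) l) (relabel (inv f) u))"
    by (simp add: emeasure_distr)
  also have "\<dots> = (\<Prod>i\<in>UNIV. u $ inv f i - l $ inv f i)"
    using le' by (simp add: emeasure_lborel_box_eq Basis_vec_def inner_axis relabel_def UNION_singleton_eq_range
         prod.reindex inj_on_def axis_eq_axis)
  also have "(\<Prod>i\<in>UNIV. u $ inv f i - l $ inv f i) = (\<Prod>i\<in>UNIV. u $ i - l $ i)"
    using prod.reindex_bij_betw[OF f, of "\<lambda>i. u $ inv f i - l $ inv f i"] by simp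
  also have "\<dots> = (\<Prod>b\<in>Basis. (u - l) \<bullet> b)"
    by (simp add: Basis_vec_def inner_axis UNION_singleton_eq_range prod.reindex inj_on_def axis_eq_axis)
  finally show "emeasure (distr lborel borel (relabel f)) (box l u) = (\<Prod>b\<in>Basis. (u - l) \<bullet> b)" .
qed simp

text \<open>The image \<open>G ` V\<close> is open by invariance of domain, so the Henstock--Kurzweil form of the theorem
  turns into one about Bochner integrals over the whole space.\<close>

lemma change_of_variables_ordered:
  fixes G :: "real^'d::{finite,wellorder} \<Rightarrow> real^'d::_" and f :: "real^'d::_ \<Rightarrow> real"
  assumes V: "open V" and der: "\<And>x. x \<in> V \<Longrightarrow> (G has_derivative G' x) (at x)" and inj: "inj_on G V"
    and f [measurable]: "f \<in> borel_measurable borel"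
    and int: "integrable lborel (\<lambda>x. indicator V x * (\<bar>det (matrix (G' x))\<bar> * f (G x)))"
  shows "integrable lborel (\<lambda>y. indicator (G ` V) y * f y)"
    "(\<integral>y. indicator (G ` V) y * f y \<partial>lborel)
      = (\<integral>x. indicator V x * (\<bar>det (matrix (G' x))\<bar> * f (G x)) \<partial>lborel)"
proof -
  let ?g = "\<lambda>x. \<bar>det (matrix (G' x))\<bar> * f (G x)"
  have "continuous_on V G"
    using der V by (intro continuous_at_imp_continuous_on) (auto intro: has_derivative_continuous)
  then have GV [measurable]: "open (G ` V)"
    using invariance_of_domain[OF _ V inj] by simp
  have si: "set_integrable lebesgue V ?g"
    unfolding set_integrable_def using int
    by (simp add: integrable_completion borel_measurable_integrable)
  have "(\<lambda>x. \<bar>det (matrix (G' x))\<bar> *\<^sub>R (vec (f (G x)) :: real^1)) absolutely_integrable_on V \<and>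
        integral V (\<lambda>x. \<bar>det (matrix (G' x))\<bar> *\<^sub>R (vec (f (G x)) :: real^1)) = vec (integral V ?g)"
    using si by (simp add: absolutely_integrable_on_1_iff integral_on_1_eq)
  then have *: "(\<lambda>y. (vec (f y) :: real^1)) absolutely_integrable_on (G ` V) \<and>
        integral (G ` V) (\<lambda>y. (vec (f y) :: real^1)) = vec (integral V ?g)"
    using V by (subst (asm) has_absolute_integral_change_of_variables)
       (auto intro: has_derivative_at_withinI der inj)
  then have f1: "f absolutely_integrable_on (G ` V)" and f2: "integral (G ` V) f = integral V ?g"
    by (simp_all add: absolutely_integrable_on_1_iff integral_on_1_eq)
  have GV' [measurable]: "G ` V \<in> sets borel" using GV by simp
  show "integrable lborel (\<lambda>y. indicator (G ` V) y * f y)"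
    using f1 unfolding set_integrable_def by (subst (asm) integrable_completion) auto
  have "(\<integral>y. indicator (G ` V) y * f y \<partial>lborel) = (LINT y:G ` V|lebesgue. f y)"
    unfolding set_lebesgue_integral_def by (subst integral_completion) auto
  also have "\<dots> = integral (G ` V) f" using f1 by (rule set_lebesgue_integral_eq_integral(2))
  also have "\<dots> = integral V ?g" by (rule f2)
  also have "\<dots> = (LINT x:V|lebesgue. ?g x)"
    using si by (rule set_lebesgue_integral_eq_integral(2)[symmetric])
  also have "\<dots> = (\<integral>x. indicator V x * ?g x \<partial>lborel)"
    unfolding set_lebesgue_integral_def using int
    by (subst integral_completion) (auto dest: borel_measurable_integrable)
  finally show "(\<integral>y. indicator (G ` V) y * f y \<partial>lborel) = (\<integral>x. indicator V x * ?g x \<partial>lborel)" .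
qed

lemma change_of_variables:
  fixes G :: "real^'d \<Rightarrow> real^'d" and f :: "real^'d \<Rightarrow> real"
  assumes V: "open V" and der: "\<And>x. x \<in> V \<Longrightarrow> (G has_derivative G' x) (at x)" and inj: "inj_on G V"
    and f [measurable]: "f \<in> borel_measurable borel"
    and int: "integrable lborel (\<lambda>x. indicator V x * (\<bar>det (matrix (G' x))\<bar> * f (G x)))"
  shows "integrable lborel (\<lambda>y. indicator (G ` V) y * f y)" (is ?A)
    "(\<integral>y. indicator (G ` V) y * f y \<partial>lborel)
      = (\<integral>x. indicator V x * (\<bar>det (matrix (G' x))\<bar> * f (G x)) \<partial>lborel)" (is ?B)
proof -
  define R where "R = (relabel Rep_ordered_index :: real^'d \<Rightarrow> real^'d ordered_index)"
  define Q where "Q = (relabel (inv Rep_ordered_index) :: real^'d ordered_index \<Rightarrow> real^'d)"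
  have bij: "bij (Rep_ordered_index :: 'd ordered_index \<Rightarrow> 'd)"
    by (rule bijI') (auto simp: Rep_ordered_index_inject intro: Rep_ordered_index_cases)
  note RQ [simp] = relabel_inverse[OF bij, folded R_def Q_def]
  have lin: "linear R" "linear Q" by (simp_all add: R_def Q_def linear_relabel)
  have cont: "continuous_on S R" "continuous_on T Q" for S T
    using lin by (simp_all add: linear_continuous_on linear_linear)
  have [measurable]: "R \<in> borel_measurable borel" "Q \<in> borel_measurable borel"
    using cont by (auto intro: borel_measurable_continuous_onI)
  have dR: "distr lborel borel R = lborel" by (simp add: R_def distr_relabel_lborel bij)
  have dQ: "distr lborel borel Q = lborel"
    by (simp add: Q_def distr_relabel_lborel bij bij_imp_bij_inv)
  have injR: "inj_on R S" and injQ: "inj_on Q T" for S T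
    by (rule inj_on_inverseI[where g = Q], rule RQ(1)) (rule inj_on_inverseI[where g = R], rule RQ(2))
  have RV: "R ` V = Q -` V" 
  proof (intro set_eqI iffI)
    fix y assume "y \<in> Q -` V"
    then have "R (Q y) \<in> R ` V" by blast
    then show "y \<in> R ` V" by simp
  qed auto
  have oRV: "open (R ` V)" unfolding RV using V cont open_vimage by blast
  let ?G = "R \<circ> G \<circ> Q" and ?G' = "\<lambda>y. R \<circ> G' (Q y) \<circ> Q"
  have der': "(?G has_derivative ?G' y) (at y)" if "y \<in> R ` V" for y
  proof -
    have "Q y \<in> V" using that by (auto simp: RV)
    then have "(G has_derivative G' (Q y)) (at (Q y))" by (rule der)
    moreover have "(Q has_derivative Q) (at y)" "(R has_derivative R) (at (G (Q y)))"
      using lin by (simp_all add: linear_imp_has_derivative)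
    ultimately show ?thesis
      by (intro diff_chain_at) simp_all
  qed
  have inj': "inj_on ?G (R ` V)"
    unfolding RV by (intro comp_inj_on injQ injR inj_on_subset[OF inj]) auto
  have det: "det (matrix (?G' y)) = det (matrix (G' (Q y)))" if "y \<in> R ` V" for y
  proof -
    have ax: "Q (axis j 1) = axis (Rep_ordered_index j) 1" for j
    proof -
      have "inv Rep_ordered_index i = j \<longleftrightarrow> i = Rep_ordered_index j" for i
        using bij by (auto simp: bij_is_inj bij_is_surj surj_f_inv_f)
      then show ?thesis by (simp add: Q_def relabel_def vec_eq_iff axis_def)
    qed
    have "matrix (?G' y) = (\<chi> i j. matrix (G' (Q y)) $ Rep_ordered_index i $ Rep_ordered_index j)"
      by (simp add: matrix_def vec_eq_iff ax R_def relabel_def)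
    then show ?thesis by (simp add: det_relabel[OF bij])
  qed
  have ind: "indicator (R ` V) y = (indicator V (Q y) :: real)" for y
    by (simp add: RV indicator_def)
  have ind2: "indicator (?G ` R ` V) y = (indicator (G ` V) (Q y) :: real)" for y
  proof -
    have "y \<in> ?G ` R ` V \<longleftrightarrow> Q y \<in> G ` V"
    proof
      assume "Q y \<in> G ` V"
      then obtain x where "x \<in> V" "Q y = G x" by blast
      then have "y = ?G (R x)" using RQ(2)[of y] by simp
      with \<open>x \<in> V\<close> show "y \<in> ?G ` R ` V" by blast
    qed auto
    then show ?thesis by (simp add: indicator_def)
  qed
  have "continuous_on V G"
    using der V by (intro continuous_at_imp_continuous_on) (auto intro: has_derivative_continuous)
  then have GV: "open (G ` V)"
    using invariance_of_domain[OF _ V inj] by simp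
  then have [measurable]: "G ` V \<in> sets borel" by simp
  have int': "integrable lborel (\<lambda>y. indicator (R ` V) y * (\<bar>det (matrix (?G' y))\<bar> * (f \<circ> Q) (?G y)))"
    "(\<integral>y. indicator (R ` V) y * (\<bar>det (matrix (?G' y))\<bar> * (f \<circ> Q) (?G y)) \<partial>lborel)
     = (\<integral>x. indicator V x * (\<bar>det (matrix (G' x))\<bar> * f (G x)) \<partial>lborel)"
  proof -
    have e: "indicator (R ` V) y * (\<bar>det (matrix (?G' y))\<bar> * (f \<circ> Q) (?G y))
       = (\<lambda>x. indicator V x * (\<bar>det (matrix (G' x))\<bar> * f (G x))) (Q y)" for y
      using det[of y] ind[of y] by (cases "y \<in> R ` V") auto
    show "integrable lborel (\<lambda>y. indicator (R ` V) y * (\<bar>det (matrix (?G' y))\<bar> * (f \<circ> Q) (?G y)))"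
      unfolding e using int by (subst (asm) dQ[symmetric], subst (asm) integrable_distr_eq)
        (auto dest: borel_measurable_integrable)
    show "(\<integral>y. indicator (R ` V) y * (\<bar>det (matrix (?G' y))\<bar> * (f \<circ> Q) (?G y)) \<partial>lborel)
     = (\<integral>x. indicator V x * (\<bar>det (matrix (G' x))\<bar> * f (G x)) \<partial>lborel)"
      unfolding e using integral_distr[of Q lborel borel "\<lambda>x. indicator V x * (\<bar>det (matrix (G' x))\<bar> * f (G x))", unfolded dQ]
        borel_measurable_integrable[OF int] by simp
  qed
  note * = change_of_variables_ordered[OF oRV der' inj' _ int'(1), unfolded ind2]
  have A: "integrable lborel (\<lambda>y. indicator (G ` V) (Q y) * f (Q y))"
    using *(1) by simp
  show ?A
    by (subst dQ[symmetric], subst integrable_distr_eq) (use A in auto)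
  have "(\<integral>y. indicator (G ` V) y * f y \<partial>lborel) = (\<integral>y. indicator (G ` V) (Q y) * f (Q y) \<partial>lborel)"
    using integral_distr[of Q lborel borel "\<lambda>y. indicator (G ` V) y * f y", unfolded dQ] by simp
  then show ?B using *(2) int'(2) by (simp add: comp_def)
qed

section \<open>Uniqueness of translation-invariant measures\<close>

text \<open>Evaluating the product integral of \<open>f x * indicator (ball 0 1) y\<close> in two ways: replacing
  \<open>x\<close> by \<open>x + y\<close>, then \<open>y\<close> by \<open>y - x\<close>, moves \<open>f\<close> from one measure to the other and leaves
  the measure of a translate of the (symmetric) ball.\<close>

lemma translation_invariant_measures_proportional:
  fixes \<mu> \<nu> :: "'a::euclidean_space measure"
  assumes sets [measurable_cong]: "sets \<mu> = sets borel" "sets \<nu> = sets borel"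
    and conc: "AE x in \<mu>. x \<in> T" "AE x in \<nu>. x \<in> T" and T: "subspace T"
    and inv: "\<And>t. t \<in> T \<Longrightarrow> distr \<mu> borel ((+) t) = \<mu>" "\<And>t. t \<in> T \<Longrightarrow> distr \<nu> borel ((+) t) = \<nu>"
    and fin: "\<And>\<rho>. emeasure \<mu> (ball 0 \<rho>) < \<infinity>" "\<And>\<rho>. emeasure \<nu> (ball 0 \<rho>) < \<infinity>"
    and f [measurable]: "f \<in> borel_measurable borel"
  shows "(\<integral>\<^sup>+x. f x \<partial>\<mu>) * emeasure \<nu> (ball 0 1) = (\<integral>\<^sup>+x. f x \<partial>\<nu>) * emeasure \<mu> (ball 0 1)"
proof -
  have sp [simp]: "space \<mu> = UNIV" "space \<nu> = UNIV"
    using sets_eq_imp_space_eq[OF sets(1)] sets_eq_imp_space_eq[OF sets(2)] by auto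
  have sf: "sigma_finite_measure M" if "sets M = sets borel" "\<And>\<rho>. emeasure M (ball 0 \<rho>) < \<infinity>" for M :: "'a measure"
  proof
    show "\<exists>A. countable A \<and> A \<subseteq> sets M \<and> \<Union> A = space M \<and> (\<forall>a\<in>A. emeasure M a \<noteq> \<infinity>)"
    proof (intro exI[of _ "range (\<lambda>n::nat. ball 0 (real n))"] conjI)
      show "(\<Union> (range (\<lambda>n::nat. ball (0::'a) (real n)))) = space M"
        using reals_Archimedean2 sets_eq_imp_space_eq[OF that(1)] by fastforce
    qed (use that in \<open>auto simp: less_top\<close>)
  qed
  interpret M: sigma_finite_measure \<mu> by (rule sf) (use assms in auto)
  interpret N: sigma_finite_measure \<nu> by (rule sf) (use assms in auto)
  interpret P: pair_sigma_finite \<mu> \<nu> by unfold_locales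
  let ?B = "indicator (ball 0 1) :: 'a \<Rightarrow> ennreal"
  have shift\<mu>: "(\<integral>\<^sup>+x. g (t + x) \<partial>\<mu>) = (\<integral>\<^sup>+x. g x \<partial>\<mu>)" if [measurable]: "g \<in> borel_measurable borel" and "t \<in> T" for g t
    using nn_integral_distr[of "(+) t" \<mu> borel g] inv(1)[OF that(2)] by simp
  have shift\<nu>: "(\<integral>\<^sup>+x. g (t + x) \<partial>\<nu>) = (\<integral>\<^sup>+x. g x \<partial>\<nu>)" if [measurable]: "g \<in> borel_measurable borel" and "t \<in> T" for g t
    using nn_integral_distr[of "(+) t" \<nu> borel g] inv(2)[OF that(2)] by simp
  have [measurable]: "ball (0::'a) 1 \<in> sets borel" by simp
  have ind\<mu>: "integral\<^sup>N \<mu> ?B = emeasure \<mu> (ball 0 1)" and ind\<nu>: "integral\<^sup>N \<nu> ?B = emeasure \<nu> (ball 0 1)"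
    by (rule nn_integral_indicator, simp add: sets)+
  have "(\<integral>\<^sup>+x. f x \<partial>\<mu>) * emeasure \<nu> (ball 0 1) = (\<integral>\<^sup>+y. (\<integral>\<^sup>+x. f x \<partial>\<mu>) * ?B y \<partial>\<nu>)"
    unfolding ind\<nu>[symmetric] by (rule nn_integral_cmult[symmetric]) measurable
  also have "\<dots> = (\<integral>\<^sup>+y. (\<integral>\<^sup>+x. f (y + x) * ?B y \<partial>\<mu>) \<partial>\<nu>)"
    using conc(2) by (intro nn_integral_cong_AE) (auto simp: shift\<mu> nn_integral_multc elim!: eventually_mono)
  also have "\<dots> = (\<integral>\<^sup>+x. (\<integral>\<^sup>+y. f (y + x) * ?B y \<partial>\<nu>) \<partial>\<mu>)"
    by (rule P.Fubini') measurable
  also have "\<dots> = (\<integral>\<^sup>+x. (\<integral>\<^sup>+y. f y * ?B (y - x) \<partial>\<nu>) \<partial>\<mu>)"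
  proof (rule nn_integral_cong_AE, use conc(1) in eventually_elim)
    fix x assume "x \<in> T"
    then show "(\<integral>\<^sup>+y. f (y + x) * ?B y \<partial>\<nu>) = (\<integral>\<^sup>+y. f y * ?B (y - x) \<partial>\<nu>)"
      using shift\<nu>[of "\<lambda>y. f y * ?B (y - x)" x] by (simp add: add.commute)
  qed
  also have "\<dots> = (\<integral>\<^sup>+y. (\<integral>\<^sup>+x. f y * ?B (y - x) \<partial>\<mu>) \<partial>\<nu>)"
    by (rule P.Fubini'[symmetric]) measurable
  also have "\<dots> = (\<integral>\<^sup>+y. f y * emeasure \<mu> (ball 0 1) \<partial>\<nu>)"
  proof (rule nn_integral_cong_AE, use conc(2) in eventually_elim)
    fix y assume "y \<in> T"
    have sym: "?B (y - x) = ?B (- y + x)" for x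
      by (simp add: indicator_def norm_minus_commute)
    have "(\<integral>\<^sup>+x. f y * ?B (y - x) \<partial>\<mu>) = f y * (\<integral>\<^sup>+x. ?B (- y + x) \<partial>\<mu>)"
      unfolding sym by (rule nn_integral_cmult) measurable
    also have "(\<integral>\<^sup>+x. ?B (- y + x) \<partial>\<mu>) = (\<integral>\<^sup>+x. ?B x \<partial>\<mu>)"
      using \<open>y \<in> T\<close> T by (intro shift\<mu>) (auto simp: subspace_neg)
    finally show "(\<integral>\<^sup>+x. f y * ?B (y - x) \<partial>\<mu>) = f y * emeasure \<mu> (ball 0 1)" by (simp add: ind\<mu>)
  qed
  also have "\<dots> = (\<integral>\<^sup>+x. f x \<partial>\<nu>) * emeasure \<mu> (ball 0 1)"
    by (rule nn_integral_multc) measurable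
  finally show ?thesis .
qed

section \<open>Squeezing towards a coordinate subspace\<close>

text \<open>The set \<open>J\<close> lists the coordinates normal to the coordinate subspace \<open>flat J\<close>, the local model of
  the zero set. Laplace asymptotics at scale \<open>s\<close> come from substituting \<open>squeeze J s\<close>, which scales the
  normal coordinates only and therefore has determinant \<open>s ^ card J\<close>.\<close>

definition tangential :: "'d set \<Rightarrow> real^'d \<Rightarrow> real^'d" where
  "tangential J y = (\<chi> i. if i \<in> J then 0 else y $ i)"

definition normal :: "'d set \<Rightarrow> real^'d \<Rightarrow> real^'d" where
  "normal J y = (\<chi> i. if i \<in> J then y $ i else 0)"

definition flat :: "'d set \<Rightarrow> (real^'d) set" where
  "flat J = {y. \<forall>i\<in>J. y $ i = 0}"

definition squeeze :: "'d set \<Rightarrow> real \<Rightarrow> real^'d \<Rightarrow> real^'d" where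
  "squeeze J s y = tangential J y + s *\<^sub>R normal J y"

lemma tangential_plus_normal: "tangential J y + normal J y = y"
  by (simp add: tangential_def normal_def vec_eq_iff)

lemma linear_tangential: "linear (tangential J)" and linear_normal: "linear (normal J)"
  by (auto intro!: linearI simp: tangential_def normal_def vec_eq_iff)

lemma linear_squeeze: "linear (squeeze J s)"
  unfolding squeeze_def by (intro linear_compose_add linear_tangential linear_compose_scale_right linear_normal)

lemma borel_measurable_linear: "linear f \<Longrightarrow> f \<in> borel_measurable borel"
  for f :: "'a::euclidean_space \<Rightarrow> 'b::real_normed_vector"
  by (intro borel_measurable_continuous_onI linear_continuous_on) (simp add: linear_linear)

lemmas measurable_coordinates [measurable] =
  borel_measurable_linear[OF linear_tangential] borel_measurable_linear[OF linear_normal]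
  borel_measurable_linear[OF linear_squeeze]

lemma normal_tangential [simp]: "normal J (tangential J y) = 0" "tangential J (normal J y) = 0"
  "normal J (normal J y) = normal J y" "tangential J (tangential J y) = tangential J y"
  by (auto simp: tangential_def normal_def vec_eq_iff)

lemma normal_squeeze [simp]: "normal J (squeeze J s y) = s *\<^sub>R normal J y"
  "tangential J (squeeze J s y) = tangential J y"
  by (auto simp: squeeze_def tangential_def normal_def vec_eq_iff)

lemma norm_tangential_le: "norm (tangential J y) \<le> norm y" and norm_normal_le: "norm (normal J y) \<le> norm y"
  by (rule norm_le_componentwise_cart, simp add: tangential_def normal_def)+

lemma flat_iff_tangential: "y \<in> flat J \<longleftrightarrow> tangential J y = y"
  and flat_iff_normal: "y \<in> flat J \<longleftrightarrow> normal J y = 0"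
  by (auto simp: flat_def tangential_def normal_def vec_eq_iff)

lemma tangential_in_flat [simp]: "tangential J y \<in> flat J"
  by (simp add: flat_iff_tangential)

lemma subspace_flat: "subspace (flat J)"
  by (auto simp: subspace_def flat_def)

lemma flat_borel [measurable]: "flat J \<in> sets borel"
  by (intro borel_closed closed_subspace subspace_flat)

lemma prod_Basis_cart: "(\<Prod>b\<in>(Basis :: (real^'d) set). f b) = (\<Prod>i\<in>UNIV. f (axis i 1))"
  by (simp add: Basis_vec_def UNION_singleton_eq_range prod.reindex inj_on_def axis_eq_axis)

lemma sum_Basis_cart: "(\<Sum>b\<in>(Basis :: (real^'d) set). f b) = (\<Sum>i\<in>UNIV. f (axis i 1))"
  by (simp add: Basis_vec_def UNION_singleton_eq_range sum.reindex inj_on_def axis_eq_axis)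

lemma emeasure_cbox_cart:
  fixes l u :: "real^'d"
  assumes "\<And>i. l $ i \<le> u $ i"
  shows "emeasure lborel (cbox l u) = ennreal (\<Prod>i\<in>UNIV. u $ i - l $ i)"
proof -
  have "l \<bullet> b \<le> u \<bullet> b" if "b \<in> Basis" for b
    using that assms by (auto simp: Basis_vec_def inner_axis)
  then show ?thesis by (simp add: emeasure_lborel_cbox_eq prod_Basis_cart inner_axis)
qed

lemma lborel_eq_squeeze:
  assumes "0 < s"
  shows "(lborel :: (real^'d) measure) = density (distr lborel borel (squeeze J s)) (\<lambda>_. ennreal (s ^ card J))"
proof -
  define c :: "real^'d \<Rightarrow> real" where "c b = (if \<exists>j\<in>J. b $ j \<noteq> 0 then s else 1)" for b
  have c: "c (axis i 1) = (if i \<in> J then s else 1)" for i by (auto simp: c_def axis_def)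
  have "(\<lambda>x. 0 + (\<Sum>j\<in>Basis. (c j * (x \<bullet> j)) *\<^sub>R j)) = squeeze J s"
  proof -
    have ax: "axis i (1::real) $ k = (if i = k then 1 else 0)" for i k :: 'd by (simp add: axis_def)
    show ?thesis
      by (simp add: fun_eq_iff sum_Basis_cart c inner_axis vec_eq_iff squeeze_def tangential_def normal_def
          ax if_distrib[of "\<lambda>x. _ * x"] cong: if_cong)
  qed
  moreover have "(\<Prod>j\<in>(Basis::(real^'d) set). \<bar>c j\<bar>) = s ^ card J"
    using assms by (simp add: prod_Basis_cart c if_distrib[of abs] prod.If_cases)
  ultimately show ?thesis
    using lborel_affine_euclidean[of c 0] assms by (simp add: c_def)
qed

lemma integral_squeeze:
  fixes f :: "real^'d \<Rightarrow> real"
  assumes s: "0 < s" and [measurable]: "f \<in> borel_measurable borel"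
  shows "integrable lborel f \<longleftrightarrow> integrable lborel (\<lambda>y. f (squeeze J s y))"
    "(\<integral>y. f y \<partial>lborel) = s ^ card J * (\<integral>y. f (squeeze J s y) \<partial>lborel)"
proof -
  have "integrable lborel f \<longleftrightarrow> integrable (density (distr lborel borel (squeeze J s)) (\<lambda>_. ennreal (s ^ card J))) f"
    using lborel_eq_squeeze[OF s] by metis
  also have "\<dots> \<longleftrightarrow> integrable lborel (\<lambda>y. f (squeeze J s y))"
    using s by (subst integrable_density) (auto simp: integrable_distr_eq)
  finally show "integrable lborel f \<longleftrightarrow> integrable lborel (\<lambda>y. f (squeeze J s y))" .
  have "(\<integral>y. f y \<partial>lborel) = (\<integral>y. f y \<partial>density (distr lborel borel (squeeze J s)) (\<lambda>_. ennreal (s ^ card J)))"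
    using lborel_eq_squeeze[OF s] by metis
  also have "\<dots> = s ^ card J * (\<integral>y. f (squeeze J s y) \<partial>lborel)"
    using s by (subst integral_density) (auto simp: integral_distr)
  finally show "(\<integral>y. f y \<partial>lborel) = s ^ card J * (\<integral>y. f (squeeze J s y) \<partial>lborel)" .
qed

section \<open>The Hausdorff measure of a coordinate subspace\<close>

lemma hausdorff_premeasure_le:
  assumes "bounded S"
  shows "hausdorff_premeasure r S \<le> ennreal (unit_ball_vol (real r) * (diameter S / 2) ^ r)"
  by (simp add: hausdorff_premeasure_def)

text \<open>Cutting a cube into \<open>n ^ r\<close> small cubes gives covers whose total premeasure stays bounded as \<open>n\<close> grows.
  For the uniqueness of translation-invariant measures it suffices that the Hausdorff measure of the
  flat unit ball is finite and positive; its value cancels in the end.\<close>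

lemma hausdorff_outer_flat_ball_finite:
  fixes J :: "'d::finite set"
  assumes \<rho>: "0 < \<rho>"
  shows "hausdorff_outer (CARD('d) - card J) (flat J \<inter> ball 0 \<rho>) < \<infinity>"
proof -
  define r where "r = CARD('d) - card J"
  define d where "d = real CARD('d)"
  have d: "1 \<le> d" by (simp add: d_def Suc_leI)
  have r: "card (- J) = r" by (simp add: r_def Compl_eq_Diff_UNIV card_Diff_subset)
  define K where "K = unit_ball_vol (real r) * (d * \<rho>) ^ r"
  have "hausdorff_approx r \<delta> (flat J \<inter> ball 0 \<rho>) \<le> ennreal K" if \<delta>: "0 < \<delta>" for \<delta>
  proof -
    obtain n :: nat where n': "max 1 (2 * d * \<rho> / \<delta>) \<le> real n"
      using real_arch_simple by blast
    then have n: "0 < n" "2 * d * \<rho> / \<delta> \<le> real n" by auto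
    define I where "I = (PiE (- J) (\<lambda>_. {..<n}) :: ('d \<Rightarrow> nat) set)"
    define S where "S k = {y \<in> flat J. \<forall>i\<in>-J. y $ i \<in> {-\<rho> + 2 * \<rho> * real (k i) / n .. -\<rho> + 2 * \<rho> * (real (k i) + 1) / n}}" for k
    have "finite I" by (simp add: I_def finite_PiE)
    have "card I = n ^ r" by (simp add: I_def card_PiE r)
    have dist: "dist x y \<le> 2 * d * \<rho> / n" if "x \<in> S k" "y \<in> S k" for x y k
    proof -
      have "\<bar>(x - y) $ i\<bar> \<le> 2 * \<rho> / n" for i
      proof (cases "i \<in> J")
        case True
        then show ?thesis using that \<rho> by (simp add: S_def flat_def)
      next
        case False
        then have "x $ i \<in> {-\<rho> + 2 * \<rho> * real (k i) / n .. -\<rho> + 2 * \<rho> * (real (k i) + 1) / n}"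
          "y $ i \<in> {-\<rho> + 2 * \<rho> * real (k i) / n .. -\<rho> + 2 * \<rho> * (real (k i) + 1) / n}"
          using that by (auto simp: S_def)
        then show ?thesis by (auto simp: abs_le_iff algebra_simps add_divide_distrib)
      qed
      then have "(\<Sum>i\<in>UNIV. \<bar>(x - y) $ i\<bar>) \<le> (\<Sum>i\<in>(UNIV::'d set). 2 * \<rho> / n)"
        by (intro sum_mono)
      then show ?thesis using norm_le_l1_cart[of "x - y"] by (simp add: dist_norm d_def mult_ac)
    qed
    have bd: "bounded (S k)" for k unfolding bounded_two_points using dist by blast
    have diam: "diameter (S k) \<le> 2 * d * \<rho> / n" for k
      using dist \<rho> d by (intro diameter_le) (auto simp: dist_norm)
    have pre: "hausdorff_premeasure r (S k) \<le> ennreal (K / n ^ r)" for k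
    proof -
      have "unit_ball_vol (real r) * (diameter (S k) / 2) ^ r \<le> unit_ball_vol (real r) * (2 * d * \<rho> / n / 2) ^ r"
        using diam diameter_ge_0[OF bd] by (intro mult_left_mono power_mono divide_right_mono) auto
      also have "\<dots> = K / n ^ r" by (simp add: K_def power_divide power_mult_distrib)
      finally show ?thesis using hausdorff_premeasure_le[OF bd] by (meson ennreal_leI order_trans)
    qed
    have "hausdorff_approx r \<delta> (flat J \<inter> ball 0 \<rho>) \<le> (\<Sum>k\<in>I. hausdorff_premeasure r (S k))"
    proof (rule hausdorff_approx_finite_cover)
      have "2 * d * \<rho> / n \<le> \<delta>" using n \<delta> by (simp add: field_simps)
      then show "diameter (S k) \<le> \<delta>" for k
        using diam[of k] by linarith
      show "flat J \<inter> ball 0 \<rho> \<subseteq> (\<Union>k\<in>I. S k)"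
      proof
        fix y assume y: "y \<in> flat J \<inter> ball 0 \<rho>"
        define k where "k = (\<lambda>i\<in>-J. nat \<lfloor>(y $ i + \<rho>) * n / (2 * \<rho>)\<rfloor>)"
        have yi: "\<bar>y $ i\<bar> < \<rho>" for i
          using y component_le_norm_cart[of y i] by simp
        have t: "0 \<le> (y $ i + \<rho>) * n / (2 * \<rho>)" "(y $ i + \<rho>) * n / (2 * \<rho>) < n" for i
        proof -
          show "0 \<le> (y $ i + \<rho>) * n / (2 * \<rho>)"
            using yi[of i] \<rho> by (intro divide_nonneg_nonneg mult_nonneg_nonneg) auto
          have "(y $ i + \<rho>) * n < (2 * \<rho>) * n"
            using yi[of i] n(1) by (intro mult_strict_right_mono) auto
          then show "(y $ i + \<rho>) * n / (2 * \<rho>) < n"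
            using \<rho> by (simp add: divide_less_eq mult.commute)
        qed
        have f: "real (k i) \<le> (y $ i + \<rho>) * n / (2 * \<rho>)" "(y $ i + \<rho>) * n / (2 * \<rho>) \<le> real (k i) + 1" if "i \<notin> J" for i
        proof -
          have "real (k i) = of_int \<lfloor>(y $ i + \<rho>) * n / (2 * \<rho>)\<rfloor>"
            using that t(1)[of i] by (simp add: k_def)
          then show "real (k i) \<le> (y $ i + \<rho>) * n / (2 * \<rho>)" "(y $ i + \<rho>) * n / (2 * \<rho>) \<le> real (k i) + 1"
            by linarith+
        qed
        have "k i < n" if "i \<notin> J" for i
          using f(1)[OF that] t(2)[of i] by linarith
        then have "k \<in> I" by (auto simp: I_def k_def)
        moreover have "y \<in> S k"
        proof -
          have "-\<rho> + 2 * \<rho> * real (k i) / n \<le> y $ i" "y $ i \<le> -\<rho> + 2 * \<rho> * (real (k i) + 1) / n" if "i \<notin> J" for i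
            using f[OF that] \<rho> n(1) by (simp_all add: field_simps)
          then show ?thesis using y by (simp add: S_def)
        qed
        ultimately show "y \<in> (\<Union>k\<in>I. S k)" by blast
      qed
    qed (use \<delta> bd \<open>finite I\<close> in auto)
    also have "\<dots> \<le> (\<Sum>k\<in>I. ennreal (K / n ^ r))" by (intro sum_mono pre)
    also have "\<dots> = ennreal K"
      using n \<open>card I = n ^ r\<close> by (simp add: ennreal_of_nat_eq_real_of_nat ennreal_mult'[symmetric] K_def)
    finally show ?thesis .
  qed
  then have "hausdorff_outer r (flat J \<inter> ball 0 \<rho>) \<le> ennreal K" by (rule hausdorff_outer_le)
  then show ?thesis by (simp add: r_def le_less_trans)
qed

text \<open>A cover of the flat unit ball thickens to a cover of a small box by boxes whose volumes are
  proportional to the premeasures.\<close>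

lemma hausdorff_outer_flat_ball_pos:
  fixes J :: "'d::finite set"
  shows "0 < hausdorff_outer (CARD('d) - card J) (flat J \<inter> ball 0 1)"
proof -
  define r where "r = CARD('d) - card J"
  have r: "card (- J) = r" by (simp add: r_def Compl_eq_Diff_UNIV card_Diff_subset)
  have rq: "card J + r = CARD('d)" by (simp add: r_def card_mono)
  define \<eta> where "\<eta> = 1 / (real CARD('d) + 1)"
  have \<eta>: "0 < \<eta>" by (simp add: \<eta>_def)
  define B :: "(real^'d) set" where "B = cbox (\<chi> i. if i \<in> J then -1 else -\<eta>) (\<chi> i. if i \<in> J then 1 else \<eta>)"
  define v where "v = unit_ball_vol (real r)"
  have v: "0 < v" by (simp add: v_def)
  define C where "C = 2 ^ CARD('d) * 2 ^ r / v"
  have C: "0 < C" using v by (simp add: C_def)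
  have B: "emeasure lborel B = ennreal (\<Prod>i\<in>UNIV. (if i \<in> J then 2 else 2 * \<eta>))"
    unfolding B_def using \<eta> by (subst emeasure_cbox_cart) (auto intro!: arg_cong[of _ _ ennreal] prod.cong)
  have Bpos: "0 < emeasure lborel B" unfolding B using \<eta> by (auto intro!: prod_pos)
  have "emeasure lborel B / ennreal C \<le> hausdorff_approx r 1 (flat J \<inter> ball 0 1)"
  proof (rule hausdorff_approx_ge)
    fix S :: "nat \<Rightarrow> (real^'d) set"
    assume S: "flat J \<inter> ball 0 1 \<subseteq> (\<Union>i. S i)" "\<And>i. bounded (S i)" "\<And>i. diameter (S i) \<le> 1"
    have "\<exists>Q. Q \<in> sets borel \<and> (\<forall>y\<in>B. tangential J y \<in> S n \<longrightarrow> y \<in> Q) \<and> emeasure lborel Q \<le> ennreal C * hausdorff_premeasure r (S n)" for n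
    proof (cases "S n = {}")
      case True
      then show ?thesis by (intro exI[of _ "{}"]) auto
    next
      case False
      then obtain a where a: "a \<in> S n" by blast
      define D where "D = diameter (S n)"
      have D: "0 \<le> D" unfolding D_def by (rule diameter_ge_0[OF S(2)])
      define l where "l = (\<chi> i. if i \<in> J then -1 else a $ i - D)"
      define u where "u = (\<chi> i. if i \<in> J then 1 else a $ i + D)"
      have 1: "y \<in> cbox l u" if y: "y \<in> B" "tangential J y \<in> S n" for y
      proof -
        have "norm (tangential J y - a) \<le> D"
          using diameter_bounded_bound[OF S(2) y(2) a] by (simp add: D_def dist_norm)
        then have comp: "\<bar>(tangential J y - a) $ i\<bar> \<le> D" for i
          using component_le_norm_cart[of "tangential J y - a" i] by linarith
        have out: "\<bar>y $ i - a $ i\<bar> \<le> D" if "i \<notin> J" for i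
          using that comp[of i] by (simp add: tangential_def)
        have inn: "-1 \<le> y $ i \<and> y $ i \<le> 1" if "i \<in> J" for i
          using y(1) that by (auto simp: B_def mem_box_cart dest: spec[of _ i])
        have "l $ i \<le> y $ i \<and> y $ i \<le> u $ i" for i
          using out[of i] inn[of i] by (auto simp: l_def u_def abs_le_iff)
        then show ?thesis by (simp add: mem_box_cart)
      qed
      have "emeasure lborel (cbox l u) = ennreal (\<Prod>i\<in>UNIV. (if i \<in> J then 2 else 2 * D))"
        using D by (subst emeasure_cbox_cart) (auto simp: l_def u_def intro!: arg_cong[of _ _ ennreal] prod.cong)
      also have "(\<Prod>i\<in>UNIV. (if i \<in> J then 2 else 2 * D)) = 2 ^ card J * (2 * D) ^ r"
        by (simp add: prod.If_cases r)
      also have "\<dots> = C * (v * (D / 2) ^ r)"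
        using v by (simp add: C_def power_mult_distrib power_divide power_add rq[symmetric])
      also have "ennreal (C * (v * (D / 2) ^ r)) = ennreal C * hausdorff_premeasure r (S n)"
        using False C D v by (simp add: hausdorff_premeasure_def v_def D_def ennreal_mult)
      finally show ?thesis using 1 by (intro exI[of _ "cbox l u"]) auto
    qed
    then obtain Q where Q: "\<And>n. Q n \<in> sets borel" "\<And>n y. y \<in> B \<Longrightarrow> tangential J y \<in> S n \<Longrightarrow> y \<in> Q n"
      "\<And>n. emeasure lborel (Q n) \<le> ennreal C * hausdorff_premeasure r (S n)" by metis
    have "B \<subseteq> (\<Union>n. Q n)"
    proof
      fix y assume y: "y \<in> B"
      have "norm (tangential J y) \<le> (\<Sum>i\<in>UNIV. \<bar>tangential J y $ i\<bar>)" by (rule norm_le_l1_cart)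
      also have "\<dots> \<le> (\<Sum>i\<in>(UNIV::'d set). \<eta>)"
      proof (rule sum_mono)
        fix i show "\<bar>tangential J y $ i\<bar> \<le> \<eta>"
          using y \<eta> by (auto simp: B_def mem_box_cart tangential_def abs_le_iff dest: spec[of _ i])
      qed
      also have "\<dots> < 1" by (simp add: \<eta>_def)
      finally have "tangential J y \<in> flat J \<inter> ball 0 1" by simp
      then show "y \<in> (\<Union>n. Q n)" using S(1) Q(2)[OF y] by blast
    qed
    then have "emeasure lborel B \<le> emeasure lborel (\<Union>n. Q n)"
      using Q by (intro emeasure_mono) auto
    also have "\<dots> \<le> (\<Sum>n. emeasure lborel (Q n))"
      using Q by (intro emeasure_subadditive_countably) auto
    also have "\<dots> \<le> (\<Sum>n. ennreal C * hausdorff_premeasure r (S n))"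
      using Q by (intro suminf_le) auto
    also have "\<dots> = ennreal C * (\<Sum>n. hausdorff_premeasure r (S n))" by simp
    finally show "emeasure lborel B / ennreal C \<le> (\<Sum>n. hausdorff_premeasure r (S n))"
      using C by (simp add: divide_le_posI_ennreal mult.commute)
  qed
  also have "\<dots> \<le> hausdorff_outer r (flat J \<inter> ball 0 1)" by (rule hausdorff_approx_le_outer) simp
  finally have "emeasure lborel B / ennreal C \<le> hausdorff_outer r (flat J \<inter> ball 0 1)" .
  moreover have "0 < emeasure lborel B / ennreal C"
    using Bpos C by (simp add: ennreal_zero_less_divide)
  ultimately show ?thesis by (simp add: r_def)
qed

definition flat_measure :: "'d::finite set \<Rightarrow> (real^'d) measure" where
  "flat_measure J = density (hausdorff_measure (CARD('d) - card J)) (indicator (flat J))"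

lemma sets_flat_measure [simp, measurable_cong]: "sets (flat_measure J) = sets borel"
  by (simp add: flat_measure_def)

lemma emeasure_flat_measure:
  fixes J :: "'d::finite set"
  assumes [measurable]: "A \<in> sets borel"
  shows "emeasure (flat_measure J) A = hausdorff_outer (CARD('d) - card J) (flat J \<inter> A)"
  using assms by (simp add: flat_measure_def emeasure_restricted emeasure_hausdorff_measure)

lemma distr_flat_measure_translation:
  assumes "t \<in> flat J"
  shows "distr (flat_measure J) borel ((+) t) = flat_measure J"
proof (rule measure_eqI)
  fix A assume "A \<in> sets (distr (flat_measure J) borel ((+) t))"
  then have [measurable]: "A \<in> sets borel" by simp
  have pre: "(+) t -` A \<in> sets borel"
    using measurable_sets[of "(+) t" borel borel A] by simp
  have 1: "(+) t ` (flat J \<inter> (+) t -` A) = flat J \<inter> A"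
  proof (intro set_eqI iffI)
    fix y assume y: "y \<in> flat J \<inter> A"
    have "y - t \<in> flat J" using y assms subspace_diff[OF subspace_flat] by blast
    with y have "y - t \<in> flat J \<inter> (+) t -` A" by simp
    then show "y \<in> (+) t ` (flat J \<inter> (+) t -` A)" by (intro image_eqI[of _ _ "y - t"]) simp_all
  qed (use assms subspace_add[OF subspace_flat] in auto)
  then have 2: "flat J \<inter> (+) t -` A = (\<lambda>y. y - t) ` (flat J \<inter> A)"
    unfolding 1[symmetric] image_image by simp
  have "hausdorff_outer r (flat J \<inter> A) \<le> ennreal (1 ^ r) * hausdorff_outer r (flat J \<inter> (+) t -` A)" for r
    unfolding 1[symmetric] by (rule hausdorff_outer_lipschitz_image) (auto intro!: lipschitz_onI)
  moreover have "hausdorff_outer r (flat J \<inter> (+) t -` A) \<le> ennreal (1 ^ r) * hausdorff_outer r (flat J \<inter> A)" for r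
    unfolding 2 by (rule hausdorff_outer_lipschitz_image) (auto intro!: lipschitz_onI simp: dist_norm)
  ultimately show "emeasure (distr (flat_measure J) borel ((+) t)) A = emeasure (flat_measure J) A"
    using pre by (simp add: emeasure_distr emeasure_flat_measure antisym sets_eq_imp_space_eq[OF sets_flat_measure])
qed simp

section \<open>Integrability of the exponential weights\<close>

lemma power_le_fact_exp:
  fixes x :: real
  assumes "0 \<le> x"
  shows "x ^ n \<le> fact n * exp x"
proof -
  have "(\<Sum>i\<in>{n}. x ^ i /\<^sub>R fact i) \<le> (\<Sum>i. x ^ i /\<^sub>R fact i)"
    using assms by (intro sum_le_suminf summable_exp_generic) auto
  then show ?thesis by (simp add: exp_def field_simps)
qed

text \<open>A series of constants on the cubes of side \<open>2 (n + 1)\<close> dominates the integrand, which on the shell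
  \<open>n \<le> norm x \<le> n + 1\<close> decays faster than any power of \<open>n\<close>.\<close>

lemma integrable_exp_neg_norm_powr:
  assumes a: "0 < a" and \<beta>: "0 < \<beta>"
  shows "integrable lborel (\<lambda>x::'a::euclidean_space. exp (- (a * norm x powr \<beta>)))"
proof (rule integrableI_nonneg)
  define d where "d = DIM('a)"
  define N where "N = nat \<lceil>(real d + 2) / \<beta>\<rceil>"
  have N: "real d + 2 \<le> \<beta> * real N"
  proof -
    have "(real d + 2) / \<beta> \<le> real N" unfolding N_def by (rule real_nat_ceiling_ge)
    then show ?thesis using \<beta> by (simp add: pos_divide_le_eq mult.commute)
  qed
  define K where "K = 4 ^ d * fact N / a ^ N"
  define e where "e n = exp (- (a * real n powr \<beta>)) * (2 * (real n + 1)) ^ d" for n :: nat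
  have bound: "e n \<le> K * (1 / real n ^ 2)" if "n \<ge> 1" for n
  proof -
    have n: "1 \<le> real n" using that by simp
    have "(a * real n powr \<beta>) ^ N * exp (- (a * real n powr \<beta>)) \<le> fact N"
      using power_le_fact_exp[of "a * real n powr \<beta>" N] a by (simp add: exp_minus field_simps)
    then have 1: "exp (- (a * real n powr \<beta>)) \<le> fact N / (a ^ N * (real n powr \<beta>) ^ N)"
      using a n by (simp add: field_simps power_mult_distrib)
    have "real n ^ (d + 2) = real n powr (real d + 2)"
      using n powr_realpow[of "real n" "d + 2"] by (simp add: add.commute)
    also have "\<dots> \<le> real n powr (\<beta> * real N)" using n N by (intro powr_mono) auto
    also have "\<dots> = (real n powr \<beta>) ^ N" using n by (simp add: powr_powr[symmetric] powr_realpow)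
    finally have 2: "real n ^ (d + 2) \<le> (real n powr \<beta>) ^ N" .
    have "e n \<le> fact N / (a ^ N * (real n powr \<beta>) ^ N) * (4 * real n) ^ d"
    proof -
      have "(2 * (real n + 1)) ^ d \<le> (4 * real n) ^ d" using n by (intro power_mono) auto
      then show ?thesis unfolding e_def using 1 n a by (intro mult_mono) auto
    qed
    also have "\<dots> \<le> fact N / (a ^ N * real n ^ (d + 2)) * (4 * real n) ^ d"
      using 2 n a by (intro mult_right_mono divide_left_mono mult_left_mono mult_pos_pos) auto
    also have "\<dots> = K * (1 / real n ^ 2)"
      using n a by (simp add: K_def power_mult_distrib power_add power2_eq_square field_simps)
    finally show ?thesis .
  qed
  have "summable (\<lambda>n. K * (1 / real n ^ 2))"
    using inverse_power_summable[of 2, where 'a = real] by (intro summable_mult) (simp add: inverse_eq_divide)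
  then have sum: "summable e"
    by (rule summable_comparison_test_ev[rotated])
       (use bound in \<open>auto simp: e_def eventually_sequentially intro!: exI[of _ 1]\<close>)
  have e0: "0 \<le> e n" for n by (simp add: e_def)
  let ?f = "\<lambda>x::'a. ennreal (exp (- (a * norm x powr \<beta>)))"
  let ?Q = "\<lambda>n::nat. cbox (- ((real n + 1) *\<^sub>R One)) ((real n + 1) *\<^sub>R One) :: 'a set"
  have "?f x \<le> (\<Sum>n. ennreal (exp (- (a * real n powr \<beta>))) * indicator (?Q n) x)" for x
  proof -
    define n where "n = nat \<lfloor>norm x\<rfloor>"
    have n: "real n \<le> norm x" "norm x \<le> real n + 1" by (auto simp: n_def)
    have "x \<in> ?Q n"
      using n(2) Basis_le_norm[of _ x] by (auto simp: mem_box abs_le_iff) (smt (verit) Basis_le_norm)+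
    moreover have "real n powr \<beta> \<le> norm x powr \<beta>" using n \<beta> by (intro powr_mono2) auto
    ultimately have "?f x \<le> ennreal (exp (- (a * real n powr \<beta>))) * indicator (?Q n) x"
      using a by (auto intro!: ennreal_leI)
    also have "\<dots> \<le> (\<Sum>n. ennreal (exp (- (a * real n powr \<beta>))) * indicator (?Q n) x)"
    proof -
      define g where "g i = ennreal (exp (- (a * real i powr \<beta>))) * indicator (?Q i) x" for i
      have "sum g {n} \<le> suminf g" by (rule sum_le_suminf) auto
      then have "g n \<le> suminf g" by simp
      then show ?thesis unfolding g_def .
    qed
    finally show ?thesis .
  qed
  then have "(\<integral>\<^sup>+x. ?f x \<partial>lborel) \<le> (\<integral>\<^sup>+x. (\<Sum>n. ennreal (exp (- (a * real n powr \<beta>))) * indicator (?Q n) x) \<partial>lborel)"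
    by (intro nn_integral_mono) auto
  also have "\<dots> = (\<Sum>n. \<integral>\<^sup>+x. ennreal (exp (- (a * real n powr \<beta>))) * indicator (?Q n) x \<partial>lborel)"
    by (rule nn_integral_suminf) measurable
  also have "\<dots> = (\<Sum>n. ennreal (e n))"
  proof (rule suminf_cong)
    fix n
    have "emeasure lborel (?Q n) = ennreal ((2 * (real n + 1)) ^ d)"
      by (subst emeasure_lborel_cbox) (auto simp: d_def algebra_simps)
    then show "(\<integral>\<^sup>+x. ennreal (exp (- (a * real n powr \<beta>))) * indicator (?Q n) x \<partial>lborel) = ennreal (e n)"
      by (simp add: nn_integral_cmult_indicator e_def ennreal_mult')
  qed
  also have "\<dots> = ennreal (\<Sum>n. e n)" using sum e0 by (simp add: suminf_ennreal2)
  also have "\<dots> < \<infinity>" by simp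
  finally show "(\<integral>\<^sup>+x. ?f x \<partial>lborel) < \<infinity>" .
qed auto

lemma power_ge_minus_one: "1 \<le> k \<Longrightarrow> 0 \<le> x \<Longrightarrow> x - 1 \<le> x ^ k" for x :: real
proof (cases "1 \<le> x")
  case True
  assume "1 \<le> k"
  then have "x ^ 1 \<le> x ^ k" using True by (intro power_increasing)
  then show ?thesis by simp
qed (use zero_le_power[of x k] in linarith)

text \<open>The functions that dominate all integrands of the local analysis: bounded support along the
  subspace, exponential decay across it. The powers \<open>j\<close> come from the error terms of the expansion.\<close>

lemma integrable_normal_profile:
  fixes J :: "'d::finite set"
  assumes c: "0 < c" and k: "1 \<le> k"
  shows "integrable lborel (\<lambda>y::real^'d. indicator {y. norm (tangential J y) \<le> \<rho>} y *
           (norm (normal J y) ^ j * exp (- ((c * norm (normal J y)) ^ k))))"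
proof (rule Bochner_Integration.integrable_bound)
  define K where "K = fact j * (2 / c) ^ j * exp 1 * exp (c / 2 * \<rho>)"
  show "integrable lborel (\<lambda>y::real^'d. K * exp (- (c / 2 * norm y powr 1)))"
    using c by (intro integrable_mult_right integrable_exp_neg_norm_powr) auto
  show "AE y in lborel. norm (indicator {y. norm (tangential J y) \<le> \<rho>} y *
           (norm (normal J y) ^ j * exp (- ((c * norm (normal J y)) ^ k)))) \<le> norm (K * exp (- (c / 2 * norm y powr 1)))"
  proof (rule AE_I2)
    fix y :: "real^'d"
    define n where "n = norm (normal J y)"
    show "norm (indicator {y. norm (tangential J y) \<le> \<rho>} y *
           (norm (normal J y) ^ j * exp (- ((c * norm (normal J y)) ^ k)))) \<le> norm (K * exp (- (c / 2 * norm y powr 1)))"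
    proof (cases "norm (tangential J y) \<le> \<rho>")
      case True
      have n0: "0 \<le> n" by (simp add: n_def)
      have ny: "norm y \<le> \<rho> + n"
        using norm_triangle_ineq[of "tangential J y" "normal J y"] True by (simp add: tangential_plus_normal n_def)
      have "(c / 2 * n) ^ j \<le> fact j * exp (c / 2 * n)" using c n0 by (intro power_le_fact_exp) auto
      then have "n ^ j \<le> fact j * (2 / c) ^ j * exp (c / 2 * n)"
        using c by (simp add: power_mult_distrib power_divide field_simps)
      moreover have "exp (- ((c * n) ^ k)) \<le> exp (1 - c * n)"
        using power_ge_minus_one[OF k, of "c * n"] c n0 by simp
      ultimately have "n ^ j * exp (- ((c * n) ^ k)) \<le> (fact j * (2 / c) ^ j * exp (c / 2 * n)) * exp (1 - c * n)"
        using n0 c by (intro mult_mono) auto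
      also have "\<dots> = fact j * (2 / c) ^ j * exp (1 - c / 2 * n)"
        by (simp add: exp_add[symmetric] mult.assoc)
      also have "\<dots> \<le> fact j * (2 / c) ^ j * exp (1 + c / 2 * \<rho> - c / 2 * norm y)"
      proof -
        have "c / 2 * norm y \<le> c / 2 * (\<rho> + n)" using ny c by (intro mult_left_mono) auto
        then show ?thesis using c by (intro mult_left_mono) (auto simp: algebra_simps)
      qed
      also have "\<dots> = K * exp (- (c / 2 * norm y powr 1))"
      proof -
        have "exp (1 + c / 2 * \<rho> - c / 2 * norm y) = exp 1 * exp (c / 2 * \<rho>) * exp (- (c / 2 * norm y))"
          by (simp add: exp_add[symmetric] del: exp_minus)
        then show ?thesis by (simp add: K_def)
      qed
      finally show ?thesis using True n0 c by (simp add: n_def K_def)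
    qed simp
  qed
qed measurable

section \<open>The mass of the limit profile\<close>

text \<open>The mass of the profile \<open>exp (- norm (D y) ^ k)\<close> over a unit ball of the kernel of \<open>D\<close>;
  the constant of proportionality is built from its value for \<open>D = normal J\<close>.\<close>

definition slab_mass :: "'d set \<Rightarrow> (real^'d \<Rightarrow> 'b::real_normed_vector) \<Rightarrow> nat \<Rightarrow> real" where
  "slab_mass J D k = (\<integral>y. indicator (ball 0 1) (tangential J y) * exp (- (norm (D y) ^ k)) \<partial>lborel)"

lemma integrable_profile:
  fixes J :: "'d::finite set" and D :: "real^'d \<Rightarrow> 'b::euclidean_space"
  assumes c: "0 < c" and k: "1 \<le> k" and D: "linear D" "\<And>y. c * norm (normal J y) \<le> norm (D y)"
  shows "integrable lborel (\<lambda>y. indicator (ball 0 \<rho>) (tangential J y) * exp (- (norm (D y) ^ k)))"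
proof (rule Bochner_Integration.integrable_bound)
  have [measurable]: "D \<in> borel_measurable borel" using D(1) by (rule borel_measurable_linear)
  show "integrable lborel (\<lambda>y::real^'d. indicator {y. norm (tangential J y) \<le> \<rho>} y *
           (norm (normal J y) ^ 0 * exp (- ((c * norm (normal J y)) ^ k))))"
    by (rule integrable_normal_profile[OF c k])
  have [measurable]: "ball (0::real^'d) \<rho> \<in> sets borel" by simp
  show "(\<lambda>y. indicator (ball 0 \<rho>) (tangential J y) * exp (- (norm (D y) ^ k))) \<in> borel_measurable lborel"
    by measurable
  have "(c * norm (normal J y)) ^ k \<le> norm (D y) ^ k" for y
    using D(2) c by (intro power_mono) auto
  then show "AE y in lborel. norm (indicator (ball 0 \<rho>) (tangential J y) * exp (- (norm (D y) ^ k)))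
     \<le> norm (indicator {y. norm (tangential J y) \<le> \<rho>} y * (norm (normal J y) ^ 0 * exp (- ((c * norm (normal J y)) ^ k))))"
    by (intro AE_I2) (auto simp: indicator_def)
qed

lemma slab_mass_normal_pos:
  fixes J :: "'d::finite set"
  assumes k: "1 \<le> k"
  shows "0 < slab_mass J (normal J) k"
proof -
  have "0 < exp (- 1) * measure lborel (ball (0::real^'d) 1)"
    using content_ball_pos[of 1 "0::real^'d"] by simp
  also have "\<dots> = (\<integral>y. exp (- 1) * indicator (ball (0::real^'d) 1) y \<partial>lborel)"
    by simp
  also have "\<dots> \<le> slab_mass J (normal J) k"
    unfolding slab_mass_def
  proof (rule integral_mono)
    show "integrable lborel (\<lambda>y. exp (- 1) * indicator (ball (0::real^'d) 1) y :: real)"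
      using emeasure_lborel_ball_finite[of "0::real^'d" 1] by (intro integrable_mult_right) auto
    show "integrable lborel (\<lambda>y. indicator (ball 0 1) (tangential J y) * exp (- (norm (normal J y) ^ k)))"
      by (rule integrable_profile[of 1]) (use k linear_normal in auto)
    fix y :: "real^'d"
    show "exp (- 1) * indicator (ball 0 1) y \<le> indicator (ball 0 1) (tangential J y) * exp (- (norm (normal J y) ^ k))"
    proof (cases "y \<in> ball 0 1")
      case True
      then have "norm (tangential J y) < 1" "norm (normal J y) \<le> 1"
        using norm_tangential_le[of J y] norm_normal_le[of J y] by auto
      moreover have "norm (normal J y) ^ k \<le> 1" using calculation by (intro power_le_one) auto
      ultimately show ?thesis using True by simp
    qed simp
  qed
  finally show ?thesis .
qed

text \<open>Both sides integrate \<open>f\<close> against a measure on \<open>flat J\<close> that is invariant under the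
  translations of \<open>flat J\<close>.\<close>

lemma profile_integral_eq_hausdorff:
  fixes J :: "'d::finite set" and D :: "real^'d \<Rightarrow> 'b::euclidean_space"
  assumes c: "0 < c" and k: "1 \<le> k" and D: "linear D" "\<And>y. c * norm (normal J y) \<le> norm (D y)"
    and D0: "\<And>y. D (tangential J y) = 0"
    and f [measurable]: "f \<in> borel_measurable borel"
  shows "(\<integral>\<^sup>+y. f (tangential J y) * ennreal (exp (- (norm (D y) ^ k))) \<partial>lborel) * emeasure (flat_measure J) (ball 0 1)
       = (\<integral>\<^sup>+y. f y \<partial>flat_measure J) * ennreal (slab_mass J D k)"
proof -
  have [measurable]: "D \<in> borel_measurable borel" using D(1) by (rule borel_measurable_linear)
  define w where "w y = ennreal (exp (- (norm (D y) ^ k)))" for y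
  have [measurable]: "w \<in> borel_measurable borel" unfolding w_def by measurable
  define \<nu> where "\<nu> = distr (density lborel w) borel (tangential J)"
  have int\<nu>: "(\<integral>\<^sup>+y. g y \<partial>\<nu>) = (\<integral>\<^sup>+y. g (tangential J y) * w y \<partial>lborel)" if [measurable]: "g \<in> borel_measurable borel" for g
    unfolding \<nu>_def by (simp add: nn_integral_distr nn_integral_density mult.commute)
  have ball\<nu>: "emeasure \<nu> (ball 0 \<rho>) = ennreal (\<integral>y. indicator (ball 0 \<rho>) (tangential J y) * exp (- (norm (D y) ^ k)) \<partial>lborel)" for \<rho>
  proof -
    have "emeasure \<nu> (ball 0 \<rho>) = (\<integral>\<^sup>+y. indicator (ball 0 \<rho>) y \<partial>\<nu>)"
      by (rule nn_integral_indicator[symmetric]) (simp add: \<nu>_def)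
    also have "\<dots> = (\<integral>\<^sup>+y. indicator (ball 0 \<rho>) (tangential J y) * w y \<partial>lborel)"
      by (rule int\<nu>) (rule borel_measurable_indicator, simp)
    also have "\<dots> = (\<integral>\<^sup>+y. ennreal (indicator (ball 0 \<rho>) (tangential J y) * exp (- (norm (D y) ^ k))) \<partial>lborel)"
      by (intro nn_integral_cong) (simp add: w_def indicator_def)
    also have "\<dots> = ennreal (\<integral>y. indicator (ball 0 \<rho>) (tangential J y) * exp (- (norm (D y) ^ k)) \<partial>lborel)"
      by (rule nn_integral_eq_integral[OF integrable_profile[OF c k D]]) auto
    finally show ?thesis .
  qed
  have "(\<integral>\<^sup>+y. f y \<partial>\<nu>) * emeasure (flat_measure J) (ball 0 1) = (\<integral>\<^sup>+y. f y \<partial>flat_measure J) * emeasure \<nu> (ball 0 1)"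
  proof (rule translation_invariant_measures_proportional[where T = "flat J"])
    show "AE x in \<nu>. x \<in> flat J" unfolding \<nu>_def by (subst AE_distr_iff) auto
    show "AE x in flat_measure J. x \<in> flat J"
      unfolding flat_measure_def by (subst AE_density) (auto simp: indicator_def intro!: borel_measurable_indicator)
    show "distr (flat_measure J) borel ((+) t) = flat_measure J" if "t \<in> flat J" for t
      using that by (rule distr_flat_measure_translation)
    show "distr \<nu> borel ((+) t) = \<nu>" if t: "t \<in> flat J" for t
    proof (rule measure_eqI)
      fix A assume "A \<in> sets (distr \<nu> borel ((+) t))"
      then have A [measurable]: "A \<in> sets borel" by simp
      have Dt: "D t = 0" using D0[of t] t by (simp add: flat_iff_tangential)
      have wt: "w (t + y) = w y" for y using D(1) Dt by (simp add: w_def linear_add)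
      have tt: "tangential J (t + y) = t + tangential J y" for y
        using t by (simp add: linear_add[OF linear_tangential] flat_iff_tangential)
      have "emeasure (distr \<nu> borel ((+) t)) A = (\<integral>\<^sup>+y. indicator A y \<partial>distr \<nu> borel ((+) t))"
        by simp
      also have "\<dots> = (\<integral>\<^sup>+y. indicator A (t + y) \<partial>\<nu>)"
        by (subst nn_integral_distr) (auto simp: \<nu>_def)
      also have "\<dots> = (\<integral>\<^sup>+y. indicator A (tangential J (t + y)) * w (t + y) \<partial>lborel)"
        by (subst int\<nu>) (auto simp: wt tt)
      also have "\<dots> = (\<integral>\<^sup>+y. indicator A (tangential J y) * w y \<partial>distr lborel borel ((+) t))"
        by (subst nn_integral_distr) auto
      also have "distr lborel borel ((+) t) = lborel" by (rule lborel_distr_plus)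
      also have "(\<integral>\<^sup>+y. indicator A (tangential J y) * w y \<partial>lborel) = (\<integral>\<^sup>+y. indicator A y \<partial>\<nu>)"
        by (rule int\<nu>[symmetric]) measurable
      also have "\<dots> = emeasure \<nu> A" by (simp add: \<nu>_def)
      finally show "emeasure (distr \<nu> borel ((+) t)) A = emeasure \<nu> A" .
    qed (simp add: \<nu>_def)
    show "emeasure (flat_measure J) (ball 0 \<rho>) < \<infinity>" for \<rho>
    proof (cases "0 < \<rho>")
      case True
      then show ?thesis using hausdorff_outer_flat_ball_finite[of \<rho> J] by (simp add: emeasure_flat_measure)
    qed (simp add: ball_empty)
    show "emeasure \<nu> (ball 0 \<rho>) < \<infinity>" for \<rho> by (simp add: ball\<nu>)
  qed (auto simp: \<nu>_def subspace_flat)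
  then show ?thesis unfolding int\<nu>[OF f] ball\<nu> by (simp add: w_def slab_mass_def)
qed

lemma linear_det_nonzero_lower_bound:
  fixes B :: "real^'n \<Rightarrow> real^'n"
  assumes "linear B" "det (matrix B) \<noteq> 0"
  obtains b where "0 < b" "\<And>x. b * norm x \<le> norm (B x)"
proof -
  have "inj B"
    using assms by (simp add: det_nz_iff_inj)
  then show ?thesis
    using linear_inj_bounded_below_pos[OF assms(1)] that by blast
qed

text \<open>Substituting \<open>B\<close> turns the profile of \<open>B\<close> into the standard one. This is the origin of the factor
  \<open>1 / gen_jacobian F\<close> of the limit.\<close>

lemma integral_exp_linear:
  fixes B :: "real^'n \<Rightarrow> real^'n"
  assumes B: "linear B" "det (matrix B) \<noteq> 0" and k: "1 \<le> k"
  shows "integrable lborel (\<lambda>w. exp (- (norm (B w) ^ k)))"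
    "\<bar>det (matrix B)\<bar> * (\<integral>w. exp (- (norm (B w) ^ k)) \<partial>lborel) = (\<integral>w. exp (- (norm (w :: real^'n) ^ k)) \<partial>lborel)"
proof -
  obtain b where b: "0 < b" "\<And>x. b * norm x \<le> norm (B x)"
    using linear_det_nonzero_lower_bound[OF B] by blast
  have "normal UNIV y = y" "tangential UNIV y = 0" for y :: "real^'n"
    by (simp_all add: normal_def tangential_def vec_eq_iff)
  then show int: "integrable lborel (\<lambda>w. exp (- (norm (B w) ^ k)))"
    using integrable_profile[of b k B UNIV 1] b k B by simp
  have "inj B"
  proof (rule linear_injective_0[OF B(1), THEN iffD2], intro allI impI)
    fix x assume "B x = 0"
    then show "x = 0" using b(2)[of x] b(1) by (simp add: mult_le_0_iff)
  qed
  have "surj B" using linear_injective_imp_surjective[OF B(1) \<open>inj B\<close>] by auto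
  have "(\<integral>y. indicator (B ` UNIV) y * exp (- (norm y ^ k)) \<partial>lborel)
      = (\<integral>x. indicator UNIV x * (\<bar>det (matrix B)\<bar> * exp (- (norm (B x) ^ k))) \<partial>lborel)"
    by (rule change_of_variables(2)) (use B int \<open>inj B\<close> in \<open>auto intro: linear_imp_has_derivative\<close>)
  then show "\<bar>det (matrix B)\<bar> * (\<integral>w. exp (- (norm (B w) ^ k)) \<partial>lborel) = (\<integral>w. exp (- (norm (w :: real^'n) ^ k)) \<partial>lborel)"
    using \<open>surj B\<close> by simp
qed

lemma slab_mass_injective:
  fixes D :: "real^'d \<Rightarrow> real^'p" and B :: "real^'d \<Rightarrow> real^'d"
  assumes B: "linear B" "det (matrix B) \<noteq> 0" and k: "1 \<le> k" and DB: "\<And>y. norm (D y) = norm (B y)"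
  shows "\<bar>det (matrix B)\<bar> * slab_mass UNIV D k = slab_mass (UNIV :: 'd set) (normal UNIV) k"
proof -
  have [simp]: "normal UNIV y = y" "tangential UNIV y = 0" for y :: "real^'d"
    by (simp_all add: normal_def tangential_def vec_eq_iff)
  show ?thesis
    using integral_exp_linear(2)[OF B k] by (simp add: slab_mass_def DB)
qed

definition select :: "('p \<Rightarrow> 'd) \<Rightarrow> real^'d \<Rightarrow> real^'p" where
  "select \<iota> y = (\<chi> i. y $ \<iota> i)"

definition embed :: "('p \<Rightarrow> 'd) \<Rightarrow> real^'p \<Rightarrow> real^'d" where
  "embed \<iota> w = (\<chi> j. if j \<in> range \<iota> then w $ inv \<iota> j else 0)"

lemma linear_select: "linear (select \<iota>)" and linear_embed: "linear (embed \<iota>)"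
  by (auto intro!: linearI simp: select_def embed_def vec_eq_iff)

lemma select_embed [simp]: "inj \<iota> \<Longrightarrow> select \<iota> (embed \<iota> w) = w"
  by (simp add: select_def embed_def vec_eq_iff)

lemma embed_select: "inj \<iota> \<Longrightarrow> embed \<iota> (select \<iota> y) = normal (range \<iota>) y"
  by (auto simp: select_def embed_def vec_eq_iff normal_def)

lemma select_tangential [simp]: "select \<iota> (tangential (range \<iota>) y) = 0"
  by (simp add: select_def tangential_def vec_eq_iff)

lemma tangential_embed [simp]: "tangential (range \<iota>) (embed \<iota> w) = 0"
  by (auto simp: embed_def tangential_def vec_eq_iff)

lemma norm_select:
  fixes \<iota> :: "'p::finite \<Rightarrow> 'd::finite"
  assumes "inj \<iota>"
  shows "norm (select \<iota> y) = norm (normal (range \<iota>) y)"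
proof -
  have "(\<Sum>i\<in>UNIV. (y $ \<iota> i)\<^sup>2) = (\<Sum>j\<in>range \<iota>. (y $ j)\<^sup>2)"
    using assms by (simp add: sum.reindex)
  also have "\<dots> = (\<Sum>j\<in>UNIV. (normal (range \<iota>) y $ j)\<^sup>2)"
    by (simp add: normal_def if_distrib[of "\<lambda>x. x\<^sup>2"] sum.If_cases)
  finally show ?thesis by (simp add: norm_vec_def L2_set_def select_def)
qed

text \<open>The image under \<open>select\<close> of Lebesgue measure on the slab over the flat unit ball is
  translation invariant, hence a multiple of Lebesgue measure, on which \<open>B\<close> acts by its
  determinant.\<close>

lemma slab_mass_surjective:
  fixes B :: "real^'p \<Rightarrow> real^'p" and \<iota> :: "'p \<Rightarrow> 'd::finite"
  assumes B: "linear B" "det (matrix B) \<noteq> 0" and k: "1 \<le> k" and \<iota>: "inj \<iota>"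
  shows "\<bar>det (matrix B)\<bar> * slab_mass (range \<iota>) (\<lambda>y. B (select \<iota> y)) k = slab_mass (range \<iota>) (normal (range \<iota>)) k"
proof -
  let ?J = "range \<iota>"
  have [measurable]: "select \<iota> \<in> borel_measurable borel" using linear_select by (rule borel_measurable_linear)
  have [measurable]: "ball (0::real^'d) 1 \<in> sets borel" by simp
  define w where "w y = (indicator (ball 0 1) (tangential ?J y) :: ennreal)" for y
  have [measurable]: "w \<in> borel_measurable borel" unfolding w_def by measurable
  define \<nu> where "\<nu> = distr (density lborel w) borel (select \<iota>)"
  have int\<nu>: "(\<integral>\<^sup>+y. g y \<partial>\<nu>) = (\<integral>\<^sup>+y. g (select \<iota> y) * w y \<partial>lborel)" if [measurable]: "g \<in> borel_measurable borel" for g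
    unfolding \<nu>_def by (simp add: nn_integral_distr nn_integral_density mult.commute)
  have ball: "emeasure \<nu> (ball 0 \<rho>) < \<infinity>" for \<rho>
  proof -
    have [measurable]: "ball (0::real^'p) \<rho> \<in> sets borel" by simp
    have "emeasure \<nu> (ball 0 \<rho>) = (\<integral>\<^sup>+y. indicator (ball 0 \<rho>) y \<partial>\<nu>)"
      by (rule nn_integral_indicator[symmetric]) (simp add: \<nu>_def)
    also have "\<dots> = (\<integral>\<^sup>+y. indicator (ball 0 \<rho>) (select \<iota> y) * w y \<partial>lborel)"
      by (rule int\<nu>) measurable
    also have "\<dots> \<le> (\<integral>\<^sup>+y. indicator (ball (0::real^'d) (1 + \<rho>)) y \<partial>lborel)"
    proof (rule nn_integral_mono)
      fix y :: "real^'d"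
      have "norm y \<le> norm (tangential ?J y) + norm (select \<iota> y)"
        using norm_triangle_ineq[of "tangential ?J y" "normal ?J y"]
        by (simp add: tangential_plus_normal norm_select[OF \<iota>])
      then show "indicator (ball 0 \<rho>) (select \<iota> y) * w y \<le> (indicator (ball 0 (1 + \<rho>)) y :: ennreal)"
        by (auto simp: w_def indicator_def)
    qed
    also have "\<dots> = emeasure lborel (ball (0::real^'d) (1 + \<rho>))" by simp
    also have "\<dots> < \<infinity>" by (rule emeasure_lborel_ball_finite)
    finally show ?thesis .
  qed
  have proportional: "(\<integral>\<^sup>+y. f y \<partial>\<nu>) * emeasure lborel (ball (0::real^'p) 1) = (\<integral>\<^sup>+y. f y \<partial>lborel) * emeasure \<nu> (ball 0 1)"
    if [measurable]: "f \<in> borel_measurable borel" for f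
  proof (rule translation_invariant_measures_proportional[where T = UNIV])
    show "distr \<nu> borel ((+) t) = \<nu>" for t
    proof (rule measure_eqI)
      fix A assume "A \<in> sets (distr \<nu> borel ((+) t))"
      then have A [measurable]: "A \<in> sets borel" by simp
      have wt: "w (embed \<iota> t + y) = w y" for y by (simp add: w_def linear_add[OF linear_tangential])
      have "emeasure (distr \<nu> borel ((+) t)) A = (\<integral>\<^sup>+y. indicator A y \<partial>distr \<nu> borel ((+) t))"
        by simp
      also have "\<dots> = (\<integral>\<^sup>+y. indicator A (t + y) \<partial>\<nu>)"
        by (subst nn_integral_distr) (auto simp: \<nu>_def)
      also have "\<dots> = (\<integral>\<^sup>+y. indicator A (select \<iota> (embed \<iota> t + y)) * w (embed \<iota> t + y) \<partial>lborel)"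
        by (subst int\<nu>) (auto simp: wt linear_add[OF linear_select] \<iota>)
      also have "\<dots> = (\<integral>\<^sup>+y. indicator A (select \<iota> y) * w y \<partial>distr lborel borel ((+) (embed \<iota> t)))"
        by (subst nn_integral_distr) auto
      also have "distr lborel borel ((+) (embed \<iota> t)) = lborel" by (rule lborel_distr_plus)
      also have "(\<integral>\<^sup>+y. indicator A (select \<iota> y) * w y \<partial>lborel) = (\<integral>\<^sup>+y. indicator A y \<partial>\<nu>)"
        by (rule int\<nu>[symmetric]) measurable
      also have "\<dots> = emeasure \<nu> A" by (simp add: \<nu>_def)
      finally show "emeasure (distr \<nu> borel ((+) t)) A = emeasure \<nu> A" .
    qed (simp add: \<nu>_def)
  qed (use ball emeasure_lborel_ball_finite in \<open>auto simp: \<nu>_def lborel_distr_plus\<close>)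
  have slab: "ennreal (slab_mass ?J (\<lambda>y. L (select \<iota> y)) k) * emeasure lborel (ball (0::real^'p) 1)
      = ennreal (\<integral>w. exp (- (norm (L w) ^ k)) \<partial>lborel) * emeasure \<nu> (ball 0 1)"
    if L: "linear L" "det (matrix L) \<noteq> 0" for L :: "real^'p \<Rightarrow> real^'p"
  proof -
    have [measurable]: "L \<in> borel_measurable borel" using L(1) by (rule borel_measurable_linear)
    obtain b where b: "0 < b" "\<And>x. b * norm x \<le> norm (L x)"
      using linear_det_nonzero_lower_bound[OF L] by blast
    have lin: "linear (\<lambda>y. L (select \<iota> y))" using linear_compose[OF linear_select L(1)] by (simp add: comp_def)
    have "(\<integral>\<^sup>+y. ennreal (exp (- (norm (L y) ^ k))) \<partial>\<nu>) = (\<integral>\<^sup>+y. ennreal (indicator (ball 0 1) (tangential ?J y) * exp (- (norm (L (select \<iota> y)) ^ k))) \<partial>lborel)"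
      by (subst int\<nu>) (auto simp: w_def indicator_def intro!: nn_integral_cong)
    also have "\<dots> = ennreal (slab_mass ?J (\<lambda>y. L (select \<iota> y)) k)"
      unfolding slab_mass_def
      by (rule nn_integral_eq_integral[OF integrable_profile[OF b(1) k lin]]) (use b(2) in \<open>auto simp: norm_select[OF \<iota>, symmetric]\<close>)
    finally show ?thesis
      using proportional[of "\<lambda>y. ennreal (exp (- (norm (L y) ^ k)))"] nn_integral_eq_integral[OF integral_exp_linear(1)[OF L k]] by simp
  qed
  have id: "linear (\<lambda>x. x :: real^'p)" "det (matrix (\<lambda>x. x :: real^'p)) \<noteq> 0"
    by (auto simp: linear_iff matrix_id[unfolded id_def])
  have eq: "slab_mass ?J (\<lambda>y. select \<iota> y) k = slab_mass ?J (normal ?J) k"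
    by (simp add: slab_mass_def norm_select[OF \<iota>])
  define b where "b = measure lborel (ball (0::real^'p) 1)"
  have b: "0 < b" using content_ball_pos[of 1 "0::real^'p"] by (simp add: b_def)
  have b': "emeasure lborel (ball (0::real^'p) 1) = ennreal b"
    unfolding b_def by (rule emeasure_eq_ennreal_measure) (use emeasure_lborel_ball_finite[of "0::real^'p" 1] in auto)
  define n where "n = enn2real (emeasure \<nu> (ball 0 1))"
  have n: "emeasure \<nu> (ball 0 1) = ennreal n" "0 \<le> n" using ball[of 1] by (simp_all add: n_def)
  have pos: "0 \<le> slab_mass ?J (\<lambda>y. L (select \<iota> y)) k" for L :: "real^'p \<Rightarrow> real^'p"
    unfolding slab_mass_def by (intro integral_nonneg_AE) auto
  have "slab_mass ?J (\<lambda>y. L (select \<iota> y)) k * b = (\<integral>w. exp (- (norm (L w) ^ k)) \<partial>lborel) * n"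
    if L: "linear L" "det (matrix L) \<noteq> 0" for L :: "real^'p \<Rightarrow> real^'p"
  proof -
    have "0 \<le> (\<integral>w. exp (- (norm (L w) ^ k)) \<partial>lborel)" by (intro integral_nonneg_AE) auto
    then show ?thesis
      using slab[OF L] b n pos[of L] unfolding b' n(1) by (simp add: ennreal_mult[symmetric])
  qed
  from this[OF B] this[OF id] integral_exp_linear(2)[OF B k]
  have "(\<bar>det (matrix B)\<bar> * slab_mass ?J (\<lambda>y. B (select \<iota> y)) k) * b = slab_mass ?J (normal ?J) k * b"
    unfolding eq by (simp add: mult.assoc)
  then show ?thesis using b by simp
qed

section \<open>Strict derivatives and local Lipschitz bounds\<close>

lemma norm_linear_le_sum_Basis:
  fixes g :: "'a::euclidean_space \<Rightarrow> 'b::real_normed_vector"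
  assumes "linear g"
  shows "norm (g v) \<le> (\<Sum>b\<in>Basis. norm (g b)) * norm v"
proof -
  have "g v = (\<Sum>b\<in>Basis. (v \<bullet> b) *\<^sub>R g b)"
    using assms by (metis (no_types, lifting) euclidean_representation linear_sum linear_scale sum.cong)
  then have "norm (g v) \<le> (\<Sum>b\<in>Basis. \<bar>v \<bullet> b\<bar> * norm (g b))"
    using norm_sum[of "\<lambda>b. (v \<bullet> b) *\<^sub>R g b" Basis] by simp
  also have "\<dots> \<le> (\<Sum>b\<in>Basis. norm v * norm (g b))"
    by (intro sum_mono mult_right_mono Basis_le_norm) auto
  also have "\<dots> = (\<Sum>b\<in>Basis. norm (g b)) * norm v" by (simp add: sum_distrib_left mult.commute)
  finally show ?thesis .
qed

lemma ck_map_has_derivative: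
  "ck_map (Suc n) f \<Longrightarrow> (f has_derivative frechet_derivative f (at x)) (at x)"
  by (simp add: frechet_derivative_works)

lemma ck_map_continuous: "ck_map n f \<Longrightarrow> continuous_on UNIV f"
proof (cases n)
  case (Suc m)
  assume "ck_map n f"
  then show ?thesis using Suc
    by (auto intro!: continuous_at_imp_continuous_on differentiable_imp_continuous_within)
qed simp

text \<open>Continuity of the derivative at \<open>z\<close> bounds the derivative of the difference of \<open>f\<close> and its
  linearisation by \<open>e\<close> on a ball, and the mean value inequality does the rest.\<close>

lemma ck_map_strict_derivative:
  fixes f :: "'a::euclidean_space \<Rightarrow> 'b::euclidean_space"
  assumes f: "ck_map (Suc 0) f" and e: "0 < e"
  obtains \<delta> where "0 < \<delta>"
    "\<And>x y. x \<in> ball z \<delta> \<Longrightarrow> y \<in> ball z \<delta> \<Longrightarrow> norm (f x - f y - frechet_derivative f (at z) (x - y)) \<le> e * norm (x - y)"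
proof -
  define f' where "f' x = frechet_derivative f (at x)" for x
  have der: "(f has_derivative f' x) (at x)" for x
    unfolding f'_def by (rule ck_map_has_derivative[OF f])
  have lin: "linear (f' x)" for x using der has_derivative_linear by blast
  have cont: "isCont (\<lambda>x. \<Sum>b\<in>Basis. norm (f' x b - f' z b)) z"
    using f by (intro continuous_intros) (auto simp: f'_def continuous_on_eq_continuous_at)
  then obtain \<delta> where \<delta>: "0 < \<delta>" "\<And>x. dist x z < \<delta> \<Longrightarrow> \<bar>\<Sum>b\<in>Basis. norm (f' x b - f' z b)\<bar> < e"
    using e unfolding continuous_at_eps_delta by (auto simp: dist_norm)
  show ?thesis
  proof (rule that[OF \<delta>(1)])
    fix x y assume xy: "x \<in> ball z \<delta>" "y \<in> ball z \<delta>"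
    have 1: "norm ((f x - f' z x) - (f y - f' z y)) \<le> e * norm (x - y)"
    proof (rule differentiable_bound[of "ball z \<delta>" _ "\<lambda>x v. f' x v - f' z v"])
      fix u assume u: "u \<in> ball z \<delta>"
      show "((\<lambda>x. f x - f' z x) has_derivative (\<lambda>v. f' u v - f' z v)) (at u within ball z \<delta>)"
        by (intro has_derivative_diff has_derivative_at_withinI[OF der]
            has_derivative_at_withinI[OF linear_imp_has_derivative] lin)
      have "norm (f' u v - f' z v) \<le> e * norm v" for v
      proof -
        have "norm (f' u v - f' z v) \<le> (\<Sum>b\<in>Basis. norm (f' u b - f' z b)) * norm v"
          by (rule norm_linear_le_sum_Basis[of "\<lambda>v. f' u v - f' z v"]) (intro linear_compose_sub lin)
        also have "\<dots> \<le> e * norm v"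
          using \<delta>(2)[of u] u by (intro mult_right_mono) (auto simp: dist_commute)
        finally show ?thesis .
      qed
      then show "onorm (\<lambda>v. f' u v - f' z v) \<le> e" by (rule onorm_le)
    qed (use xy in auto)
    have 2: "(f x - f' z x) - (f y - f' z y) = f x - f y - f' z (x - y)"
      by (simp add: linear_diff[OF lin])
    show "norm (f x - f y - frechet_derivative f (at z) (x - y)) \<le> e * norm (x - y)"
      using 1 unfolding 2 unfolding f'_def .
  qed
qed

definition lipschitz_near :: "'a::metric_space \<Rightarrow> ('a \<Rightarrow> 'b::metric_space) \<Rightarrow> bool" where
  "lipschitz_near z f \<longleftrightarrow> (\<exists>\<delta>>0. \<exists>L. L-lipschitz_on (ball z \<delta>) f)"

lemma lipschitz_near_const: "lipschitz_near z (\<lambda>_. c)"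
  unfolding lipschitz_near_def using lipschitz_on_constant zero_less_one by blast

lemma lipschitz_near_common:
  assumes "lipschitz_near z f" "lipschitz_near z g"
  obtains \<delta> L M where "0 < \<delta>" "L-lipschitz_on (ball z \<delta>) f" "M-lipschitz_on (ball z \<delta>) g"
proof -
  obtain d1 L d2 M where "0 < d1" "L-lipschitz_on (ball z d1) f" "0 < d2" "M-lipschitz_on (ball z d2) g"
    using assms unfolding lipschitz_near_def by blast
  then have "0 < min d1 d2" "L-lipschitz_on (ball z (min d1 d2)) f" "M-lipschitz_on (ball z (min d1 d2)) g"
    by (auto intro: lipschitz_on_subset)
  then show ?thesis by (rule that)
qed

lemma lipschitz_near_add:
  fixes f g :: "'a::metric_space \<Rightarrow> 'b::real_normed_vector"
  shows "lipschitz_near z f \<Longrightarrow> lipschitz_near z g \<Longrightarrow> lipschitz_near z (\<lambda>x. f x + g x)"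
  by (metis (no_types) lipschitz_near_common lipschitz_near_def lipschitz_on_add)

lemma lipschitz_on_mult:
  fixes f g :: "'a::metric_space \<Rightarrow> real"
  assumes f: "L-lipschitz_on S f" and g: "M-lipschitz_on S g"
    and bf: "\<And>x. x \<in> S \<Longrightarrow> \<bar>f x\<bar> \<le> P" and bg: "\<And>x. x \<in> S \<Longrightarrow> \<bar>g x\<bar> \<le> Q" and "0 \<le> P" "0 \<le> Q"
  shows "(L * Q + P * M)-lipschitz_on S (\<lambda>x. f x * g x)"
proof (rule lipschitz_onI)
  fix x y assume xy: "x \<in> S" "y \<in> S"
  have "f x * g x - f y * g y = (f x - f y) * g x + f y * (g x - g y)" by (simp add: algebra_simps)
  then have "dist (f x * g x) (f y * g y) \<le> dist (f x) (f y) * \<bar>g x\<bar> + \<bar>f y\<bar> * dist (g x) (g y)"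
    by (metis abs_mult abs_triangle_ineq dist_real_def)
  also have "\<dots> \<le> (L * dist x y) * Q + P * (M * dist x y)"
    using xy assms lipschitz_onD[OF f] lipschitz_onD[OF g] lipschitz_on_nonneg[OF f]
    by (intro add_mono mult_mono) auto
  finally show "dist (f x * g x) (f y * g y) \<le> (L * Q + P * M) * dist x y" by (simp add: algebra_simps)
qed (use assms lipschitz_on_nonneg[OF f] lipschitz_on_nonneg[OF g] in auto)

lemma lipschitz_on_ball_bounded:
  fixes f :: "'a::metric_space \<Rightarrow> real"
  assumes "L-lipschitz_on (ball z \<delta>) f" "x \<in> ball z \<delta>" "0 < \<delta>"
  shows "\<bar>f x\<bar> \<le> \<bar>f z\<bar> + L * \<delta>"
proof -
  have "\<bar>f x - f z\<bar> \<le> L * dist x z"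
    using lipschitz_onD[OF assms(1,2), of z] assms(3) by (simp add: dist_real_def)
  also have "\<dots> \<le> L * \<delta>"
    using assms(2) lipschitz_on_nonneg[OF assms(1)] by (intro mult_left_mono) (auto simp: dist_commute)
  finally show ?thesis by linarith
qed

lemma lipschitz_near_mult:
  fixes f g :: "'a::metric_space \<Rightarrow> real"
  assumes "lipschitz_near z f" "lipschitz_near z g"
  shows "lipschitz_near z (\<lambda>x. f x * g x)"
proof -
  obtain \<delta> L M where d: "0 < \<delta>" and f: "L-lipschitz_on (ball z \<delta>) f" and g: "M-lipschitz_on (ball z \<delta>) g"
    using lipschitz_near_common[OF assms] .
  have "0 \<le> L * \<delta>" "0 \<le> M * \<delta>" using d lipschitz_on_nonneg[OF f] lipschitz_on_nonneg[OF g] by auto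
  then have "(L * (\<bar>g z\<bar> + M * \<delta>) + (\<bar>f z\<bar> + L * \<delta>) * M)-lipschitz_on (ball z \<delta>) (\<lambda>x. f x * g x)"
    using d by (intro lipschitz_on_mult[OF f g] lipschitz_on_ball_bounded[OF f] lipschitz_on_ball_bounded[OF g]) auto
  then show ?thesis using d unfolding lipschitz_near_def by blast
qed

lemma lipschitz_near_sum:
  fixes f :: "'i \<Rightarrow> 'a::metric_space \<Rightarrow> 'b::real_normed_vector"
  shows "(\<And>i. i \<in> I \<Longrightarrow> lipschitz_near z (f i)) \<Longrightarrow> lipschitz_near z (\<lambda>x. \<Sum>i\<in>I. f i x)"
  by (induction I rule: infinite_finite_induct) (auto intro: lipschitz_near_add lipschitz_near_const)

lemma lipschitz_near_prod:
  fixes f :: "'i \<Rightarrow> 'a::metric_space \<Rightarrow> real"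
  shows "(\<And>i. i \<in> I \<Longrightarrow> lipschitz_near z (f i)) \<Longrightarrow> lipschitz_near z (\<lambda>x. \<Prod>i\<in>I. f i x)"
  by (induction I rule: infinite_finite_induct) (auto intro: lipschitz_near_mult lipschitz_near_const)

lemma lipschitz_near_linear:
  fixes f :: "'a::metric_space \<Rightarrow> 'b::euclidean_space" and g :: "'b \<Rightarrow> 'c::real_normed_vector"
  assumes f: "lipschitz_near z f" and g: "linear g"
  shows "lipschitz_near z (\<lambda>x. g (f x))"
proof -
  obtain \<delta> L where d: "0 < \<delta>" "L-lipschitz_on (ball z \<delta>) f"
    using f unfolding lipschitz_near_def by blast
  obtain K where K: "0 < K" "\<And>x. norm (g x) \<le> K * norm x"
    using linear_bounded_pos[OF g] by blast
  have "(K * L)-lipschitz_on (ball z \<delta>) (\<lambda>x. g (f x))"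
  proof (rule lipschitz_onI)
    fix x y assume xy: "x \<in> ball z \<delta>" "y \<in> ball z \<delta>"
    have "dist (g (f x)) (g (f y)) \<le> K * dist (f x) (f y)"
      using K(2)[of "f x - f y"] by (simp add: dist_norm linear_diff[OF g])
    also have "\<dots> \<le> K * (L * dist x y)"
      using K(1) lipschitz_onD[OF d(2) xy] by simp
    finally show "dist (g (f x)) (g (f y)) \<le> K * L * dist x y" by simp
  qed (use K(1) lipschitz_on_nonneg[OF d(2)] in simp)
  then show ?thesis using d(1) unfolding lipschitz_near_def by blast
qed

lemma lipschitz_near_det:
  fixes M :: "'a::metric_space \<Rightarrow> real^'n^'n"
  assumes "\<And>i j. lipschitz_near z (\<lambda>x. M x $ i $ j)"
  shows "lipschitz_near z (\<lambda>x. det (M x))"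
  unfolding det_def by (intro lipschitz_near_sum lipschitz_near_mult lipschitz_near_const lipschitz_near_prod assms)

lemma ck_map_lipschitz_near:
  fixes f :: "'a::euclidean_space \<Rightarrow> 'b::euclidean_space"
  assumes "ck_map (Suc 0) f"
  shows "lipschitz_near z f"
proof -
  let ?D = "frechet_derivative f (at z)"
  have lin: "linear ?D" using ck_map_has_derivative[OF assms] has_derivative_linear by blast
  obtain K where K: "0 < K" "\<And>x. norm (?D x) \<le> K * norm x"
    using linear_bounded_pos[OF lin] by blast
  obtain \<delta> where \<delta>: "0 < \<delta>"
    "\<And>x y. x \<in> ball z \<delta> \<Longrightarrow> y \<in> ball z \<delta> \<Longrightarrow> norm (f x - f y - ?D (x - y)) \<le> 1 * norm (x - y)"
    using ck_map_strict_derivative[OF assms zero_less_one] by blast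
  have "(K + 1)-lipschitz_on (ball z \<delta>) f"
  proof (rule lipschitz_onI)
    fix x y assume "x \<in> ball z \<delta>" "y \<in> ball z \<delta>"
    then have "norm (f x - f y - ?D (x - y)) \<le> norm (x - y)" using \<delta>(2) by force
    moreover have "norm (f x - f y) \<le> norm (f x - f y - ?D (x - y)) + norm (?D (x - y))"
      by (metis diff_add_cancel norm_triangle_ineq)
    ultimately show "dist (f x) (f y) \<le> (K + 1) * dist x y"
      using K(2)[of "x - y"] by (simp add: dist_norm algebra_simps)
  qed (use K in simp)
  then show ?thesis using \<delta>(1) unfolding lipschitz_near_def by blast
qed

text \<open>The constant \<open>1 - 1 / \<theta>\<close> serves both sides since \<open>2 - 1 / \<theta> \<le> \<theta>\<close>.\<close>

lemma lipschitz_near_inverse_abs: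
  fixes f :: "'a::metric_space \<Rightarrow> real"
  assumes f: "lipschitz_near z f" and 1: "\<bar>f z\<bar> = 1" and \<theta>: "1 < \<theta>"
  obtains \<delta> L where "0 < \<delta>" "L-lipschitz_on (ball z \<delta>) (\<lambda>x. 1 / \<bar>f x\<bar>)"
    "\<And>x. x \<in> ball z \<delta> \<Longrightarrow> 1 / \<theta> \<le> \<bar>f x\<bar> \<and> \<bar>f x\<bar> \<le> \<theta>"
proof -
  obtain d M where d: "0 < d" "M-lipschitz_on (ball z d) f"
    using f unfolding lipschitz_near_def by blast
  have M: "0 \<le> M" using lipschitz_on_nonneg[OF d(2)] .
  define \<mu> where "\<mu> = 1 - 1 / \<theta>"
  have \<mu>: "0 < \<mu>" "1 + \<mu> \<le> \<theta>"
  proof -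
    show "0 < \<mu>" using \<theta> by (simp add: \<mu>_def)
    have "0 \<le> (\<theta> - 1)\<^sup>2 / \<theta>" using \<theta> by simp
    then show "1 + \<mu> \<le> \<theta>" using \<theta> by (simp add: \<mu>_def power2_eq_square field_simps)
  qed
  define \<delta> where "\<delta> = min d (\<mu> / (M + 1))"
  have \<delta>: "0 < \<delta>" using d \<mu> M by (simp add: \<delta>_def)
  have near: "1 / \<theta> \<le> \<bar>f x\<bar> \<and> \<bar>f x\<bar> \<le> \<theta>" if x: "x \<in> ball z \<delta>" for x
  proof -
    have "\<bar>f x - f z\<bar> \<le> M * dist x z"
      using lipschitz_onD[OF d(2), of x z] x d(1) by (simp add: \<delta>_def dist_real_def)
    also have "\<dots> \<le> M * (\<mu> / (M + 1))"
      using x M by (intro mult_left_mono) (auto simp: \<delta>_def dist_commute)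
    also have "\<dots> \<le> \<mu>" using M \<mu> by (simp add: field_simps)
    finally have "\<bar>f x - f z\<bar> \<le> \<mu>" .
    then have "1 - \<mu> \<le> \<bar>f x\<bar>" "\<bar>f x\<bar> \<le> 1 + \<mu>" using 1 by linarith+
    then show ?thesis using \<mu> by (simp add: \<mu>_def)
  qed
  have "(\<theta>\<^sup>2 * M)-lipschitz_on (ball z \<delta>) (\<lambda>x. 1 / \<bar>f x\<bar>)"
  proof (rule lipschitz_onI)
    fix x y assume xy: "x \<in> ball z \<delta>" "y \<in> ball z \<delta>"
    have p: "0 < \<bar>f x\<bar>" "0 < \<bar>f y\<bar>" using near[OF xy(1)] near[OF xy(2)] \<theta> by (auto simp: field_simps)
    have i: "1 / \<bar>f x\<bar> \<le> \<theta>" "1 / \<bar>f y\<bar> \<le> \<theta>"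
      using near[OF xy(1)] near[OF xy(2)] p \<theta> by (auto simp: field_simps)
    have "1 / \<bar>f x\<bar> - 1 / \<bar>f y\<bar> = (\<bar>f y\<bar> - \<bar>f x\<bar>) * ((1 / \<bar>f x\<bar>) * (1 / \<bar>f y\<bar>))"
      using p by (simp add: field_simps)
    then have "dist (1 / \<bar>f x\<bar>) (1 / \<bar>f y\<bar>) = \<bar>\<bar>f y\<bar> - \<bar>f x\<bar>\<bar> * ((1 / \<bar>f x\<bar>) * (1 / \<bar>f y\<bar>))"
      using p by (simp add: dist_real_def abs_mult)
    also have "\<dots> \<le> dist (f x) (f y) * (\<theta> * \<theta>)"
      using i p \<theta> by (intro mult_mono) (auto simp: dist_real_def)
    also have "\<dots> \<le> (M * dist x y) * (\<theta> * \<theta>)"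
      using lipschitz_onD[OF d(2), of x y] xy by (intro mult_right_mono) (auto simp: \<delta>_def)
    finally show "dist (1 / \<bar>f x\<bar>) (1 / \<bar>f y\<bar>) \<le> \<theta>\<^sup>2 * M * dist x y"
      by (simp add: power2_eq_square mult_ac)
  qed (use M in simp)
  then show ?thesis using that \<delta> near by blast
qed

text \<open>The determinant is a polynomial in the matrix entries, and these are directional derivatives of \<open>F\<close>.\<close>

lemma continuous_on_gen_jacobian:
  fixes F :: "real^'d \<Rightarrow> real^'p"
  assumes "ck_map (Suc 0) F"
  shows "continuous_on UNIV (gen_jacobian F)"
proof -
  have *: "continuous_on UNIV (\<lambda>x. jacobian F (at x) $ i $ j)" for i j
    using assms by (auto simp: jacobian_def matrix_def intro!: continuous_on_component)
  then have "continuous_on UNIV (\<lambda>x. det (jacobian F (at x) ** transpose (jacobian F (at x))))"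
    "continuous_on UNIV (\<lambda>x. det (transpose (jacobian F (at x)) ** jacobian F (at x)))"
    unfolding det_def matrix_matrix_mult_def transpose_def
    by (simp_all only: vec_lambda_beta)
      (intro continuous_on_sum continuous_on_mult continuous_on_const continuous_on_prod *)+
  then show ?thesis
    unfolding gen_jacobian_def Let_def by (cases "CARD('p) \<le> CARD('d)") (auto intro!: continuous_intros)
qed

section \<open>Charts that flatten the zero set\<close>

lemma matrix_axis: "matrix f $ i $ j = f (axis j 1) $ i"
  by (simp add: matrix_def)

lemma gram_matrix: "(transpose (matrix f) ** matrix f) $ i $ j = f (axis i 1) \<bullet> f (axis j 1)"
  by (simp add: matrix_matrix_mult_def transpose_def matrix_def inner_vec_def)

lemma det_nonzero_right_inverse:
  fixes B :: "real^'n \<Rightarrow> real^'n"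
  assumes "linear B" "det (matrix B) \<noteq> 0"
  obtains C where "linear C" "\<And>x. B (C x) = x" "\<And>x. C (B x) = x"
proof -
  have "inj B" using assms by (simp add: det_nz_iff_inj)
  then obtain C where C: "linear C" "\<forall>x. C (B x) = x" "\<forall>x. B (C x) = x"
    using linear_injective_isomorphism[OF assms(1) \<open>inj B\<close>] by blast
  then show ?thesis using that by blast
qed

text \<open>A map that differs from a linear isometry by a small multiple of the distance is almost an isometry.\<close>

lemma strict_derivative_bilipschitz:
  fixes G :: "'a::euclidean_space \<Rightarrow> 'b::euclidean_space"
  assumes \<theta>: "1 < \<theta>" and L: "linear L" "\<And>v. norm (L v) = norm v"
    and strict: "norm (G x - G y - L (x - y)) \<le> (1 - 1 / \<theta>) * norm (x - y)"
  shows "norm (G x - G y) \<le> \<theta> * norm (x - y)" "norm (x - y) \<le> \<theta> * norm (G x - G y)"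
proof -
  have "0 \<le> (\<theta> - 1)\<^sup>2 / \<theta>" using \<theta> by simp
  then have t: "2 - 1 / \<theta> \<le> \<theta>" using \<theta> by (simp add: power2_eq_square field_simps)
  have "norm (G x - G y) \<le> norm (G x - G y - L (x - y)) + norm (L (x - y))"
    by (metis diff_add_cancel norm_triangle_ineq)
  also have "\<dots> \<le> (2 - 1 / \<theta>) * norm (x - y)" using strict L(2)[of "x - y"] by (simp add: algebra_simps)
  also have "\<dots> \<le> \<theta> * norm (x - y)" using t by (rule mult_right_mono) simp
  finally show "norm (G x - G y) \<le> \<theta> * norm (x - y)" .
  have "norm (L (x - y)) \<le> norm (G x - G y) + norm (G x - G y - L (x - y))"
    by (metis diff_diff_eq2 diff_self diff_zero norm_triangle_ineq4 add_diff_cancel_left')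
  then have "norm (x - y) \<le> norm (G x - G y) + (1 - 1 / \<theta>) * norm (x - y)"
    using strict L(2) by simp
  then have "(1 / \<theta>) * norm (x - y) \<le> norm (G x - G y)" by (simp add: algebra_simps)
  then show "norm (x - y) \<le> \<theta> * norm (G x - G y)" using \<theta> by (simp add: field_simps)
qed

text \<open>The map \<open>U\<close> rotates \<open>flat (range \<iota>)\<close> onto the kernel of \<open>A\<close> and the other coordinates onto its
  orthogonal complement, which is the range of the adjoint of \<open>A\<close>. On that complement \<open>A\<close> is injective.\<close>

lemma isometry_onto_complement:
  fixes A :: "real^'d \<Rightarrow> real^'p" and \<iota> :: "'p \<Rightarrow> 'd"
  assumes A: "linear A" "surj A" and \<iota>: "inj \<iota>"
  obtains U g where "linear U" "\<And>y. norm (U y) = norm y" "linear g" "\<And>w. U (embed \<iota> w) = g w"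
    "\<And>y. A (U y) = A (g (select \<iota> y))" "\<And>w. A (g w) = 0 \<Longrightarrow> w = 0"
proof -
  define At where "At = adjoint A"
  have At: "linear At" "\<And>x y. At w \<bullet> y = w \<bullet> A y" for w :: "real^'p" and x y
    unfolding At_def using adjoint_linear[OF A(1)] by (auto simp: inner_commute[of "adjoint A w"] adjoint_works[OF A(1)] inner_commute[of w])
  have At0: "w = 0" if "At w = 0" for w
  proof -
    obtain y where "A y = w" using A(2) by (metis surj_def)
    then show ?thesis using At(2)[of w y] that by simp
  qed
  have "inj At" using linear_injective_0[OF At(1)] At0 by blast
  define N where "N = range At"
  define K where "K = {y. A y = 0}"
  have sub: "subspace N" "subspace K" "subspace (range (embed \<iota>))"
    unfolding N_def K_def
    using linear_subspace_image[OF At(1) subspace_UNIV] linear_subspace_image[OF linear_embed subspace_UNIV]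
    by (auto simp: subspace_def linear_add[OF A(1)] linear_scale[OF A(1)] linear_0[OF A(1)])
  have K: "K = {y \<in> UNIV. \<forall>x\<in>N. orthogonal x y}"
  proof -
    have "A y = 0 \<longleftrightarrow> (\<forall>w. At w \<bullet> y = 0)" for y
      unfolding At(2) by (metis inner_eq_zero_iff inner_zero_right)
    then show ?thesis by (auto simp: K_def N_def orthogonal_def)
  qed
  have flat: "flat (range \<iota>) = {y \<in> UNIV. \<forall>x\<in>range (embed \<iota>). orthogonal x y}"
  proof -
    have e: "embed \<iota> w \<bullet> y = w \<bullet> select \<iota> y" for w y
    proof -
      have "embed \<iota> w \<bullet> y = (\<Sum>j\<in>range \<iota>. w $ inv \<iota> j * y $ j)"
        by (simp add: inner_vec_def embed_def if_distrib[of "\<lambda>x. x * _"] sum.If_cases)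
      also have "\<dots> = w \<bullet> select \<iota> y"
        using \<iota> by (simp add: sum.reindex inner_vec_def select_def)
      finally show ?thesis .
    qed
    have "y \<in> flat (range \<iota>) \<longleftrightarrow> select \<iota> y = 0" for y
      by (auto simp: flat_def select_def vec_eq_iff)
    moreover have "select \<iota> y = 0 \<longleftrightarrow> (\<forall>w. embed \<iota> w \<bullet> y = 0)" for y
      unfolding e by (metis inner_eq_zero_iff inner_zero_right inner_commute)
    ultimately show ?thesis by (auto simp: orthogonal_def)
  qed
  have "inj (embed \<iota>)" using select_embed[OF \<iota>] by (metis injI)
  have "dim N = CARD('p)" "dim (range (embed \<iota>)) = CARD('p)"
    unfolding N_def using dim_image_eq[OF At(1), of UNIV] dim_image_eq[OF linear_embed, of \<iota> UNIV] \<open>inj At\<close> \<open>inj (embed \<iota>)\<close>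
    by (simp_all add: inj_on_subset)
  moreover have "dim K + dim N = CARD('d)" "dim (flat (range \<iota>)) + dim (range (embed \<iota>)) = CARD('d)"
    unfolding K flat using dim_subspace_orthogonal_to_vectors[OF sub(1) subspace_UNIV] dim_subspace_orthogonal_to_vectors[OF sub(3) subspace_UNIV]
    by simp_all
  ultimately have dims: "dim (flat (range \<iota>)) = dim K" "dim (UNIV :: (real^'p) set) = dim N" by auto
  obtain f where f: "linear f" "f ` flat (range \<iota>) = K" "\<And>x. x \<in> flat (range \<iota>) \<Longrightarrow> norm (f x) = norm x"
    using isometries_subspaces[OF subspace_flat sub(2) dims(1)] by metis
  obtain g where g: "linear g" "g ` (UNIV :: (real^'p) set) = N" "\<And>x :: real^'p. norm (g x) = norm x"
    using isometries_subspaces[OF subspace_UNIV sub(1) dims(2)] by (metis UNIV_I)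
  define U where "U y = f (tangential (range \<iota>) y) + g (select \<iota> y)" for y
  show ?thesis
  proof (rule that[of U g])
    show "linear U" unfolding U_def
      using linear_compose[OF linear_tangential f(1)] linear_compose[OF linear_select g(1)]
      by (intro linear_compose_add) (simp_all add: comp_def)
    have Kf: "f (tangential (range \<iota>) y) \<in> K" for y using f(2) by auto
    have gN: "g w \<in> N" for w using g(2) by auto
    show "norm (U y) = norm y" for y
    proof -
      have "orthogonal (f (tangential (range \<iota>) y)) (g (select \<iota> y))"
        using Kf[of y] gN[of "select \<iota> y"] K by (auto simp: orthogonal_commute)
      then have "(norm (U y))\<^sup>2 = (norm (tangential (range \<iota>) y))\<^sup>2 + (norm (select \<iota> y))\<^sup>2"
        unfolding U_def by (subst norm_add_Pythagorean) (simp_all add: f(3) g(3))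
      also have "\<dots> = (norm (tangential (range \<iota>) y))\<^sup>2 + (norm (normal (range \<iota>) y))\<^sup>2"
        by (simp add: norm_select[OF \<iota>])
      also have "\<dots> = (norm (tangential (range \<iota>) y + normal (range \<iota>) y))\<^sup>2"
      proof (rule norm_add_Pythagorean[symmetric])
        show "orthogonal (tangential (range \<iota>) y) (normal (range \<iota>) y)"
          unfolding orthogonal_def inner_vec_def tangential_def normal_def by (intro sum.neutral) auto
      qed
      finally show ?thesis by (simp add: tangential_plus_normal)
    qed
    show "U (embed \<iota> w) = g w" for w using f(1) \<iota> by (simp add: U_def linear_0)
    show "A (U y) = A (g (select \<iota> y))" for y
      using Kf[of y] A(1) by (simp add: U_def linear_add K_def)
    show "w = 0" if "A (g w) = 0" for w
    proof -
      have "g w \<in> K" "g w \<in> N" using that gN by (auto simp: K_def)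
      then have "orthogonal (g w) (g w)" using K by blast
      then show ?thesis using g(3)[of w] by (simp add: orthogonal_def)
    qed
  qed (rule g(1))
qed

text \<open>In the coordinates given by the orthogonal map \<open>U\<close>, \<open>A\<close> is the square matrix of \<open>B\<close> padded with
  zero columns, and the padding contributes nothing to the Gram matrix.\<close>

lemma det_gram_restrict:
  fixes A :: "real^'d \<Rightarrow> real^'p" and \<iota> :: "'p \<Rightarrow> 'd"
  assumes lin: "linear A" "linear U" "linear B" and U: "\<And>y. norm (U y) = norm y" and \<iota>: "inj \<iota>"
    and AU: "\<And>y. A (U y) = B (select \<iota> y)"
  shows "det (matrix A ** transpose (matrix A)) = (det (matrix B))\<^sup>2"
proof -
  have "orthogonal_transformation U" using lin(2) U by (simp add: orthogonal_transformation)
  then have "orthogonal_matrix (matrix U)" using orthogonal_transformation_matrix by blast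
  then have 1: "matrix U ** transpose (matrix U) = mat 1" by (simp add: orthogonal_matrix_def)
  have 2: "matrix (select \<iota>) ** transpose (matrix (select \<iota>)) = (mat 1 :: real^'p^'p)"
  proof -
    have "(\<Sum>j\<in>UNIV. axis j 1 $ \<iota> i * axis j 1 $ \<iota> k) = (if i = k then 1 else (0::real))" for i k
    proof -
      have "(\<Sum>j\<in>UNIV. axis j 1 $ \<iota> i * axis j 1 $ \<iota> k) = (\<Sum>j\<in>UNIV. if j = \<iota> i then (if \<iota> i = \<iota> k then 1 else (0::real)) else 0)"
        by (intro sum.cong) (auto simp: axis_def)
      then show ?thesis using \<iota> by (simp add: inj_eq)
    qed
    then show ?thesis
      by (simp add: matrix_matrix_mult_def transpose_def matrix_def select_def mat_def vec_eq_iff)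
  qed
  have "A \<circ> U = B \<circ> select \<iota>" using AU by (simp add: fun_eq_iff)
  then have 3: "matrix A ** matrix U = matrix B ** matrix (select \<iota>)"
    using matrix_compose[OF lin(2,1)] matrix_compose[OF linear_select lin(3)] by metis
  have "matrix A ** transpose (matrix A) = (matrix A ** (matrix U ** transpose (matrix U))) ** transpose (matrix A)"
    unfolding 1 by simp
  also have "\<dots> = (matrix A ** matrix U) ** transpose (matrix A ** matrix U)"
    by (simp add: matrix_transpose_mul matrix_mul_assoc)
  also have "\<dots> = matrix B ** (matrix (select \<iota>) ** transpose (matrix (select \<iota>))) ** transpose (matrix B)"
    unfolding 3 by (simp add: matrix_transpose_mul matrix_mul_assoc)
  also have "\<dots> = matrix B ** transpose (matrix B)" unfolding 2 by simp
  finally show ?thesis by (simp add: det_mul det_transpose power2_eq_square)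
qed

text \<open>In a chart, \<open>F\<close> agrees with \<open>D \<circ> G\<close> to second order in the distance to \<open>flat J\<close>, where \<open>D\<close> is linear
  with kernel \<open>flat J\<close>, and \<open>G\<close> changes lengths and volumes by factors at most \<open>\<theta>\<close>. In the charts
  constructed below the derivative of \<open>G\<close> at \<open>z\<close> is orthogonal, which allows \<open>\<theta>\<close> arbitrarily close to 1.
  The assumption \<open>D_mass\<close> records that the profile of \<open>D\<close> has \<open>1 / gen_jacobian F z\<close> times the standard
  mass. The assumption \<open>G_det_lipschitz\<close> keeps the integrand Lipschitz after the change of variables,
  as a rate that is linear in the scale requires.\<close>

locale chart =
  fixes F :: "real^'d \<Rightarrow> real^'p" and J :: "'d set" and z :: "real^'d" and \<theta> \<delta> :: real
    and G :: "real^'d \<Rightarrow> real^'d" and G' :: "real^'d \<Rightarrow> real^'d \<Rightarrow> real^'d" and D :: "real^'d \<Rightarrow> real^'p"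
    and c C L :: real and k :: nat
  assumes F_smooth: "smooth_map F" and card_J: "card J = min CARD('d) CARD('p)" and theta: "1 < \<theta>" and delta: "0 < \<delta>" and c: "0 < c"
    and k: "1 \<le> k"
    and D_linear: "linear D" and D_tangential: "\<And>y. D (tangential J y) = 0"
    and D_lower: "\<And>y. c * norm (normal J y) \<le> norm (D y)"
    and D_mass: "gen_jacobian F z * slab_mass J D k = slab_mass J (normal J) k"
    and jac_pos: "0 < gen_jacobian F z"
    and G_z: "G z = 0"
    and G_deriv: "\<And>x. x \<in> ball z \<delta> \<Longrightarrow> (G has_derivative G' x) (at x)"
    and G_upper: "\<And>x y. x \<in> ball z \<delta> \<Longrightarrow> y \<in> ball z \<delta> \<Longrightarrow> norm (G x - G y) \<le> \<theta> * norm (x - y)"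
    and G_lower: "\<And>x y. x \<in> ball z \<delta> \<Longrightarrow> y \<in> ball z \<delta> \<Longrightarrow> norm (x - y) \<le> \<theta> * norm (G x - G y)"
    and G_det: "\<And>x. x \<in> ball z \<delta> \<Longrightarrow> 1 / \<theta> \<le> \<bar>det (matrix (G' x))\<bar> \<and> \<bar>det (matrix (G' x))\<bar> \<le> \<theta>"
    and G_det_lipschitz: "L-lipschitz_on (ball z \<delta>) (\<lambda>x. 1 / \<bar>det (matrix (G' x))\<bar>)"
    and F_close: "\<And>x. x \<in> ball z \<delta> \<Longrightarrow> norm (F x - D (G x)) \<le> C * (norm (normal J (G x)))\<^sup>2"
    and F_lower: "\<And>x. x \<in> ball z \<delta> \<Longrightarrow> c * norm (normal J (G x)) \<le> norm (F x)"
    and jac_close: "\<And>x. x \<in> ball z \<delta> \<Longrightarrow> gen_jacobian F x \<le> \<theta> * gen_jacobian F z \<and> gen_jacobian F z \<le> \<theta> * gen_jacobian F x"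

lemma continuous_near_ratio:
  fixes f :: "'a::metric_space \<Rightarrow> real"
  assumes "isCont f z" "0 < f z" "1 < \<theta>"
  obtains \<delta> where "0 < \<delta>" "\<And>x. x \<in> ball z \<delta> \<Longrightarrow> f x \<le> \<theta> * f z \<and> f z \<le> \<theta> * f x"
proof -
  have "f z / \<theta> < f z" "f z < \<theta> * f z" using assms by (auto simp: field_simps)
  then have "\<forall>\<^sub>F x in nhds z. f z / \<theta> < f x \<and> f x < \<theta> * f z"
    using assms(1) unfolding isCont_def
    by (intro eventually_conj order_tendstoD[of f "f z"]) (auto simp: tendsto_at_iff_tendsto_nhds)
  then obtain \<delta> where "0 < \<delta>" "\<And>x. dist x z < \<delta> \<Longrightarrow> f z / \<theta> < f x \<and> f x < \<theta> * f z"
    unfolding eventually_nhds_metric by blast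
  then show ?thesis
    using that[of \<delta>] assms by (auto simp: dist_commute field_simps dest: less_imp_le)
qed

lemma (in chart) shrink:
  assumes "0 < \<delta>'" "\<delta>' \<le> \<delta>"
  shows "chart F J z \<theta> \<delta>' G G' D c C L k"
proof -
  have sub: "x \<in> ball z \<delta>" if "x \<in> ball z \<delta>'" for x using that assms by auto
  have "L-lipschitz_on (ball z \<delta>') (\<lambda>x. 1 / \<bar>det (matrix (G' x))\<bar>)"
    using G_det_lipschitz by (rule lipschitz_on_subset) (use sub in blast)
  then show ?thesis
    by (intro chart.intro F_smooth card_J theta assms(1) c k D_linear D_tangential D_lower D_mass jac_pos G_z
        G_deriv G_upper G_lower G_det F_close F_lower jac_close) (assumption | erule sub)+
qed

lemma jacobian_eq_matrix: "jacobian F (at x) = matrix (frechet_derivative F (at x))"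
  by (simp add: jacobian_def)

text \<open>If \<open>F\<close> has at most as many components as variables, its derivative at \<open>z\<close> is onto, and the chart takes
  the components of \<open>F\<close> themselves as normal coordinates: \<open>F = D \<circ> G\<close> holds exactly. Rotating by \<open>V\<close> and
  normalising with the inverse of \<open>B\<close> makes the derivative of \<open>G\<close> at \<open>z\<close> orthogonal.\<close>

lemma chart_submersion:
  fixes F :: "real^'d \<Rightarrow> real^'p" and \<iota> :: "'p \<Rightarrow> 'd"
  assumes F: "smooth_map F" and z: "F z = 0" and J: "gen_jacobian F z \<noteq> 0"
    and le: "CARD('p) \<le> CARD('d)" and \<iota>: "inj \<iota>" and \<theta>: "1 < \<theta>" and k: "1 \<le> k"
  shows "\<exists>\<delta> G G' D c C L. chart F (range \<iota>) z \<theta> \<delta> G G' D c C L k"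
proof -
  let ?J = "range \<iota>"
  have ck: "ck_map n F" for n using F by (simp add: smooth_map_def)
  define A where "A x = frechet_derivative F (at x)" for x
  have der: "(F has_derivative A x) (at x)" for x
    unfolding A_def by (rule ck_map_has_derivative[OF ck])
  have linA: "linear (A x)" for x using der has_derivative_linear by blast
  have gj: "gen_jacobian F x = sqrt (det (matrix (A x) ** transpose (matrix (A x))))" for x
    using le by (simp add: gen_jacobian_def jacobian_eq_matrix A_def Let_def)
  have "surj (A z)"
  proof -
    let ?M = "matrix (A z)"
    have "invertible (?M ** transpose ?M)"
      using J unfolding gj by (simp add: invertible_det_nz)
    then obtain V where "(?M ** transpose ?M) ** V = mat 1" unfolding invertible_def by blast
    then have "?M *v ((transpose ?M ** V) *v y) = y" for y
      by (simp add: matrix_vector_mul_assoc matrix_mul_assoc)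
    then show ?thesis using fun_cong[OF matrix_vector_mul(2)[OF linA]] by (metis surjI)
  qed
  then obtain U g where U: "linear U" "\<And>y. norm (U y) = norm y" and g: "linear g" "\<And>w. U (embed \<iota> w) = g w"
    and AU: "\<And>y. A z (U y) = A z (g (select \<iota> y))" and inj: "\<And>w. A z (g w) = 0 \<Longrightarrow> w = 0"
    using isometry_onto_complement[OF linA[of z] \<open>surj (A z)\<close> \<iota>] by blast
  define B where "B w = A z (g w)" for w
  have linB: "linear B" unfolding B_def using linear_compose[OF g(1) linA[of z]] by (simp add: comp_def)
  have "inj B" using linear_injective_0[OF linB] inj by (auto simp: B_def)
  then have detB: "det (matrix B) \<noteq> 0" using det_nz_iff_inj[OF linB] by blast
  obtain Binv where Binv: "linear Binv" "\<And>x. B (Binv x) = x" "\<And>x. Binv (B x) = x"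
    using det_nonzero_right_inverse[OF linB detB] by blast
  obtain b where b: "0 < b" "\<And>x. b * norm x \<le> norm (B x)"
    using linear_det_nonzero_lower_bound[OF linB detB] by blast
  have "det (matrix (A z) ** transpose (matrix (A z))) = (det (matrix B))\<^sup>2"
    by (rule det_gram_restrict[OF linA U(1) linB U(2) \<iota>]) (simp add: AU B_def)
  then have JB: "gen_jacobian F z = \<bar>det (matrix B)\<bar>" by (simp add: gj)
  have "inj U"
  proof (rule linear_injective_0[OF U(1), THEN iffD2], intro allI impI)
    fix x assume "U x = 0"
    then show "x = 0" using U(2)[of x] by simp
  qed
  then obtain V where V: "linear V" "\<And>x. V (U x) = x" "\<And>x. U (V x) = x"
    using linear_injective_isomorphism[OF U(1) \<open>inj U\<close>] by blast
  have Vnorm: "norm (V x) = norm x" for x using U(2)[of "V x"] V(3) by simp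
  define D where "D y = B (select \<iota> y)" for y
  \<comment> \<open>The normal coordinates of \<open>G x\<close> are \<open>F x\<close> up to the linear map \<open>Binv\<close>, the tangential ones are linear.\<close>
  define G where "G x = embed \<iota> (Binv (F x)) + tangential ?J (V (x - z))" for x
  define G' where "G' x v = embed \<iota> (Binv (A x v)) + tangential ?J (V v)" for x v
  have linEB: "linear (\<lambda>w. embed \<iota> (Binv w))"
    using linear_compose[OF Binv(1) linear_embed] by (simp add: comp_def)
  have linTV: "linear (\<lambda>v. tangential ?J (V v))"
    using linear_compose[OF V(1) linear_tangential] by (simp add: comp_def)
  have linG': "linear (G' x)" for x
    unfolding G'_def using linear_compose[OF linA linEB] linTV by (intro linear_compose_add) (simp_all add: comp_def)
  have G'z: "G' z v = V v" for v
  proof -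
    define y where "y = V v"
    have "A z v = B (select \<iota> y)" using AU[of y] V(3) by (simp add: y_def B_def)
    then show ?thesis
      unfolding G'_def y_def[symmetric] by (simp add: Binv(3) embed_select[OF \<iota>] add.commute[of "normal ?J y"] tangential_plus_normal)
  qed
  have Gder: "(G has_derivative G' x) (at x)" for x
  proof -
    have "((\<lambda>x. embed \<iota> (Binv (F x))) has_derivative (\<lambda>v. embed \<iota> (Binv (A x v)))) (at x)"
      using diff_chain_at[OF der linear_imp_has_derivative[OF linEB]] by (simp add: comp_def)
    moreover have "((\<lambda>x. tangential ?J (V (x - z))) has_derivative (\<lambda>v. tangential ?J (V v))) (at x)"
    proof -
      have "((\<lambda>x. x - z) has_derivative (\<lambda>v. v)) (at x)" by (auto intro!: derivative_eq_intros)
      from diff_chain_at[OF this linear_imp_has_derivative[OF linTV]] show ?thesis by (simp add: comp_def)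
    qed
    ultimately show ?thesis unfolding G_def G'_def by (rule has_derivative_add)
  qed
  obtain K where K: "0 < K" "\<And>w. norm (embed \<iota> (Binv w)) \<le> K * norm w"
    using linear_bounded_pos[OF linEB] by blast
  define e where "e = (1 - 1 / \<theta>) / K"
  have e: "0 < e" using \<theta> K by (simp add: e_def)
  obtain d1 where d1: "0 < d1" "\<And>x y. x \<in> ball z d1 \<Longrightarrow> y \<in> ball z d1 \<Longrightarrow> norm (F x - F y - A z (x - y)) \<le> e * norm (x - y)"
    using ck_map_strict_derivative[OF ck e] unfolding A_def by blast
  have strict: "norm (G x - G y - V (x - y)) \<le> (1 - 1 / \<theta>) * norm (x - y)" if "x \<in> ball z d1" "y \<in> ball z d1" for x y
  proof -
    have t: "tangential ?J (V (x - z)) - tangential ?J (V (y - z)) = tangential ?J (V (x - y))"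
      using linear_diff[OF linTV, of "x - z" "y - z"] by simp
    have "V (x - y) = embed \<iota> (Binv (A z (x - y))) + tangential ?J (V (x - y))"
      using G'z[of "x - y"] by (simp add: G'_def)
    moreover have "G x - G y = embed \<iota> (Binv (F x)) - embed \<iota> (Binv (F y)) + tangential ?J (V (x - y))"
      unfolding t[symmetric] by (simp add: G_def)
    ultimately have "G x - G y - V (x - y) = embed \<iota> (Binv (F x)) - embed \<iota> (Binv (F y)) - embed \<iota> (Binv (A z (x - y)))"
      by (metis add_diff_cancel_right)
    also have "\<dots> = embed \<iota> (Binv (F x - F y - A z (x - y)))"
      by (simp add: linear_diff[OF linEB])
    finally have "norm (G x - G y - V (x - y)) \<le> K * norm (F x - F y - A z (x - y))" using K(2) by simp
    also have "\<dots> \<le> K * (e * norm (x - y))" using K(1) d1(2)[OF that] by simp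
    finally show ?thesis using K(1) by (simp add: e_def)
  qed
  have bilip: "norm (G x - G y) \<le> \<theta> * norm (x - y)" "norm (x - y) \<le> \<theta> * norm (G x - G y)"
    if "x \<in> ball z d1" "y \<in> ball z d1" for x y
    using strict_derivative_bilipschitz[OF \<theta> V(1) Vnorm strict[OF that]] by auto
  have "lipschitz_near z (\<lambda>x. matrix (G' x) $ i $ j)" for i j
  proof -
    have "lipschitz_near z (\<lambda>x. A x (axis j 1))"
      unfolding A_def using ck[of "Suc (Suc 0)"] by (intro ck_map_lipschitz_near) auto
    moreover have "linear (\<lambda>w. embed \<iota> (Binv w) $ i)"
      by (rule linearI) (simp_all add: linear_add[OF linEB] linear_scale[OF linEB])
    ultimately have "lipschitz_near z (\<lambda>x. embed \<iota> (Binv (A x (axis j 1))) $ i)"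
      by (rule lipschitz_near_linear)
    then show ?thesis
      unfolding matrix_axis G'_def by (simp add: lipschitz_near_add lipschitz_near_const)
  qed
  then have lipdet: "lipschitz_near z (\<lambda>x. det (matrix (G' x)))" by (rule lipschitz_near_det)
  have "G' z = V" using G'z by auto
  moreover have "orthogonal_transformation V" using V(1) Vnorm by (simp add: orthogonal_transformation)
  ultimately have det1: "\<bar>det (matrix (G' z))\<bar> = 1"
    using orthogonal_transformation_matrix[of V] det_orthogonal_matrix[of "matrix V"] by auto
  obtain d2 L where d2: "0 < d2" "L-lipschitz_on (ball z d2) (\<lambda>x. 1 / \<bar>det (matrix (G' x))\<bar>)"
    "\<And>x. x \<in> ball z d2 \<Longrightarrow> 1 / \<theta> \<le> \<bar>det (matrix (G' x))\<bar> \<and> \<bar>det (matrix (G' x))\<bar> \<le> \<theta>"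
    using lipschitz_near_inverse_abs[OF lipdet det1 \<theta>] by blast
  have jp: "0 < gen_jacobian F z" using JB detB by simp
  have jc: "isCont (gen_jacobian F) z"
    using continuous_on_gen_jacobian[OF ck] by (simp add: continuous_on_eq_continuous_at)
  then obtain d3 where d3: "0 < d3" "\<And>x. x \<in> ball z d3 \<Longrightarrow> gen_jacobian F x \<le> \<theta> * gen_jacobian F z \<and> gen_jacobian F z \<le> \<theta> * gen_jacobian F x"
    using continuous_near_ratio[OF jc jp \<theta>] by blast
  define \<delta> where "\<delta> = min d1 (min d2 d3)"
  have \<delta>: "0 < \<delta>" "\<delta> \<le> d1" "\<delta> \<le> d2" "\<delta> \<le> d3" using d1 d2 d3 by (auto simp: \<delta>_def)
  have sub: "x \<in> ball z d1" "x \<in> ball z d2" "x \<in> ball z d3" if "x \<in> ball z \<delta>" for x using that \<delta> by auto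
  have DG: "D (G x) = F x" for x
    by (simp add: D_def G_def linear_add[OF linear_select] select_embed[OF \<iota>] Binv)
  have nG: "b * norm (normal ?J y) \<le> norm (D y)" for y
    using b(2)[of "select \<iota> y"] by (simp add: D_def norm_select[OF \<iota>])
  have "chart F ?J z \<theta> \<delta> G G' D b 0 L k"
  proof (rule chart.intro)
    show "card ?J = min CARD('d) CARD('p)" using le \<iota> by (simp add: card_image)
    show "gen_jacobian F z * slab_mass ?J D k = slab_mass ?J (normal ?J) k"
      unfolding JB D_def by (rule slab_mass_surjective[OF linB detB k \<iota>])
    show "linear D" unfolding D_def using linear_compose[OF linear_select linB] by (simp add: comp_def)
    show "D (tangential ?J y) = 0" for y by (simp add: D_def linear_0[OF linB])
    show "G z = 0" using z by (simp add: G_def linear_0[OF linEB] linear_0[OF linTV])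
    show "L-lipschitz_on (ball z \<delta>) (\<lambda>x. 1 / \<bar>det (matrix (G' x))\<bar>)"
      using d2(2) by (rule lipschitz_on_subset) (use \<delta> in auto)
    show "norm (F x - D (G x)) \<le> 0 * (norm (normal ?J (G x)))\<^sup>2" for x by (simp add: DG)
    show "b * norm (normal ?J (G x)) \<le> norm (F x)" for x using nG[of "G x"] by (simp add: DG)
  qed (use F \<theta> \<delta>(1) b(1) k jp Gder bilip d2(3) d3(2) sub nG in auto)
  then show ?thesis by blast
qed

text \<open>With more components than variables the derivative at \<open>z\<close> is injective and the zero is isolated.
  The chart is a translation, every direction is normal, and Taylor's formula with quadratic remainder
  compares \<open>F\<close> with its derivative.\<close>

lemma chart_immersion:
  fixes F :: "real^'d \<Rightarrow> real^'p"
  assumes F: "smooth_map F" and z: "F z = 0" and J: "gen_jacobian F z \<noteq> 0"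
    and le: "\<not> CARD('p) \<le> CARD('d)" and \<theta>: "1 < \<theta>" and k: "1 \<le> k"
  shows "\<exists>\<delta> G G' D c C L. chart F UNIV z \<theta> \<delta> G G' D c C L k"
proof -
  have [simp]: "normal UNIV y = y" "tangential UNIV y = 0" for y :: "real^'d"
    by (simp_all add: normal_def tangential_def vec_eq_iff)
  have ck: "ck_map n F" for n using F by (simp add: smooth_map_def)
  define A where "A x = frechet_derivative F (at x)" for x
  have der: "(F has_derivative A x) (at x)" for x
    unfolding A_def by (rule ck_map_has_derivative[OF ck])
  have linA: "linear (A x)" for x using der has_derivative_linear by blast
  have gj: "gen_jacobian F x = sqrt (det (transpose (matrix (A x)) ** matrix (A x)))" for x
    using le by (simp add: gen_jacobian_def jacobian_eq_matrix A_def Let_def)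
  have "inj (A z)"
  proof (rule linear_injective_0[OF linA, THEN iffD2], intro allI impI)
    fix y assume y: "A z y = 0"
    let ?M = "matrix (A z)"
    have "invertible (transpose ?M ** ?M)"
      using J unfolding gj by (simp add: invertible_det_nz)
    then obtain V where V: "V ** (transpose ?M ** ?M) = mat 1" unfolding invertible_def by blast
    have "(V ** transpose ?M) *v (?M *v y) = (V ** (transpose ?M ** ?M)) *v y"
      by (simp only: matrix_vector_mul_assoc matrix_mul_assoc)
    also have "\<dots> = y" unfolding V by simp
    finally have "(V ** transpose ?M) *v (?M *v y) = y" .
    moreover have "?M *v y = 0" using y fun_cong[OF matrix_vector_mul(2)[OF linA]] by simp
    ultimately show "y = 0" by simp
  qed
  have "dim (range (A z)) \<le> dim (UNIV :: (real^'d) set)"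
    using dim_image_le[OF linA, of z UNIV] by simp
  \<comment> \<open>Mapping the range of \<open>A z\<close> isometrically into the source makes the determinant of \<open>A z\<close> meaningful.\<close>
  then obtain \<Phi> :: "real^'p \<Rightarrow> real^'d" where \<Phi>: "linear \<Phi>" "\<And>x. x \<in> range (A z) \<Longrightarrow> norm (\<Phi> x) = norm x"
    using isometry_subset_subspace[OF linear_subspace_image[OF linA subspace_UNIV] subspace_UNIV] by metis
  define B where "B y = \<Phi> (A z y)" for y
  have linB: "linear B" unfolding B_def using linear_compose[OF linA[of z] \<Phi>(1)] by (simp add: comp_def)
  have nB: "norm (B y) = norm (A z y)" for y using \<Phi>(2) by (simp add: B_def)
  have inn: "B x \<bullet> B y = A z x \<bullet> A z y" for x y
    unfolding dot_norm by (simp add: nB linear_add[OF linB, symmetric] linear_add[OF linA, symmetric])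
  have "transpose (matrix (A z)) ** matrix (A z) = transpose (matrix B) ** matrix B"
    by (simp add: vec_eq_iff gram_matrix inn)
  then have "det (transpose (matrix (A z)) ** matrix (A z)) = (det (matrix B))\<^sup>2"
    by (simp add: det_mul det_transpose power2_eq_square)
  then have JB: "gen_jacobian F z = \<bar>det (matrix B)\<bar>" by (simp add: gj)
  have detB: "det (matrix B) \<noteq> 0" using J JB by simp
  obtain b where b: "0 < b" "\<And>x. b * norm x \<le> norm (A z x)"
    using linear_inj_bounded_below_pos[OF linA \<open>inj (A z)\<close>] by metis
  have jp: "0 < gen_jacobian F z" using JB detB by simp
  have jc: "isCont (gen_jacobian F) z"
    using continuous_on_gen_jacobian[OF ck] by (simp add: continuous_on_eq_continuous_at)
  then obtain d3 where d3: "0 < d3" "\<And>x. x \<in> ball z d3 \<Longrightarrow> gen_jacobian F x \<le> \<theta> * gen_jacobian F z \<and> gen_jacobian F z \<le> \<theta> * gen_jacobian F x"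
    using continuous_near_ratio[OF jc jp \<theta>] by blast
  have "\<exists>d>0. \<exists>K\<ge>0. \<forall>x\<in>ball z d. norm (A x v - A z v) \<le> K * norm (x - z)" for v
  proof -
    have "lipschitz_near z (\<lambda>x. A x v)"
      unfolding A_def using ck[of "Suc (Suc 0)"] by (intro ck_map_lipschitz_near) auto
    then obtain d K where "0 < d" and K: "K-lipschitz_on (ball z d) (\<lambda>x. A x v)"
      unfolding lipschitz_near_def by blast
    have "\<forall>x\<in>ball z d. norm (A x v - A z v) \<le> K * norm (x - z)"
      using lipschitz_onD[OF K, of _ z] \<open>0 < d\<close> by (simp add: dist_norm)
    then show ?thesis using \<open>0 < d\<close> lipschitz_on_nonneg[OF K] by blast
  qed
  then obtain d K where d: "\<And>v. 0 < d v" "\<And>v. 0 \<le> K v" "\<And>v x. x \<in> ball z (d v) \<Longrightarrow> norm (A x v - A z v) \<le> K v * norm (x - z)"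
    by metis
  define d1 where "d1 = Min (d ` Basis)"
  define C where "C = (\<Sum>v\<in>Basis. K v)"
  have d1: "0 < d1" "\<And>v. v \<in> Basis \<Longrightarrow> d1 \<le> d v" using d(1) by (auto simp: d1_def)
  have C: "0 \<le> C" using d(2) by (simp add: C_def sum_nonneg)
  have on: "onorm (\<lambda>v. A x v - A z v) \<le> C * norm (x - z)" if "x \<in> ball z d1" for x
  proof (rule onorm_le)
    fix v
    have "norm (A x v - A z v) \<le> (\<Sum>b\<in>Basis. norm (A x b - A z b)) * norm v"
      by (rule norm_linear_le_sum_Basis[of "\<lambda>v. A x v - A z v"]) (intro linear_compose_sub linA)
    also have "\<dots> \<le> (\<Sum>b\<in>Basis. K b * norm (x - z)) * norm v"
      using that d1 d(3) by (intro mult_right_mono sum_mono) force+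
    finally show "norm (A x v - A z v) \<le> C * norm (x - z) * norm v" by (simp add: C_def sum_distrib_right)
  qed
  have taylor: "norm (F x - A z (x - z)) \<le> C * (norm (x - z))\<^sup>2" if x: "x \<in> ball z d1" for x
  proof -
    have "norm ((F x - A z x) - (F z - A z z)) \<le> C * norm (x - z) * norm (x - z)"
    proof (rule differentiable_bound[of "cball z (norm (x - z))" _ "\<lambda>u v. A u v - A z v"])
      fix u assume u: "u \<in> cball z (norm (x - z))"
      show "((\<lambda>x. F x - A z x) has_derivative (\<lambda>v. A u v - A z v)) (at u within cball z (norm (x - z)))"
        by (intro has_derivative_diff has_derivative_at_withinI[OF der]
            has_derivative_at_withinI[OF linear_imp_has_derivative] linA)
      have "u \<in> ball z d1" using u x by (auto simp: dist_norm norm_minus_commute)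
      then have "onorm (\<lambda>v. A u v - A z v) \<le> C * norm (u - z)" by (rule on)
      also have "\<dots> \<le> C * norm (x - z)"
        using u C by (intro mult_left_mono) (auto simp: dist_norm norm_minus_commute)
      finally show "onorm (\<lambda>v. A u v - A z v) \<le> C * norm (x - z)" .
    qed (auto simp: dist_norm norm_minus_commute)
    moreover have "(F x - A z x) - (F z - A z z) = F x - A z (x - z)"
      using z by (simp add: linear_diff[OF linA])
    ultimately show ?thesis by (simp only: power2_eq_square mult.assoc)
  qed
  \<comment> \<open>On this radius the quadratic remainder is at most half of the lower bound of \<open>A z\<close>.\<close>
  define d2 where "d2 = b / (2 * (C + 1))"
  have d2: "0 < d2" using b C by (simp add: d2_def)
  define \<delta> where "\<delta> = min d1 (min d2 d3)"
  have \<delta>: "0 < \<delta>" "\<delta> \<le> d1" "\<delta> \<le> d2" "\<delta> \<le> d3" using d1 d2 d3 by (auto simp: \<delta>_def)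
  have sub: "x \<in> ball z d1" "x \<in> ball z d2" "x \<in> ball z d3" if "x \<in> ball z \<delta>" for x using that \<delta> by auto
  have lower: "b / 2 * norm (x - z) \<le> norm (F x)" if "x \<in> ball z \<delta>" for x
  proof -
    have "C * norm (x - z) \<le> (C + 1) * d2"
      using sub(2)[OF that] C by (intro mult_mono) (auto simp: dist_norm norm_minus_commute)
    also have "\<dots> = b / 2"
    proof -
      have "a * (b / (2 * a)) = b / 2" if "a \<noteq> 0" for a using that by simp
      from this[of "C + 1"] C have "(C + 1) * (b / (2 * (C + 1))) = b / 2" by simp
      then show ?thesis by (simp only: d2_def)
    qed
    finally have "C * norm (x - z) * norm (x - z) \<le> b / 2 * norm (x - z)"
      by (rule mult_right_mono) simp
    then have "C * (norm (x - z))\<^sup>2 \<le> b / 2 * norm (x - z)"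
      by (simp only: power2_eq_square mult.assoc)
    moreover have "norm (A z (x - z)) \<le> norm (F x) + norm (F x - A z (x - z))"
      by (metis norm_triangle_sub norm_minus_commute)
    ultimately show ?thesis using taylor[OF sub(1)[OF that]] b(2)[of "x - z"] by simp
  qed
  have "chart F UNIV z \<theta> \<delta> (\<lambda>x. x - z) (\<lambda>x v. v) (A z) (b / 2) C 0 k"
  proof (rule chart.intro)
    show "card (UNIV :: 'd set) = min CARD('d) CARD('p)" using le by simp
    show "gen_jacobian F z * slab_mass UNIV (A z) k = slab_mass (UNIV :: 'd set) (normal UNIV) k"
      unfolding JB using slab_mass_injective[OF linB detB k nB[symmetric]] .
    show "((\<lambda>x. x - z) has_derivative (\<lambda>v. v)) (at x)" for x
      by (auto intro!: derivative_eq_intros)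
    have "det (matrix (\<lambda>v::real^'d. v)) = 1" by (simp add: matrix_id[unfolded id_def])
    then show "1 / \<theta> \<le> \<bar>det (matrix (\<lambda>v::real^'d. v))\<bar> \<and> \<bar>det (matrix (\<lambda>v::real^'d. v))\<bar> \<le> \<theta>"
      using \<theta> by simp
    show "0-lipschitz_on (ball z \<delta>) (\<lambda>x. 1 / \<bar>det (matrix (\<lambda>v::real^'d. v))\<bar>)" by (rule lipschitz_on_constant)
    show "b / 2 * norm (normal UNIV y) \<le> norm (A z y)" for y :: "real^'d"
    proof -
      have "b * norm y \<le> 2 * norm (A z y)" using b(2)[of y] norm_ge_zero[of "A z y"] by linarith
      then show ?thesis by simp
    qed
    have "norm w \<le> \<theta> * norm w" for w :: "real^'d" using \<theta> mult_right_mono[of 1 \<theta> "norm w"] by simp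
    then show "norm (x - z - (y - z)) \<le> \<theta> * norm (x - y)" "norm (x - y) \<le> \<theta> * norm (x - z - (y - z))" for x y :: "real^'d"
      by simp_all
  qed (use F \<theta> \<delta>(1) b(1) k jp d3(2) sub taylor lower linA linear_0[OF linA] in auto)
  then show ?thesis by blast
qed

section \<open>The local expansion in a chart\<close>

text \<open>A Lipschitz bump that vanishes outside \<open>ball z (\<delta> / 2)\<close>, well inside the domain of a chart.\<close>

definition tent :: "'a::metric_space \<Rightarrow> real \<Rightarrow> 'a \<Rightarrow> real" where
  "tent z \<delta> x = max 0 (1 - 2 * dist x z / \<delta>)"

lemma tent_bounds: "0 \<le> tent z \<delta> x" "0 < \<delta> \<Longrightarrow> tent z \<delta> x \<le> 1"
  by (auto simp: tent_def)

lemma tent_zero: "0 < \<delta> \<Longrightarrow> \<delta> / 2 \<le> dist x z \<Longrightarrow> tent z \<delta> x = 0"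
  by (simp add: tent_def field_simps)

lemma tent_lipschitz: "0 < \<delta> \<Longrightarrow> (2 / \<delta>)-lipschitz_on UNIV (tent z \<delta>)"
proof (rule lipschitz_onI)
  fix x y assume d: "0 < \<delta>"
  have "\<bar>dist x z - dist y z\<bar> \<le> dist x y" by (metis abs_dist_diff_le dist_commute)
  then have "\<bar>2 * dist x z / \<delta> - 2 * dist y z / \<delta>\<bar> \<le> 2 / \<delta> * dist x y"
    using d by (simp add: abs_le_iff field_simps)
  then show "dist (tent z \<delta> x) (tent z \<delta> y) \<le> 2 / \<delta> * dist x y"
    by (auto simp: tent_def dist_real_def)
qed simp

lemma continuous_on_tent: "0 < \<delta> \<Longrightarrow> continuous_on S (tent z \<delta>)"
  using lipschitz_on_continuous_on[OF tent_lipschitz] continuous_on_subset by blast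

text \<open>The decay at the lower bound \<open>m\<close> is kept, so that the error stays integrable over unbounded normal
  coordinates.\<close>

lemma exp_power_difference:
  fixes a b m P :: real
  assumes "0 \<le> m" "m \<le> a" "m \<le> b" "a \<le> P" "b \<le> P"
  shows "\<bar>exp (- (a ^ k)) - exp (- (b ^ k))\<bar> \<le> real k * P ^ (k - 1) * \<bar>a - b\<bar> * exp (- (m ^ k))"
proof -
  have main: "\<bar>exp (- (a ^ k)) - exp (- (b ^ k))\<bar> \<le> real k * P ^ (k - 1) * \<bar>a - b\<bar> * exp (- (m ^ k))"
    if "0 \<le> m" "m \<le> a" "a \<le> b" "b \<le> P" for a b
  proof -
    have p: "a ^ k \<le> b ^ k" "m ^ k \<le> a ^ k" using that by (auto intro!: power_mono)
    have "exp (- (a ^ k)) - exp (- (b ^ k)) = exp (- (a ^ k)) * (1 - exp (- (b ^ k - a ^ k)))"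
      by (simp add: algebra_simps exp_add[symmetric])
    also have "\<dots> \<le> exp (- (m ^ k)) * (b ^ k - a ^ k)"
    proof -
      have "1 - exp (- (b ^ k - a ^ k)) \<le> b ^ k - a ^ k"
        using exp_ge_add_one_self[of "- (b ^ k - a ^ k)"] by linarith
      then show ?thesis using p by (intro mult_mono) auto
    qed
    also have "b ^ k - a ^ k \<le> real k * P ^ (k - 1) * (b - a)"
    proof -
      have "(\<Sum>i<k. a ^ (k - Suc i) * b ^ i) \<le> (\<Sum>i<k. P ^ (k - 1))"
      proof (rule sum_mono)
        fix i assume "i \<in> {..<k}"
        then have "P ^ (k - Suc i) * P ^ i = P ^ (k - 1)" by (simp add: power_add[symmetric])
        moreover have "a ^ (k - Suc i) * b ^ i \<le> P ^ (k - Suc i) * P ^ i"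
          using that by (intro mult_mono power_mono) auto
        ultimately show "a ^ (k - Suc i) * b ^ i \<le> P ^ (k - 1)" by simp
      qed
      then have "(b - a) * (\<Sum>i<k. a ^ (k - Suc i) * b ^ i) \<le> (b - a) * (real k * P ^ (k - 1))"
        using that by (intro mult_left_mono) auto
      then show ?thesis unfolding power_diff_sumr2[of b k a] by (simp only: mult_ac)
    qed
    finally have "exp (- (a ^ k)) - exp (- (b ^ k)) \<le> exp (- (m ^ k)) * (real k * P ^ (k - 1) * (b - a))"
      by simp
    then show ?thesis using that p by (simp add: mult_ac)
  qed
  show ?thesis
  proof (cases "a \<le> b")
    case True
    then show ?thesis using main[of a b] assms by simp
  next
    case False
    then show ?thesis using main[of b a] assms by (simp add: abs_minus_commute)
  qed
qed

text \<open>Up to a constant factor, the limit of the measures with Lebesgue density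
  \<open>exp (- (norm (F x) / s) ^ k) / s ^ min CARD('d) CARD('p)\<close> as \<open>s\<close> tends to 0.\<close>

definition level_measure :: "(real^'d \<Rightarrow> real^'p) \<Rightarrow> (real^'d) measure" where
  "level_measure F = density (hausdorff_measure (CARD('d) - min CARD('d) CARD('p)))
     (\<lambda>x. indicator (F -` {0}) x * ennreal (1 / gen_jacobian F x))"

lemma sets_level_measure [simp, measurable_cong]: "sets (level_measure F) = sets borel"
  by (simp add: level_measure_def)

lemma space_level_measure [simp]: "space (level_measure F) = UNIV"
  by (simp add: level_measure_def)

context chart
begin

definition "V = ball z \<delta>"
definition "inverse_chart = inv_into V G"
text \<open>The integrand \<open>tent z \<delta> x * g x\<close> in the coordinates of the chart, including the volume factor of the
  change of variables.\<close>

definition transported :: "(real^'d \<Rightarrow> real) \<Rightarrow> real^'d \<Rightarrow> real" where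
  "transported g y = (if y \<in> G ` V
   then tent z \<delta> (inverse_chart y) * g (inverse_chart y) / \<bar>det (matrix (G' (inverse_chart y)))\<bar> else 0)"

lemma continuous_F: "continuous_on S F"
proof -
  have "ck_map 0 F" using F_smooth unfolding smooth_map_def ..
  then show ?thesis using ck_map_continuous continuous_on_subset by blast
qed

lemma z_in_V: "z \<in> V" using delta by (simp add: V_def)

lemma inj_G: "inj_on G V"
proof (rule inj_onI)
  fix x y assume "x \<in> V" "y \<in> V" "G x = G y"
  then show "x = y" using G_lower[of x y] by (simp add: V_def)
qed

lemma inverse_chart_G [simp]: "x \<in> V \<Longrightarrow> inverse_chart (G x) = x"
  unfolding inverse_chart_def by (rule inv_into_f_f[OF inj_G])

lemma continuous_G: "continuous_on V G"
  using has_derivative_continuous[OF G_deriv] by (intro continuous_at_imp_continuous_on) (simp add: V_def)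

lemma open_image: "open (G ` V)"
  using invariance_of_domain[OF continuous_G _ inj_G] by (simp add: V_def)

lemma inverse_chart_lipschitz: "\<theta>-lipschitz_on (G ` V) inverse_chart"
proof (rule lipschitz_onI)
  fix x y assume "x \<in> G ` V" "y \<in> G ` V"
  then show "dist (inverse_chart x) (inverse_chart y) \<le> \<theta> * dist x y"
    using G_lower by (auto simp: dist_norm V_def[symmetric])
qed (use theta in simp)

lemma chart_lipschitz: "\<theta>-lipschitz_on V G"
  using G_upper theta by (intro lipschitz_onI) (auto simp: dist_norm V_def)

lemma norm_G_le: "x \<in> V \<Longrightarrow> norm (G x) \<le> \<theta> * \<delta>"
proof -
  assume x: "x \<in> V"
  have "norm (G x) \<le> \<theta> * norm (x - z)" using G_upper[of x z] x z_in_V G_z by (simp add: V_def)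
  also have "\<dots> \<le> \<theta> * \<delta>" using x theta by (intro mult_left_mono) (auto simp: V_def dist_norm norm_minus_commute)
  finally show ?thesis .
qed

lemma det_pos: "x \<in> V \<Longrightarrow> 0 < \<bar>det (matrix (G' x))\<bar>"
  using G_det[of x] theta by (auto simp: V_def)

lemma inverse_det_le: "x \<in> V \<Longrightarrow> 1 / \<bar>det (matrix (G' x))\<bar> \<le> \<theta>"
  using G_det[of x] det_pos[of x] theta by (auto simp: V_def field_simps)

lemma inverse_det_ge: "x \<in> V \<Longrightarrow> 1 / \<theta> \<le> 1 / \<bar>det (matrix (G' x))\<bar>"
  using G_det[of x] det_pos[of x] theta by (auto simp: V_def field_simps)

lemma separation:
  obtains \<rho> where "0 < \<rho>" "\<And>y y'. y \<in> G ` cball z (\<delta> / 2) \<Longrightarrow> y' \<notin> G ` V \<Longrightarrow> \<rho> \<le> dist y y'"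
proof -
  have sub: "cball z (\<delta> / 2) \<subseteq> V" using delta by (auto simp: V_def)
  have "compact (G ` cball z (\<delta> / 2))"
    by (intro compact_continuous_image continuous_on_subset[OF continuous_G sub]) simp
  moreover have "closed (- (G ` V))" using open_image by (simp add: closed_Compl)
  moreover have "G ` cball z (\<delta> / 2) \<inter> - (G ` V) = {}" using sub by blast
  ultimately obtain \<rho> where "0 < \<rho>" "\<forall>y\<in>G ` cball z (\<delta> / 2). \<forall>y'\<in>- (G ` V). \<rho> \<le> dist y y'"
    using separate_compact_closed by blast
  then show ?thesis using that by blast
qed

lemma transported_outside: "y \<notin> G ` cball z (\<delta> / 2) \<Longrightarrow> transported g y = 0"
proof (cases "y \<in> G ` V")
  case True
  assume y: "y \<notin> G ` cball z (\<delta> / 2)"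
  from True obtain x where x: "x \<in> V" "y = G x" by blast
  with y have "x \<notin> cball z (\<delta> / 2)" by blast
  then have "tent z \<delta> x = 0" using delta by (intro tent_zero) (auto simp: dist_commute)
  then show ?thesis using x by (simp add: transported_def)
qed (simp add: transported_def)

lemma transported_G: "x \<in> V \<Longrightarrow> transported g (G x) = tent z \<delta> x * g x / \<bar>det (matrix (G' x))\<bar>"
  by (simp add: transported_def)

lemma transported_bound:
  fixes g :: "real^'d \<Rightarrow> real"
  assumes "\<And>x. x \<in> V \<Longrightarrow> \<bar>g x\<bar> \<le> M" "0 \<le> M"
  shows "\<bar>transported g y\<bar> \<le> \<theta> * M"
proof (cases "y \<in> G ` V")
  case True
  then obtain x where x: "x \<in> V" "y = G x" by blast
  have "\<bar>transported g y\<bar> = tent z \<delta> x * \<bar>g x\<bar> * (1 / \<bar>det (matrix (G' x))\<bar>)"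
    using x tent_bounds(1)[of z \<delta> x] by (simp add: transported_G abs_mult)
  also have "\<dots> \<le> 1 * M * \<theta>"
    using x assms tent_bounds(1)[of z \<delta> x] tent_bounds(2)[OF delta, of z x] delta inverse_det_le[OF x(1)] theta by (intro mult_mono) auto
  finally show ?thesis by (simp add: mult.commute)
qed (use assms theta in \<open>simp add: transported_def\<close>)

text \<open>Within \<open>G ` V\<close> the bound is a product rule. Across the boundary it needs the positive distance
  between the support of the tent and the complement of \<open>G ` V\<close>.\<close>

lemma transported_lipschitz:
  obtains K where "0 \<le> K"
    "\<And>(g :: real^'d \<Rightarrow> real) M N. (\<And>x. x \<in> V \<Longrightarrow> \<bar>g x\<bar> \<le> M) \<Longrightarrow> 0 \<le> M \<Longrightarrow> N-lipschitz_on V g \<Longrightarrow> (K * (M + N))-lipschitz_on UNIV (transported g)"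
proof -
  obtain \<rho> where \<rho>: "0 < \<rho>" "\<And>y y'. y \<in> G ` cball z (\<delta> / 2) \<Longrightarrow> y' \<notin> G ` V \<Longrightarrow> \<rho> \<le> dist y y'"
    using separation by blast
  have L: "0 \<le> L" using G_det_lipschitz lipschitz_on_nonneg by blast
  define K where "K = (\<theta> * (2 / \<delta>) + \<theta> + L) * \<theta> + \<theta> / \<rho>"
  have K: "0 \<le> K" using theta delta L \<rho> by (simp add: K_def)
  show ?thesis
  proof (rule that[OF K])
    fix g :: "real^'d \<Rightarrow> real" and M N assume g: "\<And>x. x \<in> V \<Longrightarrow> \<bar>g x\<bar> \<le> M" and M: "0 \<le> M" and N: "N-lipschitz_on V g"
    have N0: "0 \<le> N" using N lipschitz_on_nonneg by blast
    define u where "u x = tent z \<delta> x * g x * (1 / \<bar>det (matrix (G' x))\<bar>)" for x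
    have "(2 / \<delta>)-lipschitz_on V (tent z \<delta>)" using tent_lipschitz[OF delta] by (rule lipschitz_on_subset) simp
    then have "((2 / \<delta>) * M + 1 * N)-lipschitz_on V (\<lambda>x. tent z \<delta> x * g x)"
      using g M N tent_bounds(1)[of z \<delta>] tent_bounds(2)[OF delta, of z] by (intro lipschitz_on_mult) (auto simp: abs_le_iff intro: order_trans[of _ 0])
    then have "(((2 / \<delta>) * M + 1 * N) * \<theta> + M * L)-lipschitz_on V u"
      unfolding u_def
    proof (rule lipschitz_on_mult)
      show "L-lipschitz_on V (\<lambda>x. 1 / \<bar>det (matrix (G' x))\<bar>)" using G_det_lipschitz by (simp add: V_def)
      show "\<bar>tent z \<delta> x * g x\<bar> \<le> M" if "x \<in> V" for x
        using g[OF that] tent_bounds(1)[of z \<delta> x] tent_bounds(2)[OF delta, of z x] delta M mult_mono[of "tent z \<delta> x" 1 "\<bar>g x\<bar>" M] by (simp add: abs_mult)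
      show "\<bar>1 / \<bar>det (matrix (G' x))\<bar>\<bar> \<le> \<theta>" if "x \<in> V" for x using inverse_det_le[OF that] by simp
    qed (use M theta in auto)
    then have u: "((\<theta> * (2 / \<delta>) + \<theta> + L) * (M + N))-lipschitz_on V u"
    proof (rule lipschitz_on_mono)
      have "(\<theta> * (2 / \<delta>) + \<theta> + L) * (M + N)
          = ((2 / \<delta>) * M + 1 * N) * \<theta> + M * L + (\<theta> * (2 / \<delta>) * N + \<theta> * M + L * N)"
        by (simp add: algebra_simps add_divide_distrib)
      moreover have "0 \<le> \<theta> * (2 / \<delta>) * N + \<theta> * M + L * N" using theta delta L M N0 by simp
      ultimately show "((2 / \<delta>) * M + 1 * N) * \<theta> + M * L \<le> (\<theta> * (2 / \<delta>) + \<theta> + L) * (M + N)" by linarith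
    qed simp
    have uG: "transported g (G x) = u x" if "x \<in> V" for x using that by (simp add: transported_G u_def)
    have one: "dist (transported g y) (transported g y') \<le> K * (M + N) * dist y y'" if "y \<in> G ` V" for y y'
    proof (cases "y' \<in> G ` V")
      case True
      with that obtain x x' where x: "x \<in> V" "y = G x" "x' \<in> V" "y' = G x'" by blast
      have "dist (transported g y) (transported g y') \<le> (\<theta> * (2 / \<delta>) + \<theta> + L) * (M + N) * dist x x'"
        using lipschitz_onD[OF u x(1,3)] x by (simp add: uG)
      also have "\<dots> \<le> (\<theta> * (2 / \<delta>) + \<theta> + L) * (M + N) * (\<theta> * dist y y')"
        using x G_lower[of x x'] theta delta L M N0 by (intro mult_left_mono) (auto simp: dist_norm V_def)
      also have "\<dots> = ((\<theta> * (2 / \<delta>) + \<theta> + L) * \<theta>) * ((M + N) * dist y y')" by (simp add: mult_ac)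
      also have "\<dots> \<le> K * ((M + N) * dist y y')"
        using theta \<rho> M N0 by (intro mult_right_mono) (auto simp: K_def)
      finally show ?thesis by (simp add: mult_ac)
    next
      case False
      then have 0: "transported g y' = 0" by (simp add: transported_def)
      show ?thesis
      proof (cases "y \<in> G ` cball z (\<delta> / 2)")
        case True
        have "dist (transported g y) (transported g y') \<le> \<theta> * M"
          using transported_bound[where g = g and M = M and y = y, OF g M] 0 by simp
        also have "\<dots> \<le> \<theta> * M * (dist y y' / \<rho>)"
          using \<rho>(2)[OF True False] \<rho>(1) theta M mult_left_mono[of 1 "dist y y' / \<rho>" "\<theta> * M"] by simp
        also have "\<dots> = \<theta> / \<rho> * (M * dist y y')" by simp
        also have "\<dots> \<le> K * ((M + N) * dist y y')"
          using theta \<rho> M N0 delta L by (intro mult_mono mult_right_mono) (auto simp: K_def)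
        finally show ?thesis by (simp add: mult_ac)
      next
        case False
        then show ?thesis using 0 K M N0 by (simp add: transported_outside)
      qed
    qed
    show "(K * (M + N))-lipschitz_on UNIV (transported g)"
    proof (rule lipschitz_onI)
      fix y y'
      show "dist (transported g y) (transported g y') \<le> K * (M + N) * dist y y'"
      proof (cases "y \<in> G ` V")
        case True then show ?thesis by (rule one)
      next
        case False
        show ?thesis
        proof (cases "y' \<in> G ` V")
          case True then show ?thesis using one[of y' y] by (simp add: dist_commute)
        next
          case no: False
          with False show ?thesis using K M N0 by (simp add: transported_def)
        qed
      qed
    qed (use K M N0 in simp)
  qed
qed

text \<open>The pointwise limit of the squeezed integrand: its smooth part freezes on \<open>flat J\<close>, and \<open>D\<close> replaces \<open>F\<close>
  in the exponent.\<close>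

definition limit_functional :: "(real^'d \<Rightarrow> real) \<Rightarrow> real" where
  "limit_functional g = (\<integral>y. transported g (tangential J y) * exp (- (norm (D y) ^ k)) \<partial>lborel)"

lemma transported_support: "transported g y \<noteq> 0 \<Longrightarrow> norm y \<le> \<theta> * \<delta>"
  using norm_G_le by (auto simp: transported_def split: if_splits)

lemma D_normal: "D y = D (normal J y)"
  using D_tangential[of y] linear_add[OF D_linear, of "tangential J y" "normal J y"]
  by (simp add: tangential_plus_normal)

lemma D_squeeze: "D (squeeze J s y) = s *\<^sub>R D y"
  using D_normal[of "squeeze J s y"] D_normal[of y] by (simp add: linear_scale[OF D_linear])

lemma limit_integrable:
  assumes g: "\<And>x. x \<in> V \<Longrightarrow> \<bar>g x\<bar> \<le> M" "0 \<le> M" and [measurable]: "transported g \<in> borel_measurable borel"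
  shows "integrable lborel (\<lambda>y. transported g (tangential J y) * exp (- (norm (D y) ^ k)))"
proof (rule Bochner_Integration.integrable_bound)
  have [measurable]: "D \<in> borel_measurable borel" using D_linear by (rule borel_measurable_linear)
  show "(\<lambda>y. transported g (tangential J y) * exp (- (norm (D y) ^ k))) \<in> borel_measurable lborel"
    by measurable
  show "integrable lborel (\<lambda>y. (\<theta> * M) * (indicator {y. norm (tangential J y) \<le> \<theta> * \<delta>} y *
           (norm (normal J y) ^ 0 * exp (- ((c * norm (normal J y)) ^ k)))))"
    by (intro integrable_mult_right integrable_normal_profile c k)
  show "AE y in lborel. norm (transported g (tangential J y) * exp (- (norm (D y) ^ k)))
     \<le> norm ((\<theta> * M) * (indicator {y. norm (tangential J y) \<le> \<theta> * \<delta>} y *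
           (norm (normal J y) ^ 0 * exp (- ((c * norm (normal J y)) ^ k)))))"
  proof (rule AE_I2)
    fix y
    have e: "exp (- (norm (D y) ^ k)) \<le> exp (- ((c * norm (normal J y)) ^ k))"
      using D_lower[of y] c by (auto intro!: power_mono)
    have "\<bar>transported g (tangential J y)\<bar> * exp (- (norm (D y) ^ k)) \<le> (\<theta> * M) * exp (- ((c * norm (normal J y)) ^ k))"
      using transported_bound[OF g] e theta g(2) by (intro mult_mono) auto
    then show "norm (transported g (tangential J y) * exp (- (norm (D y) ^ k)))
     \<le> norm ((\<theta> * M) * (indicator {y. norm (tangential J y) \<le> \<theta> * \<delta>} y *
           (norm (normal J y) ^ 0 * exp (- ((c * norm (normal J y)) ^ k)))))"
      using transported_support[of g "tangential J y"] theta g(2)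
      by (cases "transported g (tangential J y) = 0") (simp_all add: abs_mult)
  qed
qed

definition rescaled :: "(real^'d \<Rightarrow> real) \<Rightarrow> real \<Rightarrow> real^'d \<Rightarrow> real" where
  "rescaled g s y = transported g y * (if y \<in> G ` V then exp (- ((norm (F (inverse_chart y)) / s) ^ k)) else 0)"

lemma rescaled_measurable:
  assumes [measurable]: "transported g \<in> borel_measurable borel"
  shows "rescaled g s \<in> borel_measurable borel"
proof -
  have "continuous_on (G ` V) (\<lambda>y. F (inverse_chart y))"
    using continuous_on_compose[OF lipschitz_on_continuous_on[OF inverse_chart_lipschitz] continuous_F] by (simp add: comp_def)
  then have "continuous_on (G ` V) (\<lambda>y. exp (- ((norm (F (inverse_chart y)) / s) ^ k)))"
    unfolding divide_inverse by (intro continuous_intros)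
  then have [measurable]: "(\<lambda>y. if y \<in> G ` V then exp (- ((norm (F (inverse_chart y)) / s) ^ k)) else 0) \<in> borel_measurable borel"
    using open_image by (intro borel_measurable_continuous_on_if) auto
  show ?thesis unfolding rescaled_def by measurable
qed

lemma local_integral:
  assumes [measurable]: "g \<in> borel_measurable borel" "transported g \<in> borel_measurable borel"
    and g: "\<And>x. x \<in> V \<Longrightarrow> \<bar>g x\<bar> \<le> M" "0 \<le> M" and s: "0 < s"
  shows "integrable lborel (\<lambda>x. tent z \<delta> x * g x * exp (- ((norm (F x) / s) ^ k)))"
    "integrable lborel (\<lambda>y. rescaled g s (squeeze J s y))"
    "(\<integral>x. tent z \<delta> x * g x * exp (- ((norm (F x) / s) ^ k)) \<partial>lborel) = s ^ card J * (\<integral>y. rescaled g s (squeeze J s y) \<partial>lborel)"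
proof -
  have [measurable]: "F \<in> borel_measurable borel" "tent z \<delta> \<in> borel_measurable borel"
    using continuous_F continuous_on_tent[OF delta] by (auto intro: borel_measurable_continuous_onI)
  note [measurable] = rescaled_measurable
  show int: "integrable lborel (\<lambda>x. tent z \<delta> x * g x * exp (- ((norm (F x) / s) ^ k)))"
  proof (rule Bochner_Integration.integrable_bound)
    show "integrable lborel (\<lambda>x. M * indicator V x)"
      unfolding V_def using emeasure_lborel_ball_finite[of z \<delta>] by (intro integrable_mult_right) auto
    show "AE x in lborel. norm (tent z \<delta> x * g x * exp (- ((norm (F x) / s) ^ k))) \<le> norm (M * indicator V x)"
    proof (rule AE_I2)
      fix x
      show "norm (tent z \<delta> x * g x * exp (- ((norm (F x) / s) ^ k))) \<le> norm (M * indicator V x)"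
      proof (cases "x \<in> V")
        case True
        have "\<bar>tent z \<delta> x\<bar> * \<bar>g x\<bar> * exp (- ((norm (F x) / s) ^ k)) \<le> 1 * M * 1"
          using tent_bounds(1)[of z \<delta> x] tent_bounds(2)[OF delta, of z x] g(1)[OF True] s g(2)
          by (intro mult_mono) auto
        then show ?thesis using True g(2) by (simp add: abs_mult)
      next
        case False
        then have "tent z \<delta> x = 0" using delta by (intro tent_zero) (auto simp: V_def dist_commute)
        then show ?thesis by simp
      qed
    qed
  qed measurable
  have eq: "indicator V x * (\<bar>det (matrix (G' x))\<bar> * rescaled g s (G x)) = tent z \<delta> x * g x * exp (- ((norm (F x) / s) ^ k))" for x
  proof (cases "x \<in> V")
    case True
    then show ?thesis using det_pos[OF True] by (simp add: rescaled_def transported_G)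
  next
    case False
    then have "tent z \<delta> x = 0" using delta by (intro tent_zero) (auto simp: V_def dist_commute)
    then show ?thesis using False by simp
  qed
  have ind: "indicator (G ` V) y * rescaled g s y = rescaled g s y" for y
    by (auto simp: rescaled_def indicator_def)
  have oV: "open V" and dV: "\<And>x. x \<in> V \<Longrightarrow> (G has_derivative G' x) (at x)" using G_deriv by (auto simp: V_def)
  have int': "integrable lborel (\<lambda>x. indicator V x * (\<bar>det (matrix (G' x))\<bar> * rescaled g s (G x)))"
    unfolding eq by (rule int)
  note cov = change_of_variables[OF oV dV inj_G rescaled_measurable[OF assms(2)] int', unfolded eq ind]
  show "integrable lborel (\<lambda>y. rescaled g s (squeeze J s y))"
    using cov(1) integral_squeeze(1)[OF s, of "rescaled g s"] by simp
  show "(\<integral>x. tent z \<delta> x * g x * exp (- ((norm (F x) / s) ^ k)) \<partial>lborel) = s ^ card J * (\<integral>y. rescaled g s (squeeze J s y) \<partial>lborel)"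
    using cov(2) integral_squeeze(2)[OF s, of "rescaled g s" J] by simp
qed

text \<open>After squeezing, the values of \<open>transported g\<close> and the exponents both differ from their limits by \<open>O(s)\<close>:
  the first because \<open>transported g\<close> is Lipschitz and normal distances are multiplied by \<open>s\<close>, the second
  because \<open>F - D \<circ> G\<close> is quadratic in the normal distance, hence \<open>O(s\<^sup>2)\<close>, before the division by \<open>s\<close>.\<close>

lemma local_laplace:
  obtains K where "0 \<le> K"
    "\<And>(g :: real^'d \<Rightarrow> real) M N s. g \<in> borel_measurable borel \<Longrightarrow> (\<And>x. x \<in> V \<Longrightarrow> \<bar>g x\<bar> \<le> M) \<Longrightarrow> 0 \<le> M \<Longrightarrow> N-lipschitz_on V g \<Longrightarrow> 0 < s \<Longrightarrow>
      \<bar>(\<integral>x. tent z \<delta> x * g x * exp (- ((norm (F x) / s) ^ k)) \<partial>lborel) / s ^ card J - limit_functional g\<bar> \<le> K * (M + N) * s"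
proof -
  obtain K where K: "0 \<le> K"
    "\<And>(g :: real^'d \<Rightarrow> real) M N. (\<And>x. x \<in> V \<Longrightarrow> \<bar>g x\<bar> \<le> M) \<Longrightarrow> 0 \<le> M \<Longrightarrow> N-lipschitz_on V g \<Longrightarrow> (K * (M + N))-lipschitz_on UNIV (transported g)"
    using transported_lipschitz by blast
  obtain B where B: "0 < B" "\<And>y. norm (D y) \<le> B * norm y" using linear_bounded_pos[OF D_linear] by blast
  define \<rho> where "\<rho> = \<theta> * \<delta>"
  have \<rho>: "0 < \<rho>" using theta delta by (simp add: \<rho>_def)
  define P where "P = B + \<bar>C\<bar> * \<rho>"
  define Q where "Q = \<theta> * (\<bar>C\<bar> * real k * P ^ (k - 1))"
  have P: "0 < P" and Q: "0 \<le> Q" using B \<rho> theta by (auto simp: P_def Q_def add_pos_nonneg)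
  define W where "W j y = indicator {y. norm (tangential J y) \<le> \<rho>} y * (norm (normal J y) ^ j * exp (- ((c * norm (normal J y)) ^ k)))" for j and y :: "real^'d"
  have W: "integrable lborel (W j)" "0 \<le> W j y" for j y
    unfolding W_def using integrable_normal_profile[OF c k] by auto
  define K' where "K' = K * (\<integral>y. W 1 y \<partial>lborel) + Q * (\<integral>y. W (k + 1) y \<partial>lborel)"
  have intW: "0 \<le> (\<integral>y. W j y \<partial>lborel)" for j using W by (intro integral_nonneg_AE) auto
  have "0 \<le> K'" using K(1) Q intW by (simp add: K'_def)
  then show ?thesis
  proof (rule that)
    fix g :: "real^'d \<Rightarrow> real" and M N s :: real
    assume meas [measurable]: "g \<in> borel_measurable borel" and g: "\<And>x. x \<in> V \<Longrightarrow> \<bar>g x\<bar> \<le> M" and M: "0 \<le> M"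
      and N: "N-lipschitz_on V g" and s: "0 < s"
    have N0: "0 \<le> N" using N lipschitz_on_nonneg by blast
    have lip: "(K * (M + N))-lipschitz_on UNIV (transported g)" by (rule K(2)[OF g M N])
    have tm [measurable]: "transported g \<in> borel_measurable borel"
      using lipschitz_on_continuous_on[OF lip] by (rule borel_measurable_continuous_onI)
    note LI = local_integral[OF meas tm g M s] and LM = limit_integrable[OF g M tm]
    let ?d = "\<lambda>y. rescaled g s (squeeze J s y) - transported g (tangential J y) * exp (- (norm (D y) ^ k))"
    have bound: "\<bar>?d y\<bar> \<le> s * (K * (M + N) * W 1 y + Q * M * W (k + 1) y)" for y
    proof (cases "norm (tangential J y) \<le> \<rho>")
      case False
      then have "transported g (tangential J y) = 0" using transported_support[of g] by (auto simp: \<rho>_def)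
      moreover have "transported g (squeeze J s y) = 0"
        using False transported_support[of g "squeeze J s y"] norm_tangential_le[of J "squeeze J s y"] by (auto simp: \<rho>_def)
      ultimately show ?thesis using False by (simp add: rescaled_def W_def)
    next
      case True
      define n where "n = norm (normal J y)"
      define a where "a = norm (D y)"
      have n0: "0 \<le> n" by (simp add: n_def)
      have a: "c * n \<le> a" "a \<le> B * n"
        using D_lower[of y] B(2)[of "normal J y"] D_normal[of y] by (auto simp: a_def n_def)
      have W1: "W 1 y = n * exp (- ((c * n) ^ k))" "W (k + 1) y = n ^ (k + 1) * exp (- ((c * n) ^ k))"
        using True by (simp_all add: W_def n_def)
      have ea: "exp (- (a ^ k)) \<le> exp (- ((c * n) ^ k))"
        using a c n0 by (auto intro!: power_mono)
      \<comment> \<open>The difference caused by freezing the values of \<open>transported g\<close>.\<close>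
      have second: "\<bar>transported g (squeeze J s y) - transported g (tangential J y)\<bar> * exp (- (a ^ k)) \<le> s * (K * (M + N) * W 1 y)"
      proof -
        have "\<bar>transported g (squeeze J s y) - transported g (tangential J y)\<bar> \<le> K * (M + N) * dist (squeeze J s y) (tangential J y)"
          using lipschitz_onD[OF lip, of "squeeze J s y" "tangential J y"] by (simp add: dist_real_def)
        also have "dist (squeeze J s y) (tangential J y) = s * n"
          using s by (simp add: dist_norm squeeze_def n_def)
        finally have "\<bar>transported g (squeeze J s y) - transported g (tangential J y)\<bar> * exp (- (a ^ k)) \<le> (K * (M + N) * (s * n)) * exp (- ((c * n) ^ k))"
          using ea K(1) M N0 s n0 by (intro mult_mono) auto
        then show ?thesis unfolding W1 by (simp add: mult_ac)
      qed
      \<comment> \<open>The difference caused by replacing \<open>F\<close> by \<open>D \<circ> G\<close> in the exponent.\<close>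
      have first: "\<bar>rescaled g s (squeeze J s y) - transported g (squeeze J s y) * exp (- (a ^ k))\<bar> \<le> s * (Q * M * W (k + 1) y)"
      proof (cases "squeeze J s y \<in> G ` V")
        case False
        then show ?thesis using s Q M W(2) by (simp add: rescaled_def transported_def)
      next
        case inG: True
        then obtain x where x: "x \<in> V" "squeeze J s y = G x" by blast
        define e where "e = norm (F x) / s"
        have nG: "norm (normal J (G x)) = s * n" unfolding x(2)[symmetric] using s by (simp add: n_def)
        have DG: "D (G x) = s *\<^sub>R D y" unfolding x(2)[symmetric] by (rule D_squeeze)
        have ce: "c * n \<le> e"
          using F_lower[of x] x(1) s unfolding nG by (simp add: V_def e_def field_simps)
        have "norm (F x - s *\<^sub>R D y) \<le> C * (s * n)\<^sup>2"
          using F_close[of x] x(1) unfolding nG DG by (simp add: V_def)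
        also have "\<dots> \<le> \<bar>C\<bar> * (s * n)\<^sup>2" by (intro mult_right_mono) auto
        finally have "\<bar>norm (F x) - norm (s *\<^sub>R D y)\<bar> \<le> \<bar>C\<bar> * (s * n)\<^sup>2"
          by (meson norm_triangle_ineq3 order_trans)
        then have "\<bar>s * e - s * a\<bar> \<le> \<bar>C\<bar> * (s * n)\<^sup>2" using s by (simp add: e_def a_def)
        moreover have "\<bar>s * e - s * a\<bar> = s * \<bar>e - a\<bar>"
          using s by (simp add: right_diff_distrib[symmetric] abs_mult)
        ultimately have "s * \<bar>e - a\<bar> \<le> s * (\<bar>C\<bar> * s * n\<^sup>2)"
          by (simp add: power2_eq_square mult_ac)
        then have ea': "\<bar>e - a\<bar> \<le> \<bar>C\<bar> * s * n\<^sup>2" using s by simp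
        have "s * n \<le> \<rho>"
          using norm_G_le[OF x(1)] norm_normal_le[of J "G x"] nG by (simp add: \<rho>_def)
        then have "\<bar>C\<bar> * s * n\<^sup>2 \<le> \<bar>C\<bar> * \<rho> * n"
          using n0 mult_right_mono[of "s * n" \<rho> n] by (simp add: power2_eq_square mult.assoc mult_left_mono)
        then have eP: "e \<le> P * n" "a \<le> P * n"
          using ea' a n0 \<rho> by (auto simp: P_def algebra_simps intro: order_trans[OF a(2)])
        have "\<bar>exp (- (e ^ k)) - exp (- (a ^ k))\<bar> \<le> real k * (P * n) ^ (k - 1) * \<bar>e - a\<bar> * exp (- ((c * n) ^ k))"
          using ce a eP c n0 by (intro exp_power_difference) auto
        also have "\<dots> \<le> real k * (P * n) ^ (k - 1) * (\<bar>C\<bar> * s * n\<^sup>2) * exp (- ((c * n) ^ k))"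
          using ea' P n0 by (intro mult_right_mono mult_left_mono) auto
        also have "\<dots> = s * (\<bar>C\<bar> * real k * P ^ (k - 1)) * (n ^ (k - 1) * n\<^sup>2 * exp (- ((c * n) ^ k)))"
          by (simp add: power_mult_distrib mult_ac)
        also have "n ^ (k - 1) * n\<^sup>2 = n ^ (k + 1)"
          using k by (simp add: power_add[symmetric])
        finally have d: "\<bar>exp (- (e ^ k)) - exp (- (a ^ k))\<bar> \<le> s * (\<bar>C\<bar> * real k * P ^ (k - 1)) * W (k + 1) y"
          unfolding W1 by simp
        have "\<bar>rescaled g s (squeeze J s y) - transported g (squeeze J s y) * exp (- (a ^ k))\<bar>
            = \<bar>transported g (squeeze J s y)\<bar> * \<bar>exp (- (e ^ k)) - exp (- (a ^ k))\<bar>"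
          using inG x by (simp add: rescaled_def e_def abs_mult[symmetric] right_diff_distrib)
        also have "\<dots> \<le> (\<theta> * M) * (s * (\<bar>C\<bar> * real k * P ^ (k - 1)) * W (k + 1) y)"
          using d transported_bound[where g = g and M = M and y = "squeeze J s y", OF g M] theta M by (intro mult_mono) auto
        finally show ?thesis by (simp add: Q_def mult_ac)
      qed
      have "\<bar>?d y\<bar> \<le> \<bar>rescaled g s (squeeze J s y) - transported g (squeeze J s y) * exp (- (a ^ k))\<bar>
         + \<bar>transported g (squeeze J s y) * exp (- (a ^ k)) - transported g (tangential J y) * exp (- (a ^ k))\<bar>"
        unfolding a_def by linarith
      also have "\<bar>transported g (squeeze J s y) * exp (- (a ^ k)) - transported g (tangential J y) * exp (- (a ^ k))\<bar>
         = \<bar>transported g (squeeze J s y) - transported g (tangential J y)\<bar> * exp (- (a ^ k))"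
        by (simp add: left_diff_distrib[symmetric] abs_mult)
      finally show ?thesis using first second by (simp add: algebra_simps)
    qed
    have eq: "(\<integral>x. tent z \<delta> x * g x * exp (- ((norm (F x) / s) ^ k)) \<partial>lborel) / s ^ card J - limit_functional g = (\<integral>y. ?d y \<partial>lborel)"
    proof -
      have "(\<integral>x. tent z \<delta> x * g x * exp (- ((norm (F x) / s) ^ k)) \<partial>lborel) / s ^ card J = (\<integral>y. rescaled g s (squeeze J s y) \<partial>lborel)"
        using LI(3) s by (simp add: divide_eq_eq mult.commute)
      then show ?thesis
        unfolding limit_functional_def using Bochner_Integration.integral_diff[OF LI(2) LM] by simp
    qed
    have "\<bar>\<integral>y. ?d y \<partial>lborel\<bar> \<le> (\<integral>y. \<bar>?d y\<bar> \<partial>lborel)" by (rule integral_abs_bound)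
    also have "\<dots> \<le> (\<integral>y. s * (K * (M + N) * W 1 y + Q * M * W (k + 1) y) \<partial>lborel)"
    proof (rule integral_mono)
      show "integrable lborel (\<lambda>y. \<bar>?d y\<bar>)"
        by (intro integrable_abs Bochner_Integration.integrable_diff LI(2) LM)
      show "integrable lborel (\<lambda>y. s * (K * (M + N) * W 1 y + Q * M * W (k + 1) y))"
        by (intro integrable_mult_right Bochner_Integration.integrable_add W(1))
    qed (rule bound)
    also have "\<dots> = s * (K * (M + N) * (\<integral>y. W 1 y \<partial>lborel) + Q * M * (\<integral>y. W (k + 1) y \<partial>lborel))"
      by (simp add: W(1))
    also have "\<dots> \<le> K' * (M + N) * s"
    proof -
      have "Q * M * (\<integral>y. W (k + 1) y \<partial>lborel) \<le> Q * (M + N) * (\<integral>y. W (k + 1) y \<partial>lborel)"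
        using Q N0 intW by (intro mult_right_mono mult_left_mono) auto
      then have "K * (M + N) * (\<integral>y. W 1 y \<partial>lborel) + Q * M * (\<integral>y. W (k + 1) y \<partial>lborel) \<le> K' * (M + N)"
        by (simp add: K'_def algebra_simps)
      from mult_left_mono[OF this, of s] s show ?thesis by (simp add: mult_ac)
    qed
    finally show "\<bar>(\<integral>x. tent z \<delta> x * g x * exp (- ((norm (F x) / s) ^ k)) \<partial>lborel) / s ^ card J - limit_functional g\<bar> \<le> K' * (M + N) * s"
      unfolding eq .
  qed
qed

end

context chart
begin

definition "r = CARD('d) - card J"

lemma jac_pos_near: "x \<in> V \<Longrightarrow> 0 < gen_jacobian F x"
  using jac_close[of x] jac_pos theta by (auto simp: V_def zero_less_mult_iff dest: less_le_trans)

text \<open>Both inequalities \<open>F_close\<close> and \<open>F_lower\<close> enter: the first shows that points of \<open>flat J\<close> are zeros,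
  the second that zeros lie on \<open>flat J\<close>.\<close>

lemma zero_iff_flat: "x \<in> V \<Longrightarrow> F x = 0 \<longleftrightarrow> G x \<in> flat J"
proof
  assume x: "x \<in> V" and "F x = 0"
  then have "c * norm (normal J (G x)) \<le> 0" using F_lower[of x] by (simp add: V_def)
  then have "normal J (G x) = 0" using c by (simp add: mult_le_0_iff)
  then show "G x \<in> flat J" by (simp add: flat_iff_normal)
next
  assume x: "x \<in> V" and f: "G x \<in> flat J"
  then have "D (G x) = 0" using D_tangential[of "G x"] by (simp add: flat_iff_tangential)
  then show "F x = 0" using F_close[of x] x f by (simp add: V_def flat_iff_normal)
qed

lemma hausdorff_image_le:
  assumes "B \<subseteq> V"
  shows "hausdorff_outer n (G ` B) \<le> ennreal (\<theta> ^ n) * hausdorff_outer n B"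
    "hausdorff_outer n B \<le> ennreal (\<theta> ^ n) * hausdorff_outer n (G ` B)"
proof -
  show "hausdorff_outer n (G ` B) \<le> ennreal (\<theta> ^ n) * hausdorff_outer n B"
    using lipschitz_on_subset[OF chart_lipschitz assms] theta by (intro hausdorff_outer_lipschitz_image) auto
  have "inverse_chart ` G ` B = B" using assms by (force simp: image_image)
  moreover have "hausdorff_outer n (inverse_chart ` G ` B) \<le> ennreal (\<theta> ^ n) * hausdorff_outer n (G ` B)"
    using lipschitz_on_subset[OF inverse_chart_lipschitz image_mono[OF assms]] theta by (intro hausdorff_outer_lipschitz_image) auto
  ultimately show "hausdorff_outer n B \<le> ennreal (\<theta> ^ n) * hausdorff_outer n (G ` B)" by simp
qed

lemma measurable_zero_set [measurable]: "F -` {0} \<in> sets borel"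
  using continuous_closed_vimage[OF closed_singleton, of F 0] continuous_F[of UNIV]
  by (auto intro!: borel_closed simp: continuous_on_eq_continuous_at)

lemma measurable_V [measurable]: "V \<in> sets borel" "G ` V \<in> sets borel"
  using open_image by (auto simp: V_def)

text \<open>The chart identifies the zero set with a piece of \<open>flat J\<close>, and as a map that is Lipschitz in both
  directions it compares the two Hausdorff measures set by set.\<close>

lemma nn_integral_transfer:
  assumes u [measurable]: "u \<in> borel_measurable borel"
  shows "(\<integral>\<^sup>+y. u (inverse_chart y) * indicator (G ` V) y \<partial>flat_measure J)
      \<le> ennreal (\<theta> ^ r) * (\<integral>\<^sup>+x. u x * indicator (V \<inter> F -` {0}) x \<partial>hausdorff_measure r)" (is ?A)
    "(\<integral>\<^sup>+x. u x * indicator (V \<inter> F -` {0}) x \<partial>hausdorff_measure r)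
      \<le> ennreal (\<theta> ^ r) * (\<integral>\<^sup>+y. u (inverse_chart y) * indicator (G ` V) y \<partial>flat_measure J)" (is ?B)
proof -
  define i where "i y = (if y \<in> G ` V then inverse_chart y else z)" for y
  have [measurable]: "i \<in> borel_measurable borel"
    unfolding i_def using lipschitz_on_continuous_on[OF inverse_chart_lipschitz]
    by (intro borel_measurable_continuous_on_if) auto
  define N1 where "N1 = distr (density (flat_measure J) (indicator (G ` V))) borel i"
  define N2 where "N2 = density (hausdorff_measure r) (indicator (V \<inter> F -` {0}) :: _ \<Rightarrow> ennreal)"
  have sets12: "sets N1 = sets borel" "sets N2 = sets borel" by (simp_all add: N1_def N2_def)
  have int1: "(\<integral>\<^sup>+x. u x \<partial>N1) = (\<integral>\<^sup>+y. u (inverse_chart y) * indicator (G ` V) y \<partial>flat_measure J)"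
  proof -
    have "(\<integral>\<^sup>+x. u x \<partial>N1) = (\<integral>\<^sup>+y. u (i y) \<partial>density (flat_measure J) (indicator (G ` V)))"
      unfolding N1_def by (rule nn_integral_distr) measurable
    also have "\<dots> = (\<integral>\<^sup>+y. indicator (G ` V) y * u (i y) \<partial>flat_measure J)"
      by (rule nn_integral_density) measurable
    also have "\<dots> = (\<integral>\<^sup>+y. u (inverse_chart y) * indicator (G ` V) y \<partial>flat_measure J)"
      by (intro nn_integral_cong) (simp add: i_def indicator_def)
    finally show ?thesis .
  qed
  have int2: "(\<integral>\<^sup>+x. u x \<partial>N2) = (\<integral>\<^sup>+x. u x * indicator (V \<inter> F -` {0}) x \<partial>hausdorff_measure r)"
    unfolding N2_def by (subst nn_integral_density) (auto simp: mult.commute)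
  have e: "emeasure N1 A = hausdorff_outer r (G ` (A \<inter> (V \<inter> F -` {0})))" "emeasure N2 A = hausdorff_outer r (A \<inter> (V \<inter> F -` {0}))"
    if [measurable]: "A \<in> sets borel" for A
  proof -
    have [measurable]: "i -` A \<in> sets borel" using measurable_sets[of i borel borel A] by simp
    have "emeasure N1 A = emeasure (flat_measure J) (G ` V \<inter> i -` A)"
      unfolding N1_def by (subst emeasure_distr) (auto simp: emeasure_restricted sets_eq_imp_space_eq[OF sets_flat_measure])
    also have "\<dots> = hausdorff_outer r (flat J \<inter> (G ` V \<inter> i -` A))"
      by (simp add: emeasure_flat_measure r_def)
    also have "flat J \<inter> (G ` V \<inter> i -` A) = G ` (A \<inter> (V \<inter> F -` {0}))"
      using zero_iff_flat by (auto simp: i_def)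
    finally show "emeasure N1 A = hausdorff_outer r (G ` (A \<inter> (V \<inter> F -` {0})))" .
    have "emeasure N2 A = emeasure (hausdorff_measure r) ((V \<inter> F -` {0}) \<inter> A)"
      unfolding N2_def by (rule emeasure_restricted) auto
    then show "emeasure N2 A = hausdorff_outer r (A \<inter> (V \<inter> F -` {0}))"
      by (simp add: emeasure_hausdorff_measure Int_commute)
  qed
  have "N1 \<le> scale_measure (ennreal (\<theta> ^ r)) N2"
    by (subst le_measure) (auto simp: sets12 e intro!: hausdorff_image_le(1))
  then have "(\<integral>\<^sup>+x. u x \<partial>N1) \<le> (\<integral>\<^sup>+x. u x \<partial>scale_measure (ennreal (\<theta> ^ r)) N2)"
    by (intro nn_integral_mono_measure) (simp_all add: sets12)
  then show ?A unfolding int1 by (subst (asm) nn_integral_scale_measure) (auto simp: int2 sets12 measurable_cong_sets[OF sets12(2) refl])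
  have "N2 \<le> scale_measure (ennreal (\<theta> ^ r)) N1"
    by (subst le_measure) (auto simp: sets12 e intro!: hausdorff_image_le(2))
  then have "(\<integral>\<^sup>+x. u x \<partial>N2) \<le> (\<integral>\<^sup>+x. u x \<partial>scale_measure (ennreal (\<theta> ^ r)) N1)"
    by (intro nn_integral_mono_measure) (simp_all add: sets12)
  then show ?B unfolding int2 by (subst (asm) nn_integral_scale_measure) (auto simp: int1 sets12 measurable_cong_sets[OF sets12(1) refl])
qed

lemma r_eq: "CARD('d) - min CARD('d) CARD('p) = r"
  by (simp add: r_def card_J)

lemma measurable_jac [measurable]: "gen_jacobian F \<in> borel_measurable borel"
proof -
  have "ck_map (Suc 0) F" using F_smooth unfolding smooth_map_def ..
  then show ?thesis by (intro borel_measurable_continuous_onI continuous_on_gen_jacobian)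
qed

lemma nn_integral_level_measure:
  assumes [measurable]: "f \<in> borel_measurable borel"
  shows "(\<integral>\<^sup>+x. f x \<partial>level_measure F) = (\<integral>\<^sup>+x. indicator (F -` {0}) x * ennreal (1 / gen_jacobian F x) * f x \<partial>hausdorff_measure r)"
  unfolding level_measure_def r_eq by (subst nn_integral_density) auto

definition "slab_measure = emeasure (flat_measure J) (ball 0 1)"

text \<open>Three factors enter: the integral of the profile is a multiple of the integral over \<open>flat J\<close>, the chart
  distorts the Hausdorff measure by \<open>\<theta> ^ r\<close>, and the volume factor and the Jacobian are constant up to
  a factor \<open>\<theta>\<close> each.\<close>

lemma limit_functional_compare:
  fixes g :: "real^'d \<Rightarrow> real"
  assumes [measurable]: "g \<in> borel_measurable borel" "transported g \<in> borel_measurable borel"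
    and g: "\<And>x. x \<in> V \<Longrightarrow> 0 \<le> g x" "\<And>x. x \<in> V \<Longrightarrow> g x \<le> M" "0 \<le> M"
  shows "ennreal (limit_functional g) * slab_measure
      \<le> ennreal (\<theta> ^ (r + 2) * slab_mass J (normal J) k) * (\<integral>\<^sup>+x. ennreal (tent z \<delta> x * g x) \<partial>level_measure F)" (is ?A)
    "ennreal (slab_mass J (normal J) k) * (\<integral>\<^sup>+x. ennreal (tent z \<delta> x * g x) \<partial>level_measure F)
      \<le> ennreal (\<theta> ^ (r + 2)) * (ennreal (limit_functional g) * slab_measure)" (is ?B)
proof -
  have gM: "\<bar>g x\<bar> \<le> M" if "x \<in> V" for x using g(1,2)[OF that] by simp
  define j where "j = gen_jacobian F z"
  have j: "0 < j" using jac_pos by (simp add: j_def)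
  define m where "m = slab_mass J D k"
  have jm: "j * m = slab_mass J (normal J) k" using D_mass by (simp add: j_def m_def)
  have m: "0 < m" using slab_mass_normal_pos[OF k, of J] j unfolding jm[symmetric] by (simp add: zero_less_mult_iff)
  define u where "u x = ennreal (if x \<in> V then tent z \<delta> x * g x * (1 / \<bar>det (matrix (G' x))\<bar>) else 0)" for x
  have [measurable]: "tent z \<delta> \<in> borel_measurable borel"
    using continuous_on_tent[OF delta] by (rule borel_measurable_continuous_onI)
  have "(\<lambda>x. if x \<in> V then 1 / \<bar>det (matrix (G' x))\<bar> else 0) \<in> borel_measurable borel"
    using lipschitz_on_continuous_on[OF G_det_lipschitz] by (intro borel_measurable_continuous_on_if) (auto simp: V_def)
  note [measurable] = this
  have u_eq: "u = (\<lambda>x. ennreal (tent z \<delta> x * g x * (if x \<in> V then 1 / \<bar>det (matrix (G' x))\<bar> else 0)))"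
    by (auto simp: u_def)
  have [measurable]: "u \<in> borel_measurable borel" unfolding u_eq by measurable
  let ?U = "\<integral>\<^sup>+x. u x * indicator (V \<inter> F -` {0}) x \<partial>hausdorff_measure r"
  let ?T = "\<integral>\<^sup>+y. u (inverse_chart y) * indicator (G ` V) y \<partial>flat_measure J"
  let ?L = "\<integral>\<^sup>+x. ennreal (tent z \<delta> x * g x) \<partial>level_measure F"
  have nonneg: "0 \<le> transported g y" for y
    using g(1) tent_bounds(1)[of z \<delta>] by (auto simp: transported_def)
  have "ennreal (limit_functional g) = (\<integral>\<^sup>+y. ennreal (transported g (tangential J y) * exp (- (norm (D y) ^ k))) \<partial>lborel)"
    unfolding limit_functional_def using nonneg limit_integrable[OF gM g(3)] by (intro nn_integral_eq_integral[symmetric]) auto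
  also have "\<dots> = (\<integral>\<^sup>+y. ennreal (transported g (tangential J y)) * ennreal (exp (- (norm (D y) ^ k))) \<partial>lborel)"
    using nonneg by (simp add: ennreal_mult)
  finally have "ennreal (limit_functional g) * slab_measure = (\<integral>\<^sup>+y. ennreal (transported g y) \<partial>flat_measure J) * ennreal m"
    unfolding slab_measure_def m_def
    using profile_integral_eq_hausdorff[OF c k D_linear D_lower D_tangential, of "\<lambda>y. ennreal (transported g y)"] by simp
  also have "(\<integral>\<^sup>+y. ennreal (transported g y) \<partial>flat_measure J) = ?T"
    by (intro nn_integral_cong) (auto simp: transported_def u_def indicator_def)
  finally have lim: "ennreal (limit_functional g) * slab_measure = ?T * ennreal m" .
  have u_le: "u x * indicator (V \<inter> F -` {0}) x \<le> ennreal (\<theta>\<^sup>2 * j) * (indicator (F -` {0}) x * ennreal (1 / gen_jacobian F x) * ennreal (tent z \<delta> x * g x))" for x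
  proof (cases "x \<in> V \<and> F x = 0")
    case True
    then have x: "x \<in> V" by simp
    have t: "0 \<le> tent z \<delta> x * g x" using g(1)[OF x] tent_bounds(1)[of z \<delta> x] by (rule mult_nonneg_nonneg[rotated])
    have "tent z \<delta> x * g x * (1 / \<bar>det (matrix (G' x))\<bar>) \<le> tent z \<delta> x * g x * \<theta>"
      using inverse_det_le[OF x] t by (rule mult_left_mono)
    also have "\<dots> = \<theta> * 1 * (tent z \<delta> x * g x)" by simp
    also have "\<dots> \<le> \<theta> * (\<theta> * j * (1 / gen_jacobian F x)) * (tent z \<delta> x * g x)"
      using jac_close[of x] x jac_pos_near[OF x] theta t by (intro mult_right_mono mult_left_mono) (auto simp: V_def j_def)
    also have "\<dots> = \<theta>\<^sup>2 * j * (1 / gen_jacobian F x * (tent z \<delta> x * g x))" by (simp add: power2_eq_square)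
    finally show ?thesis
      using True t jac_pos_near[OF x] j by (simp add: u_def ennreal_mult''[symmetric] ennreal_mult'[symmetric] ennreal_leI)
  qed (auto simp: indicator_def)
  have le_u: "indicator (F -` {0}) x * ennreal (1 / gen_jacobian F x) * ennreal (tent z \<delta> x * g x) \<le> ennreal (\<theta>\<^sup>2 / j) * (u x * indicator (V \<inter> F -` {0}) x)" for x
  proof (cases "x \<in> V")
    case False
    then have "tent z \<delta> x = 0" using delta by (intro tent_zero) (auto simp: V_def dist_commute)
    then show ?thesis by simp
  next
    case x: True
    have t: "0 \<le> tent z \<delta> x * g x" using g(1)[OF x] tent_bounds(1)[of z \<delta> x] by (rule mult_nonneg_nonneg[rotated])
    have "1 / gen_jacobian F x \<le> \<theta> / j"
      using jac_close[of x] x jac_pos_near[OF x] j by (simp add: V_def j_def field_simps)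
    moreover have "1 \<le> \<theta> * (1 / \<bar>det (matrix (G' x))\<bar>)"
      using inverse_det_ge[OF x] theta by (simp add: field_simps)
    ultimately have "1 / gen_jacobian F x * 1 \<le> \<theta> / j * (\<theta> * (1 / \<bar>det (matrix (G' x))\<bar>))"
      using theta j by (intro mult_mono) auto
    from mult_right_mono[OF this t]
    have "1 / gen_jacobian F x * (tent z \<delta> x * g x) \<le> \<theta>\<^sup>2 / j * (tent z \<delta> x * g x * (1 / \<bar>det (matrix (G' x))\<bar>))"
      by (simp add: power2_eq_square mult_ac)
    then show ?thesis
      using x t jac_pos_near[OF x] j by (auto simp: u_def indicator_def ennreal_mult''[symmetric] ennreal_mult'[symmetric] intro!: ennreal_leI)
  qed
  have "?U \<le> (\<integral>\<^sup>+x. ennreal (\<theta>\<^sup>2 * j) * (indicator (F -` {0}) x * ennreal (1 / gen_jacobian F x) * ennreal (tent z \<delta> x * g x)) \<partial>hausdorff_measure r)"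
    by (intro nn_integral_mono u_le)
  also have "\<dots> = ennreal (\<theta>\<^sup>2 * j) * ?L"
    by (subst nn_integral_level_measure, measurable) (subst nn_integral_cmult, auto)
  finally have U: "?U \<le> ennreal (\<theta>\<^sup>2 * j) * ?L" .
  have "?L = (\<integral>\<^sup>+x. indicator (F -` {0}) x * ennreal (1 / gen_jacobian F x) * ennreal (tent z \<delta> x * g x) \<partial>hausdorff_measure r)"
    by (rule nn_integral_level_measure) measurable
  also have "\<dots> \<le> (\<integral>\<^sup>+x. ennreal (\<theta>\<^sup>2 / j) * (u x * indicator (V \<inter> F -` {0}) x) \<partial>hausdorff_measure r)"
    by (intro nn_integral_mono le_u)
  also have "\<dots> = ennreal (\<theta>\<^sup>2 / j) * ?U" by (rule nn_integral_cmult) measurable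
  finally have L: "?L \<le> ennreal (\<theta>\<^sup>2 / j) * ?U" .
  have "?T * ennreal m \<le> (ennreal (\<theta> ^ r) * (ennreal (\<theta>\<^sup>2 * j) * ?L)) * ennreal m"
    by (intro mult_right_mono order_trans[OF nn_integral_transfer(1) mult_left_mono[OF U]]) simp_all
  also have "\<dots> = (ennreal (\<theta> ^ r) * ennreal (\<theta>\<^sup>2 * j) * ennreal m) * ?L" by (simp only: mult_ac)
  also have "ennreal (\<theta> ^ r) * ennreal (\<theta>\<^sup>2 * j) * ennreal m = ennreal (\<theta> ^ (r + 2) * slab_mass J (normal J) k)"
    unfolding jm[symmetric] using theta j m by (simp add: ennreal_mult[symmetric] power_add power2_eq_square mult_ac)
  finally show ?A unfolding lim .
  have "ennreal (slab_mass J (normal J) k) * ?L \<le> ennreal (slab_mass J (normal J) k) * (ennreal (\<theta>\<^sup>2 / j) * (ennreal (\<theta> ^ r) * ?T))"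
    by (intro mult_left_mono order_trans[OF L mult_left_mono[OF nn_integral_transfer(2)]]) simp_all
  also have "\<dots> = (ennreal (slab_mass J (normal J) k) * ennreal (\<theta>\<^sup>2 / j) * ennreal (\<theta> ^ r)) * ?T" by (simp only: mult_ac)
  also have "ennreal (slab_mass J (normal J) k) * ennreal (\<theta>\<^sup>2 / j) * ennreal (\<theta> ^ r) = ennreal (\<theta> ^ (r + 2)) * ennreal m"
    unfolding jm[symmetric] using theta j m by (simp add: ennreal_mult[symmetric] power_add power2_eq_square mult_ac)
  also have "\<dots> * ?T = ennreal (\<theta> ^ (r + 2)) * (?T * ennreal m)" by (simp only: mult_ac)
  finally show ?B unfolding lim .
qed

text \<open>By scaling, every ball of \<open>flat J\<close> around 0 has positive Hausdorff measure, and the chart carries such a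
  ball into the zero set.\<close>

lemma level_measure_pos: "0 < emeasure (level_measure F) V"
proof -
  have "0 \<in> G ` V" using G_z z_in_V by (metis imageI)
  then obtain \<rho> where \<rho>: "0 < \<rho>" "ball 0 \<rho> \<subseteq> G ` V" using open_image open_contains_ball by blast
  have "(1 / \<rho>)-lipschitz_on (flat J \<inter> ball 0 \<rho>) (\<lambda>y. (1 / \<rho>) *\<^sub>R y)"
    using \<rho>(1) by (intro lipschitz_onI) (auto simp: dist_norm simp flip: scaleR_diff_right)
  moreover have "(\<lambda>y. (1 / \<rho>) *\<^sub>R y) ` (flat J \<inter> ball 0 \<rho>) = flat J \<inter> ball 0 1"
  proof (intro set_eqI iffI)
    fix y assume y: "y \<in> flat J \<inter> ball 0 1"
    then have "\<rho> *\<^sub>R y \<in> flat J \<inter> ball 0 \<rho>"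
      using subspace_scale[OF subspace_flat] \<rho>(1) by auto
    moreover have "y = (1 / \<rho>) *\<^sub>R (\<rho> *\<^sub>R y)" using \<rho>(1) by simp
    ultimately show "y \<in> (\<lambda>y. (1 / \<rho>) *\<^sub>R y) ` (flat J \<inter> ball 0 \<rho>)" by blast
  qed (use \<rho>(1) subspace_scale[OF subspace_flat] in \<open>auto simp: divide_simps\<close>)
  ultimately have "hausdorff_outer r (flat J \<inter> ball 0 1) \<le> ennreal ((1 / \<rho>) ^ r) * hausdorff_outer r (flat J \<inter> ball 0 \<rho>)"
    using hausdorff_outer_lipschitz_image[of "1 / \<rho>" "flat J \<inter> ball 0 \<rho>" "\<lambda>y. (1 / \<rho>) *\<^sub>R y" r] \<rho>(1) by simp
  then have 1: "hausdorff_outer r (flat J \<inter> ball 0 \<rho>) \<noteq> 0"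
    using hausdorff_outer_flat_ball_pos[of J] by (auto simp: r_def)
  have "flat J \<inter> ball 0 \<rho> \<subseteq> G ` (V \<inter> F -` {0})" using \<rho>(2) zero_iff_flat by force
  then have "hausdorff_outer r (flat J \<inter> ball 0 \<rho>) \<le> ennreal (\<theta> ^ r) * hausdorff_outer r (V \<inter> F -` {0})"
    using hausdorff_outer_mono hausdorff_image_le(1)[of "V \<inter> F -` {0}" r] order_trans by blast
  with 1 have 2: "hausdorff_outer r (V \<inter> F -` {0}) \<noteq> 0" by auto
  define j where "j = 1 / (\<theta> * gen_jacobian F z)"
  have j: "0 < j" using theta jac_pos by (simp add: j_def)
  have "0 < ennreal j * hausdorff_outer r (V \<inter> F -` {0})"
    using j 2 by (simp add: ennreal_zero_less_mult_iff less_le)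
  also have "\<dots> = (\<integral>\<^sup>+x. ennreal j * indicator (V \<inter> F -` {0}) x \<partial>hausdorff_measure r)"
    by (simp add: nn_integral_cmult_indicator emeasure_hausdorff_measure)
  also have "\<dots> \<le> (\<integral>\<^sup>+x. indicator (F -` {0}) x * ennreal (1 / gen_jacobian F x) * indicator V x \<partial>hausdorff_measure r)"
  proof (rule nn_integral_mono)
    fix x
    have "j \<le> 1 / gen_jacobian F x" if "x \<in> V"
      using jac_close[of x] jac_pos_near[OF that] that theta jac_pos by (simp add: j_def V_def field_simps)
    then show "ennreal j * indicator (V \<inter> F -` {0}) x \<le> indicator (F -` {0}) x * ennreal (1 / gen_jacobian F x) * indicator V x"
      by (auto simp: indicator_def intro!: ennreal_leI)
  qed
  also have "\<dots> = emeasure (level_measure F) V"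
    by (subst nn_integral_level_measure[symmetric]) auto
  finally show ?thesis .
qed

end

text \<open>The constant by which limits of rescaled integrals exceed the level measure. It depends on \<open>J\<close> and \<open>k\<close>
  only, so it is the same in all charts and cancels in quotients.\<close>

definition density_const :: "'d::finite set \<Rightarrow> nat \<Rightarrow> real" where
  "density_const J k = slab_mass J (normal J) k / enn2real (emeasure (flat_measure J) (ball 0 1))"

lemma flat_ball_measure:
  fixes J :: "'d::finite set"
  shows "emeasure (flat_measure J) (ball 0 1) = ennreal (enn2real (emeasure (flat_measure J) (ball 0 1)))"
    "0 < enn2real (emeasure (flat_measure J) (ball 0 1))"
  using hausdorff_outer_flat_ball_finite[of 1 J] hausdorff_outer_flat_ball_pos[of J]
  by (auto simp: emeasure_flat_measure enn2real_positive_iff)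

lemma density_const_pos: "1 \<le> k \<Longrightarrow> 0 < density_const J k"
  unfolding density_const_def using slab_mass_normal_pos flat_ball_measure(2) by (intro divide_pos_pos) auto

lemma (in chart) limit_functional_compare_real:
  fixes g :: "real^'d \<Rightarrow> real"
  assumes meas [measurable]: "g \<in> borel_measurable borel" "transported g \<in> borel_measurable borel"
    and g: "\<And>x. x \<in> V \<Longrightarrow> 0 \<le> g x" "\<And>x. x \<in> V \<Longrightarrow> g x \<le> M" "0 \<le> M"
  shows "integrable (level_measure F) (\<lambda>x. tent z \<delta> x * g x)"
    "density_const J k * (\<integral>x. tent z \<delta> x * g x \<partial>level_measure F) \<le> \<theta> ^ (CARD('d) + 2) * limit_functional g"
    "limit_functional g \<le> \<theta> ^ (CARD('d) + 2) * (density_const J k * (\<integral>x. tent z \<delta> x * g x \<partial>level_measure F))"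
proof -
  let ?L = "\<integral>\<^sup>+x. ennreal (tent z \<delta> x * g x) \<partial>level_measure F"
  let ?\<kappa> = "slab_mass J (normal J) k"
  define \<tau> where "\<tau> = enn2real (emeasure (flat_measure J) (ball 0 1))"
  have \<tau>: "slab_measure = ennreal \<tau>" "0 < \<tau>" using flat_ball_measure[of J] by (simp_all add: \<tau>_def slab_measure_def)
  have \<kappa>: "0 < ?\<kappa>" by (rule slab_mass_normal_pos[OF k])
  have [measurable]: "tent z \<delta> \<in> borel_measurable borel"
    using continuous_on_tent[OF delta] by (rule borel_measurable_continuous_onI)
  have nonneg: "0 \<le> tent z \<delta> x * g x" for x
  proof (cases "x \<in> V")
    case True
    then show ?thesis using g(1) tent_bounds(1)[of z \<delta> x] by (intro mult_nonneg_nonneg) auto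
  next
    case False
    then have "tent z \<delta> x = 0" using delta by (intro tent_zero) (auto simp: V_def dist_commute)
    then show ?thesis by simp
  qed
  have lim0: "0 \<le> limit_functional g"
    unfolding limit_functional_def using g(1) tent_bounds(1)[of z \<delta>]
    by (intro integral_nonneg_AE AE_I2) (auto simp: transported_def)
  note cmp = limit_functional_compare[OF meas g]
  have fin: "?L < \<infinity>"
  proof (rule ccontr)
    assume "\<not> ?L < \<infinity>"
    then have "?L = \<infinity>" by (simp add: less_top[symmetric])
    then have "ennreal ?\<kappa> * ?L = \<infinity>" using \<kappa> by (simp add: ennreal_mult_top)
    moreover have "ennreal (\<theta> ^ (r + 2)) * (ennreal (limit_functional g) * slab_measure) < \<infinity>"
      unfolding \<tau>(1) by (simp add: ennreal_mult_less_top)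
    ultimately show False using cmp(2) by simp
  qed
  show int: "integrable (level_measure F) (\<lambda>x. tent z \<delta> x * g x)"
    using fin nonneg by (intro integrableI_nonneg) auto
  define I where "I = (\<integral>x. tent z \<delta> x * g x \<partial>level_measure F)"
  have I0: "0 \<le> I" unfolding I_def using nonneg by (intro integral_nonneg_AE) auto
  have L: "?L = ennreal I" unfolding I_def using int nonneg by (intro nn_integral_eq_integral) auto
  have t: "1 \<le> \<theta>" using theta by simp
  have "r \<le> CARD('d)" by (simp add: r_def)
  then have pw: "\<theta> ^ (r + 2) \<le> \<theta> ^ (CARD('d) + 2)" using t by (intro power_increasing) auto
  have "limit_functional g * \<tau> \<le> \<theta> ^ (r + 2) * ?\<kappa> * I"
    using cmp(1) unfolding L \<tau>(1) using lim0 \<tau>(2) \<kappa> I0 t by (simp add: ennreal_mult[symmetric])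
  also have "\<dots> \<le> \<theta> ^ (CARD('d) + 2) * ?\<kappa> * I"
    using pw \<kappa> I0 by (intro mult_right_mono) auto
  finally show "limit_functional g \<le> \<theta> ^ (CARD('d) + 2) * (density_const J k * (\<integral>x. tent z \<delta> x * g x \<partial>level_measure F))"
    unfolding density_const_def \<tau>_def[symmetric] I_def[symmetric] using \<tau>(2) by (simp add: field_simps)
  have "?\<kappa> * I \<le> \<theta> ^ (r + 2) * (limit_functional g * \<tau>)"
    using cmp(2) unfolding L \<tau>(1) using lim0 \<tau>(2) \<kappa> I0 t by (simp add: ennreal_mult[symmetric])
  also have "\<dots> \<le> \<theta> ^ (CARD('d) + 2) * (limit_functional g * \<tau>)"
    using pw lim0 \<tau>(2) by (intro mult_right_mono) auto
  finally show "density_const J k * (\<integral>x. tent z \<delta> x * g x \<partial>level_measure F) \<le> \<theta> ^ (CARD('d) + 2) * limit_functional g"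
    unfolding density_const_def \<tau>_def[symmetric] I_def[symmetric] using \<tau>(2) by (simp add: field_simps)
qed

text \<open>One coordinate set \<open>J\<close> serves all zeros, which makes the constant of proportionality global.\<close>

lemma chart_family_exists:
  fixes F :: "real^'d \<Rightarrow> real^'p"
  assumes F: "smooth_map F" and jac: "\<And>x. F x = 0 \<Longrightarrow> gen_jacobian F x \<noteq> 0" and k: "1 \<le> k"
  obtains J :: "'d set" where
    "\<And>z \<theta>. F z = 0 \<Longrightarrow> 1 < \<theta> \<Longrightarrow> \<exists>\<delta> G G' D c C L. chart F J z \<theta> \<delta> G G' D c C L k"
proof (cases "CARD('p) \<le> CARD('d)")
  case True
  then obtain \<iota> :: "'p \<Rightarrow> 'd" where "inj \<iota>"
    using card_le_inj[of "UNIV :: 'p set" "UNIV :: 'd set"] by auto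
  then show ?thesis using that[of "range \<iota>"] chart_submersion[OF F _ jac True _ _ k] by blast
next
  case False
  then show ?thesis using that[of UNIV] chart_immersion[OF F _ jac False _ k] by blast
qed

section \<open>Localised expansions and their superposition\<close>

text \<open>Localised by the weight \<open>\<omega>\<close>, the rescaled integral of \<open>g\<close> has a limit \<open>\<Phi> g\<close> at a rate that is
  linear in the scale \<open>s\<close>, and \<open>\<Phi>\<close> is the level measure up to the factor \<open>\<gamma>\<close> and powers of \<open>\<theta>\<close>.\<close>

definition expands :: "(real^'d \<Rightarrow> real^'p) \<Rightarrow> nat \<Rightarrow> real \<Rightarrow> real \<Rightarrow> (real^'d \<Rightarrow> real) \<Rightarrow> (real^'d) set \<Rightarrow> real \<Rightarrow> ((real^'d \<Rightarrow> real) \<Rightarrow> real) \<Rightarrow> bool" where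
  "expands F k \<gamma> \<theta> \<omega> A K \<Phi> \<longleftrightarrow> 0 \<le> K \<and> (\<forall>g M N.
      g \<in> borel_measurable borel \<and> (\<forall>x\<in>A. \<bar>g x\<bar> \<le> M) \<and> 0 \<le> M \<and> N-lipschitz_on A g \<longrightarrow>
      (\<forall>s>0. integrable lborel (\<lambda>x. \<omega> x * g x * exp (- ((norm (F x) / s) ^ k))) \<and>
        \<bar>(\<integral>x. \<omega> x * g x * exp (- ((norm (F x) / s) ^ k)) \<partial>lborel) / s ^ min CARD('d) CARD('p) - \<Phi> g\<bar> \<le> K * (M + N) * s) \<and>
      ((\<forall>x\<in>A. 0 \<le> g x) \<longrightarrow> integrable (level_measure F) (\<lambda>x. \<omega> x * g x) \<and>
        \<gamma> * (\<integral>x. \<omega> x * g x \<partial>level_measure F) \<le> \<theta> ^ (CARD('d) + 2) * \<Phi> g \<and>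
        \<Phi> g \<le> \<theta> ^ (CARD('d) + 2) * (\<gamma> * (\<integral>x. \<omega> x * g x \<partial>level_measure F))))"

lemma expandsD:
  fixes F :: "real^'d \<Rightarrow> real^'p"
  assumes "expands F k \<gamma> \<theta> \<omega> A K \<Phi>"
    and "g \<in> borel_measurable borel" "\<forall>x\<in>A. \<bar>g x\<bar> \<le> M" "0 \<le> M" "N-lipschitz_on A g"
  shows "0 < s \<Longrightarrow> integrable lborel (\<lambda>x. \<omega> x * g x * exp (- ((norm (F x) / s) ^ k)))"
    "0 < s \<Longrightarrow> \<bar>(\<integral>x. \<omega> x * g x * exp (- ((norm (F x) / s) ^ k)) \<partial>lborel) / s ^ min CARD('d) CARD('p) - \<Phi> g\<bar> \<le> K * (M + N) * s"
    "\<forall>x\<in>A. 0 \<le> g x \<Longrightarrow> integrable (level_measure F) (\<lambda>x. \<omega> x * g x)"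
    "\<forall>x\<in>A. 0 \<le> g x \<Longrightarrow> \<gamma> * (\<integral>x. \<omega> x * g x \<partial>level_measure F) \<le> \<theta> ^ (CARD('d) + 2) * \<Phi> g"
    "\<forall>x\<in>A. 0 \<le> g x \<Longrightarrow> \<Phi> g \<le> \<theta> ^ (CARD('d) + 2) * (\<gamma> * (\<integral>x. \<omega> x * g x \<partial>level_measure F))"
  using assms unfolding expands_def by blast+

lemma expands_nonneg: "expands F k \<gamma> \<theta> \<omega> A K \<Phi> \<Longrightarrow> 0 \<le> K"
  by (simp add: expands_def)

lemma expandsI:
  fixes F :: "real^'d \<Rightarrow> real^'p"
  assumes "0 \<le> K"
    and "\<And>g M N s. g \<in> borel_measurable borel \<Longrightarrow> (\<And>x. x \<in> A \<Longrightarrow> \<bar>g x\<bar> \<le> M) \<Longrightarrow> 0 \<le> M \<Longrightarrow> N-lipschitz_on A g \<Longrightarrow> 0 < s \<Longrightarrow>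
      integrable lborel (\<lambda>x. \<omega> x * g x * exp (- ((norm (F x) / s) ^ k))) \<and>
        \<bar>(\<integral>x. \<omega> x * g x * exp (- ((norm (F x) / s) ^ k)) \<partial>lborel) / s ^ min CARD('d) CARD('p) - \<Phi> g\<bar> \<le> K * (M + N) * s"
    and "\<And>g M N. g \<in> borel_measurable borel \<Longrightarrow> (\<And>x. x \<in> A \<Longrightarrow> \<bar>g x\<bar> \<le> M) \<Longrightarrow> 0 \<le> M \<Longrightarrow> N-lipschitz_on A g \<Longrightarrow> (\<And>x. x \<in> A \<Longrightarrow> 0 \<le> g x) \<Longrightarrow>
      integrable (level_measure F) (\<lambda>x. \<omega> x * g x) \<and>
        \<gamma> * (\<integral>x. \<omega> x * g x \<partial>level_measure F) \<le> \<theta> ^ (CARD('d) + 2) * \<Phi> g \<and>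
        \<Phi> g \<le> \<theta> ^ (CARD('d) + 2) * (\<gamma> * (\<integral>x. \<omega> x * g x \<partial>level_measure F))"
  shows "expands F k \<gamma> \<theta> \<omega> A K \<Phi>"
  unfolding expands_def
proof (intro conjI allI impI assms(1), goal_cases)
  case (1 g M N s) then show ?case using assms(2)[of g M N s] by blast
next
  case (2 g M N s) then show ?case using assms(2)[of g M N s] by blast
next
  case (3 g M N) then show ?case using assms(3)[of g M N] by blast
next
  case (4 g M N) then show ?case using assms(3)[of g M N] by blast
next
  case (5 g M N) then show ?case using assms(3)[of g M N] by blast
qed

lemma (in chart) expands_tent:
  "\<exists>K \<Phi>. expands F k (density_const J k) \<theta> (tent z \<delta>) (ball z \<delta>) K \<Phi>"
proof -
  obtain K where K: "0 \<le> K"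
    "\<And>(g :: real^'d \<Rightarrow> real) M N s. g \<in> borel_measurable borel \<Longrightarrow> (\<And>x. x \<in> V \<Longrightarrow> \<bar>g x\<bar> \<le> M) \<Longrightarrow> 0 \<le> M \<Longrightarrow> N-lipschitz_on V g \<Longrightarrow> 0 < s \<Longrightarrow>
      \<bar>(\<integral>x. tent z \<delta> x * g x * exp (- ((norm (F x) / s) ^ k)) \<partial>lborel) / s ^ card J - limit_functional g\<bar> \<le> K * (M + N) * s"
    using local_laplace by blast
  obtain K' where "0 \<le> K'" and K': "\<And>(g :: real^'d \<Rightarrow> real) M N. (\<And>x. x \<in> V \<Longrightarrow> \<bar>g x\<bar> \<le> M) \<Longrightarrow> 0 \<le> M \<Longrightarrow> N-lipschitz_on V g \<Longrightarrow> (K' * (M + N))-lipschitz_on UNIV (transported g)"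
    using transported_lipschitz by blast
  have tm: "transported g \<in> borel_measurable borel"
    if "\<And>x. x \<in> V \<Longrightarrow> \<bar>g x\<bar> \<le> M" "0 \<le> M" "N-lipschitz_on V g" for g M N
    using lipschitz_on_continuous_on[OF K'[OF that]] by (rule borel_measurable_continuous_onI)
  have "expands F k (density_const J k) \<theta> (tent z \<delta>) V K limit_functional"
  proof (rule expandsI[OF K(1)], goal_cases)
    case (1 g M N s)
    show ?case
      using local_integral(1)[OF 1(1) tm[OF 1(2-4)] 1(2,3,5)] K(2)[OF 1] by (simp add: card_J)
  next
    case (2 g M N)
    have "\<And>x. x \<in> V \<Longrightarrow> g x \<le> M" using 2(2) by (simp add: abs_le_iff)
    then show ?case using limit_functional_compare_real[OF 2(1) tm[OF 2(2-4)] 2(5) _ 2(3)] by blast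
  qed
  then show ?thesis unfolding V_def by blast
qed

text \<open>The factor \<open>f\<close> moves into the integrand, so it must be bounded and Lipschitz. It will normalise a sum
  of tents to a cutoff function.\<close>

lemma expands_sum:
  fixes F :: "real^'d \<Rightarrow> real^'p" and f :: "real^'d \<Rightarrow> real"
  assumes T: "finite T" and ex: "\<And>z. z \<in> T \<Longrightarrow> expands F k \<gamma> \<theta> (\<omega> z) (A z) (K z) (\<Phi> z)" and A: "\<And>z. z \<in> T \<Longrightarrow> A z \<subseteq> U"
    and f [measurable]: "f \<in> borel_measurable borel" and fb: "\<And>x. x \<in> U \<Longrightarrow> 0 \<le> f x \<and> f x \<le> b" "0 \<le> b" and fL: "Lf-lipschitz_on U f"
  shows "expands F k \<gamma> \<theta> (\<lambda>x. (\<Sum>z\<in>T. \<omega> z x) * f x) U ((\<Sum>z\<in>T. K z) * (b + Lf)) (\<lambda>g. \<Sum>z\<in>T. \<Phi> z (\<lambda>x. g x * f x))"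
proof -
  have K0: "0 \<le> K z" if "z \<in> T" for z using expands_nonneg[OF ex[OF that]] .
  have Lf: "0 \<le> Lf" using fL lipschitz_on_nonneg by blast
  have gf: "(\<lambda>x. g x * f x) \<in> borel_measurable borel" "\<forall>x\<in>A z. \<bar>g x * f x\<bar> \<le> M * b" "0 \<le> M * b"
      "(N * b + M * Lf)-lipschitz_on (A z) (\<lambda>x. g x * f x)"
    if z: "z \<in> T" and g: "g \<in> borel_measurable borel" "\<forall>x\<in>U. \<bar>g x\<bar> \<le> M" "0 \<le> M" "N-lipschitz_on U g" for g M N z
  proof -
    show "(\<lambda>x. g x * f x) \<in> borel_measurable borel" using g(1) by measurable
    show "\<forall>x\<in>A z. \<bar>g x * f x\<bar> \<le> M * b"
      using A[OF z] g(2) fb(1) g(3) by (auto simp: abs_mult subset_iff intro!: mult_mono)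
    show "0 \<le> M * b" using g(3) fb(2) by simp
    have "(N * b + M * Lf)-lipschitz_on U (\<lambda>x. g x * f x)"
      by (rule lipschitz_on_mult[OF g(4) fL]) (use fb g(2,3) in auto)
    then show "(N * b + M * Lf)-lipschitz_on (A z) (\<lambda>x. g x * f x)" by (rule lipschitz_on_subset) (rule A[OF z])
  qed
  have split: "(\<Sum>z\<in>T. \<omega> z x) * f x * g x * w = (\<Sum>z\<in>T. \<omega> z x * (g x * f x) * w)"
     "(\<Sum>z\<in>T. \<omega> z x) * f x * g x = (\<Sum>z\<in>T. \<omega> z x * (g x * f x))" for g :: "real^'d \<Rightarrow> real" and x w
    by (simp_all add: sum_distrib_left sum_distrib_right mult_ac)
  show ?thesis
  proof (rule expandsI, goal_cases)
    case 1
    show ?case using K0 fb(2) Lf by (simp add: sum_nonneg)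
  next
    case (2 g M N s)
    have gM: "\<forall>x\<in>U. \<bar>g x\<bar> \<le> M" using 2(2) by blast
    have D: "integrable lborel (\<lambda>x. \<omega> z x * (g x * f x) * exp (- ((norm (F x) / s) ^ k)))"
      "\<bar>(\<integral>x. \<omega> z x * (g x * f x) * exp (- ((norm (F x) / s) ^ k)) \<partial>lborel) / s ^ min CARD('d) CARD('p) - \<Phi> z (\<lambda>x. g x * f x)\<bar> \<le> K z * (M * b + (N * b + M * Lf)) * s"
      if "z \<in> T" for z
      using expandsD(1,2)[OF ex[OF that] gf[OF that 2(1) gM 2(3,4)] 2(5)] by auto
    have N0: "0 \<le> N" using 2(4) lipschitz_on_nonneg by blast
    have eq: "(\<integral>x. (\<Sum>z\<in>T. \<omega> z x) * f x * g x * exp (- ((norm (F x) / s) ^ k)) \<partial>lborel) / s ^ min CARD('d) CARD('p) - (\<Sum>z\<in>T. \<Phi> z (\<lambda>x. g x * f x))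
      = (\<Sum>z\<in>T. (\<integral>x. \<omega> z x * (g x * f x) * exp (- ((norm (F x) / s) ^ k)) \<partial>lborel) / s ^ min CARD('d) CARD('p) - \<Phi> z (\<lambda>x. g x * f x))"
      unfolding split(1) using D(1)
      by (subst Bochner_Integration.integral_sum) (auto simp: sum_subtractf sum_divide_distrib)
    have "\<bar>\<Sum>z\<in>T. (\<integral>x. \<omega> z x * (g x * f x) * exp (- ((norm (F x) / s) ^ k)) \<partial>lborel) / s ^ min CARD('d) CARD('p) - \<Phi> z (\<lambda>x. g x * f x)\<bar>
       \<le> (\<Sum>z\<in>T. \<bar>(\<integral>x. \<omega> z x * (g x * f x) * exp (- ((norm (F x) / s) ^ k)) \<partial>lborel) / s ^ min CARD('d) CARD('p) - \<Phi> z (\<lambda>x. g x * f x)\<bar>)"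
      by (rule sum_abs)
    also have "\<dots> \<le> (\<Sum>z\<in>T. K z * (M * b + (N * b + M * Lf)) * s)"
      by (intro sum_mono D(2))
    also have "\<dots> \<le> (\<Sum>z\<in>T. K z * ((b + Lf) * (M + N)) * s)"
      using K0 2(3,5) N0 Lf by (intro sum_mono mult_right_mono mult_left_mono) (auto simp: algebra_simps)
    also have "\<dots> = (\<Sum>z\<in>T. K z) * (b + Lf) * (M + N) * s"
      unfolding sum_distrib_right by (intro sum.cong) (simp_all add: mult_ac)
    finally have "\<bar>(\<integral>x. (\<Sum>z\<in>T. \<omega> z x) * f x * g x * exp (- ((norm (F x) / s) ^ k)) \<partial>lborel) / s ^ min CARD('d) CARD('p)
        - (\<Sum>z\<in>T. \<Phi> z (\<lambda>x. g x * f x))\<bar> \<le> (\<Sum>z\<in>T. K z) * (b + Lf) * (M + N) * s"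
      unfolding eq .
    moreover have "integrable lborel (\<lambda>x. (\<Sum>z\<in>T. \<omega> z x) * f x * g x * exp (- ((norm (F x) / s) ^ k)))"
      unfolding split(1) by (intro Bochner_Integration.integrable_sum D(1))
    ultimately show ?case by blast
  next
    case (3 g M N)
    have gM: "\<forall>x\<in>U. \<bar>g x\<bar> \<le> M" using 3(2) by blast
    have nonneg: "\<forall>x\<in>A z. 0 \<le> g x * f x" if "z \<in> T" for z
      using that 3(5) fb(1) A by (auto simp: subset_iff)
    have D: "integrable (level_measure F) (\<lambda>x. \<omega> z x * (g x * f x))"
      "\<gamma> * (\<integral>x. \<omega> z x * (g x * f x) \<partial>level_measure F) \<le> \<theta> ^ (CARD('d) + 2) * \<Phi> z (\<lambda>x. g x * f x)"
      "\<Phi> z (\<lambda>x. g x * f x) \<le> \<theta> ^ (CARD('d) + 2) * (\<gamma> * (\<integral>x. \<omega> z x * (g x * f x) \<partial>level_measure F))"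
      if "z \<in> T" for z
      using expandsD(3-5)[OF ex[OF that] gf[OF that 3(1) gM 3(3,4)] nonneg[OF that]] by auto
    have int: "(\<integral>x. (\<Sum>z\<in>T. \<omega> z x) * f x * g x \<partial>level_measure F) = (\<Sum>z\<in>T. \<integral>x. \<omega> z x * (g x * f x) \<partial>level_measure F)"
      unfolding split(2) by (rule Bochner_Integration.integral_sum) (rule D(1))
    show ?case
      unfolding int unfolding split(2) sum_distrib_left
      using D(2,3) by (intro conjI Bochner_Integration.integrable_sum D(1) sum_mono) auto
  qed
qed

lemma lipschitz_on_inverse_max:
  fixes S :: "'a::metric_space \<Rightarrow> real"
  assumes "L-lipschitz_on U S" "0 < c"
  shows "(L / c\<^sup>2)-lipschitz_on U (\<lambda>x. 1 / max (S x) c)"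
proof (rule lipschitz_onI)
  fix x y assume xy: "x \<in> U" "y \<in> U"
  define a where "a = max (S x) c" define b where "b = max (S y) c"
  have ab: "c \<le> a" "c \<le> b" "\<bar>b - a\<bar> \<le> \<bar>S y - S x\<bar>" by (auto simp: a_def b_def)
  have "dist (1 / a) (1 / b) = \<bar>b - a\<bar> / (a * b)"
  proof -
    have "1 / a - 1 / b = (b - a) / (a * b)" using ab assms(2) by (simp add: field_simps)
    moreover have "0 < a * b" using ab assms(2) by simp
    ultimately show ?thesis by (simp add: dist_real_def abs_divide)
  qed
  also have "\<dots> \<le> (L * dist x y) / (c * c)"
  proof (rule frac_le)
    show "\<bar>b - a\<bar> \<le> L * dist x y"
      using ab(3) lipschitz_onD[OF assms(1) xy] by (simp add: dist_real_def abs_minus_commute)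
    show "c * c \<le> a * b" using ab assms(2) by (intro mult_mono) auto
  qed (use assms(2) lipschitz_on_nonneg[OF assms(1)] in auto)
  finally show "dist (1 / max (S x) c) (1 / max (S y) c) \<le> L / c\<^sup>2 * dist x y"
    by (simp add: a_def b_def power2_eq_square)
qed (use assms lipschitz_on_nonneg[OF assms(1)] in auto)

lemma lipschitz_on_sum:
  fixes f :: "'i \<Rightarrow> 'a::metric_space \<Rightarrow> 'b::real_normed_vector"
  shows "(\<And>i. i \<in> I \<Longrightarrow> (L i)-lipschitz_on U (f i)) \<Longrightarrow> (\<Sum>i\<in>I. L i)-lipschitz_on U (\<lambda>x. \<Sum>i\<in>I. f i x)"
  by (induction I rule: infinite_finite_induct) (auto intro: lipschitz_on_add lipschitz_on_constant)

text \<open>Finitely many half-size chart balls cover the compact zero set. Dividing the sum \<open>S\<close> of their tents by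
  \<open>max S c\<close> gives a Lipschitz cutoff that equals 1 wherever \<open>S\<close> exceeds \<open>c\<close>.\<close>

lemma cutoff_expansion:
  fixes F :: "real^'d \<Rightarrow> real^'p"
  assumes fam: "\<forall>z. F z = 0 \<longrightarrow> (\<exists>\<delta> G G' D c C L. chart F J z \<theta> \<delta> G G' D c C L k)"
    and Z: "compact (F -` {0})" and U: "open U" "F -` {0} \<subseteq> U"
  obtains \<omega> W K \<Phi> where "open W" "F -` {0} \<subseteq> W" "W \<subseteq> U" "continuous_on UNIV \<omega>" "\<And>x. 0 \<le> \<omega> x" "\<And>x. \<omega> x \<le> 1"
    "\<And>x. x \<notin> U \<Longrightarrow> \<omega> x = 0" "\<And>x. x \<in> W \<Longrightarrow> \<omega> x = 1" "expands F k (density_const J k) \<theta> \<omega> U K \<Phi>"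
proof -
  have "\<exists>\<delta> K \<Phi>. 0 < \<delta> \<and> ball z \<delta> \<subseteq> U \<and> expands F k (density_const J k) \<theta> (tent z \<delta>) (ball z \<delta>) K \<Phi>" if z: "z \<in> F -` {0}" for z
  proof -
    obtain \<delta> G G' D c C L where ch: "chart F J z \<theta> \<delta> G G' D c C L k" using fam z by auto
    obtain e where e: "0 < e" "ball z e \<subseteq> U" using U z open_contains_ball by blast
    have "0 < \<delta>" using ch by (simp add: chart_def)
    then have "chart F J z \<theta> (min \<delta> e) G G' D c C L k" using e(1) by (intro chart.shrink[OF ch]) auto
    from chart.expands_tent[OF this] have "\<exists>K \<Phi>. expands F k (density_const J k) \<theta> (tent z (min \<delta> e)) (ball z (min \<delta> e)) K \<Phi>" .
    then show ?thesis
    proof -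
      have "0 < min \<delta> e" "ball z (min \<delta> e) \<subseteq> U" using e \<open>0 < \<delta>\<close> by auto
      with \<open>\<exists>K \<Phi>. _\<close> show ?thesis by blast
    qed
  qed
  then obtain \<delta> K \<Phi> where \<delta>: "\<And>z. z \<in> F -` {0} \<Longrightarrow> 0 < \<delta> z" "\<And>z. z \<in> F -` {0} \<Longrightarrow> ball z (\<delta> z) \<subseteq> U"
    and ex: "\<And>z. z \<in> F -` {0} \<Longrightarrow> expands F k (density_const J k) \<theta> (tent z (\<delta> z)) (ball z (\<delta> z)) (K z) (\<Phi> z)"
    by metis
  obtain T where T: "T \<subseteq> F -` {0}" "finite T" "F -` {0} \<subseteq> (\<Union>z\<in>T. ball z (\<delta> z / 2))"
  proof -
    have "F -` {0} \<subseteq> (\<Union>z\<in>F -` {0}. ball z (\<delta> z / 2))" using \<delta>(1) by force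
    with compactE_image[OF Z, of "F -` {0}" "\<lambda>z. ball z (\<delta> z / 2)"] that show ?thesis by auto
  qed
  define S where "S x = (\<Sum>z\<in>T. tent z (\<delta> z) x)" for x
  have cS: "continuous_on A S" for A
    unfolding S_def using \<delta>(1) T(1) by (intro continuous_on_sum continuous_on_tent) auto
  have S0: "0 \<le> S x" for x unfolding S_def by (intro sum_nonneg tent_bounds(1))
  \<comment> \<open>On the compact zero set \<open>S\<close> attains a positive minimum; half of it is a strict lower bound.\<close>
  have "\<exists>c>0. \<forall>x\<in>F -` {0}. c < S x"
  proof (cases "F -` {0} = {}")
    case False
    obtain x0 where x0: "x0 \<in> F -` {0}" "\<And>x. x \<in> F -` {0} \<Longrightarrow> S x0 \<le> S x"
      using continuous_attains_inf[OF Z False cS] by blast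
    obtain z where z: "z \<in> T" "x0 \<in> ball z (\<delta> z / 2)" using T(3) x0(1) by blast
    have "0 < tent z (\<delta> z) x0" using z T(1) \<delta>(1)[of z] by (auto simp: tent_def dist_commute field_simps)
    also have "\<dots> \<le> S x0" unfolding S_def using z T(2) tent_bounds(1) by (intro member_le_sum) auto
    finally show ?thesis using x0(2) by (intro exI[of _ "S x0 / 2"]) force
  qed (auto intro: exI[of _ 1])
  then obtain c where c: "0 < c" "\<And>x. x \<in> F -` {0} \<Longrightarrow> c < S x" by blast
  define f where "f x = 1 / max (S x) c" for x
  define W where "W = {x. c < S x}"
  define LS where "LS = (\<Sum>z\<in>T. 2 / \<delta> z)"
  have cf: "continuous_on UNIV f"
    unfolding f_def using c(1) by (intro continuous_intros cS) (auto simp: max_def)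
  have LS: "LS-lipschitz_on U S"
    unfolding S_def LS_def using \<delta>(1) T(1) by (intro lipschitz_on_sum lipschitz_on_subset[OF tent_lipschitz]) auto
  show ?thesis
  proof (rule that[of W "\<lambda>x. S x * f x"])
    show "open W" unfolding W_def using cS[of UNIV] by (intro open_Collect_less) auto
    show "F -` {0} \<subseteq> W" using c(2) by (auto simp: W_def)
    have out: "S x = 0" if "x \<notin> U" for x
      unfolding S_def
    proof (intro sum.neutral ballI)
      fix z assume z: "z \<in> T"
      then have "x \<notin> ball z (\<delta> z)" using that \<delta>(2) T(1) by blast
      then show "tent z (\<delta> z) x = 0" using \<delta>(1)[of z] z T(1) by (intro tent_zero) (auto simp: dist_commute)
    qed
    show "W \<subseteq> U"
    proof
      fix x assume "x \<in> W"
      then show "x \<in> U" using out[of x] c(1) by (cases "x \<in> U") (auto simp: W_def)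
    qed
    show "continuous_on UNIV (\<lambda>x. S x * f x)" by (intro continuous_intros cS cf)
    show "0 \<le> S x * f x" "S x * f x \<le> 1" for x
      using S0[of x] c(1) by (auto simp: f_def max_def field_simps)
    show "S x * f x = 0" if "x \<notin> U" for x using out[OF that] by simp
    show "S x * f x = 1" if "x \<in> W" for x using that c(1) by (auto simp: W_def f_def max_def)
    show "expands F k (density_const J k) \<theta> (\<lambda>x. S x * f x) U ((\<Sum>z\<in>T. K z) * (1 / c + LS / c\<^sup>2)) (\<lambda>g. \<Sum>z\<in>T. \<Phi> z (\<lambda>x. g x * f x))"
      unfolding S_def
    proof (rule expands_sum[OF T(2)])
      show "f \<in> borel_measurable borel" using cf by (rule borel_measurable_continuous_onI)
      show "0 \<le> f x \<and> f x \<le> 1 / c" for x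
        using c(1) S0[of x] by (auto simp: f_def max_def intro!: divide_left_mono)
      show "(LS / c\<^sup>2)-lipschitz_on U f" unfolding f_def using LS c(1) by (rule lipschitz_on_inverse_max)
    qed (use ex \<delta>(2) T(1) c(1) in auto)
  qed
qed

section \<open>Decay away from the zero set\<close>

text \<open>Off a neighbourhood of the zero set, compactness and growth bound \<open>F\<close> from below, so the
  weight decays exponentially in \<open>1 / s ^ k\<close> and absorbs any admissible growth.\<close>

lemma tail_estimate:
  fixes F :: "real^'d \<Rightarrow> 'b::euclidean_space"
  assumes F: "continuous_on UNIV F" and k: "1 \<le> k" and m: "0 < m" and \<alpha>: "0 < \<alpha>"
    and growth: "\<forall>x. R \<le> norm x \<longrightarrow> m * norm x powr \<alpha> \<le> norm (F x)"
    and W: "open W" "F -` {0} \<subseteq> W"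
  obtains a C where "0 < a" "0 \<le> C"
    "\<And>f B K0 s. f \<in> borel_measurable borel \<Longrightarrow> (\<And>x. x \<in> W \<Longrightarrow> f x = 0) \<Longrightarrow>
      (\<And>x. \<bar>f x\<bar> \<le> B * exp (K0 * norm x powr (\<alpha> * real k))) \<Longrightarrow> 0 \<le> B \<Longrightarrow> 0 \<le> K0 \<Longrightarrow> 0 < s \<Longrightarrow> s \<le> 1 \<Longrightarrow> s ^ k * (K0 + 1) \<le> a \<Longrightarrow>
      integrable lborel (\<lambda>x. f x * exp (- ((norm (F x) / s) ^ k))) \<and>
      \<bar>\<integral>x. f x * exp (- ((norm (F x) / s) ^ k)) \<partial>lborel\<bar> / s ^ q \<le> C * B * s"
proof -
  define t where "t x = norm x powr (\<alpha> * real k)" for x :: "real^'d"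
  have t0: "0 \<le> t x" for x by (simp add: t_def)
  define \<rho> where "\<rho> = max R 1"
  have comp: "compact (cball 0 \<rho> - W)" using W(1) by (simp add: compact_diff)
  have cont: "continuous_on (cball 0 \<rho> - W) (\<lambda>x. norm (F x))"
    using continuous_on_subset[OF F] by (intro continuous_intros) auto
  obtain \<eta> where \<eta>: "0 < \<eta>" "\<And>x. x \<in> cball 0 \<rho> - W \<Longrightarrow> \<eta> \<le> norm (F x)"
  proof (cases "cball 0 \<rho> - W = {}")
    case False
    then obtain x0 where x0: "x0 \<in> cball 0 \<rho> - W" "\<And>x. x \<in> cball 0 \<rho> - W \<Longrightarrow> norm (F x0) \<le> norm (F x)"
      using continuous_attains_inf[OF comp False cont] by blast
    have "F x0 \<noteq> 0" using x0(1) W(2) by blast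
    then show ?thesis using that[of "norm (F x0)"] x0(2) by simp
  next
    case True
    have "\<And>x. x \<in> cball 0 \<rho> - W \<Longrightarrow> 1 \<le> norm (F x)" unfolding True by simp
    then show ?thesis using that[of 1] by simp
  qed
  \<comment> \<open>The first bound governs the compact part off \<open>W\<close>, the second the region of growth, where \<open>t x \<ge> 1\<close>.\<close>
  define a where "a = min (\<eta> ^ k / (1 + \<rho> powr (\<alpha> * real k))) (m ^ k / 2)"
  have a: "0 < a" using \<eta>(1) m by (auto simp: a_def intro!: divide_pos_pos add_pos_nonneg)
  have lower: "a * (1 + t x) \<le> norm (F x) ^ k" if "x \<notin> W" for x
  proof (cases "norm x \<le> \<rho>")
    case True
    have "t x \<le> \<rho> powr (\<alpha> * real k)" unfolding t_def using True \<alpha> by (intro powr_mono2) auto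
    then have "a * (1 + t x) \<le> (\<eta> ^ k / (1 + \<rho> powr (\<alpha> * real k))) * (1 + \<rho> powr (\<alpha> * real k))"
      using a t0[of x] \<eta>(1) by (intro mult_mono) (auto simp: a_def)
    also have "\<dots> = \<eta> ^ k"
    proof -
      have "0 < 1 + \<rho> powr (\<alpha> * real k)" by (intro add_pos_nonneg) auto
      then show ?thesis by simp
    qed
    also have "\<dots> \<le> norm (F x) ^ k" using \<eta>(1) \<eta>(2)[of x] True that by (intro power_mono) auto
    finally show ?thesis .
  next
    case False
    then have x: "R \<le> norm x" "1 \<le> norm x" by (auto simp: \<rho>_def)
    have "norm x powr 0 \<le> t x" unfolding t_def using x \<alpha> by (intro powr_mono) auto
    then have "1 \<le> t x" using x(2) by (cases "x = 0") auto
    then have "a * (1 + t x) \<le> (m ^ k / 2) * (2 * t x)"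
    proof -
      have "a \<le> m ^ k / 2" unfolding a_def by (rule min.cobounded2)
      then show ?thesis using a \<open>1 \<le> t x\<close> by (intro mult_mono) auto
    qed
    also have "\<dots> = (m * norm x powr \<alpha>) ^ k"
    proof -
      have "0 < norm x powr \<alpha>" using x(2) by (cases "x = 0") auto
      from powr_realpow[OF this, of k] show ?thesis
        by (simp add: t_def power_mult_distrib powr_powr[symmetric])
    qed
    also have "\<dots> \<le> norm (F x) ^ k" using growth x(1) m by (intro power_mono) auto
    finally show ?thesis .
  qed
  define e where "e x = exp (- (1 * norm x powr (\<alpha> * real k)))" for x :: "real^'d"
  have inte: "integrable lborel e"
    unfolding e_def using \<alpha> k by (intro integrable_exp_neg_norm_powr) auto
  define E where "E = (\<integral>x. e x \<partial>lborel)"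
  have E0: "0 \<le> E" unfolding E_def e_def by (intro integral_nonneg_AE) auto
  \<comment> \<open>Exponential decay in \<open>u = a / s ^ k\<close> beats the power \<open>s ^ (q + 1)\<close>: one factor more than the normalisation.\<close>
  define C where "C = fact (q + 1) / a ^ (q + 1) * E"
  have "0 \<le> C" using a E0 by (simp add: C_def)
  with a show ?thesis
  proof (rule that)
    fix f :: "real^'d \<Rightarrow> real" and B K0 s :: real
    assume [measurable]: "f \<in> borel_measurable borel" and fW: "\<And>x. x \<in> W \<Longrightarrow> f x = 0"
      and fB: "\<And>x. \<bar>f x\<bar> \<le> B * exp (K0 * norm x powr (\<alpha> * real k))"
      and B: "0 \<le> B" and K0: "0 \<le> K0" and s: "0 < s" "s \<le> 1" "s ^ k * (K0 + 1) \<le> a"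
    have [measurable]: "F \<in> borel_measurable borel" using F by (rule borel_measurable_continuous_onI)
    define u where "u = a / s ^ k"
    have u: "0 < u" "K0 + 1 \<le> u" using a s by (auto simp: u_def field_simps)
    have bound: "\<bar>f x * exp (- ((norm (F x) / s) ^ k))\<bar> \<le> B * exp (- u) * e x" for x
    proof (cases "x \<in> W")
      case True
      then show ?thesis using B by (simp add: fW e_def)
    next
      case False
      have "u * (1 + t x) \<le> (norm (F x) / s) ^ k"
        using lower[OF False] s by (simp add: u_def power_divide divide_right_mono)
      moreover have "(K0 + 1) * t x \<le> u * t x" using u t0 by (intro mult_right_mono) auto
      ultimately have "K0 * t x - (norm (F x) / s) ^ k \<le> - u - t x" by (simp add: algebra_simps)
      then have "exp (K0 * t x - (norm (F x) / s) ^ k) \<le> exp (- u) * e x"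
        by (simp add: e_def t_def exp_add[symmetric])
      have "\<bar>f x * exp (- ((norm (F x) / s) ^ k))\<bar> \<le> (B * exp (K0 * t x)) * exp (- ((norm (F x) / s) ^ k))"
        using fB[of x] by (simp add: abs_mult t_def mult_right_mono)
      also have "\<dots> = B * exp (K0 * t x - (norm (F x) / s) ^ k)" by (simp add: exp_diff exp_minus field_simps)
      also have "\<dots> \<le> B * (exp (- u) * e x)" using B \<open>exp (K0 * t x - _) \<le> _\<close> by (intro mult_left_mono)
      finally show ?thesis by simp
    qed
    have int: "integrable lborel (\<lambda>x. f x * exp (- ((norm (F x) / s) ^ k)))"
    proof (rule Bochner_Integration.integrable_bound)
      show "integrable lborel (\<lambda>x. B * exp (- u) * e x)" using inte by (rule integrable_mult_right)
      show "AE x in lborel. norm (f x * exp (- ((norm (F x) / s) ^ k))) \<le> norm (B * exp (- u) * e x)"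
        using bound by (intro AE_I2) (metis abs_ge_self order_trans real_norm_def)
    qed measurable
    have "u ^ (q + 1) * exp (- u) \<le> fact (q + 1)"
      using power_le_fact_exp[of u "q + 1"] u by (simp add: exp_minus field_simps)
    then have "exp (- u) \<le> fact (q + 1) / u ^ (q + 1)"
      using u(1) by (simp add: pos_le_divide_eq mult.commute)
    also have "\<dots> = fact (q + 1) / a ^ (q + 1) * (s ^ k) ^ (q + 1)"
      by (simp add: u_def power_divide)
    also have "\<dots> \<le> fact (q + 1) / a ^ (q + 1) * s ^ (q + 1)"
    proof -
      have "s ^ k \<le> s ^ 1" using s k by (intro power_decreasing) auto
      then show ?thesis using s a by (intro mult_left_mono power_mono) auto
    qed
    finally have eu: "exp (- u) \<le> fact (q + 1) / a ^ (q + 1) * s ^ (q + 1)" .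
    have "\<bar>\<integral>x. f x * exp (- ((norm (F x) / s) ^ k)) \<partial>lborel\<bar> \<le> (\<integral>x. \<bar>f x * exp (- ((norm (F x) / s) ^ k))\<bar> \<partial>lborel)"
      by (rule integral_abs_bound)
    also have "\<dots> \<le> (\<integral>x. B * exp (- u) * e x \<partial>lborel)"
      using bound by (intro integral_mono integrable_abs int integrable_mult_right inte)
    also have "\<dots> = B * E * exp (- u)" by (simp add: E_def)
    also have "\<dots> \<le> B * E * (fact (q + 1) / a ^ (q + 1) * s ^ (q + 1))"
      using eu B E0 by (intro mult_left_mono) auto
    also have "\<dots> = C * B * s * s ^ q" by (simp add: C_def)
    finally have "\<bar>\<integral>x. f x * exp (- ((norm (F x) / s) ^ k)) \<partial>lborel\<bar> / s ^ q \<le> C * B * s"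
      using s by (simp add: pos_divide_le_eq)
    with int show "integrable lborel (\<lambda>x. f x * exp (- ((norm (F x) / s) ^ k))) \<and>
      \<bar>\<integral>x. f x * exp (- ((norm (F x) / s) ^ k)) \<partial>lborel\<bar> / s ^ q \<le> C * B * s" by blast
  qed
qed

section \<open>The global expansion\<close>

lemma eq_if_linearly_close:
  fixes x y :: real
  assumes "0 < s0" "\<And>s. 0 < s \<Longrightarrow> s \<le> s0 \<Longrightarrow> \<bar>x - y\<bar> \<le> c * s"
  shows "x = y"
proof -
  have "((\<lambda>s. c * s) \<longlongrightarrow> c * 0) (at_right 0)" by (intro tendsto_intros)
  moreover have "\<forall>\<^sub>F s in at_right 0. \<bar>x - y\<bar> \<le> c * s"
    unfolding eventually_at_right_field using assms by (intro exI[of _ s0]) auto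
  ultimately have "\<bar>x - y\<bar> \<le> c * 0" by (intro tendsto_lowerbound[of _ _ "at_right 0"]) auto
  then show ?thesis by simp
qed

lemma le_if_le_power_mult:
  fixes x y :: real
  assumes "\<And>\<theta>. 1 < \<theta> \<Longrightarrow> x \<le> \<theta> ^ n * y"
  shows "x \<le> y"
proof -
  have "((\<lambda>\<theta>. \<theta> ^ n * y) \<longlongrightarrow> 1 ^ n * y) (at_right 1)" by (intro tendsto_intros)
  moreover have "\<forall>\<^sub>F \<theta> in at_right 1. x \<le> \<theta> ^ n * y"
    using assms by (auto simp: eventually_at_right_field intro!: exI[of _ 2])
  ultimately have "x \<le> 1 ^ n * y" by (intro tendsto_lowerbound[of _ _ "at_right 1"]) auto
  then show ?thesis by simp
qed

lemma compact_zero_set: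
  fixes F :: "'a::euclidean_space \<Rightarrow> 'b::euclidean_space"
  assumes F: "continuous_on UNIV F" and m: "0 < m" and \<alpha>: "0 < \<alpha>"
    and growth: "\<And>x. R \<le> norm x \<Longrightarrow> m * norm x powr \<alpha> \<le> norm (F x)"
  shows "compact (F -` {0})"
proof -
  have "F -` {0} \<subseteq> cball 0 (max R 1)"
  proof
    fix x assume x: "x \<in> F -` {0}"
    show "x \<in> cball 0 (max R 1)"
    proof (rule ccontr)
      assume "x \<notin> cball 0 (max R 1)"
      then have "R \<le> norm x" "1 \<le> norm x" by auto
      then have "0 < m * norm x powr \<alpha>" using m by (intro mult_pos_pos) auto
      then show False using growth[OF \<open>R \<le> norm x\<close>] x by simp
    qed
  qed
  then have "bounded (F -` {0})" using bounded_cball bounded_subset by blast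
  moreover have "closed (F -` {0})" using F by (intro continuous_closed_vimage) (auto simp: continuous_on_eq_continuous_at)
  ultimately show ?thesis by (simp add: compact_eq_bounded_closed)
qed

lemma AE_level_measure:
  fixes F :: "real^'d \<Rightarrow> real^'p"
  assumes F: "smooth_map F"
  shows "AE x in level_measure F. x \<in> F -` {0}"
proof -
  have ck: "ck_map n F" for n using F by (simp add: smooth_map_def)
  have [measurable]: "gen_jacobian F \<in> borel_measurable borel"
    by (intro borel_measurable_continuous_onI continuous_on_gen_jacobian ck)
  have "closed (F -` {0})"
    using ck_map_continuous[OF ck[of 1]] by (intro continuous_closed_vimage) (auto simp: continuous_on_eq_continuous_at)
  then have [measurable]: "F -` {0} \<in> sets borel" by simp
  show ?thesis
  proof -
    have "(\<lambda>x. indicator (F -` {0}) x * ennreal (1 / gen_jacobian F x)) \<in> borel_measurable (hausdorff_measure (CARD('d) - min CARD('d) CARD('p)))"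
      by measurable
    from AE_density[OF this] show ?thesis unfolding level_measure_def by (auto simp: indicator_def)
  qed
qed

text \<open>A cutoff splits the integral into a part near the zero set, which has a limit \<open>\<Phi> g\<close> at a linear rate,
  and a tail that is of order \<open>s\<close>. The charts of distortion 2 behind the cutoff only show that \<open>\<Phi> g\<close> is
  comparable to the integral over the level measure. But \<open>\<Phi> g\<close> is determined by \<open>F\<close> and \<open>g\<close> alone, since
  different cutoffs differ by a tail, so charts of any distortion \<open>\<theta>\<close> may be used to compare, and \<open>\<theta> \<rightarrow> 1\<close>
  turns the comparison into an identity.\<close>

theorem laplace_expansion:
  fixes F :: "real^'d \<Rightarrow> real^'p"
  assumes F: "smooth_map F" and jac': "\<forall>x. F x = 0 \<longrightarrow> gen_jacobian F x \<noteq> 0" and k: "1 \<le> k" and m: "0 < m" and \<alpha>: "0 < \<alpha>"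
    and growth': "\<forall>x. R \<le> norm x \<longrightarrow> m * norm x powr \<alpha> \<le> norm (F x)"
    and U: "open U" "F -` {0} \<subseteq> U"
  obtains \<gamma> a C where "0 < \<gamma>" "0 < a" "0 \<le> C" "finite_measure (level_measure F)"
    "\<And>g B K0 M N s. g \<in> borel_measurable borel \<Longrightarrow> (\<And>x. \<bar>g x\<bar> \<le> B * exp (K0 * norm x powr (\<alpha> * real k))) \<Longrightarrow> 0 \<le> B \<Longrightarrow> 0 \<le> K0 \<Longrightarrow>
      \<forall>x\<in>U. \<bar>g x\<bar> \<le> M \<Longrightarrow> 0 \<le> M \<Longrightarrow> N-lipschitz_on U g \<Longrightarrow> 0 < s \<Longrightarrow> s \<le> 1 \<Longrightarrow> s ^ k * (K0 + 1) \<le> a \<Longrightarrow>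
      integrable lborel (\<lambda>x. g x * exp (- ((norm (F x) / s) ^ k))) \<and>
      \<bar>(\<integral>x. g x * exp (- ((norm (F x) / s) ^ k)) \<partial>lborel) / s ^ min CARD('d) CARD('p) - \<gamma> * (\<integral>x. g x \<partial>level_measure F)\<bar> \<le> C * (M + N + B) * s"
proof -
  let ?q = "min CARD('d) CARD('p)" and ?w = "\<lambda>s x. exp (- ((norm (F x) / s) ^ k))"
  have jac: "gen_jacobian F x \<noteq> 0" if "F x = 0" for x using jac' that by blast
  have growth: "m * norm x powr \<alpha> \<le> norm (F x)" if "R \<le> norm x" for x using growth' that by blast
  have ck: "ck_map n F" for n using F by (simp add: smooth_map_def)
  have contF: "continuous_on UNIV F" using ck[of 0] by simp
  have [measurable]: "F \<in> borel_measurable borel" using contF by (rule borel_measurable_continuous_onI)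
  obtain J :: "'d set" where J: "\<And>z \<theta>. F z = 0 \<Longrightarrow> 1 < \<theta> \<Longrightarrow> \<exists>\<delta> G G' D c C L. chart F J z \<theta> \<delta> G G' D c C L k"
    using chart_family_exists[OF F jac k] by blast
  define \<gamma> where "\<gamma> = density_const J k"
  have \<gamma>: "0 < \<gamma>" unfolding \<gamma>_def using k by (rule density_const_pos)
  have Z: "compact (F -` {0})" by (rule compact_zero_set[OF contF m \<alpha> growth])
  have J: "\<forall>z. F z = 0 \<longrightarrow> (\<exists>\<delta> G G' D c C L. chart F J z \<theta> \<delta> G G' D c C L k)" if "1 < \<theta>" for \<theta>
    using J that by blast
  have two: "1 < (2 :: real)" by simp
  note AEZ = AE_level_measure[OF F]
  obtain \<omega> W K \<Phi> where W: "open W" "F -` {0} \<subseteq> W" "W \<subseteq> U" and \<omega>: "continuous_on UNIV \<omega>" "\<And>x. 0 \<le> \<omega> x" "\<And>x. \<omega> x \<le> 1"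
    "\<And>x. x \<notin> U \<Longrightarrow> \<omega> x = 0" "\<And>x. x \<in> W \<Longrightarrow> \<omega> x = 1" and ex0: "expands F k (density_const J k) 2 \<omega> U K \<Phi>"
    by (rule cutoff_expansion[OF J[OF two] Z U]) (rule that; assumption)
  note ex = ex0[folded \<gamma>_def]
  have K0: "0 \<le> K" using expands_nonneg[OF ex] .
  have \<omega>M [measurable]: "\<omega> \<in> borel_measurable borel" using \<omega>(1) by (rule borel_measurable_continuous_onI)
  have AE1: "AE x in level_measure F. \<omega> x = 1" using AEZ W(2) \<omega>(5) by (auto elim: eventually_mono)
  have one: "(\<lambda>x. 1 :: real) \<in> borel_measurable borel" "\<forall>x\<in>U. \<bar>1 :: real\<bar> \<le> 1" "0 \<le> (1::real)" "0-lipschitz_on U (\<lambda>x. 1 :: real)" "\<forall>x\<in>U. 0 \<le> (1::real)"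
    by (auto intro: lipschitz_on_constant)
  have int1: "integrable (level_measure F) (\<lambda>x. 1 :: real)"
    using expandsD(3)[OF ex one(1-4) one(5)] by (rule integrable_cong_AE_imp) (use AE1 in \<open>auto elim: eventually_mono\<close>)
  have finl: "finite_measure (level_measure F)"
    using int1 by (intro finite_measureI) (simp add: integrable_iff_bounded)
  interpret lev: finite_measure "level_measure F" by (rule finl)
  have AEU: "AE x in level_measure F. x \<in> U" using AEZ U(2) by (auto elim: eventually_mono)
  have intg: "integrable (level_measure F) g"
    if "g \<in> borel_measurable borel" "\<forall>x\<in>U. \<bar>g x\<bar> \<le> M" for g :: "real^'d \<Rightarrow> real" and M
    using that AEU by (intro lev.integrable_const_bound[of _ M]) (auto elim: eventually_mono)
  \<comment> \<open>Only for nonnegative \<open>g\<close> do the comparisons in \<open>expands\<close> apply.\<close>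
  have pos_case: "\<Phi> g = \<gamma> * (\<integral>x. g x \<partial>level_measure F)"
    if g: "g \<in> borel_measurable borel" "\<forall>x\<in>U. \<bar>g x\<bar> \<le> M" "0 \<le> M" "N-lipschitz_on U g" and g0: "\<forall>x\<in>U. 0 \<le> g x" for g M N
  proof -
    have [measurable]: "g \<in> borel_measurable borel" by (rule g(1))
    have squeezed: "\<gamma> * (\<integral>x. g x \<partial>level_measure F) \<le> \<theta> ^ (CARD('d) + 2) * \<Phi> g \<and> \<Phi> g \<le> \<theta> ^ (CARD('d) + 2) * (\<gamma> * (\<integral>x. g x \<partial>level_measure F))"
      if \<theta>: "1 < \<theta>" for \<theta>
    proof -
      obtain \<omega>' W' K' \<Phi>' where W': "open W'" "F -` {0} \<subseteq> W'" and \<omega>': "continuous_on UNIV \<omega>'" "\<And>x. 0 \<le> \<omega>' x" "\<And>x. \<omega>' x \<le> 1"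
        "\<And>x. x \<notin> U \<Longrightarrow> \<omega>' x = 0" "\<And>x. x \<in> W' \<Longrightarrow> \<omega>' x = 1" and ex0': "expands F k (density_const J k) \<theta> \<omega>' U K' \<Phi>'"
        and "W' \<subseteq> U"
        by (rule cutoff_expansion[OF J[OF \<theta>] Z U]) (rule that; assumption)
      note ex' = ex0'[folded \<gamma>_def]
      have [measurable]: "\<omega>' \<in> borel_measurable borel" using \<omega>'(1) by (rule borel_measurable_continuous_onI)
      have AE1': "AE x in level_measure F. \<omega>' x = 1" using AEZ W'(2) \<omega>'(5) by (auto elim: eventually_mono)
      have WW': "open (W \<inter> W')" "F -` {0} \<subseteq> W \<inter> W'" using W(1,2) W' by auto
      obtain a' C' where a': "0 < a'" "0 \<le> C'"
        and tail: "\<And>f B K0 s. f \<in> borel_measurable borel \<Longrightarrow> (\<And>x. x \<in> W \<inter> W' \<Longrightarrow> f x = 0) \<Longrightarrow>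
          (\<And>x. \<bar>f x\<bar> \<le> B * exp (K0 * norm x powr (\<alpha> * real k))) \<Longrightarrow> 0 \<le> B \<Longrightarrow> 0 \<le> K0 \<Longrightarrow> 0 < s \<Longrightarrow> s \<le> 1 \<Longrightarrow> s ^ k * (K0 + 1) \<le> a' \<Longrightarrow>
          integrable lborel (\<lambda>x. f x * ?w s x) \<and> \<bar>\<integral>x. f x * ?w s x \<partial>lborel\<bar> / s ^ ?q \<le> C' * B * s"
        using tail_estimate[OF contF k m \<alpha> growth' WW', of ?q] by blast
      define f where "f x = (\<omega> x - \<omega>' x) * g x" for x
      have fM: "\<bar>f x\<bar> \<le> M * exp (0 * norm x powr (\<alpha> * real k))" for x
      proof (cases "x \<in> U")
        case True
        have "\<bar>\<omega> x - \<omega>' x\<bar> \<le> 1" using \<omega>(2,3)[of x] \<omega>'(2,3)[of x] by (auto simp: abs_le_iff)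
        then have "\<bar>\<omega> x - \<omega>' x\<bar> * \<bar>g x\<bar> \<le> 1 * M" using g(2) True by (intro mult_mono) auto
        then show ?thesis by (simp add: f_def abs_mult)
      next
        case False
        then show ?thesis using g(3) by (simp add: f_def \<omega>(4) \<omega>'(4))
      qed
      \<comment> \<open>The two cutoffs agree near the zero set, so their limits differ by the limit of a tail.\<close>
      have "\<Phi> g = \<Phi>' g"
      proof (rule eq_if_linearly_close)
        define s0 where "s0 = min 1 a'"
        show "0 < s0" using a' by (simp add: s0_def)
        fix s assume s: "0 < s" "s \<le> s0"
        have s1: "s \<le> 1" "s ^ k * (0 + 1) \<le> a'"
        proof -
          show "s \<le> 1" using s by (simp add: s0_def)
          then have "s ^ k \<le> s ^ 1" using s k by (intro power_decreasing) auto
          then show "s ^ k * (0 + 1) \<le> a'" using s by (simp add: s0_def)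
        qed
        have fm: "f \<in> borel_measurable borel" unfolding f_def by measurable
        have t: "\<bar>\<integral>x. f x * ?w s x \<partial>lborel\<bar> / s ^ ?q \<le> C' * M * s"
          using tail[OF fm _ fM g(3) order_refl s(1) s1] \<omega>(5) \<omega>'(5) by (auto simp: f_def)
        note e = expandsD(1,2)[OF ex g s(1)] and e' = expandsD(1,2)[OF ex' g s(1)]
        have "(\<integral>x. f x * ?w s x \<partial>lborel) = (\<integral>x. \<omega> x * g x * ?w s x \<partial>lborel) - (\<integral>x. \<omega>' x * g x * ?w s x \<partial>lborel)"
          unfolding f_def left_diff_distrib by (rule Bochner_Integration.integral_diff) (rule e(1), rule e'(1))
        then have "(\<integral>x. f x * ?w s x \<partial>lborel) / s ^ ?q = (\<integral>x. \<omega> x * g x * ?w s x \<partial>lborel) / s ^ ?q - (\<integral>x. \<omega>' x * g x * ?w s x \<partial>lborel) / s ^ ?q"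
          by (simp add: diff_divide_distrib)
        moreover have "\<bar>(\<integral>x. f x * ?w s x \<partial>lborel) / s ^ ?q\<bar> \<le> C' * M * s" using t s(1) by simp
        ultimately have "\<bar>\<Phi> g - \<Phi>' g\<bar> \<le> K * (M + N) * s + K' * (M + N) * s + C' * M * s"
          using e(2) e'(2) unfolding abs_le_iff by linarith
        then show "\<bar>\<Phi> g - \<Phi>' g\<bar> \<le> (K * (M + N) + K' * (M + N) + C' * M) * s" by (simp add: algebra_simps)
      qed
      moreover have "(\<integral>x. \<omega>' x * g x \<partial>level_measure F) = (\<integral>x. g x \<partial>level_measure F)"
        by (rule integral_cong_AE) (use AE1' in \<open>auto elim: eventually_mono\<close>)
      ultimately show ?thesis using expandsD(4,5)[OF ex' g g0] by simp
    qed
    show ?thesis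
    proof (rule antisym)
      show "\<Phi> g \<le> \<gamma> * (\<integral>x. g x \<partial>level_measure F)"
        by (rule le_if_le_power_mult[where n = "CARD('d) + 2"]) (rule squeezed[THEN conjunct2])
      show "\<gamma> * (\<integral>x. g x \<partial>level_measure F) \<le> \<Phi> g"
        by (rule le_if_le_power_mult[where n = "CARD('d) + 2"]) (rule squeezed[THEN conjunct1])
    qed
  qed
  \<comment> \<open>Adding the constant \<open>M\<close> makes \<open>g\<close> nonnegative, and \<open>\<Phi>\<close> inherits additivity from the integrals.\<close>
  have ident: "\<Phi> g = \<gamma> * (\<integral>x. g x \<partial>level_measure F)"
    if g: "g \<in> borel_measurable borel" "\<forall>x\<in>U. \<bar>g x\<bar> \<le> M" "0 \<le> M" "N-lipschitz_on U g" for g M N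
  proof -
    have [measurable]: "g \<in> borel_measurable borel" by (rule g(1))
    define g' where "g' x = g x + M" for x
    define h where "h = (\<lambda>x::real^'d. M)"
    have g': "g' \<in> borel_measurable borel" "\<forall>x\<in>U. \<bar>g' x\<bar> \<le> 2 * M" "0 \<le> 2 * M" "(N + 0)-lipschitz_on U g'" "\<forall>x\<in>U. 0 \<le> g' x"
    proof -
      show "g' \<in> borel_measurable borel" unfolding g'_def by measurable
      have "\<bar>g' x\<bar> \<le> 2 * M \<and> 0 \<le> g' x" if "x \<in> U" for x
        using g(2)[rule_format, OF that] by (auto simp: g'_def abs_le_iff)
      then show "\<forall>x\<in>U. \<bar>g' x\<bar> \<le> 2 * M" "\<forall>x\<in>U. 0 \<le> g' x" by blast+
      show "0 \<le> 2 * M" using g(3) by simp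
      show "(N + 0)-lipschitz_on U g'" unfolding g'_def by (rule lipschitz_on_add[OF g(4) lipschitz_on_constant])
    qed
    have h: "h \<in> borel_measurable borel" "\<forall>x\<in>U. \<bar>h x\<bar> \<le> M" "0 \<le> M" "0-lipschitz_on U h" "\<forall>x\<in>U. 0 \<le> h x"
      unfolding h_def using g(3) by (auto intro: lipschitz_on_constant)
    have "\<Phi> g' = \<Phi> g + \<Phi> h"
    proof (rule eq_if_linearly_close[OF zero_less_one])
      fix s :: real assume s: "0 < s"
      note e = expandsD(1,2)[OF ex g s] and e' = expandsD(1,2)[OF ex g'(1-4) s] and eh = expandsD(1,2)[OF ex h(1-4) s]
      have "(\<integral>x. \<omega> x * g' x * ?w s x \<partial>lborel) = (\<integral>x. \<omega> x * g x * ?w s x + \<omega> x * h x * ?w s x \<partial>lborel)"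
        by (simp add: g'_def h_def algebra_simps)
      also have "\<dots> = (\<integral>x. \<omega> x * g x * ?w s x \<partial>lborel) + (\<integral>x. \<omega> x * h x * ?w s x \<partial>lborel)"
        by (rule Bochner_Integration.integral_add) (rule e(1), rule eh(1))
      finally have "(\<integral>x. \<omega> x * g' x * ?w s x \<partial>lborel) / s ^ ?q = (\<integral>x. \<omega> x * g x * ?w s x \<partial>lborel) / s ^ ?q + (\<integral>x. \<omega> x * h x * ?w s x \<partial>lborel) / s ^ ?q"
        by (simp add: add_divide_distrib)
      then have "\<bar>\<Phi> g' - (\<Phi> g + \<Phi> h)\<bar> \<le> K * (M + N) * s + K * (2 * M + (N + 0)) * s + K * (M + 0) * s"
        using e(2) e'(2) eh(2) unfolding abs_le_iff by linarith
      then show "\<bar>\<Phi> g' - (\<Phi> g + \<Phi> h)\<bar> \<le> (K * (M + N) + K * (2 * M + (N + 0)) + K * (M + 0)) * s" by (simp add: algebra_simps)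
    qed
    moreover have "(\<integral>x. g' x \<partial>level_measure F) = (\<integral>x. g x \<partial>level_measure F) + (\<integral>x. h x \<partial>level_measure F)"
      unfolding g'_def h_def using intg[OF g(1,2)] by (intro Bochner_Integration.integral_add) auto
    ultimately show ?thesis using pos_case[OF g'] pos_case[OF h] by (simp add: distrib_left)
  qed
  obtain a C where a: "0 < a" "0 \<le> C"
    and tail: "\<And>f B K0 s. f \<in> borel_measurable borel \<Longrightarrow> (\<And>x. x \<in> W \<Longrightarrow> f x = 0) \<Longrightarrow>
      (\<And>x. \<bar>f x\<bar> \<le> B * exp (K0 * norm x powr (\<alpha> * real k))) \<Longrightarrow> 0 \<le> B \<Longrightarrow> 0 \<le> K0 \<Longrightarrow> 0 < s \<Longrightarrow> s \<le> 1 \<Longrightarrow> s ^ k * (K0 + 1) \<le> a \<Longrightarrow>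
      integrable lborel (\<lambda>x. f x * ?w s x) \<and> \<bar>\<integral>x. f x * ?w s x \<partial>lborel\<bar> / s ^ ?q \<le> C * B * s"
    using tail_estimate[OF contF k m \<alpha> growth' W(1,2), of ?q] by blast
  show ?thesis
  proof (rule that[OF \<gamma> a(1) _ finl, of "K + C"])
    show "0 \<le> K + C" using K0 a by simp
    fix g :: "real^'d \<Rightarrow> real" and B K0 M N s :: real
    assume gm [measurable]: "g \<in> borel_measurable borel" and gB: "\<And>x. \<bar>g x\<bar> \<le> B * exp (K0 * norm x powr (\<alpha> * real k))"
      and B: "0 \<le> B" and K00: "0 \<le> K0" and gM: "\<forall>x\<in>U. \<bar>g x\<bar> \<le> M" and M: "0 \<le> M" and N: "N-lipschitz_on U g"
      and s: "0 < s" "s \<le> 1" "s ^ k * (K0 + 1) \<le> a"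
    have N0: "0 \<le> N" using N lipschitz_on_nonneg by blast
    define f where "f x = (1 - \<omega> x) * g x" for x
    have fB: "\<bar>f x\<bar> \<le> B * exp (K0 * norm x powr (\<alpha> * real k))" for x
    proof -
      have "\<bar>1 - \<omega> x\<bar> * \<bar>g x\<bar> \<le> 1 * \<bar>g x\<bar>" using \<omega>(2,3)[of x] by (intro mult_right_mono) auto
      then show ?thesis using gB[of x] by (simp add: f_def abs_mult)
    qed
    have fm: "f \<in> borel_measurable borel" unfolding f_def by measurable
    have t: "integrable lborel (\<lambda>x. f x * ?w s x)" "\<bar>\<integral>x. f x * ?w s x \<partial>lborel\<bar> / s ^ ?q \<le> C * B * s"
      using tail[OF fm _ fB B K00 s] \<omega>(5) by (auto simp: f_def)
    note e = expandsD(1,2)[OF ex gm gM M N s(1)]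
    have eq: "(\<lambda>x. g x * ?w s x) = (\<lambda>x. \<omega> x * g x * ?w s x + f x * ?w s x)"
      by (simp add: f_def fun_eq_iff algebra_simps)
    have int: "integrable lborel (\<lambda>x. g x * ?w s x)"
      unfolding eq by (rule Bochner_Integration.integrable_add) (rule e(1), rule t(1))
    have "(\<integral>x. g x * ?w s x \<partial>lborel) = (\<integral>x. \<omega> x * g x * ?w s x \<partial>lborel) + (\<integral>x. f x * ?w s x \<partial>lborel)"
      unfolding eq by (rule Bochner_Integration.integral_add) (rule e(1), rule t(1))
    then have "(\<integral>x. g x * ?w s x \<partial>lborel) / s ^ ?q = (\<integral>x. \<omega> x * g x * ?w s x \<partial>lborel) / s ^ ?q + (\<integral>x. f x * ?w s x \<partial>lborel) / s ^ ?q"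
      by (simp add: add_divide_distrib)
    moreover have "\<bar>(\<integral>x. f x * ?w s x \<partial>lborel) / s ^ ?q\<bar> \<le> C * B * s" using t(2) s(1) by simp
    ultimately have "\<bar>(\<integral>x. g x * ?w s x \<partial>lborel) / s ^ ?q - \<gamma> * (\<integral>x. g x \<partial>level_measure F)\<bar> \<le> K * (M + N) * s + C * B * s"
      using e(2) unfolding ident[OF gm gM M N] abs_le_iff by linarith
    also have "\<dots> \<le> (K + C) * (M + N + B) * s"
    proof -
      have "K * (M + N) + C * B \<le> (K + C) * (M + N + B)" using K0 a(2) M N0 B by (simp add: algebra_simps)
      from mult_right_mono[OF this, of s] s show ?thesis by (simp add: algebra_simps)
    qed
    finally show "integrable lborel (\<lambda>x. g x * ?w s x) \<and>
      \<bar>(\<integral>x. g x * ?w s x \<partial>lborel) / s ^ ?q - \<gamma> * (\<integral>x. g x \<partial>level_measure F)\<bar> \<le> (K + C) * (M + N + B) * s"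
      using int by blast
  qed
qed

lemma level_measure_nonzero:
  fixes F :: "real^'d \<Rightarrow> real^'p"
  assumes F: "smooth_map F" and jac: "\<And>x. F x = 0 \<Longrightarrow> gen_jacobian F x \<noteq> 0" and z: "F z = 0"
  shows "0 < emeasure (level_measure F) UNIV"
proof -
  obtain J :: "'d set" where J: "\<And>z \<theta>. F z = 0 \<Longrightarrow> 1 < \<theta> \<Longrightarrow> \<exists>\<delta> G G' D c C L. chart F J z \<theta> \<delta> G G' D c C L 1"
    using chart_family_exists[OF F jac order_refl] by blast
  have "(1::real) < 2" by simp
  from J[OF z this] obtain \<delta> G G' D c C L where ch: "chart F J z 2 \<delta> G G' D c C L 1" by blast
  have "0 < emeasure (level_measure F) (chart.V z \<delta>)" by (rule chart.level_measure_pos[OF ch])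
  also have "\<dots> \<le> emeasure (level_measure F) UNIV" by (rule emeasure_mono) auto
  finally show ?thesis .
qed

text \<open>Where the growth condition holds, the exponents of \<open>g\<close> and of the weight add up to at most the negative
  number \<open>K0 - m ^ k / \<epsilon>\<close> times \<open>norm x powr (\<alpha> * real k)\<close>; elsewhere the integrand is bounded.\<close>

lemma weighted_integrable:
  fixes F :: "real^'d \<Rightarrow> 'b::euclidean_space"
  assumes F: "continuous_on UNIV F" and k: "1 \<le> k" and m: "0 < m" and \<alpha>: "0 < \<alpha>"
    and growth: "\<And>x. R \<le> norm x \<Longrightarrow> m * norm x powr \<alpha> \<le> norm (F x)"
    and g [measurable]: "g \<in> borel_measurable borel" and gB: "\<And>x. \<bar>g x\<bar> \<le> B * exp (K0 * norm x powr (\<alpha> * real k))"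
    and K0: "0 \<le> K0" and \<epsilon>: "0 < \<epsilon>" "\<epsilon> * K0 < m ^ k"
  shows "integrable lborel (\<lambda>x. g x * exp (- (norm (F x) ^ k / \<epsilon>)))"
proof (rule Bochner_Integration.integrable_bound)
  have [measurable]: "F \<in> borel_measurable borel" using F by (rule borel_measurable_continuous_onI)
  show "(\<lambda>x. g x * exp (- (norm (F x) ^ k / \<epsilon>))) \<in> borel_measurable lborel" by measurable
  define b where "b = m ^ k / \<epsilon> - K0"
  have b: "0 < b" using \<epsilon> by (simp add: b_def field_simps)
  define T where "T = max R 1 powr (\<alpha> * real k)"
  have T: "0 \<le> T" by (simp add: T_def)
  have B: "0 \<le> B"
  proof (rule ccontr)
    assume "\<not> 0 \<le> B"
    then have "B * exp (K0 * norm (0::real^'d) powr (\<alpha> * real k)) < 0" by (intro mult_neg_pos) auto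
    with gB[of 0] show False by linarith
  qed
  show "integrable lborel (\<lambda>x::real^'d. B * exp (K0 * T + b * T) * exp (- (b * norm x powr (\<alpha> * real k))))"
    using b \<alpha> k by (intro integrable_mult_right integrable_exp_neg_norm_powr) auto
  show "AE x in lborel. norm (g x * exp (- (norm (F x) ^ k / \<epsilon>))) \<le> norm (B * exp (K0 * T + b * T) * exp (- (b * norm x powr (\<alpha> * real k))))"
  proof (rule AE_I2)
    fix x :: "real^'d"
    define t where "t = norm x powr (\<alpha> * real k)"
    have t: "0 \<le> t" by (simp add: t_def)
    have "K0 * t - norm (F x) ^ k / \<epsilon> \<le> K0 * T + b * T - b * t"
    proof (cases "max R 1 \<le> norm x")
      case True
      have "0 < norm x powr \<alpha>" using True by (cases "x = 0") auto
      from powr_realpow[OF this, of k] have "m ^ k * t = (m * norm x powr \<alpha>) ^ k"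
        by (simp add: t_def power_mult_distrib powr_powr[symmetric])
      also have "\<dots> \<le> norm (F x) ^ k" using growth[of x] True m by (intro power_mono) auto
      finally have "m ^ k * t / \<epsilon> \<le> norm (F x) ^ k / \<epsilon>" using \<epsilon>(1) by (intro divide_right_mono) auto
      moreover have "0 \<le> K0 * T + b * T" using K0 b T by simp
      ultimately show ?thesis by (simp add: b_def left_diff_distrib)
    next
      case False
      then have "t \<le> T" unfolding t_def T_def using \<alpha> by (intro powr_mono2) auto
      then have "K0 * t \<le> K0 * T" "b * t \<le> b * T" using K0 b by (auto intro: mult_left_mono)
      moreover have "0 \<le> norm (F x) ^ k / \<epsilon>" using \<epsilon>(1) by simp
      ultimately show ?thesis by linarith
    qed
    then have "exp (K0 * t) * exp (- (norm (F x) ^ k / \<epsilon>)) \<le> exp (K0 * T + b * T) * exp (- (b * t))"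
      by (simp add: exp_add[symmetric])
    then have 1: "B * (exp (K0 * t) * exp (- (norm (F x) ^ k / \<epsilon>))) \<le> B * (exp (K0 * T + b * T) * exp (- (b * t)))"
      using B by (rule mult_left_mono)
    have "\<bar>g x\<bar> * exp (- (norm (F x) ^ k / \<epsilon>)) \<le> B * exp (K0 * t) * exp (- (norm (F x) ^ k / \<epsilon>))"
      using gB[of x] by (intro mult_right_mono) (auto simp: t_def)
    also have "\<dots> \<le> B * (exp (K0 * T + b * T) * exp (- (b * t)))" using 1 by (simp only: mult.assoc)
    finally show "norm (g x * exp (- (norm (F x) ^ k / \<epsilon>))) \<le> norm (B * exp (K0 * T + b * T) * exp (- (b * norm x powr (\<alpha> * real k))))"
      using B by (simp add: abs_mult t_def[symmetric] mult.assoc)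
  qed
qed

text \<open>Polynomials are dense by Stone--Weierstrass and Lipschitz on bounded sets.\<close>

lemma lipschitz_approximation:
  fixes g :: "'a::euclidean_space \<Rightarrow> real"
  assumes g: "continuous_on UNIV g" and U: "bounded U" and \<eta>: "0 < \<eta>"
  obtains p N where "continuous_on UNIV p" "N-lipschitz_on U p" "\<And>x. x \<in> U \<Longrightarrow> \<bar>g x - p x\<bar> \<le> \<eta>"
proof -
  have cc: "compact (closure U)" using U by (simp add: compact_closure)
  obtain p where p: "real_polynomial_function p" "\<And>x. x \<in> closure U \<Longrightarrow> \<bar>g x - p x\<bar> < \<eta>"
    using Stone_Weierstrass_real_polynomial_function[OF cc continuous_on_subset[OF g subset_UNIV] \<eta>] by blast
  have "\<exists>N M. N-lipschitz_on U p \<and> 0 \<le> M \<and> (\<forall>x\<in>U. \<bar>p x\<bar> \<le> M)"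
    using p(1)
  proof induction
    case (linear f)
    then obtain K where K: "0 < K" "\<And>x. \<bar>f x\<bar> \<le> K * norm x"
      using bounded_linear.pos_bounded[OF linear] by (auto simp: mult.commute)
    obtain B where B: "\<And>x. x \<in> U \<Longrightarrow> norm x \<le> B" "0 < B" using U bounded_pos by metis
    have "K-lipschitz_on U f"
    proof (rule lipschitz_onI)
      fix x y
      show "dist (f x) (f y) \<le> K * dist x y"
        using K(2)[of "x - y"] by (simp add: dist_norm linear_diff[OF bounded_linear.linear[OF linear]])
    qed (use K in simp)
    moreover have "\<bar>f x\<bar> \<le> K * B" if "x \<in> U" for x
      using K(2)[of x] mult_left_mono[OF B(1)[OF that], of K] K(1) by linarith
    ultimately show ?case using K(1) B(2) by (intro exI[of _ K] exI[of _ "K * B"]) auto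
  next
    case (const c)
    show ?case by (intro exI[of _ 0] exI[of _ "\<bar>c\<bar>"]) (auto intro: lipschitz_on_constant)
  next
    case (add f g)
    then obtain N M N' M' where "N-lipschitz_on U f" "0 \<le> M" "\<forall>x\<in>U. \<bar>f x\<bar> \<le> M" "N'-lipschitz_on U g" "0 \<le> M'" "\<forall>x\<in>U. \<bar>g x\<bar> \<le> M'"
      by blast
    then show ?case by (intro exI[of _ "N + N'"] exI[of _ "M + M'"]) (auto intro!: lipschitz_on_add order_trans[OF abs_triangle_ineq] add_mono)
  next
    case (mult f g)
    then obtain N M N' M' where f: "N-lipschitz_on U f" "0 \<le> M" "\<forall>x\<in>U. \<bar>f x\<bar> \<le> M" and g: "N'-lipschitz_on U g" "0 \<le> M'" "\<forall>x\<in>U. \<bar>g x\<bar> \<le> M'"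
      by blast
    have "(N * M' + M * N')-lipschitz_on U (\<lambda>x. f x * g x)"
      by (rule lipschitz_on_mult[OF f(1) g(1)]) (use f g in auto)
    moreover have "\<bar>f x * g x\<bar> \<le> M * M'" if "x \<in> U" for x
      using f(2,3) g(2,3) that by (auto simp: abs_mult intro!: mult_mono)
    ultimately show ?case using f(2) g(2) by (intro exI[of _ "N * M' + M * N'"] exI[of _ "M * M'"]) auto
  qed
  then obtain N where N: "N-lipschitz_on U p" by blast
  have cp: "continuous_on UNIV p"
    using p(1) by (intro continuous_at_imp_continuous_on ballI continuous_real_polymonial_function)
  show ?thesis
  proof (rule that[OF cp N])
    show "\<bar>g x - p x\<bar> \<le> \<eta>" if "x \<in> U" for x
      using p(2)[of x] that closure_subset[of U] by force
  qed
qed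

section \<open>Expectations as quotients of integrals\<close>

text \<open>Recognising the normalised set function as a density gives countable additivity and reduces
  expectations to quotients of integrals.\<close>

lemma laplace_measure_eq_density:
  fixes F :: "real^'d \<Rightarrow> real^'p" and w :: "real^'d \<Rightarrow> ennreal"
  assumes \<nu> [measurable_cong]: "sets \<nu> = sets borel" and w [measurable]: "w \<in> borel_measurable borel"
    and mass: "\<And>A. A \<in> sets borel \<Longrightarrow> laplace_mass F \<Psi> k \<epsilon> A = (\<integral>\<^sup>+x. w x * indicator A x \<partial>\<nu>)"
  shows "laplace_measure F \<Psi> k \<epsilon> = density \<nu> (\<lambda>x. w x / laplace_mass F \<Psi> k \<epsilon> UNIV)"
proof -
  let ?D = "density \<nu> (\<lambda>x. w x / laplace_mass F \<Psi> k \<epsilon> UNIV)"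
  have sp: "space \<nu> = UNIV" using sets_eq_imp_space_eq[OF \<nu>] by simp
  have em: "emeasure ?D A = laplace_mass F \<Psi> k \<epsilon> A / laplace_mass F \<Psi> k \<epsilon> UNIV" if A [measurable]: "A \<in> sets borel" for A
  proof -
    have "emeasure ?D A = (\<integral>\<^sup>+x. w x * indicator A x / laplace_mass F \<Psi> k \<epsilon> UNIV \<partial>\<nu>)"
      using A \<nu> by (subst emeasure_density) (auto simp: ennreal_times_divide divide_ennreal_def mult_ac intro!: nn_integral_cong)
    also have "\<dots> = (\<integral>\<^sup>+x. w x * indicator A x \<partial>\<nu>) / laplace_mass F \<Psi> k \<epsilon> UNIV"
      by (rule nn_integral_divide) measurable
    finally show ?thesis by (simp add: mass)
  qed
  have "measure_of UNIV (sets borel) (\<lambda>A. laplace_mass F \<Psi> k \<epsilon> A / laplace_mass F \<Psi> k \<epsilon> UNIV)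
      = measure_of UNIV (sets borel) (emeasure ?D)"
    by (rule measure_of_eq) (auto simp: em sets.sigma_sets_eq[of borel, simplified])
  also have "\<dots> = ?D" using measure_of_of_measure[of ?D] by (simp add: sp \<nu>)
  finally show ?thesis unfolding laplace_measure_def .
qed

lemma normalized_density:
  fixes w :: "'a \<Rightarrow> real"
  assumes w: "\<And>x. 0 \<le> w x" "integrable \<nu> w" and t: "0 < (\<integral>x. w x \<partial>\<nu>)"
    and P: "P = density \<nu> (\<lambda>x. ennreal (w x) / (\<integral>\<^sup>+x. ennreal (w x) \<partial>\<nu>))"
    and \<phi>: "\<phi> \<in> borel_measurable \<nu>"
  shows "integrable P \<phi> \<longleftrightarrow> integrable \<nu> (\<lambda>x. w x * \<phi> x)"
    "(\<integral>x. \<phi> x \<partial>P) = (\<integral>x. w x * \<phi> x \<partial>\<nu>) / (\<integral>x. w x \<partial>\<nu>)"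
proof -
  define t where "t = (\<integral>x. w x \<partial>\<nu>)"
  have t0: "0 < t" using t by (simp add: t_def)
  have T: "(\<integral>\<^sup>+x. ennreal (w x) \<partial>\<nu>) = ennreal t"
    unfolding t_def using w by (intro nn_integral_eq_integral) auto
  have P': "P = density \<nu> (\<lambda>x. ennreal (w x / t))"
    unfolding P T using w(1) t0 by (simp add: divide_ennreal)
  have [measurable]: "w \<in> borel_measurable \<nu>" using w(2) by (rule borel_measurable_integrable)
  have wt: "AE x in \<nu>. 0 \<le> w x / t" using w(1) t0 by simp
  have "integrable P \<phi> \<longleftrightarrow> integrable \<nu> (\<lambda>x. (w x / t) *\<^sub>R \<phi> x)"
    unfolding P' by (rule integrable_density) (use \<phi> wt in auto)
  also have "\<dots> \<longleftrightarrow> integrable \<nu> (\<lambda>x. (w x * \<phi> x) / t)" by simp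
  also have "\<dots> \<longleftrightarrow> integrable \<nu> (\<lambda>x. w x * \<phi> x)"
  proof
    assume "integrable \<nu> (\<lambda>x. (w x * \<phi> x) / t)"
    from integrable_mult_right[OF this, of t] show "integrable \<nu> (\<lambda>x. w x * \<phi> x)" using t0 by simp
  qed (rule integrable_divide)
  finally show "integrable P \<phi> \<longleftrightarrow> integrable \<nu> (\<lambda>x. w x * \<phi> x)" .
  have "(\<integral>x. \<phi> x \<partial>P) = (\<integral>x. (w x / t) *\<^sub>R \<phi> x \<partial>\<nu>)"
    unfolding P' by (rule integral_density) (use \<phi> wt in auto)
  also have "\<dots> = (\<integral>x. (w x * \<phi> x) / t \<partial>\<nu>)" by simp
  also have "\<dots> = (\<integral>x. w x * \<phi> x \<partial>\<nu>) / t" by simp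
  finally show "(\<integral>x. \<phi> x \<partial>P) = (\<integral>x. w x * \<phi> x \<partial>\<nu>) / (\<integral>x. w x \<partial>\<nu>)" by (simp add: t_def)
qed

lemma quotient_difference:
  fixes a b a0 b0 :: real
  assumes b0: "0 < b0" and b: "\<bar>b - b0\<bar> \<le> b0 / 2" and q: "\<bar>a0\<bar> \<le> M * b0"
  shows "\<bar>a / b - a0 / b0\<bar> \<le> 2 / b0 * (\<bar>a - a0\<bar> + M * \<bar>b - b0\<bar>)"
proof -
  have bp: "b0 / 2 \<le> b" "0 < b" using b b0 unfolding abs_le_iff by linarith+
  have M: "\<bar>a0 / b0\<bar> \<le> M" using q b0 by (simp add: abs_divide pos_divide_le_eq)
  have "a / b - a0 / b0 = ((a - a0) - (a0 / b0) * (b - b0)) / b"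
    using b0 bp by (simp add: field_simps)
  then have "\<bar>a / b - a0 / b0\<bar> = \<bar>(a - a0) - (a0 / b0) * (b - b0)\<bar> * (1 / b)"
    using bp by (simp add: abs_divide)
  also have "\<dots> \<le> (\<bar>a - a0\<bar> + M * \<bar>b - b0\<bar>) * (2 / b0)"
  proof (rule mult_mono)
    have "\<bar>(a0 / b0) * (b - b0)\<bar> \<le> M * \<bar>b - b0\<bar>"
      unfolding abs_mult using M by (intro mult_right_mono) auto
    then show "\<bar>(a - a0) - (a0 / b0) * (b - b0)\<bar> \<le> \<bar>a - a0\<bar> + M * \<bar>b - b0\<bar>" by linarith
    show "1 / b \<le> 2 / b0" using bp b0 by (simp add: field_simps)
    have "0 \<le> M" using M by linarith
    then show "0 \<le> \<bar>a - a0\<bar> + M * \<bar>b - b0\<bar>" by simp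
  qed (use bp in auto)
  finally show ?thesis by (simp add: mult.commute)
qed

locale laplace_setup =
  fixes F :: "real^'d \<Rightarrow> real^'p"
    and \<Psi> :: "real^'d \<Rightarrow> real"
    and k :: nat
    and m \<alpha> R C\<^sub>\<Psi> :: real
  assumes k: "k \<ge> 1"
    and F_smooth: "smooth_map F"
    and F_zero: "F 0 = 0"
    and JF_nonzero: "\<And>x. F x = 0 \<Longrightarrow> gen_jacobian F x \<noteq> 0"
    and m: "m > 0" and \<alpha>: "\<alpha> > 0"
    and F_growth: "\<And>x. R \<le> norm x \<Longrightarrow> m * norm x powr \<alpha> \<le> norm (F x)"
    and \<Psi>_cont: "continuous_on UNIV \<Psi>"
    and \<Psi>_nonneg: "\<And>x. \<Psi> x \<ge> 0"
    and C\<^sub>\<Psi>: "C\<^sub>\<Psi> \<ge> 0"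
    and \<Psi>_growth: "\<And>x. \<Psi> x \<le> C\<^sub>\<Psi> * exp (C\<^sub>\<Psi> * norm x powr (\<alpha> * real k))"
    and \<Psi>_pos: "\<And>x. F x = 0 \<Longrightarrow> \<Psi> x > 0"
begin

definition "weight \<epsilon> x = exp (- (norm (F x) ^ k / \<epsilon>))" for \<epsilon> x

lemma F_cont: "continuous_on UNIV F"
proof -
  have "ck_map 0 F" using F_smooth unfolding smooth_map_def ..
  then show ?thesis by simp
qed

lemma measurable_F [measurable]: "F \<in> borel_measurable borel"
  using F_cont by (rule borel_measurable_continuous_onI)

lemma measurable_\<Psi> [measurable]: "\<Psi> \<in> borel_measurable borel"
  using \<Psi>_cont by (rule borel_measurable_continuous_onI)

lemma measurable_weight [measurable]: "weight \<epsilon> \<in> borel_measurable borel"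
  unfolding weight_def by measurable

lemma mass_pos_eps: "\<epsilon> \<noteq> 0 \<Longrightarrow> laplace_mass F \<Psi> k \<epsilon> A = (\<integral>\<^sup>+x. ennreal (\<Psi> x * weight \<epsilon> x) * indicator A x \<partial>lborel)"
  by (simp add: laplace_mass_def weight_def)

lemma mass_zero:
  assumes [measurable]: "A \<in> sets borel"
  shows "laplace_mass F \<Psi> k 0 A = (\<integral>\<^sup>+x. ennreal (\<Psi> x) * indicator A x \<partial>level_measure F)"
proof -
  have "ck_map (Suc 0) F" using F_smooth unfolding smooth_map_def ..
  then have [measurable]: "gen_jacobian F \<in> borel_measurable borel"
    by (intro borel_measurable_continuous_onI continuous_on_gen_jacobian)
  have "closed (F -` {0})" using F_cont by (intro continuous_closed_vimage) (auto simp: continuous_on_eq_continuous_at)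
  then have [measurable]: "F -` {0} \<in> sets borel" by simp
  have meas: "(\<lambda>x. indicator (F -` {0}) x * ennreal (1 / gen_jacobian F x)) \<in> borel_measurable (hausdorff_measure (CARD('d) - min CARD('d) CARD('p)))"
    by measurable
  have "(\<integral>\<^sup>+x. ennreal (\<Psi> x) * indicator A x \<partial>level_measure F)
     = (\<integral>\<^sup>+x. indicator (F -` {0}) x * ennreal (1 / gen_jacobian F x) * (ennreal (\<Psi> x) * indicator A x) \<partial>hausdorff_measure (CARD('d) - min CARD('d) CARD('p)))"
    unfolding level_measure_def by (rule nn_integral_density[OF meas]) measurable
  also have "\<dots> = laplace_mass F \<Psi> k 0 A"
  proof -
    have "ennreal (\<Psi> x / gen_jacobian F x) = ennreal (1 / gen_jacobian F x) * ennreal (\<Psi> x)" for x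
      using ennreal_mult'[OF \<Psi>_nonneg, of x "1 / gen_jacobian F x"] by (simp add: mult.commute)
    then show ?thesis
      unfolding laplace_mass_def by (auto simp: indicator_def intro!: nn_integral_cong)
  qed
  finally show ?thesis by simp
qed

lemma measure_pos_eps: "\<epsilon> \<noteq> 0 \<Longrightarrow> laplace_measure F \<Psi> k \<epsilon> = density lborel (\<lambda>x. ennreal (\<Psi> x * weight \<epsilon> x) / laplace_mass F \<Psi> k \<epsilon> UNIV)"
  by (rule laplace_measure_eq_density) (auto simp: mass_pos_eps)

lemma measure_zero: "laplace_measure F \<Psi> k 0 = density (level_measure F) (\<lambda>x. ennreal (\<Psi> x) / laplace_mass F \<Psi> k 0 UNIV)"
  by (rule laplace_measure_eq_density) (auto simp: mass_zero)

lemma mass_positive_eps: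
  assumes "\<epsilon> \<noteq> 0"
  shows "0 < laplace_mass F \<Psi> k \<epsilon> UNIV"
proof -
  have w0: "0 < \<Psi> 0 * weight \<epsilon> 0" using \<Psi>_pos[OF F_zero] by (simp add: weight_def)
  have "continuous_on UNIV (\<lambda>x. \<Psi> x * weight \<epsilon> x)"
    unfolding weight_def divide_inverse by (intro continuous_intros \<Psi>_cont F_cont)
  then have isc: "isCont (\<lambda>x. \<Psi> x * weight \<epsilon> x) 0" by (simp add: continuous_on_eq_continuous_at)
  have two: "1 < (2 :: real)" by simp
  obtain d where d: "0 < d" "\<And>x. x \<in> ball 0 d \<Longrightarrow> \<Psi> x * weight \<epsilon> x \<le> 2 * (\<Psi> 0 * weight \<epsilon> 0) \<and> \<Psi> 0 * weight \<epsilon> 0 \<le> 2 * (\<Psi> x * weight \<epsilon> x)"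
    by (rule continuous_near_ratio[OF isc w0 two]) (rule that; assumption)
  have "0 < emeasure lborel (ball (0::real^'d) d)"
  proof -
    have "emeasure lborel (ball (0::real^'d) d) = ennreal (measure lborel (ball (0::real^'d) d))"
      by (rule emeasure_eq_ennreal_measure) (use emeasure_lborel_ball_finite[of "0::real^'d" d] in auto)
    then show ?thesis using content_ball_pos[OF d(1), of "0::real^'d"] by simp
  qed
  then have "0 < ennreal (\<Psi> 0 * weight \<epsilon> 0 / 2) * emeasure lborel (ball (0::real^'d) d)"
    using w0 by (simp add: ennreal_zero_less_mult_iff)
  also have "\<dots> = (\<integral>\<^sup>+x. ennreal (\<Psi> 0 * weight \<epsilon> 0 / 2) * indicator (ball (0::real^'d) d) x \<partial>lborel)"
    by (simp add: nn_integral_cmult_indicator)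
  also have "\<dots> \<le> (\<integral>\<^sup>+x. ennreal (\<Psi> x * weight \<epsilon> x) * indicator UNIV x \<partial>lborel)"
    using d(2) by (intro nn_integral_mono) (auto simp: indicator_def field_simps intro!: ennreal_leI)
  finally show ?thesis using assms by (simp add: mass_pos_eps)
qed

text \<open>A vanishing integral of a positive function would make the zero set a null set of the level measure.\<close>

lemma mass_positive_zero: "0 < laplace_mass F \<Psi> k 0 UNIV"
proof (rule ccontr)
  assume "\<not> 0 < laplace_mass F \<Psi> k 0 UNIV"
  then have "(\<integral>\<^sup>+x. ennreal (\<Psi> x) \<partial>level_measure F) = 0" by (simp add: mass_zero)
  then have "AE x in level_measure F. ennreal (\<Psi> x) = 0" by (subst (asm) nn_integral_0_iff_AE) auto
  with AE_level_measure[OF F_smooth] have "AE x in level_measure F. False"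
  proof eventually_elim
    fix x assume "x \<in> F -` {0}" "ennreal (\<Psi> x) = 0"
    then show False using \<Psi>_pos[of x] by (simp add: ennreal_eq_0_iff)
  qed
  then have "emeasure (level_measure F) UNIV = 0"
    using emeasure_eq_0_AE[of "\<lambda>_. True" "level_measure F"] by simp
  then show False using level_measure_nonzero[OF F_smooth JF_nonzero F_zero] by simp
qed

lemma prob_space_normalized:
  fixes w :: "real^'d \<Rightarrow> ennreal"
  assumes \<nu> [measurable_cong]: "sets \<nu> = sets borel" and w [measurable]: "w \<in> borel_measurable borel"
    and T: "T = (\<integral>\<^sup>+x. w x \<partial>\<nu>)" "0 < T" "T < \<infinity>"
  shows "prob_space (density \<nu> (\<lambda>x. w x / T))"
proof
  have "emeasure (density \<nu> (\<lambda>x. w x / T)) (space (density \<nu> (\<lambda>x. w x / T))) = (\<integral>\<^sup>+x. w x / T \<partial>\<nu>)"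
    by (subst emeasure_density) (auto intro!: nn_integral_cong)
  also have "\<dots> = T / T" unfolding T(1) by (rule nn_integral_divide) measurable
  also have "\<dots> = 1" using T(2,3) by (simp add: ennreal_divide_self less_top)
  finally show "emeasure (density \<nu> (\<lambda>x. w x / T)) (space (density \<nu> (\<lambda>x. w x / T))) = 1" .
qed

lemma prob_space_laplace:
  assumes "laplace_mass F \<Psi> k \<epsilon> UNIV < \<infinity>"
  shows "prob_space (laplace_measure F \<Psi> k \<epsilon>)"
proof (cases "\<epsilon> = 0")
  case True
  then show ?thesis
    using assms mass_positive_zero unfolding True measure_zero
    by (intro prob_space_normalized) (auto simp: mass_zero)
next
  case False
  then show ?thesis
    using assms mass_positive_eps[OF False] unfolding measure_pos_eps[OF False]
    by (intro prob_space_normalized) (auto simp: mass_pos_eps)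
qed

lemma growth_nonneg: "\<bar>\<Psi> x\<bar> \<le> C\<^sub>\<Psi> * exp (C\<^sub>\<Psi> * norm x powr (\<alpha> * real k))"
  using \<Psi>_growth[of x] \<Psi>_nonneg[of x] by simp

lemma integrable_\<Psi>_weight:
  assumes "0 < \<epsilon>" "\<epsilon> * C\<^sub>\<Psi> < m ^ k"
  shows "integrable lborel (\<lambda>x. \<Psi> x * weight \<epsilon> x)"
  unfolding weight_def
  by (rule weighted_integrable[OF F_cont k m \<alpha> F_growth measurable_\<Psi> growth_nonneg C\<^sub>\<Psi> assms])

lemma expectation_eps:
  assumes \<epsilon>: "0 < \<epsilon>" and int: "integrable lborel (\<lambda>x. \<Psi> x * weight \<epsilon> x)" and [measurable]: "\<phi> \<in> borel_measurable borel"
  shows "integrable (laplace_measure F \<Psi> k \<epsilon>) \<phi> \<longleftrightarrow> integrable lborel (\<lambda>x. \<Psi> x * weight \<epsilon> x * \<phi> x)"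
    "(\<integral>x. \<phi> x \<partial>laplace_measure F \<Psi> k \<epsilon>) = (\<integral>x. \<Psi> x * weight \<epsilon> x * \<phi> x \<partial>lborel) / (\<integral>x. \<Psi> x * weight \<epsilon> x \<partial>lborel)"
proof -
  have nn: "0 \<le> \<Psi> x * weight \<epsilon> x" for x using \<Psi>_nonneg by (simp add: weight_def)
  have eps0: "\<epsilon> \<noteq> 0" using \<epsilon> by simp
  have T: "laplace_mass F \<Psi> k \<epsilon> UNIV = (\<integral>\<^sup>+x. ennreal (\<Psi> x * weight \<epsilon> x) \<partial>lborel)"
    using eps0 by (simp add: mass_pos_eps)
  have "(\<integral>\<^sup>+x. ennreal (\<Psi> x * weight \<epsilon> x) \<partial>lborel) = ennreal (\<integral>x. \<Psi> x * weight \<epsilon> x \<partial>lborel)"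
    using int nn by (intro nn_integral_eq_integral) auto
  then have pos: "0 < (\<integral>x. \<Psi> x * weight \<epsilon> x \<partial>lborel)"
    using mass_positive_eps[OF eps0] unfolding T by simp
  note nd = normalized_density[OF nn int pos measure_pos_eps[OF eps0, unfolded T], of \<phi>]
  show "integrable (laplace_measure F \<Psi> k \<epsilon>) \<phi> \<longleftrightarrow> integrable lborel (\<lambda>x. \<Psi> x * weight \<epsilon> x * \<phi> x)"
    "(\<integral>x. \<phi> x \<partial>laplace_measure F \<Psi> k \<epsilon>) = (\<integral>x. \<Psi> x * weight \<epsilon> x * \<phi> x \<partial>lborel) / (\<integral>x. \<Psi> x * weight \<epsilon> x \<partial>lborel)"
    by (rule nd, simp)+
qed

lemma integrable_level:
  assumes fin: "finite_measure (level_measure F)" and f: "continuous_on UNIV f"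
  shows "integrable (level_measure F) (f :: _ \<Rightarrow> real)"
proof -
  interpret finite_measure "level_measure F" by (rule fin)
  have [measurable]: "f \<in> borel_measurable borel" using f by (rule borel_measurable_continuous_onI)
  have "compact (f ` (F -` {0}))"
    by (intro compact_continuous_image continuous_on_subset[OF f] compact_zero_set[OF F_cont m \<alpha> F_growth]) auto
  then obtain M where M: "\<And>x. x \<in> F -` {0} \<Longrightarrow> \<bar>f x\<bar> \<le> M"
    using compact_imp_bounded bounded_iff by (metis imageI real_norm_def)
  show ?thesis
    by (rule integrable_const_bound[of _ M]) (use AE_level_measure[OF F_smooth] M in \<open>auto elim!: eventually_mono\<close>)
qed

lemma expectation_zero:
  assumes fin: "finite_measure (level_measure F)" and \<phi>: "continuous_on UNIV \<phi>"
  shows "integrable (laplace_measure F \<Psi> k 0) \<phi>"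
    "(\<integral>x. \<phi> x \<partial>laplace_measure F \<Psi> k 0) = (\<integral>x. \<Psi> x * \<phi> x \<partial>level_measure F) / (\<integral>x. \<Psi> x \<partial>level_measure F)"
    "0 < (\<integral>x. \<Psi> x \<partial>level_measure F)"
    "laplace_mass F \<Psi> k 0 UNIV < \<infinity>"
proof -
  have \<phi>m: "\<phi> \<in> borel_measurable (level_measure F)" using borel_measurable_continuous_onI[OF \<phi>] by simp
  have int: "integrable (level_measure F) \<Psi>" by (rule integrable_level[OF fin \<Psi>_cont])
  have T: "laplace_mass F \<Psi> k 0 UNIV = (\<integral>\<^sup>+x. ennreal (\<Psi> x) \<partial>level_measure F)" by (simp add: mass_zero)
  have T': "(\<integral>\<^sup>+x. ennreal (\<Psi> x) \<partial>level_measure F) = ennreal (\<integral>x. \<Psi> x \<partial>level_measure F)"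
    using int \<Psi>_nonneg by (intro nn_integral_eq_integral) auto
  show pos: "0 < (\<integral>x. \<Psi> x \<partial>level_measure F)" using mass_positive_zero unfolding T T' by simp
  show "laplace_mass F \<Psi> k 0 UNIV < \<infinity>" unfolding T T' by simp
  note nd = normalized_density[OF \<Psi>_nonneg int pos measure_zero[unfolded T] \<phi>m]
  have "integrable (level_measure F) (\<lambda>x. \<Psi> x * \<phi> x)"
    by (intro integrable_level[OF fin] continuous_intros \<Psi>_cont \<phi>)
  then show "integrable (laplace_measure F \<Psi> k 0) \<phi>" using nd(1) by simp
  show "(\<integral>x. \<phi> x \<partial>laplace_measure F \<Psi> k 0) = (\<integral>x. \<Psi> x * \<phi> x \<partial>level_measure F) / (\<integral>x. \<Psi> x \<partial>level_measure F)"
    by (rule nd(2))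
qed

lemma bounded_continuous_bound:
  assumes "bounded U" "continuous_on UNIV (f :: real^'d \<Rightarrow> real)"
  obtains M where "0 \<le> M" "\<And>x. x \<in> U \<Longrightarrow> \<bar>f x\<bar> \<le> M"
proof -
  have "compact (f ` closure U)"
    using assms by (intro compact_continuous_image continuous_on_subset[OF assms(2)]) (auto simp: compact_closure)
  then obtain M where M: "\<forall>y\<in>f ` closure U. norm y \<le> M" using compact_imp_bounded bounded_iff by metis
  have "\<bar>f x\<bar> \<le> max M 0" if "x \<in> U" for x
    using M that closure_subset[of U] by (force simp: le_max_iff_disj)
  then show ?thesis using that[of "max M 0"] by simp
qed

text \<open>For continuous \<open>g\<close> the limit follows from the expansion of a Lipschitz approximant on \<open>U\<close>. The
  approximation error is controlled uniformly in \<open>s\<close> by the expansion for the constant 1.\<close>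

lemma expansion_and_limit:
  assumes U: "open U" "bounded U" "F -` {0} \<subseteq> U"
  obtains \<gamma> a C where "0 < \<gamma>" "0 < a" "0 \<le> C" "finite_measure (level_measure F)"
    "\<And>g B K0 M N s. g \<in> borel_measurable borel \<Longrightarrow> (\<And>x. \<bar>g x\<bar> \<le> B * exp (K0 * norm x powr (\<alpha> * real k))) \<Longrightarrow> 0 \<le> B \<Longrightarrow> 0 \<le> K0 \<Longrightarrow>
      \<forall>x\<in>U. \<bar>g x\<bar> \<le> M \<Longrightarrow> 0 \<le> M \<Longrightarrow> N-lipschitz_on U g \<Longrightarrow> 0 < s \<Longrightarrow> s \<le> 1 \<Longrightarrow> s ^ k * (K0 + 1) \<le> a \<Longrightarrow>
      integrable lborel (\<lambda>x. g x * exp (- ((norm (F x) / s) ^ k))) \<and>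
      \<bar>(\<integral>x. g x * exp (- ((norm (F x) / s) ^ k)) \<partial>lborel) / s ^ min CARD('d) CARD('p) - \<gamma> * (\<integral>x. g x \<partial>level_measure F)\<bar> \<le> C * (M + N + B) * s"
    "\<And>g B K0. continuous_on UNIV g \<Longrightarrow> (\<And>x. \<bar>g x\<bar> \<le> B * exp (K0 * norm x powr (\<alpha> * real k))) \<Longrightarrow> 0 \<le> B \<Longrightarrow> 0 \<le> K0 \<Longrightarrow>
      ((\<lambda>s. (\<integral>x. g x * exp (- ((norm (F x) / s) ^ k)) \<partial>lborel) / s ^ min CARD('d) CARD('p)) \<longlongrightarrow> \<gamma> * (\<integral>x. g x \<partial>level_measure F)) (at_right 0)"
proof -
  let ?q = "min CARD('d) CARD('p)" and ?w = "\<lambda>s x. exp (- ((norm (F x) / s) ^ k))"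
  have growth': "\<forall>x. R \<le> norm x \<longrightarrow> m * norm x powr \<alpha> \<le> norm (F x)" using F_growth by blast
  have jac': "\<forall>x. F x = 0 \<longrightarrow> gen_jacobian F x \<noteq> 0" using JF_nonzero by blast
  show ?thesis
  proof (rule laplace_expansion[OF F_smooth jac' k m \<alpha> growth' U(1,3)])
  fix \<gamma> a C :: real
  assume *: "0 < \<gamma>" "0 < a" "0 \<le> C" "finite_measure (level_measure F)" and
    exps: "\<And>g B K0 M N s. g \<in> borel_measurable borel \<Longrightarrow> (\<And>x. \<bar>g x\<bar> \<le> B * exp (K0 * norm x powr (\<alpha> * real k))) \<Longrightarrow> 0 \<le> B \<Longrightarrow> 0 \<le> K0 \<Longrightarrow>
      \<forall>x\<in>U. \<bar>g x\<bar> \<le> M \<Longrightarrow> 0 \<le> M \<Longrightarrow> N-lipschitz_on U g \<Longrightarrow> 0 < s \<Longrightarrow> s \<le> 1 \<Longrightarrow> s ^ k * (K0 + 1) \<le> a \<Longrightarrow>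
      integrable lborel (\<lambda>x. g x * exp (- ((norm (F x) / s) ^ k))) \<and>
      \<bar>(\<integral>x. g x * exp (- ((norm (F x) / s) ^ k)) \<partial>lborel) / s ^ min CARD('d) CARD('p) - \<gamma> * (\<integral>x. g x \<partial>level_measure F)\<bar> \<le> C * (M + N + B) * s"
  interpret lev: finite_measure "level_measure F" by (rule *(4))
  obtain a' C' where a': "0 < a'" "0 \<le> C'"
    and tail: "\<And>f B K0 s. f \<in> borel_measurable borel \<Longrightarrow> (\<And>x. x \<in> U \<Longrightarrow> f x = 0) \<Longrightarrow>
      (\<And>x. \<bar>f x\<bar> \<le> B * exp (K0 * norm x powr (\<alpha> * real k))) \<Longrightarrow> 0 \<le> B \<Longrightarrow> 0 \<le> K0 \<Longrightarrow> 0 < s \<Longrightarrow> s \<le> 1 \<Longrightarrow> s ^ k * (K0 + 1) \<le> a' \<Longrightarrow>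
      integrable lborel (\<lambda>x. f x * ?w s x) \<and> \<bar>\<integral>x. f x * ?w s x \<partial>lborel\<bar> / s ^ ?q \<le> C' * B * s"
    using tail_estimate[OF F_cont k m \<alpha> growth' U(1,3), of ?q] by blast
  have AEU: "AE x in level_measure F. x \<in> U" using AE_level_measure[OF F_smooth] U(3) by (auto elim: eventually_mono)
  have [measurable]: "U \<in> sets borel" using U(1) by simp
  have one: "(\<lambda>x. 1 :: real) \<in> borel_measurable borel" "\<And>x::real^'d. \<bar>1 :: real\<bar> \<le> 1 * exp (0 * norm x powr (\<alpha> * real k))" "0 \<le> (1::real)" "0 \<le> (0::real)"
    "\<forall>x\<in>U. \<bar>1 :: real\<bar> \<le> 1" "0-lipschitz_on U (\<lambda>x. 1 :: real)"
    by (auto intro: lipschitz_on_constant)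
  show thesis
  proof (rule that[OF * exps])
    fix g :: "real^'d \<Rightarrow> real" and B K0 :: real
    assume g: "continuous_on UNIV g" and gB: "\<And>x. \<bar>g x\<bar> \<le> B * exp (K0 * norm x powr (\<alpha> * real k))" and B: "0 \<le> B" and K0: "0 \<le> K0"
    have [measurable]: "g \<in> borel_measurable borel" using g by (rule borel_measurable_continuous_onI)
    define I where "I f s = (\<integral>x. f x * ?w s x \<partial>lborel) / s ^ ?q" for f :: "real^'d \<Rightarrow> real" and s
    define L where "L = (\<integral>x. (1::real) \<partial>level_measure F)"
    have L: "0 \<le> L" unfolding L_def by simp
    have "\<forall>\<^sub>F s in at_right 0. \<bar>I g s - \<gamma> * (\<integral>x. g x \<partial>level_measure F)\<bar> < e" if e: "0 < e" for e
    proof -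
      \<comment> \<open>Twice the mass \<open>\<gamma> * L\<close> multiplies the approximation error, once before and once after the limit.\<close>
      define \<eta> where "\<eta> = e / (2 * (2 * \<gamma> * L + 1))"
      have \<eta>: "0 < \<eta>" using e *(1) L by (simp add: \<eta>_def add_nonneg_pos)
      have \<eta>2: "2 * \<eta> * \<gamma> * L \<le> e / 2"
      proof -
        have pos: "0 < 2 * \<gamma> * L + 1" using *(1) L by (intro add_nonneg_pos) auto
        have "2 * (e / (2 * D)) * \<gamma> * L = e / 2 * ((2 * \<gamma> * L) / D)" for D by simp
        from this[of "2 * \<gamma> * L + 1"]
        have "2 * \<eta> * \<gamma> * L = e / 2 * ((2 * \<gamma> * L) / (2 * \<gamma> * L + 1))" unfolding \<eta>_def .
        also have "\<dots> \<le> e / 2 * 1" using pos e by (intro mult_left_mono) auto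
        finally show ?thesis by simp
      qed
      obtain p N where p: "continuous_on UNIV p" "N-lipschitz_on U p" "\<And>x. x \<in> U \<Longrightarrow> \<bar>g x - p x\<bar> \<le> \<eta>"
        using lipschitz_approximation[OF g U(2) \<eta>] by blast
      have [measurable]: "p \<in> borel_measurable borel" using p(1) by (rule borel_measurable_continuous_onI)
      obtain M where M: "0 \<le> M" "\<And>x. x \<in> U \<Longrightarrow> \<bar>p x\<bar> \<le> M" using bounded_continuous_bound[OF U(2) p(1)] by blast
      \<comment> \<open>Decompose \<open>g\<close> into the approximant \<open>h\<close> on \<open>U\<close>, the tail \<open>f\<close> off \<open>U\<close> and a remainder of size \<open>\<eta>\<close> on \<open>U\<close>.\<close>
      define h where "h x = (if x \<in> U then p x else 0)" for x
      have hm [measurable]: "h \<in> borel_measurable borel" unfolding h_def by measurable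
      have h: "\<And>x. \<bar>h x\<bar> \<le> M * exp (0 * norm x powr (\<alpha> * real k))" "\<forall>x\<in>U. \<bar>h x\<bar> \<le> M" "N-lipschitz_on U h"
        using M lipschitz_on_transform[OF p(2), of h] by (auto simp: h_def)
      define f where "f x = (if x \<in> U then 0 else g x)" for x
      have fm: "f \<in> borel_measurable borel" unfolding f_def by measurable
      have fB: "\<bar>f x\<bar> \<le> B * exp (K0 * norm x powr (\<alpha> * real k))" for x using gB[of x] B by (auto simp: f_def)
      have fU: "\<And>x. x \<in> U \<Longrightarrow> f x = 0" by (simp add: f_def)
      define c where "c = C * (M + N + M) + \<eta> * (C * (1 + 0 + 1)) + C' * B"
      define s0 where "s0 = min 1 (min (a / (K0 + 1)) (a' / (K0 + 1)))"
      have s0: "0 < s0" using *(2) a' K0 by (simp add: s0_def)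
      have bound: "\<bar>I g s - \<gamma> * (\<integral>x. g x \<partial>level_measure F)\<bar> \<le> e / 2 + c * s" if s: "0 < s" "s \<le> s0" for s
      proof -
        have s1: "s \<le> 1" "s ^ k * (K0 + 1) \<le> a" "s ^ k * (K0 + 1) \<le> a'" "s ^ k * (0 + 1) \<le> a"
        proof -
          show "s \<le> 1" using s by (simp add: s0_def)
          then have "s ^ k \<le> s ^ 1" using s k by (intro power_decreasing) auto
          then have sk: "s ^ k \<le> a / (K0 + 1)" "s ^ k \<le> a' / (K0 + 1)" using s by (auto simp: s0_def)
          then show s2: "s ^ k * (K0 + 1) \<le> a" "s ^ k * (K0 + 1) \<le> a'" using K0 by (simp_all add: pos_le_divide_eq)
          have "s ^ k * (0 + 1) \<le> s ^ k * (K0 + 1)" using K0 s by (intro mult_left_mono) auto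
          then show "s ^ k * (0 + 1) \<le> a" using s2 by linarith
        qed
        note eh = exps[OF hm h(1) M(1) order_refl h(2) M(1) h(3) s(1) s1(1,4)]
        note e1 = exps[OF one(1-5) one(3) one(6) s(1) s1(1,4)]
        note ef = tail[OF fm fU fB B K0 s(1) s1(1,3)]
        define d where "d x = (g x - h x - f x) * ?w s x" for x
        have dle: "\<bar>d x\<bar> \<le> \<eta> * (1 * ?w s x)" for x
          using p(3)[of x] \<eta> by (auto simp: d_def h_def f_def abs_mult intro!: mult_right_mono)
        have [measurable]: "d \<in> borel_measurable borel" unfolding d_def f_def by measurable
        have id: "integrable lborel d"
        proof (rule Bochner_Integration.integrable_bound)
          show "integrable lborel (\<lambda>x. \<eta> * (1 * ?w s x))" by (rule integrable_mult_right) (rule conjunct1[OF e1])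
          show "AE x in lborel. norm (d x) \<le> norm (\<eta> * (1 * ?w s x))"
          proof (rule AE_I2)
            fix x show "norm (d x) \<le> norm (\<eta> * (1 * ?w s x))" using dle[of x] unfolding real_norm_def by linarith
          qed
        qed simp
        have "\<bar>\<integral>x. d x \<partial>lborel\<bar> \<le> (\<integral>x. \<bar>d x\<bar> \<partial>lborel)" by (rule integral_abs_bound)
        also have "\<dots> \<le> (\<integral>x. \<eta> * (1 * ?w s x) \<partial>lborel)"
          by (rule integral_mono[OF integrable_abs[OF id] integrable_mult_right[OF conjunct1[OF e1]]]) (rule dle)
        also have "\<dots> = \<eta> * (\<integral>x. 1 * ?w s x \<partial>lborel)" by (rule integral_mult_right_zero)
        finally have "\<bar>\<integral>x. d x \<partial>lborel\<bar> / s ^ ?q \<le> \<eta> * (\<integral>x. 1 * ?w s x \<partial>lborel) / s ^ ?q"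
          using s(1) by (intro divide_right_mono) auto
        then have D: "\<bar>(\<integral>x. d x \<partial>lborel) / s ^ ?q\<bar> \<le> \<eta> * I (\<lambda>x. 1) s"
          using s(1) by (simp add: I_def)
        have I1: "\<eta> * I (\<lambda>x. 1) s \<le> \<eta> * (\<gamma> * L + C * (1 + 0 + 1) * s)"
        proof (rule mult_left_mono)
          have "\<bar>I (\<lambda>x. 1) s - \<gamma> * L\<bar> \<le> C * (1 + 0 + 1) * s" unfolding I_def L_def by (rule conjunct2[OF e1])
          then show "I (\<lambda>x. 1) s \<le> \<gamma> * L + C * (1 + 0 + 1) * s" by linarith
        qed (use \<eta> in simp)
        have eq: "(\<lambda>x. g x * ?w s x) = (\<lambda>x. (h x * ?w s x + f x * ?w s x) + d x)"
          by (simp add: d_def fun_eq_iff algebra_simps)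
        have "(\<integral>x. g x * ?w s x \<partial>lborel) = ((\<integral>x. h x * ?w s x \<partial>lborel) + (\<integral>x. f x * ?w s x \<partial>lborel)) + (\<integral>x. d x \<partial>lborel)"
          unfolding eq using conjunct1[OF eh] conjunct1[OF ef] id by (simp only: Bochner_Integration.integral_add Bochner_Integration.integrable_add)
        then have Ig: "I g s = I h s + (\<integral>x. f x * ?w s x \<partial>lborel) / s ^ ?q + (\<integral>x. d x \<partial>lborel) / s ^ ?q"
          by (simp add: I_def add_divide_distrib)
        have H: "\<bar>I h s - \<gamma> * (\<integral>x. h x \<partial>level_measure F)\<bar> \<le> C * (M + N + M) * s" unfolding I_def by (rule conjunct2[OF eh])
        have Fb: "\<bar>(\<integral>x. f x * ?w s x \<partial>lborel) / s ^ ?q\<bar> \<le> C' * B * s" using conjunct2[OF ef] s(1) by simp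
        have lim: "\<bar>\<gamma> * (\<integral>x. h x \<partial>level_measure F) - \<gamma> * (\<integral>x. g x \<partial>level_measure F)\<bar> \<le> \<eta> * \<gamma> * L"
        proof -
          have ih: "integrable (level_measure F) h"
            by (rule lev.integrable_const_bound[of _ M]) (use h(1) in auto)
          have ig: "integrable (level_measure F) g" by (rule integrable_level[OF *(4) g])
          have "\<bar>(\<integral>x. h x \<partial>level_measure F) - (\<integral>x. g x \<partial>level_measure F)\<bar> = \<bar>\<integral>x. h x - g x \<partial>level_measure F\<bar>"
            using ih ig by simp
          also have "\<dots> \<le> (\<integral>x. \<bar>h x - g x\<bar> \<partial>level_measure F)" by (rule integral_abs_bound)
          also have "\<dots> \<le> (\<integral>x. \<eta> * 1 \<partial>level_measure F)"
          proof (rule integral_mono_AE)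
            show "AE x in level_measure F. \<bar>h x - g x\<bar> \<le> \<eta> * 1"
              using AEU by eventually_elim (use p(3) in \<open>auto simp: h_def abs_minus_commute\<close>)
          qed (use ih ig in auto)
          also have "\<dots> = \<eta> * L" unfolding L_def by simp
          finally have "\<bar>(\<integral>x. h x \<partial>level_measure F) - (\<integral>x. g x \<partial>level_measure F)\<bar> \<le> \<eta> * L" .
          from mult_left_mono[OF this, of \<gamma>] *(1) show ?thesis
            by (simp add: right_diff_distrib[symmetric] abs_mult mult_ac)
        qed
        have "\<bar>I g s - \<gamma> * (\<integral>x. g x \<partial>level_measure F)\<bar>
          \<le> C * (M + N + M) * s + C' * B * s + \<eta> * (\<gamma> * L + C * (1 + 0 + 1) * s) + \<eta> * \<gamma> * L"
          using H Fb D I1 lim unfolding Ig abs_le_iff by linarith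
        also have "\<dots> = 2 * \<eta> * \<gamma> * L + c * s" by (simp add: c_def algebra_simps)
        finally show ?thesis using \<eta>2 by linarith
      qed
      define s1 where "s1 = min s0 (e / (2 * (\<bar>c\<bar> + 1)))"
      have s1: "0 < s1" using s0 e by (simp add: s1_def)
      have "\<bar>I g s - \<gamma> * (\<integral>x. g x \<partial>level_measure F)\<bar> < e" if s: "0 < s" "s < s1" for s
      proof -
        have "c * s \<le> (\<bar>c\<bar> + 1) * s" using s by (intro mult_right_mono) auto
        also have "\<dots> < (\<bar>c\<bar> + 1) * (e / (2 * (\<bar>c\<bar> + 1)))" using s by (intro mult_strict_left_mono) (auto simp: s1_def)
        also have "\<dots> = e / 2"
        proof -
          have "b * (e / (2 * b)) = e / 2" if "b \<noteq> 0" for b using that by simp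
          from this[of "\<bar>c\<bar> + 1"] show ?thesis by simp
        qed
        finally show ?thesis using bound[of s] s by (simp add: s1_def)
      qed
      then show ?thesis unfolding eventually_at_right_field using s1 by blast
    qed
    then show "((\<lambda>s. (\<integral>x. g x * ?w s x \<partial>lborel) / s ^ ?q) \<longlongrightarrow> \<gamma> * (\<integral>x. g x \<partial>level_measure F)) (at_right 0)"
      unfolding tendsto_iff dist_real_def I_def by blast
  qed
qed
qed

end

context laplace_setup
begin

section \<open>Convergence and rate for the normalised measures\<close>

text \<open>The scale \<open>s\<close> is \<open>\<epsilon> powr (1 / k)\<close>, which turns the weight \<open>exp (- norm (F x) ^ k / \<epsilon>)\<close> into
  \<open>exp (- (norm (F x) / s) ^ k)\<close> and makes the rate linear.\<close>

definition scaled_integral :: "(real^'d \<Rightarrow> real) \<Rightarrow> real \<Rightarrow> real" where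
  "scaled_integral g s = (\<integral>x. g x * exp (- ((norm (F x) / s) ^ k)) \<partial>lborel) / s ^ min CARD('d) CARD('p)"

lemma weight_scale:
  assumes "s ^ k = \<epsilon>"
  shows "exp (- ((norm (F x) / s) ^ k)) = weight \<epsilon> x"
  by (simp add: weight_def power_divide assms)

lemma scale_power: "0 < \<epsilon> \<Longrightarrow> (\<epsilon> powr (1 / real k)) ^ k = \<epsilon>"
  using k by (simp add: powr_realpow[symmetric] powr_powr)

lemma expectation_scaled:
  assumes s: "0 < s" "s ^ k = \<epsilon>" and \<phi>: "continuous_on UNIV \<phi>"
    and int: "integrable lborel (\<lambda>x. \<Psi> x * weight \<epsilon> x)"
  shows "(\<integral>x. \<phi> x \<partial>laplace_measure F \<Psi> k \<epsilon>) = scaled_integral (\<lambda>x. \<Psi> x * \<phi> x) s / scaled_integral \<Psi> s"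
proof -
  have \<epsilon>: "0 < \<epsilon>" using s by (metis zero_less_power)
  have eq: "(\<lambda>x. \<Psi> x * \<phi> x * weight \<epsilon> x) = (\<lambda>x. \<Psi> x * weight \<epsilon> x * \<phi> x)" by (simp add: mult_ac)
  show ?thesis
    unfolding expectation_eps(2)[OF \<epsilon> int borel_measurable_continuous_onI[OF \<phi>]] scaled_integral_def weight_scale[OF s(2)] eq
    using s(1) by simp
qed

lemma growth_mult:
  assumes "\<And>x. \<bar>\<phi> x\<bar> \<le> c * exp (c * norm x powr (\<alpha> * real k))"
  shows "\<bar>\<Psi> x * \<phi> x\<bar> \<le> C\<^sub>\<Psi> * c * exp ((C\<^sub>\<Psi> + c) * norm x powr (\<alpha> * real k))"
proof -
  have "\<bar>\<Psi> x * \<phi> x\<bar> \<le> (C\<^sub>\<Psi> * exp (C\<^sub>\<Psi> * norm x powr (\<alpha> * real k))) * (c * exp (c * norm x powr (\<alpha> * real k)))"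
    unfolding abs_mult using C\<^sub>\<Psi> by (intro mult_mono growth_nonneg assms) auto
  also have "\<dots> = C\<^sub>\<Psi> * c * exp ((C\<^sub>\<Psi> + c) * norm x powr (\<alpha> * real k))"
    by (simp add: distrib_right exp_add)
  finally show ?thesis .
qed

lemma well_defined:
  assumes "0 \<le> \<epsilon>"
  shows "0 < laplace_mass F \<Psi> k \<epsilon> UNIV"
    "\<epsilon> * C\<^sub>\<Psi> < m ^ k \<Longrightarrow> laplace_mass F \<Psi> k \<epsilon> UNIV < \<infinity>"
proof -
  show "0 < laplace_mass F \<Psi> k \<epsilon> UNIV"
    using mass_positive_zero mass_positive_eps by (cases "\<epsilon> = 0") auto
  assume small: "\<epsilon> * C\<^sub>\<Psi> < m ^ k"
  show "laplace_mass F \<Psi> k \<epsilon> UNIV < \<infinity>"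
  proof (cases "\<epsilon> = 0")
    case True
    have "bounded (F -` {0})"
      using compact_zero_set[OF F_cont m \<alpha> F_growth] compact_imp_bounded by blast
    then obtain b where b: "F -` {0} \<subseteq> ball 0 b" using bounded_subset_ballD by blast
    have "finite_measure (level_measure F)"
      by (rule expansion_and_limit[OF open_ball bounded_ball b])
    from expectation_zero(4)[OF this continuous_on_const] show ?thesis by (simp add: True)
  next
    case False
    then have \<epsilon>: "0 < \<epsilon>" using assms by simp
    have "(\<integral>\<^sup>+x. ennreal (\<Psi> x * weight \<epsilon> x) \<partial>lborel) = ennreal (\<integral>x. \<Psi> x * weight \<epsilon> x \<partial>lborel)"
      using integrable_\<Psi>_weight[OF \<epsilon> small] \<Psi>_nonneg by (intro nn_integral_eq_integral) (auto simp: weight_def)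
    then show ?thesis using False by (simp add: mass_pos_eps)
  qed
qed

lemma eventually_small:
  fixes b c :: real
  assumes "0 < b" "0 \<le> c"
  shows "\<forall>\<^sub>F \<epsilon> in at_right 0. 0 < \<epsilon> \<and> \<epsilon> * c < b"
proof -
  have "\<epsilon> * c < b" if "0 < \<epsilon>" "\<epsilon> < b / (c + 1)" for \<epsilon>
  proof -
    have "\<epsilon> * c \<le> \<epsilon> * (c + 1)" using that by (intro mult_left_mono) auto
    also have "\<dots> < b" using that(2) assms by (simp add: pos_less_divide_eq)
    finally show ?thesis .
  qed
  moreover have "0 < b / (c + 1)" using assms by simp
  ultimately show ?thesis unfolding eventually_at_right_field by blast
qed

lemma expectation_tendsto:
  assumes U: "open U" "bounded U" "F -` {0} \<subseteq> U" and \<phi>: "continuous_on UNIV \<phi>" and c: "0 \<le> c"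
    and \<phi>c: "\<And>x. \<bar>\<phi> x\<bar> \<le> c * exp (c * norm x powr (\<alpha> * real k))"
  shows "integrable (laplace_measure F \<Psi> k 0) \<phi>"
    "\<forall>\<^sub>F \<epsilon> in at_right 0. integrable (laplace_measure F \<Psi> k \<epsilon>) \<phi>"
    "((\<lambda>\<epsilon>. \<integral>x. \<phi> x \<partial>laplace_measure F \<Psi> k \<epsilon>) \<longlongrightarrow> (\<integral>x. \<phi> x \<partial>laplace_measure F \<Psi> k 0)) (at_right 0)"
proof -
  have \<phi>m: "\<phi> \<in> borel_measurable borel" using \<phi> by (rule borel_measurable_continuous_onI)
  have \<Psi>\<phi>: "continuous_on UNIV (\<lambda>x. \<Psi> x * \<phi> x)" by (intro continuous_intros \<Psi>_cont \<phi>)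
  have \<Psi>\<phi>m: "(\<lambda>x. \<Psi> x * \<phi> x) \<in> borel_measurable borel" using \<Psi>\<phi> by (rule borel_measurable_continuous_onI)
  have B: "0 \<le> C\<^sub>\<Psi> * c" "0 \<le> C\<^sub>\<Psi> + c" using C\<^sub>\<Psi> c by auto
  have lims: "finite_measure (level_measure F) \<and> (\<exists>\<gamma>>0.
      (scaled_integral (\<lambda>x. \<Psi> x * \<phi> x) \<longlongrightarrow> \<gamma> * (\<integral>x. \<Psi> x * \<phi> x \<partial>level_measure F)) (at_right 0) \<and>
      (scaled_integral \<Psi> \<longlongrightarrow> \<gamma> * (\<integral>x. \<Psi> x \<partial>level_measure F)) (at_right 0))"
  proof (rule expansion_and_limit[OF U])
    fix \<gamma> a C :: real
    assume \<gamma>: "0 < \<gamma>" and fin: "finite_measure (level_measure F)" and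
      lim: "\<And>g B K0. continuous_on UNIV g \<Longrightarrow> (\<And>x. \<bar>g x\<bar> \<le> B * exp (K0 * norm x powr (\<alpha> * real k))) \<Longrightarrow> 0 \<le> B \<Longrightarrow> 0 \<le> K0 \<Longrightarrow>
        ((\<lambda>s. (\<integral>x. g x * exp (- ((norm (F x) / s) ^ k)) \<partial>lborel) / s ^ min CARD('d) CARD('p)) \<longlongrightarrow> \<gamma> * (\<integral>x. g x \<partial>level_measure F)) (at_right 0)"
    note l1 = lim[OF \<Psi>\<phi> growth_mult[OF \<phi>c] B, folded scaled_integral_def]
      and l2 = lim[OF \<Psi>_cont growth_nonneg C\<^sub>\<Psi> C\<^sub>\<Psi>, folded scaled_integral_def]
    show ?thesis by (intro conjI fin exI[of _ \<gamma>] \<gamma> l1 l2)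
  qed
  then obtain \<gamma> where fin: "finite_measure (level_measure F)" and \<gamma>: "0 < \<gamma>"
    and l1: "(scaled_integral (\<lambda>x. \<Psi> x * \<phi> x) \<longlongrightarrow> \<gamma> * (\<integral>x. \<Psi> x * \<phi> x \<partial>level_measure F)) (at_right 0)"
    and l2: "(scaled_integral \<Psi> \<longlongrightarrow> \<gamma> * (\<integral>x. \<Psi> x \<partial>level_measure F)) (at_right 0)"
    by blast
  show "integrable (laplace_measure F \<Psi> k 0) \<phi>" by (rule expectation_zero(1)[OF fin \<phi>])
  have mk: "0 < m ^ k" using m by simp
  have int\<Psi>: "\<forall>\<^sub>F \<epsilon> in at_right 0. 0 < \<epsilon> \<and> integrable lborel (\<lambda>x. \<Psi> x * weight \<epsilon> x)"
    using eventually_small[OF mk C\<^sub>\<Psi>] by eventually_elim (auto intro: integrable_\<Psi>_weight)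
  have int\<phi>: "\<forall>\<^sub>F \<epsilon> in at_right 0. integrable lborel (\<lambda>x. \<Psi> x * weight \<epsilon> x * \<phi> x)"
    using eventually_small[OF mk B(2)]
  proof eventually_elim
    fix \<epsilon> :: real assume \<epsilon>: "0 < \<epsilon> \<and> \<epsilon> * (C\<^sub>\<Psi> + c) < m ^ k"
    have "integrable lborel (\<lambda>x. (\<Psi> x * \<phi> x) * exp (- (norm (F x) ^ k / \<epsilon>)))"
      by (rule weighted_integrable[OF F_cont k m \<alpha> F_growth \<Psi>\<phi>m growth_mult[OF \<phi>c] B(2) conjunct1[OF \<epsilon>] conjunct2[OF \<epsilon>]])
    then show "integrable lborel (\<lambda>x. \<Psi> x * weight \<epsilon> x * \<phi> x)" by (simp add: weight_def mult_ac)
  qed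
  show "\<forall>\<^sub>F \<epsilon> in at_right 0. integrable (laplace_measure F \<Psi> k \<epsilon>) \<phi>"
    using int\<Psi> int\<phi>
  proof eventually_elim
    fix \<epsilon> :: real
    assume A: "0 < \<epsilon> \<and> integrable lborel (\<lambda>x. \<Psi> x * weight \<epsilon> x)" "integrable lborel (\<lambda>x. \<Psi> x * weight \<epsilon> x * \<phi> x)"
    show "integrable (laplace_measure F \<Psi> k \<epsilon>) \<phi>"
      using expectation_eps(1)[OF conjunct1[OF A(1)] conjunct2[OF A(1)] \<phi>m] A(2) by (rule iffD2)
  qed
  define Q where "Q s = scaled_integral (\<lambda>x. \<Psi> x * \<phi> x) s / scaled_integral \<Psi> s" for s
  have L: "0 < (\<integral>x. \<Psi> x \<partial>level_measure F)" by (rule expectation_zero(3)[OF fin \<phi>])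
  have nz: "\<gamma> * (\<integral>x. \<Psi> x \<partial>level_measure F) \<noteq> 0" using \<gamma> L by simp
  have "(Q \<longlongrightarrow> (\<gamma> * (\<integral>x. \<Psi> x * \<phi> x \<partial>level_measure F)) / (\<gamma> * (\<integral>x. \<Psi> x \<partial>level_measure F))) (at_right 0)"
    unfolding Q_def by (rule tendsto_divide[OF l1 l2 nz])
  moreover have "(\<gamma> * (\<integral>x. \<Psi> x * \<phi> x \<partial>level_measure F)) / (\<gamma> * (\<integral>x. \<Psi> x \<partial>level_measure F)) = (\<integral>x. \<phi> x \<partial>laplace_measure F \<Psi> k 0)"
    unfolding expectation_zero(2)[OF fin \<phi>] using \<gamma> by simp
  ultimately have Q: "(Q \<longlongrightarrow> (\<integral>x. \<phi> x \<partial>laplace_measure F \<Psi> k 0)) (at_right 0)" by simp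
  have pw: "filterlim (\<lambda>\<epsilon>::real. \<epsilon> powr (1 / real k)) (at_right 0) (at_right 0)"
  proof (rule tendsto_imp_filterlim_at_right)
    have "((\<lambda>\<epsilon>::real. \<epsilon> powr (1 / real k)) \<longlongrightarrow> 0 powr (1 / real k)) (at_right 0)"
    proof (rule tendsto_powr'[OF tendsto_ident_at tendsto_const])
      show "(0::real) \<noteq> 0 \<or> 0 < 1 / real k \<and> (\<forall>\<^sub>F \<epsilon> in at_right 0. 0 \<le> (\<epsilon>::real))"
        using k by (auto simp: eventually_at_right_field intro!: exI[of _ 1])
    qed
    then show "((\<lambda>\<epsilon>::real. \<epsilon> powr (1 / real k)) \<longlongrightarrow> 0) (at_right 0)" by simp
    show "\<forall>\<^sub>F \<epsilon>::real in at_right 0. 0 < \<epsilon> powr (1 / real k)"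
      by (auto simp: eventually_at_right_field intro!: exI[of _ 1])
  qed
  have ev: "\<forall>\<^sub>F \<epsilon> in at_right 0. Q (\<epsilon> powr (1 / real k)) = (\<integral>x. \<phi> x \<partial>laplace_measure F \<Psi> k \<epsilon>)"
    using int\<Psi>
  proof eventually_elim
    fix \<epsilon> :: real
    assume A: "0 < \<epsilon> \<and> integrable lborel (\<lambda>x. \<Psi> x * weight \<epsilon> x)"
    have s: "0 < \<epsilon> powr (1 / real k)" using A by simp
    show "Q (\<epsilon> powr (1 / real k)) = (\<integral>x. \<phi> x \<partial>laplace_measure F \<Psi> k \<epsilon>)"
      unfolding Q_def by (rule expectation_scaled[OF s scale_power[OF conjunct1[OF A]] \<phi> conjunct2[OF A], symmetric])
  qed
  show "((\<lambda>\<epsilon>. \<integral>x. \<phi> x \<partial>laplace_measure F \<Psi> k \<epsilon>) \<longlongrightarrow> (\<integral>x. \<phi> x \<partial>laplace_measure F \<Psi> k 0)) (at_right 0)"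
    by (rule Lim_transform_eventually[OF filterlim_compose[OF Q pw] ev])
qed

text \<open>The expansions of numerator and denominator have errors linear in \<open>s\<close>. The threshold \<open>s2\<close> keeps the
  denominator above half of its limit, and \<open>a\<close> is the threshold of integrability from the expansion, which
  depends on the growth of \<open>\<phi>\<close>.\<close>

lemma expectation_rate:
  assumes U: "open U" "bounded U" "F -` {0} \<subseteq> U" and \<Psi>lip: "M\<^sub>\<Psi>-lipschitz_on U \<Psi>"
  obtains b s2 a :: real where "0 < b" "0 < s2" "0 < a"
    "\<And>\<phi> c N \<epsilon>. continuous_on UNIV \<phi> \<Longrightarrow> 0 \<le> c \<Longrightarrow> (\<And>x. \<bar>\<phi> x\<bar> \<le> c * exp (c * norm x powr (\<alpha> * real k))) \<Longrightarrow>
      N-lipschitz_on U \<phi> \<Longrightarrow> 0 < \<epsilon> \<Longrightarrow> \<epsilon> < min (min 1 (s2 ^ k)) (a / (C\<^sub>\<Psi> + c + 1)) \<Longrightarrow>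
      integrable (laplace_measure F \<Psi> k \<epsilon>) \<phi> \<and>
      \<bar>(\<integral>x. \<phi> x \<partial>laplace_measure F \<Psi> k \<epsilon>) - (\<integral>x. \<phi> x \<partial>laplace_measure F \<Psi> k 0)\<bar>
        \<le> b * (1 + c) * (1 + (SUP x\<in>U. \<bar>\<phi> x\<bar>) + N) * \<epsilon> powr (1 / real k)"
proof (rule expansion_and_limit[OF U])
  fix \<gamma> a C :: real
  assume \<gamma>: "0 < \<gamma>" and a: "0 < a" and C: "0 \<le> C" and fin: "finite_measure (level_measure F)" and
    exps: "\<And>g B K0 M N s. g \<in> borel_measurable borel \<Longrightarrow> (\<And>x. \<bar>g x\<bar> \<le> B * exp (K0 * norm x powr (\<alpha> * real k))) \<Longrightarrow> 0 \<le> B \<Longrightarrow> 0 \<le> K0 \<Longrightarrow>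
      \<forall>x\<in>U. \<bar>g x\<bar> \<le> M \<Longrightarrow> 0 \<le> M \<Longrightarrow> N-lipschitz_on U g \<Longrightarrow> 0 < s \<Longrightarrow> s \<le> 1 \<Longrightarrow> s ^ k * (K0 + 1) \<le> a \<Longrightarrow>
      integrable lborel (\<lambda>x. g x * exp (- ((norm (F x) / s) ^ k))) \<and>
      \<bar>(\<integral>x. g x * exp (- ((norm (F x) / s) ^ k)) \<partial>lborel) / s ^ min CARD('d) CARD('p) - \<gamma> * (\<integral>x. g x \<partial>level_measure F)\<bar> \<le> C * (M + N + B) * s"
  obtain P where P: "0 \<le> P" "\<And>x. x \<in> U \<Longrightarrow> \<bar>\<Psi> x\<bar> \<le> P" using bounded_continuous_bound[OF U(2) \<Psi>_cont] by blast
  have M\<Psi>: "0 \<le> M\<^sub>\<Psi>" using \<Psi>lip by (rule lipschitz_on_nonneg)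
  have U0: "0 \<in> U" using U(3) F_zero by auto
  define L where "L = (\<integral>x. \<Psi> x \<partial>level_measure F)"
  define Q where "Q = P + M\<^sub>\<Psi> + C\<^sub>\<Psi>"
  define t0 where "t0 = \<gamma> * L"
  have L: "0 < L" unfolding L_def by (rule expectation_zero(3)[OF fin \<Psi>_cont])
  have t0: "0 < t0" using \<gamma> L by (simp add: t0_def)
  have Q: "0 \<le> Q" using P(1) M\<Psi> C\<^sub>\<Psi> by (simp add: Q_def)
  have CQ: "0 \<le> C * Q" using C Q by simp
  define s2 where "s2 = t0 / (2 * (C * Q) + 1)"
  have s2: "0 < s2" using t0 CQ by (simp add: s2_def add_nonneg_pos)
  \<comment> \<open>The summand 1 makes the constant positive even if \<open>C * Q\<close> vanishes.\<close>
  define b where "b = 4 * (C * Q) / t0 + 1"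
  have b: "0 < b" using CQ t0 unfolding b_def by (intro add_nonneg_pos) auto
  show thesis
  proof (rule that[OF b s2 a])
    fix \<phi> :: "real^'d \<Rightarrow> real" and c N \<epsilon> :: real
    assume \<phi>: "continuous_on UNIV \<phi>" and c: "0 \<le> c" and \<phi>c: "\<And>x. \<bar>\<phi> x\<bar> \<le> c * exp (c * norm x powr (\<alpha> * real k))"
      and lip: "N-lipschitz_on U \<phi>" and \<epsilon>: "0 < \<epsilon>" "\<epsilon> < min (min 1 (s2 ^ k)) (a / (C\<^sub>\<Psi> + c + 1))"
    have N: "0 \<le> N" using lip by (rule lipschitz_on_nonneg)
    define M where "M = (SUP x\<in>U. \<bar>\<phi> x\<bar>)"
    have M_ge: "\<bar>\<phi> x\<bar> \<le> M" if "x \<in> U" for x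
    proof -
      obtain M1 where "\<And>x. x \<in> U \<Longrightarrow> \<bar>\<phi> x\<bar> \<le> M1" using bounded_continuous_bound[OF U(2) \<phi>] by blast
      then have "bdd_above ((\<lambda>x. \<bar>\<phi> x\<bar>) ` U)" by (intro bdd_aboveI2)
      then show ?thesis unfolding M_def by (rule cSUP_upper[OF that])
    qed
    have M: "0 \<le> M" using M_ge[OF U0] by linarith
    define s where "s = \<epsilon> powr (1 / real k)"
    have s: "0 < s" "s ^ k = \<epsilon>" using \<epsilon>(1) by (auto simp: s_def scale_power)
    have \<epsilon>s: "s ^ k < 1 ^ k" "s ^ k < s2 ^ k" "s ^ k < a / (C\<^sub>\<Psi> + c + 1)" using \<epsilon>(2) by (auto simp: s(2))
    have s1: "s \<le> 1" using power_less_imp_less_base[OF \<epsilon>s(1)] by simp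
    have ss2: "s \<le> s2" using power_less_imp_less_base[OF \<epsilon>s(2)] s2 by simp
    have sa: "s ^ k * (C\<^sub>\<Psi> + c + 1) \<le> a" using \<epsilon>s(3) C\<^sub>\<Psi> c by (simp add: pos_less_divide_eq)
    moreover have "s ^ k * (C\<^sub>\<Psi> + 1) \<le> s ^ k * (C\<^sub>\<Psi> + c + 1)" using s(1) c by (intro mult_left_mono) auto
    ultimately have sa': "s ^ k * (C\<^sub>\<Psi> + 1) \<le> a" by linarith
    have \<phi>m: "\<phi> \<in> borel_measurable borel" using \<phi> by (rule borel_measurable_continuous_onI)
    have \<Psi>\<phi>: "continuous_on UNIV (\<lambda>x. \<Psi> x * \<phi> x)" by (intro continuous_intros \<Psi>_cont \<phi>)
    have \<Psi>\<phi>m: "(\<lambda>x. \<Psi> x * \<phi> x) \<in> borel_measurable borel" using \<Psi>\<phi> by (rule borel_measurable_continuous_onI)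
    have B: "0 \<le> C\<^sub>\<Psi> * c" "0 \<le> C\<^sub>\<Psi> + c" "0 \<le> P * M" using C\<^sub>\<Psi> c P(1) M by auto
    have PU: "\<forall>x\<in>U. \<bar>\<Psi> x\<bar> \<le> P" using P(2) by blast
    have PMU: "\<forall>x\<in>U. \<bar>\<Psi> x * \<phi> x\<bar> \<le> P * M"
      unfolding abs_mult using P M_ge by (intro ballI mult_mono) auto
    have lip2: "(M\<^sub>\<Psi> * M + P * N)-lipschitz_on U (\<lambda>x. \<Psi> x * \<phi> x)"
      by (rule lipschitz_on_mult[OF \<Psi>lip lip]) (use P M M_ge in auto)
    note e1 = exps[OF \<Psi>\<phi>m growth_mult[OF \<phi>c] B(1,2) PMU B(3) lip2 s(1) s1 sa]
    note e2 = exps[OF measurable_\<Psi> growth_nonneg C\<^sub>\<Psi> C\<^sub>\<Psi> PU P(1) \<Psi>lip s(1) s1 sa']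
    let ?a = "scaled_integral (\<lambda>x. \<Psi> x * \<phi> x) s" and ?b = "scaled_integral \<Psi> s"
    define L1 where "L1 = (\<integral>x. \<Psi> x * \<phi> x \<partial>level_measure F)"
    have int\<Psi>: "integrable lborel (\<lambda>x. \<Psi> x * weight \<epsilon> x)"
      using conjunct1[OF e2] unfolding weight_scale[OF s(2)] .
    have "integrable lborel (\<lambda>x. \<Psi> x * \<phi> x * weight \<epsilon> x)"
      using conjunct1[OF e1] unfolding weight_scale[OF s(2)] .
    then have "integrable lborel (\<lambda>x. \<Psi> x * weight \<epsilon> x * \<phi> x)" by (simp add: mult_ac)
    then have int: "integrable (laplace_measure F \<Psi> k \<epsilon>) \<phi>"
      using expectation_eps(1)[OF \<epsilon>(1) int\<Psi> \<phi>m] by blast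
    have db: "\<bar>?b - t0\<bar> \<le> C * Q * s"
      using conjunct2[OF e2] unfolding scaled_integral_def t0_def L_def Q_def .
    have da: "\<bar>?a - \<gamma> * L1\<bar> \<le> C * (Q * (M + N + c)) * s"
    proof -
      have "P * M + (M\<^sub>\<Psi> * M + P * N) + C\<^sub>\<Psi> * c \<le> Q * (M + N + c)"
      proof -
        have "0 \<le> P * c" "0 \<le> M\<^sub>\<Psi> * N" "0 \<le> M\<^sub>\<Psi> * c" "0 \<le> C\<^sub>\<Psi> * M" "0 \<le> C\<^sub>\<Psi> * N"
          using P(1) c M\<Psi> N C\<^sub>\<Psi> M by auto
        then show ?thesis unfolding Q_def by (simp add: algebra_simps)
      qed
      then have "C * (P * M + (M\<^sub>\<Psi> * M + P * N) + C\<^sub>\<Psi> * c) * s \<le> C * (Q * (M + N + c)) * s"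
        using C s(1) by (intro mult_left_mono mult_right_mono) auto
      then show ?thesis using conjunct2[OF e1] unfolding scaled_integral_def L1_def by (rule order_trans[rotated])
    qed
    have half: "\<bar>?b - t0\<bar> \<le> t0 / 2"
    proof -
      have "C * Q * s \<le> C * Q * s2" using CQ ss2 by (intro mult_left_mono)
      also have "\<dots> \<le> t0 / 2"
      proof -
        have "(2 * (C * Q) + 1) * s2 = t0" using CQ by (simp add: s2_def)
        then show ?thesis using s2 by (simp add: algebra_simps)
      qed
      finally show ?thesis using db by linarith
    qed
    have L1: "\<bar>\<gamma> * L1\<bar> \<le> M * t0"
    proof -
      have AEU: "AE x in level_measure F. x \<in> U" using AE_level_measure[OF F_smooth] U(3) by (auto elim: eventually_mono)
      have i1: "integrable (level_measure F) (\<lambda>x. \<Psi> x * \<phi> x)" by (rule integrable_level[OF fin \<Psi>\<phi>])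
      have i2: "integrable (level_measure F) \<Psi>" by (rule integrable_level[OF fin \<Psi>_cont])
      have "\<bar>L1\<bar> \<le> (\<integral>x. \<bar>\<Psi> x * \<phi> x\<bar> \<partial>level_measure F)" unfolding L1_def by (rule integral_abs_bound)
      also have "\<dots> \<le> (\<integral>x. M * \<Psi> x \<partial>level_measure F)"
      proof (rule integral_mono_AE[OF integrable_abs[OF i1] integrable_mult_right[OF i2]])
        show "AE x in level_measure F. \<bar>\<Psi> x * \<phi> x\<bar> \<le> M * \<Psi> x"
          using AEU
        proof eventually_elim
          fix x assume "x \<in> U"
          from mult_right_mono[OF M_ge[OF this] \<Psi>_nonneg[of x]] show "\<bar>\<Psi> x * \<phi> x\<bar> \<le> M * \<Psi> x"
            using \<Psi>_nonneg[of x] by (simp add: abs_mult mult.commute)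
        qed
      qed
      also have "\<dots> = M * L" unfolding L_def by (rule integral_mult_right_zero)
      finally have "\<gamma> * \<bar>L1\<bar> \<le> \<gamma> * (M * L)" using \<gamma> by (intro mult_left_mono) auto
      then show ?thesis using \<gamma> by (simp add: t0_def abs_mult mult_ac)
    qed
    have eq0: "(\<integral>x. \<phi> x \<partial>laplace_measure F \<Psi> k 0) = \<gamma> * L1 / t0"
      unfolding expectation_zero(2)[OF fin \<phi>] L1_def t0_def L_def using \<gamma> by simp
    have eq1: "(\<integral>x. \<phi> x \<partial>laplace_measure F \<Psi> k \<epsilon>) = ?a / ?b"
      by (rule expectation_scaled[OF s \<phi> int\<Psi>])
    have "\<bar>?a / ?b - \<gamma> * L1 / t0\<bar> \<le> 2 / t0 * (\<bar>?a - \<gamma> * L1\<bar> + M * \<bar>?b - t0\<bar>)"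
      by (rule quotient_difference[OF t0 half L1])
    also have "\<dots> \<le> 2 / t0 * (C * (Q * (M + N + c)) * s + M * (C * Q * s))"
      using t0 M da db by (intro mult_left_mono add_mono) auto
    also have "\<dots> = 2 * (C * Q) / t0 * (2 * M + N + c) * s" by (simp add: field_simps)
    also have "\<dots> \<le> b * ((1 + c) * (1 + M + N)) * s"
    proof (rule mult_right_mono)
      have "2 * M + N + c \<le> 2 * ((1 + c) * (1 + M + N))"
      proof -
        have "0 \<le> c * M" "0 \<le> c * N" using c M N by auto
        then show ?thesis using c M N by (simp add: algebra_simps)
      qed
      then have "2 * (C * Q) / t0 * (2 * M + N + c) \<le> 2 * (C * Q) / t0 * (2 * ((1 + c) * (1 + M + N)))"
        using CQ t0 by (intro mult_left_mono) auto
      also have "\<dots> = (4 * (C * Q) / t0) * ((1 + c) * (1 + M + N))" by simp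
      also have "\<dots> \<le> b * ((1 + c) * (1 + M + N))"
        unfolding b_def using c M N by (intro mult_right_mono) auto
      finally show "2 * (C * Q) / t0 * (2 * M + N + c) \<le> b * ((1 + c) * (1 + M + N))" .
    qed (use s in simp)
    finally show "integrable (laplace_measure F \<Psi> k \<epsilon>) \<phi> \<and>
      \<bar>(\<integral>x. \<phi> x \<partial>laplace_measure F \<Psi> k \<epsilon>) - (\<integral>x. \<phi> x \<partial>laplace_measure F \<Psi> k 0)\<bar>
        \<le> b * (1 + c) * (1 + (SUP x\<in>U. \<bar>\<phi> x\<bar>) + N) * \<epsilon> powr (1 / real k)"
      unfolding eq0 eq1 M_def[symmetric] s_def[symmetric] using int by (simp add: mult.assoc)
  qed
qed

end

theorem theorem3:
  fixes F :: "real^'d \<Rightarrow> real^'p"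
    and \<Psi> :: "real^'d \<Rightarrow> real"
    and k :: nat
    and m \<alpha> R C\<^sub>\<Psi> :: real
  assumes k: "k \<ge> 1"
    and F_smooth: "smooth_map F"
    and F_zero: "F 0 = 0"
    and JF_nonzero: "\<And>x. F x = 0 \<Longrightarrow> gen_jacobian F x \<noteq> 0"
    and m: "m > 0" and \<alpha>: "\<alpha> > 0" and R: "R \<ge> 0"
    and F_growth: "\<And>x. norm x \<ge> R \<Longrightarrow> norm (F x) \<ge> m * norm x powr \<alpha>"
    and \<Psi>_cont: "continuous_on UNIV \<Psi>"
    and \<Psi>_nonneg: "\<And>x. \<Psi> x \<ge> 0"
    and C\<^sub>\<Psi>: "C\<^sub>\<Psi> \<ge> 0"
    and \<Psi>_growth: "\<And>x. \<Psi> x \<le> C\<^sub>\<Psi> * exp (C\<^sub>\<Psi> * norm x powr (\<alpha> * real k))"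
    and \<Psi>_pos: "\<And>x. F x = 0 \<Longrightarrow> \<Psi> x > 0"
  shows
    "(\<forall>\<epsilon>\<ge>0. 0 < laplace_mass F \<Psi> k \<epsilon> UNIV \<and>
       (\<epsilon> * C\<^sub>\<Psi> < m ^ k \<longrightarrow> laplace_mass F \<Psi> k \<epsilon> UNIV < \<infinity>) \<and>
       (laplace_mass F \<Psi> k \<epsilon> UNIV < \<infinity> \<longrightarrow> prob_space (laplace_measure F \<Psi> k \<epsilon>))) \<and>
     (\<forall>U. open U \<and> bounded U \<and> F -` {0} \<subseteq> U \<longrightarrow>
       (\<forall>\<phi> :: real^'d \<Rightarrow> real.
          continuous_on UNIV \<phi> \<and>
          (\<exists>C\<^sub>\<phi>\<ge>0. \<forall>x. \<bar>\<phi> x\<bar> \<le> C\<^sub>\<phi> * exp (C\<^sub>\<phi> * norm x powr (\<alpha> * real k))) \<longrightarrow>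
          integrable (laplace_measure F \<Psi> k 0) \<phi> \<and>
          (\<forall>\<^sub>F \<epsilon> in at_right 0. integrable (laplace_measure F \<Psi> k \<epsilon>) \<phi>) \<and>
          ((\<lambda>\<epsilon>. \<bar>(\<integral>x. \<phi> x \<partial>laplace_measure F \<Psi> k \<epsilon>) - (\<integral>x. \<phi> x \<partial>laplace_measure F \<Psi> k 0)\<bar>)
             \<longlongrightarrow> 0) (at_right 0)) \<and>
       ((\<exists>M\<^sub>\<Psi>. M\<^sub>\<Psi>-lipschitz_on U \<Psi>) \<longrightarrow>
        (\<exists>A \<epsilon>\<^sub>0 :: real \<Rightarrow> real.
           continuous_on {0..} A \<and> mono_on {0..} A \<and> (\<forall>c\<ge>0. A c \<ge> 0) \<and>
           continuous_on {0..} \<epsilon>\<^sub>0 \<and> antimono_on {0..} \<epsilon>\<^sub>0 \<and> (\<forall>c\<ge>0. \<epsilon>\<^sub>0 c > 0) \<and>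
           (\<forall>(\<phi> :: real^'d \<Rightarrow> real) C\<^sub>\<phi> M\<^sub>\<phi>.
              continuous_on UNIV \<phi> \<and> C\<^sub>\<phi> \<ge> 0 \<and>
              (\<forall>x. \<bar>\<phi> x\<bar> \<le> C\<^sub>\<phi> * exp (C\<^sub>\<phi> * norm x powr (\<alpha> * real k))) \<and>
              M\<^sub>\<phi>-lipschitz_on U \<phi> \<longrightarrow>
              (\<forall>\<epsilon>. 0 < \<epsilon> \<and> \<epsilon> < \<epsilon>\<^sub>0 C\<^sub>\<phi> \<longrightarrow>
                 integrable (laplace_measure F \<Psi> k \<epsilon>) \<phi> \<and>
                 \<bar>(\<integral>x. \<phi> x \<partial>laplace_measure F \<Psi> k \<epsilon>) - (\<integral>x. \<phi> x \<partial>laplace_measure F \<Psi> k 0)\<bar>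
                   \<le> A C\<^sub>\<phi> * (1 + (SUP x\<in>U. \<bar>\<phi> x\<bar>) + M\<^sub>\<phi>) * \<epsilon> powr (1 / real k))))))"
proof -
  interpret laplace_setup F \<Psi> k m \<alpha> R C\<^sub>\<Psi>
    by unfold_locales (fact k F_smooth F_zero JF_nonzero m \<alpha> F_growth \<Psi>_cont \<Psi>_nonneg C\<^sub>\<Psi> \<Psi>_growth \<Psi>_pos)+
  have rate: "\<exists>A \<epsilon>\<^sub>0 :: real \<Rightarrow> real.
           continuous_on {0..} A \<and> mono_on {0..} A \<and> (\<forall>c\<ge>0. A c \<ge> 0) \<and>
           continuous_on {0..} \<epsilon>\<^sub>0 \<and> antimono_on {0..} \<epsilon>\<^sub>0 \<and> (\<forall>c\<ge>0. \<epsilon>\<^sub>0 c > 0) \<and>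
           (\<forall>(\<phi> :: real^'d \<Rightarrow> real) C\<^sub>\<phi> M\<^sub>\<phi>.
              continuous_on UNIV \<phi> \<and> C\<^sub>\<phi> \<ge> 0 \<and>
              (\<forall>x. \<bar>\<phi> x\<bar> \<le> C\<^sub>\<phi> * exp (C\<^sub>\<phi> * norm x powr (\<alpha> * real k))) \<and>
              M\<^sub>\<phi>-lipschitz_on U \<phi> \<longrightarrow>
              (\<forall>\<epsilon>. 0 < \<epsilon> \<and> \<epsilon> < \<epsilon>\<^sub>0 C\<^sub>\<phi> \<longrightarrow>
                 integrable (laplace_measure F \<Psi> k \<epsilon>) \<phi> \<and>
                 \<bar>(\<integral>x. \<phi> x \<partial>laplace_measure F \<Psi> k \<epsilon>) - (\<integral>x. \<phi> x \<partial>laplace_measure F \<Psi> k 0)\<bar>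
                   \<le> A C\<^sub>\<phi> * (1 + (SUP x\<in>U. \<bar>\<phi> x\<bar>) + M\<^sub>\<phi>) * \<epsilon> powr (1 / real k)))"
    if U: "open U" "bounded U" "F -` {0} \<subseteq> U" and lip: "M\<^sub>\<Psi>-lipschitz_on U \<Psi>" for U M\<^sub>\<Psi>
  proof (rule expectation_rate[OF U lip])
    fix b s2 a :: real
    assume b: "0 < b" and s2: "0 < s2" and a: "0 < a" and
      est: "\<And>\<phi> c N \<epsilon>. continuous_on UNIV \<phi> \<Longrightarrow> 0 \<le> c \<Longrightarrow> (\<And>x. \<bar>\<phi> x\<bar> \<le> c * exp (c * norm x powr (\<alpha> * real k))) \<Longrightarrow>
        N-lipschitz_on U \<phi> \<Longrightarrow> 0 < \<epsilon> \<Longrightarrow> \<epsilon> < min (min 1 (s2 ^ k)) (a / (C\<^sub>\<Psi> + c + 1)) \<Longrightarrow>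
        integrable (laplace_measure F \<Psi> k \<epsilon>) \<phi> \<and>
        \<bar>(\<integral>x. \<phi> x \<partial>laplace_measure F \<Psi> k \<epsilon>) - (\<integral>x. \<phi> x \<partial>laplace_measure F \<Psi> k 0)\<bar>
          \<le> b * (1 + c) * (1 + (SUP x\<in>U. \<bar>\<phi> x\<bar>) + N) * \<epsilon> powr (1 / real k)"
    define A where "A c = b * (1 + c)" for c
    define \<epsilon>\<^sub>0 where "\<epsilon>\<^sub>0 c = min (min 1 (s2 ^ k)) (a / (C\<^sub>\<Psi> + c + 1))" for c
    have "continuous_on {0..} A" unfolding A_def by (intro continuous_intros)
    moreover have "mono_on {0..} A"
      unfolding A_def using b by (intro mono_onI mult_left_mono) auto
    moreover have "\<forall>c\<ge>0. A c \<ge> 0" unfolding A_def using b by simp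
    moreover have "continuous_on {0..} \<epsilon>\<^sub>0"
      unfolding \<epsilon>\<^sub>0_def using C\<^sub>\<Psi> by (intro continuous_intros) (auto simp: add_nonneg_pos add_eq_0_iff_both_eq_0)
    moreover have "antimono_on {0..} \<epsilon>\<^sub>0"
      unfolding \<epsilon>\<^sub>0_def using C\<^sub>\<Psi> a by (intro monotone_onI min.mono order_refl divide_left_mono) auto
    moreover have "\<forall>c\<ge>0. \<epsilon>\<^sub>0 c > 0" unfolding \<epsilon>\<^sub>0_def using s2 a C\<^sub>\<Psi> by simp
    moreover have "\<forall>(\<phi> :: real^'d \<Rightarrow> real) c N.
        continuous_on UNIV \<phi> \<and> 0 \<le> c \<and> (\<forall>x. \<bar>\<phi> x\<bar> \<le> c * exp (c * norm x powr (\<alpha> * real k))) \<and> N-lipschitz_on U \<phi> \<longrightarrow>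
        (\<forall>\<epsilon>. 0 < \<epsilon> \<and> \<epsilon> < \<epsilon>\<^sub>0 c \<longrightarrow> integrable (laplace_measure F \<Psi> k \<epsilon>) \<phi> \<and>
          \<bar>(\<integral>x. \<phi> x \<partial>laplace_measure F \<Psi> k \<epsilon>) - (\<integral>x. \<phi> x \<partial>laplace_measure F \<Psi> k 0)\<bar>
            \<le> A c * (1 + (SUP x\<in>U. \<bar>\<phi> x\<bar>) + N) * \<epsilon> powr (1 / real k))"
    proof (rule allI, rule allI, rule allI, rule impI, rule allI, rule impI)
      fix \<phi> :: "real^'d \<Rightarrow> real" and c N \<epsilon> :: real
      assume \<phi>: "continuous_on UNIV \<phi> \<and> 0 \<le> c \<and> (\<forall>x. \<bar>\<phi> x\<bar> \<le> c * exp (c * norm x powr (\<alpha> * real k))) \<and> N-lipschitz_on U \<phi>"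
        and \<epsilon>: "0 < \<epsilon> \<and> \<epsilon> < \<epsilon>\<^sub>0 c"
      show "integrable (laplace_measure F \<Psi> k \<epsilon>) \<phi> \<and>
          \<bar>(\<integral>x. \<phi> x \<partial>laplace_measure F \<Psi> k \<epsilon>) - (\<integral>x. \<phi> x \<partial>laplace_measure F \<Psi> k 0)\<bar>
            \<le> A c * (1 + (SUP x\<in>U. \<bar>\<phi> x\<bar>) + N) * \<epsilon> powr (1 / real k)"
        unfolding A_def by (rule est) (use \<phi> \<epsilon> in \<open>simp_all add: \<epsilon>\<^sub>0_def\<close>)
    qed
    ultimately show ?thesis by (intro exI[of _ A] exI[of _ \<epsilon>\<^sub>0] conjI)
  qed
  show ?thesis
  proof (intro conjI allI impI; (elim conjE exE)?)
    fix \<epsilon> :: real assume "0 \<le> \<epsilon>"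
    then show "0 < laplace_mass F \<Psi> k \<epsilon> UNIV" by (rule well_defined)
  next
    fix \<epsilon> :: real assume "0 \<le> \<epsilon>" "\<epsilon> * C\<^sub>\<Psi> < m ^ k"
    then show "laplace_mass F \<Psi> k \<epsilon> UNIV < \<infinity>" by (rule well_defined)
  next
    fix \<epsilon> :: real assume "laplace_mass F \<Psi> k \<epsilon> UNIV < \<infinity>"
    then show "prob_space (laplace_measure F \<Psi> k \<epsilon>)" by (rule prob_space_laplace)
  next
    fix U and \<phi> :: "real^'d \<Rightarrow> real" and c
    assume U: "open U" "bounded U" "F -` {0} \<subseteq> U" and \<phi>: "continuous_on UNIV \<phi>" and c: "0 \<le> c"
      "\<forall>x. \<bar>\<phi> x\<bar> \<le> c * exp (c * norm x powr (\<alpha> * real k))"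
    note et = expectation_tendsto[OF U \<phi> c(1) spec[OF c(2)]]
    show "integrable (laplace_measure F \<Psi> k 0) \<phi>" by (rule et(1))
    show "\<forall>\<^sub>F \<epsilon> in at_right 0. integrable (laplace_measure F \<Psi> k \<epsilon>) \<phi>" by (rule et(2))
    show "((\<lambda>\<epsilon>. \<bar>(\<integral>x. \<phi> x \<partial>laplace_measure F \<Psi> k \<epsilon>) - (\<integral>x. \<phi> x \<partial>laplace_measure F \<Psi> k 0)\<bar>) \<longlongrightarrow> 0) (at_right 0)"
      using et(3) by (intro tendsto_rabs_zero) (simp add: LIM_zero)
  next
    fix U M\<^sub>\<Psi>
    assume "open U" "bounded U" "F -` {0} \<subseteq> U" "M\<^sub>\<Psi>-lipschitz_on U \<Psi>"
    from rate[OF this] show "\<exists>A \<epsilon>\<^sub>0 :: real \<Rightarrow> real.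
           continuous_on {0..} A \<and> mono_on {0..} A \<and> (\<forall>c\<ge>0. A c \<ge> 0) \<and>
           continuous_on {0..} \<epsilon>\<^sub>0 \<and> antimono_on {0..} \<epsilon>\<^sub>0 \<and> (\<forall>c\<ge>0. \<epsilon>\<^sub>0 c > 0) \<and>
           (\<forall>(\<phi> :: real^'d \<Rightarrow> real) C\<^sub>\<phi> M\<^sub>\<phi>.
              continuous_on UNIV \<phi> \<and> C\<^sub>\<phi> \<ge> 0 \<and>
              (\<forall>x. \<bar>\<phi> x\<bar> \<le> C\<^sub>\<phi> * exp (C\<^sub>\<phi> * norm x powr (\<alpha> * real k))) \<and>
              M\<^sub>\<phi>-lipschitz_on U \<phi> \<longrightarrow>
              (\<forall>\<epsilon>. 0 < \<epsilon> \<and> \<epsilon> < \<epsilon>\<^sub>0 C\<^sub>\<phi> \<longrightarrow>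
                 integrable (laplace_measure F \<Psi> k \<epsilon>) \<phi> \<and>
                 \<bar>(\<integral>x. \<phi> x \<partial>laplace_measure F \<Psi> k \<epsilon>) - (\<integral>x. \<phi> x \<partial>laplace_measure F \<Psi> k 0)\<bar>
                   \<le> A C\<^sub>\<phi> * (1 + (SUP x\<in>U. \<bar>\<phi> x\<bar>) + M\<^sub>\<phi>) * \<epsilon> powr (1 / real k)))" .
  qed
qed

end
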